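(* There exists a nilpotent Lie group $H$ equipped with a left invariant sub-Riemannian metric $d$ such that $(H,d)$ is not locally quasiconformally equivalent to its tangent cone $(\mathbb{G},d_{\mathbb{G}})$ at the identity; that is, there are no nonempty open sets $U\subseteq H$ and $U'\subseteq\mathbb{G}$ for which there exists a quasiconformal homeomorphism $U\to U'$.
   Context: **Sub-Riemannian manifolds.** A sub-Riemannian manifold is a triple $(M,\mathcal{H},\mathrm{g})$, where $M$ is a (connected) smooth manifold, $\mathcal{H}\subseteq TM$ is a smooth bracket generating sub-bundle (the horizontal distribution; iterated Lie brackets of local sections of $\mathcal H$ span $T_pM$ at every $p$), and $\mathrm{g}$ is a smooth section of the positive definite quadratic forms on $\mathcal{H}$. Its sub-Riemannian (Carnot-Carathéodory) metric is $d(p,q)=\inf\int_0^1\sqrt{\mathrm{g}_{\gamma(t)}(\dot\gamma(t),\dot\gamma(t))}\,dt$, the infimum over all absolutely continuous curves $\gamma:[0,1]\to M$ with $\gamma(0)=p$, $\gamma(1)=q$ and $\dot\gamma$ tangent to $\mathcal{H}$ almost everywhere. A left invariant sub-Riemannian metric on a Lie group is one arising from a left invariant $\mathcal{H}$ and a left invariant $\mathrm{g}$. **Carnot groups.** A stratified nilpotent Lie algebra is a Lie algebra $\mathfrak{g}=V_1\oplus\cdots\oplus V_s$ with $[V_j,V_1]=V_{j+1}$ for $1\le j\le s$, $V_s\ne\{0\}$, $V_{s+1}=\{0\}$. A Carnot group is a connected, simply connected Lie group $\mathbb{G}$ whose Lie algebra is stratified nilpotent, endowed with the left invariant sub-Riemannian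 metric whose horizontal distribution is obtained by left translating $V_1$, with respect to a left invariant scalar product determined by a scalar product on $V_1$. **Tangent cone.** Let $(M,\mathcal{H},\mathrm{g})$ be sub-Riemannian and $p\in M$. Let $L_0=\{0\}$, let $L_1$ be the set of smooth sections of $\mathcal{H}$ defined near $p$, and $L_{i+1}=L_i+[L_1,L_i]$. Let $L_i(p)\subseteq T_pM$ be the set of values at $p$, and $V_i(p)=L_i(p)/L_{i-1}(p)$. If the dimensions of the $V_i(p)$ are independent of $p$ (as is automatic for left invariant structures on Lie groups), the Lie bracket of vector fields induces a Lie bracket on $\mathfrak{g}(p)=V_1(p)\oplus\cdots\oplus V_{s}(p)$, making it a stratified nilpotent Lie algebra. The tangent cone at $p$ is the Carnot group $\mathbb{G}_p$ with Lie algebra $\mathfrak{g}(p)$ and with the left invariant sub-Riemannian metric $d_p$ induced by the scalar product $\mathrm{g}_p$ on $V_1(p)=\mathcal{H}_p$. (Equivalently, it is the pointed Gromov-Hausdorff limit of $(M,\lambda d,p)$ as $\lambda\to\infty$.) **Quasiconformal maps.** Let $(M,d)$, $(M',d')$ be metric spaces, $U\subseteq M$ open, $f:U\to M'$ a topological embedding. For $p\in U$ and small $t>0$ set $$H_f(p,t)=\frac{\sup\{d'(f(p),f(q)) : q\in U,\ d(p,q)\le t\}}{\inf\{d'(f(p),f(q)) : q\in U,\ d(p,q)\ge t\}}.$$ The map $f$ is $K$-quasiconformal ($K\ge1$) if $\limsup_{t\to0}H_f(p,t)\le K$ for all $p\in U$, and quasiconformal if it is $K$-quasiconformal for some $K\ge1$.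 A quasiconformal homeomorphism $U\to U'$ is a quasiconformal embedding with image $U'$. *)

theory Defs
  imports "HOL-Analysis.Analysis" "HOL-Library.Function_Algebras" "HOL-Algebra.Generated_Groups"
begin

text \<open>Functions into a real vector space form one under the pointwise operations. Tangent
  vectors and vector fields below are functions, so that this makes the library notions
  \<open>span\<close>, \<open>subspace\<close> and \<open>dim\<close> available for them.\<close>

instantiation "fun" :: (type, real_vector) real_vector
begin

definition scaleR_fun :: "real \<Rightarrow> ('a \<Rightarrow> 'b) \<Rightarrow> 'a \<Rightarrow> 'b"
  where "scaleR_fun c f = (\<lambda>x. c *\<^sub>R f x)"

instance
  by standard (auto simp: scaleR_fun_def fun_eq_iff scaleR_add_right scaleR_add_left)

end


section \<open>Smooth manifolds\<close>

text \<open>The model spaces are the library's \<open>Euclidean_space n\<close>, i.e. the sequences that vanish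
  from index \<open>n\<close> on. A function is \<open>C\<^sup>k\<close> if its iterated partial derivatives up to order
  \<open>k\<close> exist and are continuous.\<close>

primrec Ck :: "nat \<Rightarrow> nat \<Rightarrow> (nat \<Rightarrow> real) set \<Rightarrow> ((nat \<Rightarrow> real) \<Rightarrow> real) \<Rightarrow> bool" where
  "Ck n 0 S f \<longleftrightarrow> continuous_map (subtopology (Euclidean_space n) S) euclideanreal f"
| "Ck n (Suc k) S f \<longleftrightarrow>
     continuous_map (subtopology (Euclidean_space n) S) euclideanreal f \<and>
     (\<forall>i<n. (\<forall>x\<in>S. (\<lambda>t. f (x(i := t))) differentiable (at (x i))) \<and>
            Ck n k S (\<lambda>x. deriv (\<lambda>t. f (x(i := t))) (x i)))"

definition Cinf :: "nat \<Rightarrow> (nat \<Rightarrow> real) set \<Rightarrow> ((nat \<Rightarrow> real) \<Rightarrow> real) \<Rightarrow> bool" where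
  "Cinf n S f \<longleftrightarrow> (\<forall>k. Ck n k S f)"

text \<open>A chart is a pair of a domain and a coordinate map. Atlases need not be maximal; all
  notions below depend only on the smooth structure that the atlas generates.\<close>

record 'a smooth_mfd =
  mtop :: "'a topology"
  mdim :: nat
  atlas :: "('a set \<times> ('a \<Rightarrow> nat \<Rightarrow> real)) set"

abbreviation pts :: "('a, 'm) smooth_mfd_scheme \<Rightarrow> 'a set" where
  "pts M \<equiv> topspace (mtop M)"

definition second_countable_top :: "'a topology \<Rightarrow> bool" where
  "second_countable_top T \<longleftrightarrow>
     (\<exists>\<B>. countable \<B> \<and> (\<forall>B\<in>\<B>. openin T B) \<and>
          (\<forall>W. openin T W \<longrightarrow> (\<exists>\<A>\<subseteq>\<B>. W = \<Union>\<A>)))"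

definition smooth_manifold :: "('a, 'm) smooth_mfd_scheme \<Rightarrow> bool" where
  "smooth_manifold M \<longleftrightarrow>
     Hausdorff_space (mtop M) \<and> second_countable_top (mtop M) \<and>
     \<Union> (fst ` atlas M) = pts M \<and>
     (\<forall>(U, \<phi>)\<in>atlas M.
        openin (mtop M) U \<and> openin (Euclidean_space (mdim M)) (\<phi> ` U) \<and>
        homeomorphic_map (subtopology (mtop M) U)
          (subtopology (Euclidean_space (mdim M)) (\<phi> ` U)) \<phi>) \<and>
     (\<forall>(U, \<phi>)\<in>atlas M. \<forall>(V, \<psi>)\<in>atlas M. \<forall>j<mdim M.
        Cinf (mdim M) (\<phi> ` (U \<inter> V)) (\<lambda>x. \<psi> (inv_into U \<phi> x) j))"

definition smooth_on :: "('a, 'm) smooth_mfd_scheme \<Rightarrow> 'a set \<Rightarrow> ('a \<Rightarrow> real) \<Rightarrow> bool" where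
  "smooth_on M W f \<longleftrightarrow> openin (mtop M) W \<and>
     (\<forall>(U, \<phi>)\<in>atlas M. Cinf (mdim M) (\<phi> ` (U \<inter> W)) (\<lambda>x. f (inv_into U \<phi> x)))"

definition smooth_near :: "('a, 'm) smooth_mfd_scheme \<Rightarrow> 'a \<Rightarrow> ('a \<Rightarrow> real) \<Rightarrow> bool" where
  "smooth_near M p f \<longleftrightarrow> (\<exists>W. p \<in> W \<and> smooth_on M W f)"

definition smooth_map ::
  "('a, 'm) smooth_mfd_scheme \<Rightarrow> ('b, 'n) smooth_mfd_scheme \<Rightarrow> ('a \<Rightarrow> 'b) \<Rightarrow> bool" where
  "smooth_map M N F \<longleftrightarrow> continuous_map (mtop M) (mtop N) F \<and>
     (\<forall>(U, \<phi>)\<in>atlas M. \<forall>(V, \<psi>)\<in>atlas N. \<forall>j<mdim N.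
        Cinf (mdim M) (\<phi> ` {p \<in> U. F p \<in> V}) (\<lambda>x. \<psi> (F (inv_into U \<phi> x)) j))"

definition prod_mfd ::
  "('a, 'm) smooth_mfd_scheme \<Rightarrow> ('b, 'n) smooth_mfd_scheme \<Rightarrow> ('a \<times> 'b) smooth_mfd" where
  "prod_mfd M N = \<lparr>
     mtop = prod_topology (mtop M) (mtop N),
     mdim = mdim M + mdim N,
     atlas = {(U \<times> V, \<lambda>(p, q) i. if i < mdim M then \<phi> p i else \<psi> q (i - mdim M)) |
                U \<phi> V \<psi>. (U, \<phi>) \<in> atlas M \<and> (V, \<psi>) \<in> atlas N}\<rparr>"


section \<open>Tangent vectors and vector fields\<close>

text \<open>Tangent vectors at \<open>p\<close> are derivations on the functions that are smooth near \<open>p\<close>;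
  they take the value \<open>0\<close> on all other functions, which makes them unique as HOL functions.\<close>

type_synonym 'a tvec = "('a \<Rightarrow> real) \<Rightarrow> real"
type_synonym 'a vfield = "'a \<Rightarrow> 'a tvec"

definition tangent_space :: "('a, 'm) smooth_mfd_scheme \<Rightarrow> 'a \<Rightarrow> 'a tvec set" where
  "tangent_space M p = {v.
     (\<forall>f. \<not> smooth_near M p f \<longrightarrow> v f = 0) \<and>
     (\<forall>f g. smooth_near M p f \<longrightarrow> smooth_near M p g \<longrightarrow>
        v (\<lambda>x. f x + g x) = v f + v g \<and>
        v (\<lambda>x. f x * g x) = f p * v g + g p * v f) \<and>
     (\<forall>c f. smooth_near M p f \<longrightarrow> v (\<lambda>x. c * f x) = c * v f)}"

definition smooth_vfield_on :: "('a, 'm) smooth_mfd_scheme \<Rightarrow> 'a set \<Rightarrow> 'a vfield \<Rightarrow> bool" where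
  "smooth_vfield_on M W X \<longleftrightarrow> openin (mtop M) W \<and>
     (\<forall>q\<in>W. X q \<in> tangent_space M q) \<and>
     (\<forall>W' f. W' \<subseteq> W \<longrightarrow> smooth_on M W' f \<longrightarrow> smooth_on M W' (\<lambda>q. X q f))"

definition vf_bracket ::
  "('a, 'm) smooth_mfd_scheme \<Rightarrow> 'a vfield \<Rightarrow> 'a vfield \<Rightarrow> 'a vfield" where
  "vf_bracket M X Y = (\<lambda>q f. if smooth_near M q f
     then X q (\<lambda>x. Y x f) - Y q (\<lambda>x. X x f) else 0)"

definition pushforward ::
  "('a, 'm) smooth_mfd_scheme \<Rightarrow> ('b, 'n) smooth_mfd_scheme \<Rightarrow> ('a \<Rightarrow> 'b) \<Rightarrow> 'a \<Rightarrow>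
   'a tvec \<Rightarrow> 'b tvec" where
  "pushforward M N F p v = (\<lambda>f. if smooth_near N (F p) f then v (\<lambda>x. f (F x)) else 0)"

text \<open>Only meaningful at times where the coordinates of the curve are differentiable, hence at
  almost every time for an absolutely continuous curve.\<close>

definition velocity :: "('a, 'm) smooth_mfd_scheme \<Rightarrow> (real \<Rightarrow> 'a) \<Rightarrow> real \<Rightarrow> 'a tvec" where
  "velocity M \<gamma> t =
     (\<lambda>f. if smooth_near M (\<gamma> t) f then deriv (\<lambda>s. f (\<gamma> s)) t else 0)"

definition abs_continuous :: "real \<Rightarrow> real \<Rightarrow> (real \<Rightarrow> real) \<Rightarrow> bool" where
  "abs_continuous a b f \<longleftrightarrow> (\<forall>\<epsilon>>0. \<exists>\<delta>>0. \<forall>I :: (real \<times> real) set.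
     finite I \<and> (\<forall>(x, y)\<in>I. a \<le> x \<and> x < y \<and> y \<le> b) \<and>
     pairwise (\<lambda>(x, y) (x', y'). disjnt {x<..<y} {x'<..<y'}) I \<and>
     (\<Sum>(x, y)\<in>I. y - x) < \<delta>
     \<longrightarrow> (\<Sum>(x, y)\<in>I. \<bar>f y - f x\<bar>) < \<epsilon>)"

definition abs_continuous_curve ::
  "('a, 'm) smooth_mfd_scheme \<Rightarrow> (real \<Rightarrow> 'a) \<Rightarrow> bool" where
  "abs_continuous_curve M \<gamma> \<longleftrightarrow> continuous_map (top_of_set {0..1}) (mtop M) \<gamma> \<and>
     (\<forall>(U, \<phi>)\<in>atlas M. \<forall>a b. 0 \<le> a \<longrightarrow> a \<le> b \<longrightarrow> b \<le> 1 \<longrightarrow> \<gamma> ` {a..b} \<subseteq> U \<longrightarrow>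
        (\<forall>i<mdim M. abs_continuous a b (\<lambda>t. \<phi> (\<gamma> t) i)))"


section \<open>Sub-Riemannian manifolds\<close>

text \<open>The quadratic forms of the metric are given by their polar forms: \<open>met M p v w\<close> is the
  scalar product of \<open>v\<close> and \<open>w\<close> in the horizontal space \<open>hor M p\<close>.\<close>

record 'a sub_riem = "'a smooth_mfd" +
  hor :: "'a \<Rightarrow> 'a tvec set"
  met :: "'a \<Rightarrow> 'a tvec \<Rightarrow> 'a tvec \<Rightarrow> real"

definition hor_section_on :: "('a, 'm) sub_riem_scheme \<Rightarrow> 'a set \<Rightarrow> 'a vfield \<Rightarrow> bool" where
  "hor_section_on M W X \<longleftrightarrow> smooth_vfield_on M W X \<and> (\<forall>q\<in>W. X q \<in> hor M q)"

definition smooth_subbundle :: "('a, 'm) sub_riem_scheme \<Rightarrow> bool" where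
  "smooth_subbundle M \<longleftrightarrow> (\<exists>k. \<forall>p\<in>pts M. \<exists>W E.
     p \<in> W \<and> (\<forall>i<k. hor_section_on M W (E i)) \<and> openin (mtop M) W \<and>
     (\<forall>q\<in>W. hor M q = span ((\<lambda>i. E i q) ` {..<k}) \<and> dim (hor M q) = k))"

text \<open>\<open>Lsec M p i\<close> is the space \<open>L\<^sub>i\<close> of vector fields defined near \<open>p\<close>. Vector fields are
  total functions here, but only their germs at \<open>p\<close> matter.\<close>

fun Lsec :: "('a, 'm) sub_riem_scheme \<Rightarrow> 'a \<Rightarrow> nat \<Rightarrow> 'a vfield set" where
  "Lsec M p 0 = {0}"
| "Lsec M p (Suc 0) = {X. \<exists>W. p \<in> W \<and> hor_section_on M W X}"
| "Lsec M p (Suc (Suc i)) = span (Lsec M p (Suc i) \<union>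
     {vf_bracket M X Y | X Y. X \<in> Lsec M p (Suc 0) \<and> Y \<in> Lsec M p (Suc i)})"

definition Lval :: "('a, 'm) sub_riem_scheme \<Rightarrow> 'a \<Rightarrow> nat \<Rightarrow> 'a tvec set" where
  "Lval M p i = (\<lambda>X. X p) ` Lsec M p i"

definition bracket_generating :: "('a, 'm) sub_riem_scheme \<Rightarrow> bool" where
  "bracket_generating M \<longleftrightarrow> (\<forall>p\<in>pts M. span (\<Union>i. Lval M p i) = tangent_space M p)"

definition smooth_hor_metric :: "('a, 'm) sub_riem_scheme \<Rightarrow> bool" where
  "smooth_hor_metric M \<longleftrightarrow>
     (\<forall>p\<in>pts M. \<forall>u\<in>hor M p. \<forall>v\<in>hor M p. \<forall>w\<in>hor M p. \<forall>c.
        met M p (u + v) w = met M p u w + met M p v w \<and>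
        met M p (c *\<^sub>R u) w = c * met M p u w \<and>
        met M p u v = met M p v u \<and>
        (u \<noteq> 0 \<longrightarrow> met M p u u > 0)) \<and>
     (\<forall>W X Y. hor_section_on M W X \<longrightarrow> hor_section_on M W Y \<longrightarrow>
        smooth_on M W (\<lambda>q. met M q (X q) (Y q)))"

definition sub_riemannian :: "('a, 'm) sub_riem_scheme \<Rightarrow> bool" where
  "sub_riemannian M \<longleftrightarrow> smooth_manifold M \<and> connected_space (mtop M) \<and> pts M \<noteq> {} \<and>
     smooth_subbundle M \<and> bracket_generating M \<and> smooth_hor_metric M"

definition horizontal_curve :: "('a, 'm) sub_riem_scheme \<Rightarrow> (real \<Rightarrow> 'a) \<Rightarrow> bool" where
  "horizontal_curve M \<gamma> \<longleftrightarrow> abs_continuous_curve M \<gamma> \<and>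
     (AE t in lebesgue_on {0..1}. velocity M \<gamma> t \<in> hor M (\<gamma> t))"

definition sr_length :: "('a, 'm) sub_riem_scheme \<Rightarrow> (real \<Rightarrow> 'a) \<Rightarrow> real" where
  "sr_length M \<gamma> =
     (LINT t|lebesgue_on {0..1}. sqrt (met M (\<gamma> t) (velocity M \<gamma> t) (velocity M \<gamma> t)))"

text \<open>The value \<open>0\<close> off the manifold is immaterial; it matches the library's
  \<open>Metric_space\<close>, which wants nonnegativity and symmetry on the whole type.\<close>

definition cc_dist :: "('a, 'm) sub_riem_scheme \<Rightarrow> 'a \<Rightarrow> 'a \<Rightarrow> real" where
  "cc_dist M p q = (if p \<in> pts M \<and> q \<in> pts M
     then Inf {sr_length M \<gamma> | \<gamma>. horizontal_curve M \<gamma> \<and> \<gamma> 0 = p \<and> \<gamma> 1 = q}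
     else 0)"


section \<open>Lie groups\<close>

definition lie_group :: "('a, 'g) monoid_scheme \<Rightarrow> ('a, 'm) smooth_mfd_scheme \<Rightarrow> bool" where
  "lie_group G M \<longleftrightarrow> group G \<and> smooth_manifold M \<and> carrier G = pts M \<and>
     smooth_map (prod_mfd M M) M (\<lambda>(x, y). x \<otimes>\<^bsub>G\<^esub> y) \<and>
     smooth_map M M (\<lambda>x. inv\<^bsub>G\<^esub> x)"

primrec lower_central :: "('a, 'g) monoid_scheme \<Rightarrow> nat \<Rightarrow> 'a set" where
  "lower_central G 0 = carrier G"
| "lower_central G (Suc n) = generate G
     {x \<otimes>\<^bsub>G\<^esub> y \<otimes>\<^bsub>G\<^esub> inv\<^bsub>G\<^esub> x \<otimes>\<^bsub>G\<^esub> inv\<^bsub>G\<^esub> y | x y. x \<in> carrier G \<and> y \<in> lower_central G n}"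

definition nilpotent_group :: "('a, 'g) monoid_scheme \<Rightarrow> bool" where
  "nilpotent_group G \<longleftrightarrow> group G \<and> (\<exists>n. lower_central G n = {\<one>\<^bsub>G\<^esub>})"

abbreviation left_push ::
  "('a, 'g) monoid_scheme \<Rightarrow> ('a, 'm) smooth_mfd_scheme \<Rightarrow> 'a \<Rightarrow> 'a \<Rightarrow> 'a tvec \<Rightarrow> 'a tvec" where
  "left_push G M a x \<equiv> pushforward M M (\<lambda>y. a \<otimes>\<^bsub>G\<^esub> y) x"

definition left_invariant_sub_riemannian ::
  "('a, 'g) monoid_scheme \<Rightarrow> ('a, 'm) sub_riem_scheme \<Rightarrow> bool" where
  "left_invariant_sub_riemannian G M \<longleftrightarrow> lie_group G M \<and> sub_riemannian M \<and>
     (\<forall>a\<in>carrier G. \<forall>x\<in>carrier G.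
        left_push G M a x ` hor M x = hor M (a \<otimes>\<^bsub>G\<^esub> x) \<and>
        (\<forall>v\<in>hor M x. \<forall>w\<in>hor M x.
           met M (a \<otimes>\<^bsub>G\<^esub> x) (left_push G M a x v) (left_push G M a x w) = met M x v w))"

text \<open>The Lie algebra of a Lie group consists of the left invariant vector fields with the
  bracket of vector fields.\<close>

definition left_invariant_fields ::
  "('a, 'g) monoid_scheme \<Rightarrow> ('a, 'm) smooth_mfd_scheme \<Rightarrow> 'a vfield set" where
  "left_invariant_fields G M = {X. smooth_vfield_on M (carrier G) X \<and>
     (\<forall>a\<in>carrier G. \<forall>x\<in>carrier G. left_push G M a x (X x) = X (a \<otimes>\<^bsub>G\<^esub> x)) \<and>
     (\<forall>x. x \<notin> carrier G \<longrightarrow> X x = 0)}"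


section \<open>Carnot groups\<close>

definition lie_algebra :: "'v::real_vector set \<Rightarrow> ('v \<Rightarrow> 'v \<Rightarrow> 'v) \<Rightarrow> bool" where
  "lie_algebra L br \<longleftrightarrow> subspace L \<and>
     (\<forall>x\<in>L. \<forall>y\<in>L. br x y \<in> L) \<and> (\<forall>x\<in>L. br x x = 0) \<and>
     (\<forall>x\<in>L. \<forall>y\<in>L. \<forall>z\<in>L. \<forall>c.
        br (x + y) z = br x z + br y z \<and> br z (x + y) = br z x + br z y \<and>
        br (c *\<^sub>R x) y = c *\<^sub>R br x y \<and> br x (c *\<^sub>R y) = c *\<^sub>R br x y \<and>
        br x (br y z) + br y (br z x) + br z (br x y) = 0)"

definition stratified_lie_algebra ::
  "'v::real_vector set \<Rightarrow> ('v \<Rightarrow> 'v \<Rightarrow> 'v) \<Rightarrow> (nat \<Rightarrow> 'v set) \<Rightarrow> nat \<Rightarrow> bool" where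
  "stratified_lie_algebra L br V s \<longleftrightarrow> lie_algebra L br \<and> 1 \<le> s \<and>
     (\<forall>j\<in>{1..s}. subspace (V j)) \<and>
     bij_betw (\<lambda>u. \<Sum>j\<in>{1..s}. u j) (\<Pi>\<^sub>E j\<in>{1..s}. V j) L \<and>
     (\<forall>j\<in>{1..s}. span {br x y | x y. x \<in> V j \<and> y \<in> V 1} = V (Suc j)) \<and>
     V s \<noteq> {0} \<and> V (Suc s) = {0}"

text \<open>The library's \<open>simply_connected\<close> applies to subsets of type-class spaces only; this is
  its definition for abstract topologies (any two loops are freely homotopic, which entails
  path-connectedness).\<close>

definition simply_connected_top :: "'a topology \<Rightarrow> bool" where
  "simply_connected_top T \<longleftrightarrow>
     (\<forall>p q. pathin T p \<and> p 1 = p 0 \<and> pathin T q \<and> q 1 = q 0 \<longrightarrow>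
        homotopic_with (\<lambda>r. r 1 = r 0) (top_of_set {0..1}) T p q)"

definition carnot_group ::
  "('a, 'g) monoid_scheme \<Rightarrow> ('a, 'm) sub_riem_scheme \<Rightarrow> (nat \<Rightarrow> 'a vfield set) \<Rightarrow> nat \<Rightarrow> bool"
  where
  "carnot_group G M V s \<longleftrightarrow>
     lie_group G M \<and> connected_space (mtop M) \<and> simply_connected_top (mtop M) \<and>
     stratified_lie_algebra (left_invariant_fields G M) (vf_bracket M) V s \<and>
     left_invariant_sub_riemannian G M \<and>
     (\<forall>x\<in>carrier G. hor M x = (\<lambda>X. X x) ` V 1)"


section \<open>The tangent cone\<close>

text \<open>The layer \<open>V\<^sub>i(p) = L\<^sub>i(p)/L\<^sub>i\<^sub>-\<^sub>1(p)\<close> is the set of cosets of \<open>Lval M p (i - 1)\<close> in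
  \<open>Lval M p i\<close>; truncated subtraction makes the layer of index \<open>0\<close> trivial. An element
  of \<open>\<gg>(p)\<close> is a sequence \<open>u\<close> whose \<open>i\<close>-th entry is in the \<open>i\<close>-th layer; layers beyond the
  step are trivial, so this is the direct sum. Cosets are added with the library's addition
  of sets.\<close>

definition gr_layer :: "('a, 'm) sub_riem_scheme \<Rightarrow> 'a \<Rightarrow> nat \<Rightarrow> 'a tvec set set" where
  "gr_layer M p i = {v +o Lval M p (i - 1) | v. v \<in> Lval M p i}"

definition equiregular :: "('a, 'm) sub_riem_scheme \<Rightarrow> bool" where
  "equiregular M \<longleftrightarrow> (\<forall>p\<in>pts M. \<forall>q\<in>pts M. \<forall>i\<ge>1.
     dim (Lval M p i) - dim (Lval M p (i - 1)) = dim (Lval M q i) - dim (Lval M q (i - 1)))"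

definition gr_alg :: "('a, 'm) sub_riem_scheme \<Rightarrow> 'a \<Rightarrow> (nat \<Rightarrow> 'a tvec set) set" where
  "gr_alg M p = {u. \<forall>i. u i \<in> gr_layer M p i}"

definition gr_add ::
  "(nat \<Rightarrow> 'a tvec set) \<Rightarrow> (nat \<Rightarrow> 'a tvec set) \<Rightarrow> nat \<Rightarrow> 'a tvec set" where
  "gr_add u w = (\<lambda>i. u i + w i)"

definition gr_scale ::
  "('a, 'm) sub_riem_scheme \<Rightarrow> 'a \<Rightarrow> real \<Rightarrow> (nat \<Rightarrow> 'a tvec set) \<Rightarrow> nat \<Rightarrow> 'a tvec set" where
  "gr_scale M p c u = (\<lambda>i. (\<lambda>v. c *\<^sub>R v) ` u i + Lval M p (i - 1))"

text \<open>The bracket of \<open>A \<in> V\<^sub>i(p)\<close> and \<open>B \<in> V\<^sub>j(p)\<close> is the class in \<open>V\<^sub>i\<^sub>+\<^sub>j(p)\<close> of \<open>[X,Y](p)\<close>, where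
  \<open>X \<in> L\<^sub>i\<close> and \<open>Y \<in> L\<^sub>j\<close> have values at \<open>p\<close> in \<open>A\<close> and \<open>B\<close>. For equiregular \<open>M\<close> all choices
  of \<open>X\<close> and \<open>Y\<close> give the same class, so that the union over them is that class.\<close>

definition coset_bracket ::
  "('a, 'm) sub_riem_scheme \<Rightarrow> 'a \<Rightarrow> nat \<Rightarrow> nat \<Rightarrow> 'a tvec set \<Rightarrow> 'a tvec set \<Rightarrow> 'a tvec set" where
  "coset_bracket M p i j A B =
     \<Union> {vf_bracket M X Y p +o Lval M p (i + j - 1) | X Y.
          X \<in> Lsec M p i \<and> Y \<in> Lsec M p j \<and> X p \<in> A \<and> Y p \<in> B}"

definition gr_bracket :: "('a, 'm) sub_riem_scheme \<Rightarrow> 'a \<Rightarrow>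
    (nat \<Rightarrow> 'a tvec set) \<Rightarrow> (nat \<Rightarrow> 'a tvec set) \<Rightarrow> nat \<Rightarrow> 'a tvec set" where
  "gr_bracket M p u w = (\<lambda>k. \<Sum>i\<in>{1..<k}. coset_bracket M p i (k - i) (u i) (w (k - i)))"

definition gr_incl ::
  "('a, 'm) sub_riem_scheme \<Rightarrow> 'a \<Rightarrow> nat \<Rightarrow> 'a tvec \<Rightarrow> nat \<Rightarrow> 'a tvec set" where
  "gr_incl M p i v = (\<lambda>j. (if j = i then v else 0) +o Lval M p (j - 1))"

text \<open>\<open>(G, C)\<close> is the tangent cone of \<open>M\<close> at \<open>p\<close>: a Carnot group with an isomorphism \<open>\<Phi>\<close> from
  \<open>\<gg>(p)\<close> onto its Lie algebra that respects the stratifications and carries the scalar product of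
  \<open>hor M p\<close> (which is the first layer) to that of \<open>C\<close>.\<close>

definition tangent_cone ::
  "('b, 'n) sub_riem_scheme \<Rightarrow> 'b \<Rightarrow> ('a, 'g) monoid_scheme \<Rightarrow> ('a, 'm) sub_riem_scheme \<Rightarrow> bool"
  where
  "tangent_cone M p G C \<longleftrightarrow> equiregular M \<and>
     (\<exists>V s \<Phi>. carnot_group G C V s \<and>
        bij_betw \<Phi> (gr_alg M p) (left_invariant_fields G C) \<and>
        (\<forall>u\<in>gr_alg M p. \<forall>w\<in>gr_alg M p. \<forall>c.
           \<Phi> (gr_add u w) = \<Phi> u + \<Phi> w \<and>
           \<Phi> (gr_scale M p c u) = c *\<^sub>R \<Phi> u \<and>
           \<Phi> (gr_bracket M p u w) = vf_bracket C (\<Phi> u) (\<Phi> w)) \<and>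
        (\<forall>i\<in>{1..s}. (\<lambda>v. \<Phi> (gr_incl M p i v)) ` Lval M p i = V i) \<and>
        (\<forall>v\<in>hor M p. \<forall>w\<in>hor M p.
           met C \<one>\<^bsub>G\<^esub> (\<Phi> (gr_incl M p 1 v) \<one>\<^bsub>G\<^esub>) (\<Phi> (gr_incl M p 1 w) \<one>\<^bsub>G\<^esub>) = met M p v w))"


section \<open>Quasiconformal maps\<close>

definition qc_quotient :: "'a set \<Rightarrow> ('a \<Rightarrow> 'a \<Rightarrow> real) \<Rightarrow> ('b \<Rightarrow> 'b \<Rightarrow> real) \<Rightarrow>
    ('a \<Rightarrow> 'b) \<Rightarrow> 'a \<Rightarrow> real \<Rightarrow> ennreal" where
  "qc_quotient U d d' f p t =
     (SUP q\<in>{q\<in>U. d p q \<le> t}. ennreal (d' (f p) (f q))) /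
     (INF q\<in>{q\<in>U. d p q \<ge> t}. ennreal (d' (f p) (f q)))"

definition quasiconformal_on :: "real \<Rightarrow> 'a set \<Rightarrow> ('a \<Rightarrow> 'a \<Rightarrow> real) \<Rightarrow>
    'b set \<Rightarrow> ('b \<Rightarrow> 'b \<Rightarrow> real) \<Rightarrow> 'a set \<Rightarrow> ('a \<Rightarrow> 'b) \<Rightarrow> bool" where
  "quasiconformal_on K M d M' d' U f \<longleftrightarrow>
     embedding_map (subtopology (Metric_space.mtopology M d) U) (Metric_space.mtopology M' d') f \<and>
     (\<forall>p\<in>U. Limsup (at_right 0) (qc_quotient U d d' f p) \<le> ennreal K)"

definition locally_qc_equivalent ::
  "'a set \<Rightarrow> ('a \<Rightarrow> 'a \<Rightarrow> real) \<Rightarrow> 'b set \<Rightarrow> ('b \<Rightarrow> 'b \<Rightarrow> real) \<Rightarrow> bool" where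
  "locally_qc_equivalent M d M' d' \<longleftrightarrow>
     (\<exists>U U' f. U \<noteq> {} \<and> U' \<noteq> {} \<and>
        openin (Metric_space.mtopology M d) U \<and> openin (Metric_space.mtopology M' d') U' \<and>
        f ` U = U' \<and> (\<exists>K\<ge>1. quasiconformal_on K M d M' d' U f))"

end

theory Submission
 imports Defs
begin

text \<open>
The group \<open>H\<close> is \<open>\<real>\<^sup>5\<close> with \<open>[X\<^sub>1,X\<^sub>2] = k X\<^sub>3\<close>, \<open>[X\<^sub>1,X\<^sub>3] = X\<^sub>4\<close>, \<open>[X\<^sub>2,X\<^sub>3] = X\<^sub>5\<close> for
\<open>k = 1\<close> and horizontal bundle spanned by \<open>X\<^sub>1, X\<^sub>2, X\<^sub>3\<close>; its tangent cone is the same family at \<open>k = 0\<close>,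
because \<open>[X\<^sub>1,X\<^sub>2]\<close> is already horizontal. Both have homogeneous dimension 7.

Let \<open>f\<close> be quasiconformal from an open subset of \<open>H\<close> into the cone. Comparing the measures of images of balls
along a tube shows that \<open>f\<close> is absolutely continuous on almost every integral curve of \<open>X\<^sub>1\<close> and \<open>X\<^sub>2\<close>, so the
first three coordinates of \<open>f\<close> have derivatives \<open>a\<^sub>i, b\<^sub>i, c\<^sub>i\<close> along \<open>X\<^sub>i\<close> almost everywhere. The points reached from
\<open>p\<close> by following \<open>X\<^sub>1, X\<^sub>2\<close> and \<open>X\<^sub>2, X\<^sub>1\<close> for time \<open>r\<close> differ by \<open>r\<^sup>2\<close> in the horizontal direction \<open>X\<^sub>3\<close> (up to
higher order), hence are \<open>o(r)\<close> apart, and by quasiconformality so are their images. On the other hand the two contact forms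
of the cone, integrated along the image curves, give these images fourth and fifth coordinates that differ
by \<open>r\<^sup>2 (a\<^sub>2 c\<^sub>1 - a\<^sub>1 c\<^sub>2)\<close> and \<open>r\<^sup>2 (b\<^sub>2 c\<^sub>1 - b\<^sub>1 c\<^sub>2)\<close>. So both vanish, and if \<open>(c\<^sub>1, c\<^sub>2) \<noteq> 0\<close> then \<open>f\<close> is
degenerate in the direction \<open>c\<^sub>2 X\<^sub>1 - c\<^sub>1 X\<^sub>2\<close>, which quasiconformality forbids. Therefore the third
coordinate of \<open>f\<close> is constant along \<open>X\<^sub>1\<close> and \<open>X\<^sub>2\<close>; these generate the Lie algebra of \<open>H\<close>, so it is locally constant
and the image of \<open>f\<close> is not open.
\<close>

section \<open>Monotone and absolutely continuous functions\<close>

text \<open>The map is never differentiated as a map between groups. Derivatives are known only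
  along X1 and X2, only for the first three coordinates of the image and only almost everywhere,
  whereas the commutator argument needs them at a base point and at the corners of a path
  simultaneously. The domain is therefore cut into countably many Borel sets on which one list of
  rational slopes, one error and one scale serve all points (\<open>tame\<close>). If such a set had
  positive measure, a Steinhaus argument would place the base point and the corners in it together;
  the estimates then bound the slope in terms of the error, and the error is fixed beforehand so as
  to make this absurd. Coordinates four and five are recovered from Riemann sums of the contact
  forms, which is why a bound on the variation of the image curves (\<open>varc\<close>) accompanies
  the slopes. The analysis uses the explicit gauge \<open>nrm\<close> and the function
  \<open>rho\<close> instead of the Carnot-Caratheodory distances; these are comparable at small
  scale, and the constants of the comparison enter only through the locale
  \<open>qc_setup\<close>.\<close>

lemma vitali_intervals:
 fixes E U :: "real set"
 assumes "open U" "E \<subseteq> U"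
  and Q: "!!x d. x \<in> E ==> 0 < d ==> \<exists>a b. a < x & x < b & b - a < d & Q a b"
 obtains C :: "(real \<times> real) set" where "countable C"
  "!!i. i \<in> C ==> fst i < snd i & Q (fst i) (snd i) & {fst i..snd i} \<subseteq> U"
  "disjoint_family_on (%i. {fst i..snd i}) C"
  "negligible (E - (\<Union>i\<in>C. {fst i..snd i}))"
proof -
 define K where "K = {i :: real \<times> real. fst i < snd i & Q (fst i) (snd i) & {fst i..snd i} \<subseteq> U}"
 \<comment> \<open>In dimension one a closed interval is the closed ball about its midpoint, so the
   covering theorem for balls applies although the points of \<open>E\<close> need not be
   midpoints.\<close>
 have cb: "cball ((fst i + snd i) / 2) ((snd i - fst i) / 2) = {fst i..snd i}" for i :: "real \<times> real"
  by (auto simp: cball_def dist_real_def abs_le_iff field_simps)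
 have 1: "0 < (snd i - fst i) / 2" if "i \<in> K" for i using that by (auto simp: K_def)
 have 2: "\<exists>i. i \<in> K & x \<in> cball ((fst i + snd i) / 2) ((snd i - fst i) / 2) & (snd i - fst i) / 2 < d"
  if x: "x \<in> E" and d: "0 < d" for x d
 proof -
  obtain e where e: "e > 0" "ball x e \<subseteq> U"
   using \<open>open U\<close> x \<open>E \<subseteq> U\<close> open_contains_ball by blast
  obtain a b where ab: "a < x" "x < b" "b - a < min d e" "Q a b" using Q[OF x, of "min d e"] d e by auto
  have "{a..b} \<subseteq> ball x e" using ab by (auto simp: ball_def dist_real_def)
  then show ?thesis unfolding cb using ab e by (intro exI[of _ "(a, b)"]) (auto simp: K_def)
 qed
 obtain C where C: "countable C" "C \<subseteq> K"
   "pairwise (%i j. disjnt (cball ((fst i + snd i) / 2) ((snd i - fst i) / 2))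
    (cball ((fst j + snd j) / 2) ((snd j - fst j) / 2))) C"
   "negligible (E - (\<Union>i\<in>C. cball ((fst i + snd i) / 2) ((snd i - fst i) / 2)))"
  by (rule Vitali_covering_theorem_cballs[of K "%i. (snd i - fst i) / 2" E "%i. (fst i + snd i) / 2", OF 1 2]) ((rule that | assumption)+)
 show ?thesis
  using C by (intro that[of C]) (auto simp: cb K_def pairwise_def disjnt_def disjoint_family_on_def)
qed

lemma nonneg_le_scaled:
 assumes "disjoint_family_on X C" "countable C" "!!i. i \<in> C ==> X i \<in> sets M" "!!i. i \<in> C ==> X i \<in> sets N"
  "!!i. i \<in> C ==> emeasure M (X i) <= c * emeasure N (X i)"
 shows "emeasure M (\<Union>i\<in>C. X i) <= c * emeasure N (\<Union>i\<in>C. X i)"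
 using assms by (subst (1 2) emeasure_UN_countable)
  (auto simp: nn_integral_cmult[symmetric] intro!: nn_integral_mono)

text \<open>The disjoint intervals of a Vitali cover exhaust \<open>E\<close> up to a null set and
  lie in \<open>U\<close>; on each the Stieltjes measure of \<open>V\<close> exceeds
  \<open>q\<close> times the length, so it is enough to add up.\<close>

lemma vitali_upper_bound:
 fixes V :: "real => real"
 assumes V: "mono V" "continuous_on UNIV V" and E: "E \<in> sets borel" and U: "open U" "E \<subseteq> U" and "0 < q"
  and Q: "!!x d. x \<in> E ==> 0 < d ==> \<exists>a b. a < x & x < b & b - a < d & q * (b - a) < V b - V a"
 shows "q * emeasure lborel E <= emeasure (interval_measure V) U"
proof -
 obtain C :: "(real \<times> real) set" where C: "countable C"
  "!!i. i \<in> C ==> fst i < snd i & q * (snd i - fst i) < V (snd i) - V (fst i) & {fst i..snd i} \<subseteq> U"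
  "disjoint_family_on (%i. {fst i..snd i}) C"
  "negligible (E - (\<Union>i\<in>C. {fst i..snd i}))"
  by (rule vitali_intervals[OF U Q]) ((rule that | assumption)+)
 let ?B = "\<Union>i\<in>C. {fst i..snd i}"
 have B: "?B \<in> sets borel" using C(1) by (intro sets.countable_UN') auto
 have *: "ennreal q * emeasure lborel ?B <= emeasure (interval_measure V) ?B"
 proof -
  have "emeasure lborel ?B <= ennreal (1 / q) * emeasure (interval_measure V) ?B"
  proof (rule nonneg_le_scaled)
   fix i assume i: "i \<in> C"
   have "emeasure lborel {fst i..snd i} = ennreal (snd i - fst i)" using C(2)[OF i] by simp
   also have "... <= ennreal (1 / q * (V (snd i) - V (fst i)))"
    using C(2)[OF i] \<open>0 < q\<close> by (intro ennreal_leI) (simp add: field_simps)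
   also have "... = ennreal (1 / q) * emeasure (interval_measure V) {fst i..snd i}"
    using C(2)[OF i] V \<open>0 < q\<close>
    by (subst emeasure_interval_measure_Icc) (auto simp: monoD simp flip: ennreal_mult')
   finally show "emeasure lborel {fst i..snd i} <= ennreal (1 / q) * emeasure (interval_measure V) {fst i..snd i}" .
  qed (use C in auto)
  then have "ennreal q * emeasure lborel ?B <= ennreal q * (ennreal (1 / q) * emeasure (interval_measure V) ?B)"
   by (intro mult_left_mono) auto
  also have "... = emeasure (interval_measure V) ?B"
   using \<open>0 < q\<close> by (simp flip: mult.assoc ennreal_mult)
  finally show ?thesis .
 qed
 have "emeasure lborel E <= emeasure lborel (?B \<union> (E - ?B))" using B E by (intro emeasure_mono) auto
 also have "... <= emeasure lborel ?B + emeasure lborel (E - ?B)"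
  using B E by (intro emeasure_subadditive) auto
 also have "emeasure lborel (E - ?B) = 0" using C(4) E B by (simp add: negligible_iff_emeasure0)
 finally have "ennreal q * emeasure lborel E <= ennreal q * emeasure lborel ?B" by (intro mult_left_mono) auto
 also note *
 also have "emeasure (interval_measure V) ?B <= emeasure (interval_measure V) U"
  using C(2) U by (intro emeasure_mono) auto
 finally show ?thesis .
qed

text \<open>The dual estimate. \<open>W\<close> is the union of the open intervals of the cover, so
  that the estimate for large slopes can be applied inside it; only countably many endpoints are
  lost.\<close>

lemma vitali_lower_bound:
 fixes V :: "real => real"
 assumes V: "mono V" "continuous_on UNIV V" and E: "E \<in> sets borel" and U: "open U" "E \<subseteq> U" and "0 < q"
  and Q: "!!x d. x \<in> E ==> 0 < d ==> \<exists>a b. a < x & x < b & b - a < d & V b - V a < q * (b - a)"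
 shows "\<exists>W. open W & negligible (E - W) & emeasure (interval_measure V) W <= q * emeasure lborel U"
proof -
 obtain C :: "(real \<times> real) set" where C: "countable C"
  "!!i. i \<in> C ==> fst i < snd i & V (snd i) - V (fst i) < q * (snd i - fst i) & {fst i..snd i} \<subseteq> U"
  "disjoint_family_on (%i. {fst i..snd i}) C"
  "negligible (E - (\<Union>i\<in>C. {fst i..snd i}))"
  by (rule vitali_intervals[OF U Q]) ((rule that | assumption)+)
 let ?B = "\<Union>i\<in>C. {fst i..snd i}" and ?W = "\<Union>i\<in>C. {fst i<..<snd i}"
 have "emeasure (interval_measure V) ?B <= ennreal q * emeasure lborel ?B"
 proof (rule nonneg_le_scaled)
  fix i assume i: "i \<in> C"
  have "emeasure (interval_measure V) {fst i..snd i} = ennreal (V (snd i) - V (fst i))"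
   using C(2)[OF i] V by (subst emeasure_interval_measure_Icc) (auto simp: monoD)
  also have "... <= ennreal (q * (snd i - fst i))" using C(2)[OF i] by (intro ennreal_leI) simp
  also have "... = ennreal q * emeasure lborel {fst i..snd i}"
   using C(2)[OF i] \<open>0 < q\<close> by (simp add: ennreal_mult')
  finally show "emeasure (interval_measure V) {fst i..snd i} <= ennreal q * emeasure lborel {fst i..snd i}" .
 qed (use C in auto)
 moreover have "emeasure (interval_measure V) ?W <= emeasure (interval_measure V) ?B"
  using C(1) by (intro emeasure_mono UN_mono sets.countable_UN') (auto)
 moreover have "emeasure lborel ?B <= emeasure lborel U" using C(2) U by (intro emeasure_mono) auto
 then have "ennreal q * emeasure lborel ?B <= ennreal q * emeasure lborel U" by (intro mult_left_mono) auto
 moreover have "negligible (E - ?W)"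
 proof (rule negligible_subset)
  have "negligible (\<Union>i\<in>C. {fst i, snd i})" using C(1) by (intro negligible_countable_Union) auto
  then show "negligible ((E - ?B) \<union> (\<Union>i\<in>C. {fst i, snd i}))"
   using C(4) by (rule negligible_Un[rotated])
 qed force
 ultimately show ?thesis by (intro exI[of _ ?W]) auto
qed

lemma open_interval_property:
 "open {x::real. \<exists>a b. a < x & x < b & R a b}"
proof -
 have "{x. \<exists>a b. a < x & x < b & R a b} = (\<Union>(a,b)\<in>{(a,b). R a b}. {a<..<b})" by auto blast
 then show ?thesis by auto
qed

text \<open>Measurable for arbitrary \<open>R\<close>: at each scale \<open>1 / Suc n\<close> the
  set is a union of open intervals.\<close>

lemma borel_small_intervals:
 "{x::real. \<forall>d>0. \<exists>a b. a < x & x < b & b - a < d & R a b} \<in> sets borel"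
proof -
 have "{x. \<forall>d>0. \<exists>a b. a < x & x < b & b - a < d & R a b}
   = (\<Inter>n::nat. {x. \<exists>a b. a < x & x < b & (b - a < 1 / Suc n & R a b)})" (is "?L = ?R")
 proof
  show "?L \<subseteq> ?R" by auto
  show "?R \<subseteq> ?L"
  proof clarsimp
   fix x d :: real assume *: "\<forall>n. \<exists>a<x. \<exists>b>x. b - a < 1 / (1 + real n) & R a b" and "0 < d"
   then obtain n where "1 / (1 + real n) < d" using nat_approx_posE by (metis of_nat_Suc add.commute)
   then show "\<exists>a<x. \<exists>b>x. b - a < d & R a b" using *[rule_format, of n] by (meson less_trans)
  qed
 qed
 also have "... \<in> sets borel"
  using open_interval_property by (intro sets.countable_INT) (auto intro!: borel_open)
 finally show ?thesis .
qed

lemma negligible_locally: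
 assumes "!!n::nat. negligible (E \<inter> {-real (Suc n)<..<real (Suc n)})"
 shows "negligible E"
proof (rule negligible_subset)
 show "negligible (\<Union>n. E \<inter> {-real (Suc n)<..<real (Suc n)})" by (intro negligible_Union_nat assms)
 show "E \<subseteq> (\<Union>n. E \<inter> {-real (Suc n)<..<real (Suc n)})"
 proof
  fix x assume x: "x \<in> E"
  obtain n :: nat where "abs x < real n" using reals_Archimedean2 by blast
  then show "x \<in> (\<Union>n. E \<inter> {-real (Suc n)<..<real (Suc n)})" using x by (auto intro!: exI[of _ n])
 qed
qed

text \<open>Lebesgue's argument. If the set has measure \<open>s\<close> in a bounded window, the
  cover by small slopes gives an open set of Stieltjes measure at most \<open>p * (s + e)\<close>
  that carries almost all of it, and the cover by large slopes inside that open set gives at least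
  \<open>q * s\<close>. As \<open>e\<close> tends to 0, \<open>p < q\<close> forces
  \<open>s = 0\<close>.\<close>

lemma mono_two_slopes_negligible:
 fixes V :: "real => real"
 assumes V: "mono V" "continuous_on UNIV V" and pq: "p < q" "0 < q"
 shows "negligible {x. (\<forall>d>0. \<exists>a b. a < x & x < b & b - a < d & V b - V a < p * (b - a))
   & (\<forall>d>0. \<exists>a b. a < x & x < b & b - a < d & q * (b - a) < V b - V a)}"
  (is "negligible ?E")
\<comment> \<open>A monotone function has no negative slopes, so for \<open>p <= 0\<close> the set
  is empty.\<close>
proof (cases "0 < p")
 case False
 have "?E = {}"
 proof -
  { fix a b :: real assume "a < b" "V b - V a < p * (b - a)"
   then have "V b - V a < 0" using False by (meson diff_gt_0_iff_gt less_le_trans mult_nonpos_nonneg not_less order.strict_implies_order)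
   then have False using \<open>a < b\<close> monoD[OF V(1), of a b] by simp }
  then have "\<not> (\<forall>d>0. \<exists>a b. a < x & x < b & b - a < d & V b - V a < p * (b - a))" for x
   using zero_less_one less_trans by blast
  then show ?thesis by blast
 qed
 then show ?thesis by (metis negligible_empty)
next
 case True
 have Eb: "?E \<in> sets borel" using sets.Int[OF borel_small_intervals[of "%a b. V b - V a < p * (b - a)"]
   borel_small_intervals[of "%a b. q * (b - a) < V b - V a"]] by (simp add: Int_def)
 have "negligible (?E \<inter> {-n<..<n})" for n :: real
 proof -
  let ?F = "?E \<inter> {-n<..<n}"
  have F: "?F \<in> sets borel" using Eb by auto
  have fin: "emeasure lborel ?F < \<infinity>"
   by (rule le_less_trans[OF emeasure_mono[of _ "{-n..n}"]]) (auto simp: emeasure_lborel_Icc_eq)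
  define s where "s = measure lborel ?F"
  have s: "emeasure lborel ?F = ennreal s" "0 <= s"
   using fin by (auto simp: s_def emeasure_eq_ennreal_measure less_top)
  have "q * s <= p * (s + e)" if e: "e > 0" for e
  proof -
   obtain T where T: "open T" "?F \<subseteq> T" "T - ?F \<in> lmeasurable" "emeasure lebesgue (T - ?F) < ennreal e"
    using sets_lebesgue_outer_open[of ?F e] F e by auto
   have "emeasure lborel T = emeasure lborel ?F + emeasure lborel (T - ?F)"
    using T F by (subst plus_emeasure) (auto simp: Un_absorb1)
   also have "... <= ennreal s + ennreal e"
    unfolding s(1) using T(1,4) F by (intro add_left_mono) (auto intro: less_imp_le)
   finally have eT: "emeasure lborel T <= ennreal (s + e)" using s e by simp
   obtain W where W: "open W" "negligible (?F - W)" "emeasure (interval_measure V) W <= p * emeasure lborel T"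
    using vitali_lower_bound[OF V F T(1,2) True] by auto
   have "q * emeasure lborel (?F \<inter> W) <= emeasure (interval_measure V) W"
    using F W(1) by (intro vitali_upper_bound[OF V _ W(1) _ pq(2)]) auto
   also have "... <= p * emeasure lborel T" by fact
   also have "... <= ennreal p * ennreal (s + e)" using eT by (intro mult_left_mono) auto
   also have "... = ennreal (p * (s + e))" using True by (simp add: ennreal_mult')
   finally have 1: "q * emeasure lborel (?F \<inter> W) <= ennreal (p * (s + e))" .
   have "emeasure lborel (?F - W) = 0" using W F by (simp add: negligible_iff_emeasure0)
   moreover have "emeasure lborel ?F = emeasure lborel (?F \<inter> W) + emeasure lborel (?F - W)"
    using F W by (subst plus_emeasure) (auto simp: Int_Diff_Un)
   ultimately have "emeasure lborel (?F \<inter> W) = ennreal s" using s by simp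
   with 1 have "ennreal (q * s) <= ennreal (p * (s + e))" using pq by (simp add: ennreal_mult')
   then show ?thesis using True s e pq by (subst (asm) ennreal_le_iff) auto
  qed
  have "q * s <= p * s"
  proof (rule field_le_epsilon)
   fix e :: real assume "0 < e"
   then show "q * s <= p * s + e"
    using \<open>!!e. e > 0 ==> q * s <= p * (s + e)\<close>[of "e / p"] True by (simp add: distrib_left)
  qed
  then have "s = 0" using pq s by (meson antisym mult_right_less_imp_less not_le mult_strict_right_mono less_eq_real_def)
  then show ?thesis using s F by (simp add: negligible_iff_emeasure0)
 qed
 then show ?thesis by (rule negligible_locally)
qed

text \<open>In a bounded window, \<open>Suc q\<close> times the measure of the set stays below the
  increment of \<open>V\<close>, for every \<open>q\<close>.\<close>

lemma mono_infinite_slope_negligible: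
 fixes V :: "real => real"
 assumes V: "mono V" "continuous_on UNIV V"
 shows "negligible {x. \<forall>q::real. \<forall>d>0. \<exists>a b. a < x & x < b & b - a < d & q * (b - a) < V b - V a}"
  (is "negligible ?E")
proof -
 define F where "F q = {x. \<forall>d>0. \<exists>a b. a < x & x < b & b - a < d & q * (b - a) < V b - V a}" for q
 have Fb: "F q \<in> sets borel" for q unfolding F_def by (rule borel_small_intervals)
 have "negligible (?E \<inter> {-n<..<n})" if "n > 0" for n :: real
 proof -
  define H where "H = (\<Inter>q::nat. F (Suc q)) \<inter> {-n<..<n}"
  have H: "H \<in> sets borel" using Fb by (auto simp: H_def intro!: sets.Int sets.countable_INT)
  have b: "ennreal (Suc q) * emeasure lborel H <= ennreal (V n - V (-n))" for q :: nat
  proof -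
   have "ennreal (Suc q) * emeasure lborel H <= emeasure (interval_measure V) {-n<..<n}"
    by (rule vitali_upper_bound[OF V H]) (auto simp: H_def F_def)
   also have "... <= emeasure (interval_measure V) {-n..n}" by (intro emeasure_mono) auto
   also have "... = ennreal (V n - V (-n))"
    using V that by (subst emeasure_interval_measure_Icc) (auto simp: monoD)
   finally show ?thesis by (simp add: ennreal_of_nat_eq_real_of_nat)
  qed
  have "emeasure lborel H < \<infinity>" using b[of 0] le_less_trans[OF _ ennreal_less_top] by simp
  then obtain s where s: "emeasure lborel H = ennreal s" "0 <= s" by (cases "emeasure lborel H") auto
  have "real (Suc q) * s <= V n - V (-n)" for q
   using b[of q] s V that monoD[OF V(1), of "-n" n] by (simp flip: ennreal_mult' del: of_nat_Suc)
  then have "s = 0"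
   using s reals_Archimedean3[of s] by (metis antisym_conv2 less_eq_real_def not_less of_nat_0_less_iff mult_less_cancel_right order_less_irrefl lessI less_trans of_nat_less_iff not_le)
  then have "negligible H" using s H by (simp add: negligible_iff_emeasure0)
  then show ?thesis by (rule negligible_subset) (auto simp: H_def F_def)
 qed
 then show ?thesis by - (rule negligible_locally, simp del: of_nat_Suc)
qed

text \<open>The hypothesis speaks of intervals with \<open>x\<close> strictly inside; letting one
  endpoint tend to \<open>x\<close> and using the continuity of \<open>V\<close> gives the one-sided
  difference quotients.\<close>

lemma slope_limit_imp_differentiable:
 fixes V :: "real => real"
 assumes V: "continuous_on UNIV V"
  and D: "!!e. e > 0 ==> \<exists>d>0. \<forall>a b. a < x & x < b & b - a < d --> abs (V b - V a - D * (b - a)) <= e * (b - a)"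
 shows "(V has_real_derivative D) (at x)" unfolding has_field_derivative_def has_derivative_at_within
proof (intro conjI bounded_linear_mult_right tendstoI)
 fix e :: real assume "0 < e"
 then obtain d where d: "d > 0" "!!a b. a < x ==> x < b ==> b - a < d ==> abs (V b - V a - D * (b - a)) <= (e/2) * (b - a)"
  using D[of "e/2"] by auto
 have le: "abs (V y - V x - D * (y - x)) <= (e/2) * abs (y - x)" if y: "y ~= x" "abs (y - x) < d" for y
 proof (cases "x < y")
  case True
  have "((%a. (e/2) * (y - a) - abs (V y - V a - D * (y - a))) \<longlongrightarrow> (e/2) * (y - x) - abs (V y - V x - D * (y - x))) (at_left x)"
   using V by (intro tendsto_intros) (auto simp: continuous_on_def intro: tendsto_within_subset)
  moreover have "\<forall>\<^sub>F a in at_left x. 0 <= (e/2) * (y - a) - abs (V y - V a - D * (y - a))"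
   unfolding eventually_at_left_field using d(2)[of _ y] True y by (intro exI[of _ "y - d"]) auto
  ultimately have "0 <= (e/2) * (y - x) - abs (V y - V x - D * (y - x))" by (intro tendsto_lowerbound) auto
  then show ?thesis using True by simp
 next
  case False
  then have yx: "y < x" using y by simp
  have "((%a. (e/2) * (a - y) - abs (V a - V y - D * (a - y))) \<longlongrightarrow> (e/2) * (x - y) - abs (V x - V y - D * (x - y))) (at_right x)"
   using V by (intro tendsto_intros) (auto simp: continuous_on_def intro: tendsto_within_subset)
  moreover have "\<forall>\<^sub>F a in at_right x. 0 <= (e/2) * (a - y) - abs (V a - V y - D * (a - y))"
   unfolding eventually_at_right_field using d(2)[of y] yx y by (intro exI[of _ "y + d"]) auto
  ultimately have "0 <= (e/2) * (x - y) - abs (V x - V y - D * (x - y))" by (intro tendsto_lowerbound) auto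
  then show ?thesis using yx abs_minus_commute[of "V x + D * y" "V y + D * x"] by (simp add: algebra_simps)
 qed
 show "\<forall>\<^sub>F y in at x. dist ((V y - V x - D * (y - x)) /\<^sub>R norm (y - x)) 0 < e"
  unfolding eventually_at
 proof (intro exI[of _ d] conjI ballI impI d(1))
  fix y assume "y ~= x & dist y x < d"
  then have "abs (V y - V x - D * (y - x)) <= (e/2) * abs (y - x)" "y ~= x"
   using le[of y] by (auto simp: dist_real_def)
  then have "abs (V y - V x - D * (y - x)) / abs (y - x) <= e / 2" by (simp add: divide_le_eq)
  moreover have "dist ((V y - V x - D * (y - x)) /\<^sub>R norm (y - x)) 0 = abs (V y - V x - D * (y - x)) / abs (y - x)"
   by (simp add: divide_inverse abs_mult mult.commute)
  ultimately show "dist ((V y - V x - D * (y - x)) /\<^sub>R norm (y - x)) 0 < e"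
   using \<open>0 < e\<close> by linarith
 qed
qed

text \<open>The derivative is the supremum \<open>D\<close> of the slopes that recur at arbitrarily
  small scale. Off the exceptional set, slopes below \<open>p\<close> and slopes above
  \<open>q\<close> cannot both recur for rationals \<open>p < q\<close> with \<open>0 < q\<close>,
  so all small-scale slopes approach \<open>D\<close>.\<close>

theorem mono_differentiable_ae:
 fixes V :: "real => real"
 assumes V: "mono V" "continuous_on UNIV V"
 shows "negligible {x. \<not> V differentiable (at x)}"
proof -
 define hi where "hi q x \<longleftrightarrow> (\<forall>d>0. \<exists>a b. a < x & x < b & b - a < d & q * (b - a) < V b - V a)" for q x :: real
 define lo where "lo q x \<longleftrightarrow> (\<forall>d>0. \<exists>a b. a < x & x < b & b - a < d & V b - V a < q * (b - a))" for q x :: real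
 have hi_mono: "hi p x" if "hi q x" "p <= q" for p q x unfolding hi_def
 proof (intro allI impI)
  fix d :: real assume "d > 0"
  then obtain a b where ab: "a < x" "x < b" "b - a < d" "q * (b - a) < V b - V a"
   using \<open>hi q x\<close> unfolding hi_def by blast
  then have "p * (b - a) <= q * (b - a)" using \<open>p <= q\<close> by (intro mult_right_mono) auto
  then show "\<exists>a b. a < x & x < b & b - a < d & p * (b - a) < V b - V a" using ab le_less_trans by blast
 qed
 let ?N = "{x. \<forall>q. hi q x} \<union> (\<Union>p\<in>\<rat>. \<Union>q\<in>\<rat> \<inter> {max 0 p<..}. {x. lo p x & hi q x})"
 have "negligible ?N"
 proof (intro negligible_Un negligible_countable_Union)
  show "negligible {x. \<forall>q. hi q x}" using mono_infinite_slope_negligible[OF V] by (simp add: hi_def)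
  fix S assume "S \<in> (%p. \<Union>q\<in>\<rat> \<inter> {max 0 p<..}. {x. lo p x & hi q x}) ` \<rat>"
  then obtain p where S: "S = (\<Union>q\<in>\<rat> \<inter> {max 0 p<..}. {x. lo p x & hi q x})" by auto
  show "negligible S" unfolding S
  proof (intro negligible_countable_Union)
   fix T assume "T \<in> (%q. {x. lo p x & hi q x}) ` (\<rat> \<inter> {max 0 p<..})"
   then show "negligible T" using mono_two_slopes_negligible[OF V, of p] by (auto simp: lo_def hi_def)
  qed (auto intro!: countable_Int1 countable_rat)
 qed (auto intro!: countable_rat)
 moreover have "{x. \<not> V differentiable (at x)} \<subseteq> ?N"
 proof (intro subsetI; rule ccontr)
  fix x assume nd: "x \<in> {x. \<not> V differentiable (at x)}" and x: "x \<notin> ?N"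
  then obtain q0 where q0: "\<not> hi q0 x" by auto
  have lohi: "\<not> (lo p x & hi q x)" if "p \<in> \<rat>" "q \<in> \<rat>" "0 < q" "p < q" for p q
   using x that by auto
  have "hi (-1) x" unfolding hi_def
  proof (intro allI impI)
   fix d :: real assume "d > 0"
   then show "\<exists>a b. a < x & x < b & b - a < d & - 1 * (b - a) < V b - V a"
    using monoD[OF V(1), of "x - d/4" "x + d/4"]
    by (rule_tac exI[of _ "x - d/4"], rule_tac exI[of _ "x + d/4"]) auto
  qed
  define D where "D = Sup {q. hi q x}"
  have bdd: "bdd_above {q. hi q x}"
   using q0 hi_mono by (intro bdd_aboveI[of _ q0]) (metis linear mem_Collect_eq)
  have "(V has_real_derivative D) (at x)"
  proof (rule slope_limit_imp_differentiable[OF V(2)])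
   fix e :: real assume e: "e > 0"
   have "\<not> hi (D + e) x" using cSup_upper[OF _ bdd, of "D + e"] e by (auto simp: D_def)
   then obtain d1 where d1: "d1 > 0" "!!a b. a < x ==> x < b ==> b - a < d1 ==> V b - V a <= (D + e) * (b - a)"
    unfolding hi_def by (meson not_less)
   have "\<exists>d2>0. \<forall>a b. a < x & x < b & b - a < d2 --> (D - e) * (b - a) <= V b - V a"
   \<comment> \<open>The exceptional sets cover only \<open>0 < q\<close>; when
     \<open>D - e / 2 <= 0\<close>, monotonicity of \<open>V\<close> already gives the lower
     bound.\<close>
   proof (cases "D - e / 2 <= 0")
    case True
    show ?thesis
    proof (intro exI[of _ 1] conjI allI impI)
     fix a b assume ab: "a < x & x < b & b - a < 1"
     have "(D - e) * (b - a) <= 0" using True e ab by (intro mult_nonpos_nonneg) auto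
     also have "0 <= V b - V a" using ab monoD[OF V(1), of a b] by auto
     finally show "(D - e) * (b - a) <= V b - V a" .
    qed auto
   next
    case False
    obtain q where q: "hi q x" "D - e / 2 < q"
     using less_cSupD[of "{q. hi q x}" "D - e/2"] \<open>hi (-1) x\<close> e by (auto simp: D_def)
    obtain q' where q': "q' \<in> \<rat>" "D - e / 2 < q'" "q' < q" using Rats_dense_in_real[OF q(2)] by auto
    obtain p where p: "p \<in> \<rat>" "D - e < p" "p < D - e / 2" using Rats_dense_in_real[of "D - e" "D - e/2"] e by auto
    have "\<not> lo p x" using lohi[OF p(1) q'(1)] q' p False hi_mono[OF q(1), of q'] by auto
    then obtain d2 where d2: "d2 > 0" "!!a b. a < x ==> x < b ==> b - a < d2 ==> p * (b - a) <= V b - V a"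
     unfolding lo_def by (meson not_less)
    show ?thesis
    proof (intro exI[of _ d2] conjI allI impI d2(1))
     fix a b assume ab: "a < x & x < b & b - a < d2"
     have "(D - e) * (b - a) <= p * (b - a)" using p ab by (intro mult_right_mono) auto
     also have "... <= V b - V a" using d2 ab by auto
     finally show "(D - e) * (b - a) <= V b - V a" .
    qed
   qed
   then obtain d2 where d2: "d2 > 0" "!!a b. a < x ==> x < b ==> b - a < d2 ==> (D - e) * (b - a) <= V b - V a"
    by blast
   show "\<exists>d>0. \<forall>a b. a < x & x < b & b - a < d --> abs (V b - V a - D * (b - a)) <= e * (b - a)"
   proof (intro exI[of _ "min d1 d2"] conjI allI impI)
    fix a b assume "a < x & x < b & b - a < min d1 d2"
    then show "abs (V b - V a - D * (b - a)) <= e * (b - a)"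
     using d1(2)[of a b] d2(2)[of a b] by (simp add: abs_le_iff algebra_simps)
   qed (use d1 d2 in auto)
  qed
  with nd show False by (auto simp: real_differentiable_def)
 qed
 ultimately show ?thesis by (rule negligible_subset)
qed

section \<open>Absolutely continuous functions and curves on an interval\<close>

abbreviation ac_family :: "real => real => (real \<times> real) set => bool" where
 "ac_family a b I \<equiv> finite I & (\<forall>(x, y)\<in>I. a <= x & x < y & y <= b) &
   pairwise (%(x, y) (x', y'). disjnt {x<..<y} {x'<..<y'}) I"

abbreviation tlen :: "(real \<times> real) set => real" where "tlen I \<equiv> \<Sum>(x, y)\<in>I. y - x"

abbreviation osc :: "(real => real) => (real \<times> real) set => real" where
 "osc f I \<equiv> \<Sum>(x, y)\<in>I. abs (f y - f x)"

text \<open>Absolute continuity of an abstract increment \<open>s x y\<close>, so that one notion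
  covers real functions and curves measured by \<open>rho\<close>, where neither a linear structure
  nor symmetry is available.\<close>

definition pair_ac :: "real => real => (real => real => real) => bool" where
 "pair_ac a b s \<longleftrightarrow> (\<forall>e>0. \<exists>d>0. \<forall>I :: (real \<times> real) set.
   ac_family a b I &
   tlen I < d
   --> (\<Sum>(x, y)\<in>I. s x y) < e)"

lemma abs_continuous_pair_ac: "abs_continuous a b f = pair_ac a b (%x y. abs (f y - f x))"
 by (simp add: abs_continuous_def pair_ac_def)

lemma pair_ac_mono:
 assumes s: "pair_ac a b s" and cd: "a <= c" "d <= b"
  and le: "!!x y. c <= x ==> x < y ==> y <= d ==> t x y <= s x y"
 shows "pair_ac c d t" unfolding pair_ac_def
proof (intro allI impI)
 fix e :: real assume "0 < e"
 then obtain dl where dl: "dl > 0" "!!I. ac_family a b I & tlen I < dl ==> (\<Sum>(x, y)\<in>I. s x y) < e"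
  using s[unfolded pair_ac_def, rule_format, OF \<open>0 < e\<close>] by blast
 have "(\<Sum>(x, y)\<in>I. t x y) < e" if I: "ac_family c d I & tlen I < dl" for I
 proof -
  have "(\<Sum>(x, y)\<in>I. t x y) <= (\<Sum>(x, y)\<in>I. s x y)" using I le by (intro sum_mono) auto
  also have "... < e" using I cd by (intro dl(2)) fastforce
  finally show ?thesis .
 qed
 then show "\<exists>dl>0. \<forall>I. ac_family c d I & tlen I < dl --> (\<Sum>(x, y)\<in>I. t x y) < e"
  using dl(1) by blast
qed

text \<open>Partitions of an interval starting at \<open>a\<close>, grown at the right end. Keeping
  them as sets of pairs makes them admissible families for \<open>pair_ac\<close>.\<close>

inductive chain :: "real => real => (real \<times> real) set => bool" for a where
 chain_refl: "chain a a {}"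
| chain_step: "chain a s I ==> s < t ==> chain a t (insert (s, t) I)"

lemma chain_props:
 assumes "chain a t I"
 shows "a <= t" "finite I" "(x, y) \<in> I ==> a <= x & x < y & y <= t"
  "pairwise (%(x, y) (x', y'). disjnt {x<..<y} {x'<..<y'}) I" "tlen I = t - a"
proof -
 have "a <= t & ac_family a t I & tlen I = t - a" using assms
 proof induction
  case (chain_step s I t)
  then have "(s, t) \<notin> I" by force
  moreover have "pairwise (%(x, y) (x', y'). disjnt {x<..<y} {x'<..<y'}) (insert (s, t) I)"
   using chain_step by (fastforce simp: pairwise_insert disjnt_def)
  ultimately show ?case using chain_step by force
 qed auto
 then show "a <= t" "finite I" "(x, y) \<in> I ==> a <= x & x < y & y <= t"
  "pairwise (%(x, y) (x', y'). disjnt {x<..<y} {x'<..<y'}) I" "tlen I = t - a" by auto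
qed

lemma chain_sum_insert:
 fixes r :: "real => real => real"
 assumes "chain a s I" "s < t"
 shows "(\<Sum>(x, y)\<in>insert (s, t) I. r x y) = (\<Sum>(x, y)\<in>I. r x y) + r s t"
proof -
 have "(s, t) \<notin> I" using chain_props(3)[OF assms(1)] assms(2) by force
 then show ?thesis using chain_props(2)[OF assms(1)] by simp
qed

text \<open>Only the piece with \<open>c\<close> in its interior has to be cut, and the triangle
  inequality says that cutting cannot decrease the sum.\<close>

lemma chain_split:
 assumes "chain a t I" "a <= c" "c <= t"
  and tri: "!!x y z. a <= x ==> x < y ==> y < z ==> z <= t ==> r x z <= r x y + r y z"
 shows "\<exists>J K. chain a c J & chain c t K &
  (\<Sum>(x, y)\<in>I. r x y) <= (\<Sum>(x, y)\<in>J. r x y) + (\<Sum>(x, y)\<in>K. r x y :: real)"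
 using assms
proof (induction arbitrary: c)
 case chain_refl
 then have "c = a" by simp
 then show ?case by (auto intro!: exI[of _ "{}"] chain.intros)
next
 case (chain_step s I t)
 have sum: "(\<Sum>(x, y)\<in>insert (s, t) I. r x y) = (\<Sum>(x, y)\<in>I. r x y) + r s t"
  using chain_sum_insert chain_step.hyps .
 have "a <= s" using chain_props chain_step.hyps by blast
 show ?case
 proof (cases "c <= s")
  case True
  then obtain J K where "chain a c J" "chain c s K"
   "(\<Sum>(x, y)\<in>I. r x y) <= (\<Sum>(x, y)\<in>J. r x y) + (\<Sum>(x, y)\<in>K. r x y)"
   using chain_step.IH[OF chain_step.prems(1) True] chain_step.prems(3) chain_step.hyps(2)
   by (meson less_le_trans less_imp_le order.trans)
  moreover from this have "chain c t (insert (s, t) K)"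
   "(\<Sum>(x, y)\<in>insert (s, t) K. r x y) = (\<Sum>(x, y)\<in>K. r x y) + r s t"
   using chain_step.hyps chain_sum_insert[of c s K t r] by (auto intro: chain.intros)
  moreover have "(\<Sum>(x, y)\<in>insert (s, t) I. r x y) <= (\<Sum>(x, y)\<in>J. r x y) + (\<Sum>(x, y)\<in>insert (s, t) K. r x y)"
   using calculation by (simp add: sum)
  ultimately show ?thesis by blast
 next
  case False
  show ?thesis
  proof (cases "c = t")
   case True
   then have "chain a c (insert (s, t) I)" "chain c t {}" using chain_step.hyps by (auto intro: chain.intros)
   then show ?thesis by (metis add.right_neutral order_refl sum.empty)
  next
   case c: False
   have "r s t <= r s c + r c t" using chain_step False c \<open>a <= s\<close> by auto
   moreover have "chain a c (insert (s, c) I)" "chain c t (insert (c, t) {})"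
    using chain_step False c by (auto intro!: chain.intros)
   moreover have "(\<Sum>(x, y)\<in>insert (s, c) I. r x y) = (\<Sum>(x, y)\<in>I. r x y) + r s c"
    using chain_step False by (intro chain_sum_insert) auto
   moreover have "(\<Sum>(x, y)\<in>insert (s, t) I. r x y) <=
     (\<Sum>(x, y)\<in>insert (s, c) I. r x y) + (\<Sum>(x, y)\<in>insert (c, t) {}. r x y)"
    using calculation by (simp add: sum)
   ultimately show ?thesis by blast
  qed
 qed
qed

text \<open>\<open>V\<close> is the total variation of \<open>r\<close> from \<open>a\<close>.
  Appending the piece \<open>(s, t)\<close> to a chain ending at \<open>s\<close> gives
  \<open>r s t <= V t - V s\<close>; chains over short intervals have small sums, which makes
  \<open>V\<close> finite and continuous.\<close>

lemma pair_ac_majorant: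
 fixes r :: "real => real => real"
 assumes ab: "a <= b" and ac: "pair_ac a b r"
  and nonneg: "!!x y. a <= x ==> x < y ==> y <= b ==> 0 <= r x y"
  and tri: "!!x y z. a <= x ==> x < y ==> y < z ==> z <= b ==> r x z <= r x y + r y z"
 obtains V where "mono V" "continuous_on UNIV V"
  "!!s t. a <= s ==> s < t ==> t <= b ==> r s t <= V t - V s"
proof -
 let ?S = "%I. \<Sum>(x, y)\<in>I. r x y"
 define V where "V t = Sup {?S I | I. chain a t I}" for t
 have small: "\<exists>dl>0. \<forall>s t I. a <= s & t <= b & t - s < dl & chain s t I --> ?S I < e" if e: "e > 0" for e
 proof -
  obtain dl where dl: "dl > 0" "!!I. ac_family a b I & tlen I < dl ==> ?S I < e"
   using ac[unfolded pair_ac_def, rule_format, OF e] by blast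
  show ?thesis
  proof (intro exI[of _ dl] conjI allI impI dl(1), elim conjE)
   fix s t I assume "a <= s" "t <= b" "t - s < dl" "chain s t I"
   then show "?S I < e" using chain_props[of s t I] by (intro dl(2)) fastforce
  qed
 qed
 obtain dl where dl: "dl > 0" "!!s t I. a <= s ==> t <= b ==> t - s < dl ==> chain s t I ==> ?S I < 1"
  using small[of 1] by auto
 \<comment> \<open>Each step of length \<open>dl / 2\<close> adds at most 1, since a chain over an
   interval shorter than \<open>dl\<close> has sum below 1.\<close>
 have bound: "?S I <= real n" if "chain a t I" "t <= b" "t <= a + real n * (dl / 2)" for n t I using that
 proof (induction n arbitrary: t I)
  case 0
  then have "a = t" using chain_props(1)[OF 0(1)] by simp
  have "I = {}" using chain_props(3)[OF 0(1)] \<open>a = t\<close> by force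
  then show ?case by simp
 next
  case (Suc n)
  show ?case
  proof (cases "t <= a + real n * (dl / 2)")
   case True
   then show ?thesis using Suc by force
  next
   case False
   let ?c = "a + real n * (dl / 2)"
   have "\<exists>J K. chain a ?c J & chain ?c t K & ?S I <= ?S J + ?S K"
    using False Suc.prems dl(1) tri by (intro chain_split) auto
   then obtain J K where JK: "chain a ?c J" "chain ?c t K" "?S I <= ?S J + ?S K" by blast
   have "?S J <= real n" using Suc.IH[OF JK(1)] False Suc.prems by auto
   moreover have "?S K < 1" using Suc.prems dl(1) by (intro dl(2)[OF _ _ _ JK(2)]) (auto simp: field_simps)
   ultimately show ?thesis using JK(3) by simp
  qed
 qed
 obtain N :: nat where N: "b <= a + real N * (dl / 2)"
  using reals_Archimedean3[of "dl / 2"] dl(1) by (metis add.commute diff_le_eq half_gt_zero less_imp_le)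
 have bdd: "bdd_above {?S I | I. chain a t I}" if "t <= b" for t
  using bound[of t _ N] that N by (intro bdd_aboveI[of _ "real N"]) auto
 have ne: "{?S I | I. chain a t I} ~= {}" if "a <= t" for t
 proof (cases "a = t")
  case True then show ?thesis using chain_refl by blast
 next
  case False then show ?thesis using chain_step[OF chain_refl, of a t] that by auto
 qed
 have up: "r s t + V s <= V t" if st: "a <= s" "s < t" "t <= b" for s t
 proof -
  have "V s <= V t - r s t" unfolding V_def[of s]
  proof (rule cSup_least[OF ne[OF st(1)]])
   fix x assume "x \<in> {?S I | I. chain a s I}"
   then obtain I where I: "chain a s I" "x = ?S I" by auto
   have "x + r s t = ?S (insert (s, t) I)" using chain_sum_insert[OF I(1) st(2), of r] I(2) by simp
   also have "... <= V t" unfolding V_def using chain_step[OF I(1) st(2)] by (intro cSup_upper bdd st) blast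
   finally show "x <= V t - r s t" by simp
  qed
  then show ?thesis by simp
 qed
 have mono: "V s <= V t" if "a <= s" "s <= t" "t <= b" for s t
  using up[of s t] nonneg[of s t] that by (cases "s = t") auto
 have cont: "\<exists>dl>0. \<forall>s t. a <= s & s <= t & t <= b & t - s < dl --> V t <= V s + e" if e0: "e > 0" for e
 proof -
  obtain dl where dl: "dl > 0" "!!s t I. a <= s ==> t <= b ==> t - s < dl ==> chain s t I ==> ?S I < e"
   using small[OF e0] by auto
  show ?thesis
  proof (intro exI[of _ dl] conjI allI impI dl(1), elim conjE)
   fix s t assume st: "a <= s" "s <= t" "t <= b" "t - s < dl"
   show "V t <= V s + e" unfolding V_def[of t]
   proof (rule cSup_least[OF ne])
    fix x assume "x \<in> {?S I | I. chain a t I}"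
    then obtain I where I: "chain a t I" "x = ?S I" by auto
    have "\<exists>J K. chain a s J & chain s t K & ?S I <= ?S J + ?S K"
     using st tri by (intro chain_split[OF I(1)]) auto
    then obtain J K where JK: "chain a s J" "chain s t K" "?S I <= ?S J + ?S K" by blast
    have "?S J <= V s" unfolding V_def using JK(1) st by (intro cSup_upper bdd) auto
    moreover have "?S K < e" using dl(2)[OF _ _ _ JK(2)] st by auto
    ultimately show "x <= V s + e" using JK(3) I(2) by simp
   qed (use st in auto)
  qed
 qed
 define c where "c t = max a (min b t)" for t
 have c: "a <= c t" "c t <= b" "!!s t. s <= t ==> c s <= c t" "!!s t. s <= t ==> c t - c s <= t - s" for t
  using ab by (auto simp: c_def)
 show ?thesis
 proof (rule that[of "%t. V (c t)"])
  show "mono (%t. V (c t))" using mono c by (auto intro!: monoI)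
  show "continuous_on UNIV (%t. V (c t))" unfolding continuous_on_iff
  proof (intro ballI allI impI)
   fix t e :: real assume "0 < e"
   then obtain dl where dl: "dl > 0" "!!s t. a <= s ==> s <= t ==> t <= b ==> t - s < dl ==> V t <= V s + e / 2"
    using cont[of "e / 2"] by auto
   have *: "dist (V (c y)) (V (c x)) < e" if "x <= y" "y - x < dl" for x y
    using mono[of "c x" "c y"] dl(2)[of "c x" "c y"] c(1)[of x] c(2)[of y] c(3,4)[OF that(1)] that \<open>0 < e\<close>
    by (simp add: dist_real_def)
   show "\<exists>d>0. \<forall>x'\<in>UNIV. dist x' t < d --> dist (V (c x')) (V (c t)) < e"
   proof (intro exI[of _ dl] conjI ballI impI dl(1))
    fix x' assume "dist x' t < dl"
    then show "dist (V (c x')) (V (c t)) < e"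
     using *[of x' t] *[of t x'] by (cases "x' <= t") (auto simp: dist_real_def dist_commute)
   qed
  qed
  show "r s t <= V (c t) - V (c s)" if "a <= s" "s < t" "t <= b" for s t
   using up[OF that] that by (simp add: c_def)
 qed
qed

text \<open>The increments of \<open>V\<close> dominate those of \<open>g\<close>, so
  \<open>V + g\<close> is monotone and \<open>g\<close> is a difference of two monotone
  functions.\<close>

lemma majorized_differentiable_ae:
 fixes V :: "real => real"
 assumes V: "mono V" "continuous_on UNIV V" and g: "!!s t. a <= s ==> s < t ==> t <= b ==> abs (g t - g s) <= V t - V s"
 shows "negligible {t. a < t & t < b & \<not> (g differentiable (at t) & V differentiable (at t))}"
proof (cases "a <= b")
 case False
 then have "{t. a < t & t < b & \<not> (g differentiable (at t) & V differentiable (at t))} = {}" by auto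
 then show ?thesis by (metis negligible_empty)
next
 case True
 define c where "c t = max a (min b t)" for t
 have c: "a <= c t" "c t <= b" for t using True by (auto simp: c_def)
 have dom: "abs (g (c t) - g (c s)) <= V t - V s" if "s <= t" for s t
 proof (cases "c s = c t")
  case True then show ?thesis using monoD[OF V(1) that] by simp
 next
  case False
  then have *: "s <= c s" "c s < c t" "c t <= t" using that by (auto simp: c_def)
  show ?thesis using g[OF c(1) *(2) c(2)] monoD[OF V(1) *(1)] monoD[OF V(1) *(3)] by linarith
 qed
 define W where "W t = V t + g (c t)" for t
 have W: "mono W"
 proof (rule monoI)
  fix s t :: real assume "s <= t"
  then show "W s <= W t" using dom[of s t] by (auto simp: W_def)
 qed
 have "continuous_on UNIV (%t. g (c t))" unfolding continuous_on_iff
 proof (intro ballI allI impI)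
  fix t e :: real assume "0 < e"
  then obtain d where d: "d > 0" "!!x. dist x t < d ==> dist (V x) (V t) < e"
   using V(2) unfolding continuous_on_iff by blast
  show "\<exists>d>0. \<forall>x'\<in>UNIV. dist x' t < d --> dist (g (c x')) (g (c t)) < e"
  proof (intro exI[of _ d] conjI ballI impI d(1))
   fix x assume "dist x t < d"
   then show "dist (g (c x)) (g (c t)) < e"
    using d(2)[of x] dom[of x t] dom[of t x] by (cases "x <= t") (auto simp: dist_real_def)
  qed
 qed
 then have Wc: "continuous_on UNIV W" unfolding W_def by (intro continuous_intros V(2))
 have "negligible ({x. \<not> V differentiable (at x)} \<union> {x. \<not> W differentiable (at x)})"
  using mono_differentiable_ae[OF V] mono_differentiable_ae[OF W Wc] by (rule negligible_Un)
 then show ?thesis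
 proof (rule negligible_subset)
  show "{t. a < t & t < b & \<not> (g differentiable (at t) & V differentiable (at t))}
   \<subseteq> {x. \<not> V differentiable (at x)} \<union> {x. \<not> W differentiable (at x)}"
 proof (intro subsetI; rule ccontr)
  fix t assume t: "t \<in> {t. a < t & t < b & \<not> (g differentiable (at t) & V differentiable (at t))}"
   "t \<notin> {x. \<not> V differentiable (at x)} \<union> {x. \<not> W differentiable (at x)}"
  then have "V differentiable (at t)" "W differentiable (at t)" by auto
  then have "(%s. W s - V s) differentiable (at t)" by (rule differentiable_diff[rotated])
  then have "g differentiable (at t)"
  proof (rule differentiable_transform_within)
   show "0 < min (t - a) (b - t)" using t by auto
   fix s assume "dist s t < min (t - a) (b - t)"
   then show "W s - V s = g s" by (auto simp: W_def c_def dist_real_def max_def min_def abs_if split: if_splits)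
  qed auto
  then show False using t \<open>V differentiable (at t)\<close> by auto
 qed
 qed
qed

theorem abs_continuous_differentiable_ae:
 assumes "abs_continuous a b g"
 shows "negligible {t. a < t & t < b & \<not> g differentiable (at t)}"
proof (cases "a <= b")
 case False
 then have "{t. a < t & t < b & \<not> g differentiable (at t)} = {}" by auto
 then show ?thesis by (metis negligible_empty)
next
 case True
 obtain V where V: "mono V" "continuous_on UNIV V" "!!s t. a <= s ==> s < t ==> t <= b ==> abs (g t - g s) <= V t - V s"
  by (rule pair_ac_majorant[OF True assms[unfolded abs_continuous_pair_ac]]) auto
 show ?thesis by (rule negligible_subset[OF majorized_differentiable_ae[OF V]]) auto
qed

text \<open>A direct gauge argument. At tags outside \<open>S\<close> the derivative controls the
  increment. Tags in \<open>S\<close> are forced into an open set \<open>T\<close> of measure below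
  the delta of absolute continuity, so the increments over their intervals have a small sum.\<close>

theorem abs_continuous_fundamental:
 assumes ab: "a <= b" and ac: "abs_continuous a b g" and S: "negligible S"
  and der: "!!t. t \<in> {a..b} - S ==> (g has_vector_derivative g' t) (at t within {a..b})"
 shows "(g' has_integral g b - g a) {a..b}"
proof -
 \<comment> \<open>With the integrand 0 on \<open>S\<close>, the tags in \<open>S\<close> contribute
   nothing but increments of \<open>g\<close>.\<close>
 define f where "f t = (if t \<in> S then 0 else g' t)" for t
 have "(f has_integral g b - g a) {a..b}" unfolding has_integral_factor_content_real
 proof (intro allI impI)
  fix e :: real assume e: "e > 0"
  show "\<exists>d. gauge d & (\<forall>p. p tagged_division_of {a..b} & d fine p -->
    norm ((\<Sum>(x, k)\<in>p. measure lborel k *\<^sub>R f x) - (g b - g a)) <= e * measure lborel {a..b})"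
  proof (cases "a = b")
   case True
   have "measure lborel k = 0" if "p tagged_division_of {a..b}" "(x, k) \<in> p" for p x k
   proof -
    have "k \<subseteq> {a..b}" using that by auto
    then have "k \<subseteq> {a}" using True by auto
    then have "k = {} \<or> k = {a}" by auto
    then show ?thesis by auto
   qed
   then have "(\<Sum>(x, k)\<in>p. measure lborel k *\<^sub>R f x) = 0" if "p tagged_division_of {a..b}" for p
    using that by (intro sum.neutral) auto
   then show ?thesis using True by (intro exI[of _ "%x. ball x 1"]) auto
  next
   case False
   then have e2: "e * (b - a) / 2 > 0" using e ab by simp
   obtain dl where dl: "dl > 0" "!!I. finite I ==> (\<forall>(x, y)\<in>I. a <= x & x < y & y <= b) ==>
     pairwise (%(x, y) (x', y'). disjnt {x<..<y} {x'<..<y'}) I ==> tlen I < dl ==>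
     osc g I < e * (b - a) / 2"
    using ac[unfolded abs_continuous_def, rule_format, OF e2] by blast
   obtain T where T: "open T" "S \<subseteq> T" "T \<in> lmeasurable" "measure lebesgue T < dl"
   proof -
    have S0: "S \<in> lmeasurable" "measure lebesgue S = 0"
     using S negligible_imp_measurable negligible_imp_measure0 by auto
    obtain T where T: "open T" "S \<subseteq> T" "T - S \<in> lmeasurable" "emeasure lebesgue (T - S) < ennreal dl"
     by (rule sets_lebesgue_outer_open[OF fmeasurableD[OF S0(1)] dl(1)]) ((rule that | assumption)+)
    have "measure lebesgue (T - S) < dl" using T(3,4) by (simp add: emeasure_eq_measure2 ennreal_less_iff)
    moreover have "T = (T - S) \<union> S" using T(2) by auto
    moreover from this have "T \<in> lmeasurable" using fmeasurable.Un[OF T(3) S0(1)] by simp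
    moreover have "measure lebesgue ((T - S) \<union> S) <= measure lebesgue (T - S) + measure lebesgue S"
     using T(3) S0(1) by (intro measure_Un_le) auto
    ultimately show ?thesis using that[OF T(1,2)] S0(2) by simp
   qed
   have "\<exists>d>0. (t \<in> S --> ball t d \<subseteq> T) & (t \<in> {a..b} - S -->
     (\<forall>y\<in>{a..b}. abs (y - t) < d --> abs (g y - g t - (y - t) * g' t) <= e / 2 * abs (y - t)))" for t
   proof (cases "t \<in> S")
    case True
    then show ?thesis using T open_contains_ball by blast
   next
    case False
    show ?thesis
    proof (cases "t \<in> {a..b}")
     case t: True
     have "(g has_derivative (%x. x *\<^sub>R g' t)) (at t within {a..b})"
      using der[of t] False t by (simp add: has_vector_derivative_def)
     then have "\<exists>d>0. \<forall>y\<in>{a..b}. norm (y - t) < d --> norm (g y - g t - (y - t) *\<^sub>R g' t) <= e / 2 * norm (y - t)"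
      using e unfolding has_derivative_within_alt by (meson half_gt_zero)
     then show ?thesis using False by auto
    qed (use False in \<open>auto intro: exI[of _ 1]\<close>)
   qed
   then obtain d where d: "!!t. d t > 0" "!!t. t \<in> S ==> ball t (d t) \<subseteq> T"
    "!!t y. t \<in> {a..b} - S ==> y \<in> {a..b} ==> abs (y - t) < d t ==> abs (g y - g t - (y - t) * g' t) <= e / 2 * abs (y - t)"
    by metis
   show ?thesis
   proof (intro exI[of _ "%t. ball t (d t)"] conjI allI impI; (elim conjE)?)
    show "gauge (%t. ball t (d t))" using d(1) by (auto simp: gauge_def)
    fix p assume p: "p tagged_division_of {a..b}" and fine: "(%t. ball t (d t)) fine p"
    have fin: "finite p" using p by auto
    have k: "\<exists>u v. k = {u..v} & u <= x & x <= v & a <= u & v <= b & {u..v} \<subseteq> ball x (d x)" if xk: "(x, k) \<in> p" for x k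
    proof -
     obtain u v where uv: "k = cbox u v" using tagged_division_ofD(4)[OF p xk] by auto
     have "x \<in> k" "k \<subseteq> {a..b}" using tagged_division_ofD(2,3)[OF p xk] by auto
     moreover have "k \<subseteq> ball x (d x)" using fine xk by (auto simp: fine_def)
     ultimately show ?thesis using uv by auto
    qed
    have Sup: "Sup k - Inf k = measure lborel k" "measure lborel k \<ge> 0" if "(x, k) \<in> p" for x k
     using k[OF that] by auto
    define h where "h x k = measure lborel k * f x - (g (Sup k) - g (Inf k))" for x and k :: "real set"
    have "(\<Sum>(x, k)\<in>p. measure lborel k *\<^sub>R f x) - (g b - g a) = (\<Sum>(x, k)\<in>p. h x k)"
     unfolding additive_tagged_division_1[OF ab p, symmetric, of g] h_def
     by (simp add: sum_subtractf split_def)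
    also have "abs (...) <= (\<Sum>(x, k)\<in>p. abs (h x k))"
     by (rule order_trans[OF sum_abs]) (simp add: split_def)
    also have "... = (\<Sum>(x, k)\<in>{(x, k)\<in>p. x \<notin> S}. abs (h x k)) + (\<Sum>(x, k)\<in>{(x, k)\<in>p. x \<in> S}. abs (h x k))"
     using fin by (subst sum.union_disjoint[symmetric]) (auto intro!: sum.cong elim: finite_subset[rotated])
    also have "(\<Sum>(x, k)\<in>{(x, k)\<in>p. x \<notin> S}. abs (h x k)) <= (\<Sum>(x, k)\<in>{(x, k)\<in>p. x \<notin> S}. e / 2 * measure lborel k)"
    proof (rule sum_mono)
     fix z assume "z \<in> {(x, k)\<in>p. x \<notin> S}"
     then obtain x k where z: "z = (x, k)" and xk: "(x, k) \<in> p" "x \<notin> S" by auto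
     obtain u v where uv: "k = {u..v}" "u <= x" "x <= v" "a <= u" "v <= b" "{u..v} \<subseteq> ball x (d x)"
      using k[OF xk(1)] by auto
     have "u \<in> {u..v}" "v \<in> {u..v}" using uv by auto
     then have "u \<in> ball x (d x)" "v \<in> ball x (d x)" using uv(6) by blast+
     then have "abs (g u - g x - (u - x) * g' x) <= e / 2 * abs (u - x)" "abs (g v - g x - (v - x) * g' x) <= e / 2 * abs (v - x)"
      using uv xk d(3)[of x u] d(3)[of x v] by (auto simp: dist_real_def)
     moreover have "e / 2 * abs (u - x) + e / 2 * abs (v - x) = e / 2 * (v - u)"
      using uv by (simp flip: distrib_left)
     moreover have "h x k = (g u - g x - (u - x) * g' x) - (g v - g x - (v - x) * g' x)"
      using uv xk by (simp add: h_def f_def algebra_simps)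
     ultimately have "abs (h x k) <= e / 2 * (v - u)" by linarith
     then show "(case z of (x, k) => abs (h x k)) <= (case z of (x, k) => e / 2 * measure lborel k)" using uv z by simp
    qed
    also have "... <= (\<Sum>(x, k)\<in>p. e / 2 * measure lborel k)" using fin e by (intro sum_mono2) auto
    also have "... = e / 2 * (b - a)"
    proof -
     have "(\<Sum>(x, k)\<in>p. e / 2 * measure lborel k) = e / 2 * (\<Sum>(x, k)\<in>p. measure lborel k)"
      by (simp only: sum_distrib_left split_def)
     then show ?thesis using additive_content_tagged_division[of p a b] p ab by simp
    qed
    also have "(\<Sum>(x, k)\<in>{(x, k)\<in>p. x \<in> S}. abs (h x k)) <= e * (b - a) / 2"
    proof -
     \<comment> \<open>Degenerate intervals are dropped, because the families of absolute continuity
       consist of pairs with \<open>x < y\<close>; their error terms are 0.\<close>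
     define q where "q = {(x, k)\<in>p. x \<in> S & measure lborel k ~= 0}"
     define F where "F = (%(x :: real, k :: real set). (Inf k, Sup k))"
     have q: "finite q" "q \<subseteq> p" using fin by (auto simp: q_def elim: finite_subset[rotated])
     have disj: "interior k \<inter> interior k' = {}" if "(x, k) \<in> q" "(x', k') \<in> q" "(x, k) ~= (x', k')" for x k x' k'
      using tagged_division_ofD(5)[OF p] that q by blast
     have int: "interior k = {Inf k<..<Sup k} & Inf k < Sup k & a <= Inf k & Sup k <= b & k = {Inf k..Sup k} & k \<subseteq> T" if xk: "(x, k) \<in> q" for x k
     proof -
      obtain u v where uv: "k = {u..v}" "u <= x" "x <= v" "a <= u" "v <= b" "{u..v} \<subseteq> ball x (d x)"
       using k[of x k] xk q by auto
      have "u < v" using uv xk by (auto simp: q_def)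
      then show ?thesis using uv d(2)[of x] xk by (auto simp: q_def)
     qed
     have D: "snd ` q division_of \<Union>(snd ` q)"
      using division_of_subset[of "snd ` p" "snd ` q"] division_of_tagged_division[OF p] tagged_division_ofD(6)[OF p] q
      by (metis (no_types, lifting) division_ofD(6) image_mono)
     have inj: "inj_on F q"
     proof (rule inj_onI, clarsimp simp: F_def)
      fix x k x' k' assume *: "(x, k) \<in> q" "(x', k') \<in> q" "Inf k = Inf k'" "Sup k = Sup k'"
      have "interior k = interior k'" "interior k ~= {}" using int[OF *(1)] int[OF *(2)] * by auto
      then have "(x, k) = (x', k')" using disj[OF *(1,2)] by blast
      then show "x = x' & k = k'" by simp
     qed
     have "osc g (F ` q) < e * (b - a) / 2"
     proof (rule dl(2))
      show "finite (F ` q)" using q by auto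
      show "\<forall>(x, y)\<in>F ` q. a <= x & x < y & y <= b" using int by (auto simp: F_def)
      show "pairwise (%(x, y) (x', y'). disjnt {x<..<y} {x'<..<y'}) (F ` q)"
      proof (rule pairwiseI)
       fix i j assume ij: "i \<in> F ` q" "j \<in> F ` q" "i ~= j"
       then obtain x k x' k' where xk: "(x, k) \<in> q" "(x', k') \<in> q" "i = (Inf k, Sup k)" "j = (Inf k', Sup k')"
        by (auto simp: F_def)
       then have "(x, k) ~= (x', k')" using ij by auto
       then show "(%(x, y) (x', y'). disjnt {x<..<y} {x'<..<y'}) i j"
        using disj[OF xk(1,2)] int[OF xk(1)] int[OF xk(2)] xk by (simp add: disjnt_def)
      qed
      have "tlen (F ` q) = (\<Sum>(x, k)\<in>q. Sup k - Inf k)"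
       by (subst sum.reindex[OF inj]) (simp add: F_def split_def)
      also have "... = (\<Sum>(x, k)\<in>q. measure lebesgue k)"
      proof (rule sum.cong)
       fix z assume "z \<in> q"
       then obtain x k where z: "z = (x, k)" "(x, k) \<in> q" by (cases z) auto
       then have k: "{Inf k..Sup k} = k" "Inf k < Sup k" using int[OF z(2)] by auto
       have "Sup k - Inf k = measure lebesgue {Inf k..Sup k}" using k(2) by simp
       then show "(case z of (x, k) => Sup k - Inf k) = (case z of (x, k) => measure lebesgue k)"
        unfolding k(1) z(1) by simp
      qed simp
      also have "... = (\<Sum>k\<in>snd ` q. measure lebesgue k)"
      proof -
       have "z = w" if "z \<in> q" "w \<in> q" "snd z = snd w" for z w
        using disj[of "fst z" "snd z" "fst w" "snd w"] int[of "fst z" "snd z"] that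
        by (metis Int_absorb greaterThanLessThan_empty_iff not_less prod.collapse)
       then show ?thesis by (subst sum.reindex) (auto simp: inj_on_def split_def)
      qed
      also have "... = measure lebesgue (\<Union>(snd ` q))" by (rule content_division[OF D])
      also have "... <= measure lebesgue T"
      proof (intro measure_mono_fmeasurable fmeasurableD lmeasurable_division[OF D] T)
       show "\<Union>(snd ` q) \<subseteq> T"
       proof (rule Union_least)
        fix k assume "k \<in> snd ` q"
        then obtain x where "(x, k) \<in> q" by force
        then show "k \<subseteq> T" using int by blast
       qed
      qed
      also have "... < dl" by (rule T)
      finally show "tlen (F ` q) < dl" .
     qed
     moreover have "osc g (F ` q) = (\<Sum>(x, k)\<in>q. abs (h x k))"
      by (subst sum.reindex[OF inj]) (auto simp: F_def split_def h_def f_def q_def abs_minus_commute intro!: sum.cong)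
     moreover have "(\<Sum>(x, k)\<in>q. abs (h x k)) = (\<Sum>(x, k)\<in>{(x, k)\<in>p. x \<in> S}. abs (h x k))"
     proof (rule sum.mono_neutral_left)
      show "finite {(x, k)\<in>p. x \<in> S}" using fin by (rule finite_subset[rotated]) auto
      show "\<forall>i\<in>{(x, k)\<in>p. x \<in> S} - q. (case i of (x, k) => abs (h x k)) = 0"
      proof
       fix i assume "i \<in> {(x, k)\<in>p. x \<in> S} - q"
       then obtain x k where i: "i = (x, k)" "(x, k) \<in> p" "measure lborel k = 0" by (auto simp: q_def)
       then have "Sup k = Inf k" using Sup[of x k] by simp
       then show "(case i of (x, k) => abs (h x k)) = 0" using i by (simp add: h_def)
      qed
     qed (auto simp: q_def)
     ultimately show ?thesis by linarith
    qed
    finally show "norm ((\<Sum>(x, k)\<in>p. measure lborel k *\<^sub>R f x) - (g b - g a)) <= e * measure lborel {a..b}"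
     using ab by simp
   qed
  qed
 qed
 then show ?thesis by (rule has_integral_spike[OF S, rotated]) (auto simp: f_def)
qed

section \<open>The groups in coordinates\<close>

type_synonym r5 = "real \<times> real \<times> real \<times> real \<times> real"

abbreviation x1 :: "r5 => real" where "x1 p \<equiv> fst p"
abbreviation x2 :: "r5 => real" where "x2 p \<equiv> fst (snd p)"
abbreviation x3 :: "r5 => real" where "x3 p \<equiv> fst (snd (snd p))"
abbreviation x4 :: "r5 => real" where "x4 p \<equiv> fst (snd (snd (snd p)))"
abbreviation x5 :: "r5 => real" where "x5 p \<equiv> snd (snd (snd (snd p)))"

text \<open>Coordinates of the second kind: a point is the product of the exponentials of
  \<open>x5 p\<close>, \<open>x4 p\<close>, \<open>x3 p\<close>, \<open>x2 p\<close>,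
  \<open>x1 p\<close> times the corresponding basis fields, in this order. \<open>k\<close> is the
  structure constant in [X1,X2] = k X3, so \<open>k = 1\<close> is the group \<open>H\<close> and
  \<open>k = 0\<close> its cone.\<close>

definition gm :: "real => r5 => r5 => r5" where
 "gm k p q = (x1 p + x1 q, x2 p + x2 q, x3 p + x3 q + k * x1 p * x2 q,
   x4 p + x4 q + x1 p * x3 q + k * (x1 p)\<^sup>2 * x2 q / 2,
   x5 p + x5 q + x2 p * x3 q + k * x1 p * x2 p * x2 q + k * x1 p * (x2 q)\<^sup>2 / 2)"

definition gi :: "real => r5 => r5" where
 "gi k p = (- x1 p, - x2 p, - x3 p + k * x1 p * x2 p,
   - x4 p + x1 p * x3 p - k * (x1 p)\<^sup>2 * x2 p / 2,
   - x5 p + x2 p * x3 p - k * x1 p * (x2 p)\<^sup>2 / 2)"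

text \<open>The box gauge with weights 1, 1, 1, 2, 2. It is homogeneous under the dilations of the
  cone; for \<open>k = 1\<close> these are not automorphisms, which is why the estimates for general
  \<open>k\<close> are restricted to sizes up to 1.\<close>

definition nrm :: "r5 => real" where
 "nrm p = max (max (abs (x1 p)) (max (abs (x2 p)) (abs (x3 p)))) (max (sqrt (abs (x4 p))) (sqrt (abs (x5 p))))"

definition rho :: "r5 => r5 => real" where
 "rho p q = nrm (gm 0 (gi 0 p) q)"

lemma gm_assoc: "gm k (gm k p q) r = gm k p (gm k q r)"
 by (simp add: gm_def prod_eq_iff algebra_simps power2_eq_square add_divide_distrib)

lemma gm_0 [simp]: "gm k 0 p = p" "gm k p 0 = p" by (simp_all add: gm_def prod_eq_iff zero_prod_def)

lemma gm_gi [simp]: "gm k (gi k p) p = 0" "gm k p (gi k p) = 0"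
 by (simp_all add: gm_def gi_def zero_prod_def prod_eq_iff algebra_simps power2_eq_square add_divide_distrib diff_divide_distrib)

lemma gm_gi_cancel [simp]: "gm k (gi k p) (gm k p q) = q" "gm k p (gm k (gi k p) q) = q"
 by (simp_all flip: gm_assoc)

lemma gm_gi_comp:
 "gm k (gi k p) q = (x1 q - x1 p, x2 q - x2 p, x3 q - x3 p - k * x1 p * (x2 q - x2 p),
   x4 q - x4 p - x1 p * (x3 q - x3 p) + k * (x1 p)\<^sup>2 * (x2 q - x2 p) / 2,
   x5 q - x5 p - x2 p * (x3 q - x3 p) - k * x1 p * (x2 q - x2 p)\<^sup>2 / 2)"
 by (simp add: gm_def gi_def prod_eq_iff field_simps power2_eq_square)

lemma nrm_nonneg [simp]: "0 <= nrm p" by (simp add: nrm_def le_max_iff_disj)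

lemma nrm_le_iff: "0 <= r ==> nrm p <= r \<longleftrightarrow> abs (x1 p) <= r & abs (x2 p) <= r & abs (x3 p) <= r & abs (x4 p) <= r\<^sup>2 & abs (x5 p) <= r\<^sup>2"
proof -
 assume "0 <= r"
 then have "sqrt y <= r \<longleftrightarrow> y <= r\<^sup>2" for y
  by (metis real_sqrt_le_iff real_sqrt_abs abs_of_nonneg)
 then show ?thesis by (auto simp: nrm_def)
qed

lemma nrm_less_iff: "0 < r ==> nrm p < r \<longleftrightarrow> abs (x1 p) < r & abs (x2 p) < r & abs (x3 p) < r & abs (x4 p) < r\<^sup>2 & abs (x5 p) < r\<^sup>2"
proof -
 assume "0 < r"
 then have "sqrt y < r \<longleftrightarrow> y < r\<^sup>2" for y
  by (metis less_imp_le real_sqrt_less_iff real_sqrt_abs abs_of_nonneg)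
 then show ?thesis by (auto simp: nrm_def)
qed

lemma nrm_comp_le: "abs (x1 p) <= nrm p" "abs (x2 p) <= nrm p" "abs (x3 p) <= nrm p" "abs (x4 p) <= (nrm p)\<^sup>2" "abs (x5 p) <= (nrm p)\<^sup>2"
 using nrm_le_iff[of "nrm p" p] by auto

lemma nrm_eq_0_iff [simp]: "nrm p = 0 \<longleftrightarrow> p = 0"
proof
 assume "nrm p = 0"
 then have "nrm p <= 0" by simp
 then show "p = 0" by (subst (asm) nrm_le_iff) (auto simp: prod_eq_iff zero_prod_def)
qed (simp add: nrm_def)

lemma abs_mult_le: "abs x <= a ==> abs y <= b ==> abs (x * y) <= a * (b::real)"
 unfolding abs_mult by (rule mult_mono) (auto intro: order_trans[OF abs_ge_zero])

text \<open>Up to size 1 every mixed term of the product is bounded by \<open>a * b\<close>, which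
  is at most \<open>a\<close> in the third coordinate and fits into
  \<open>(2 * (a + b))\<^sup>2\<close> in the last two.\<close>

lemma nrm_gm_le:
 assumes "abs k <= 1" "nrm p <= a" "nrm q <= b" "a <= 1" "b <= 1"
 shows "nrm (gm k p q) <= 2 * (a + b)"
proof -
 have ab: "0 <= a" "0 <= b" using assms nrm_nonneg order_trans by blast+
 have p: "abs (x1 p) <= a" "abs (x2 p) <= a" "abs (x3 p) <= a" "abs (x4 p) <= a\<^sup>2" "abs (x5 p) <= a\<^sup>2"
  and q: "abs (x1 q) <= b" "abs (x2 q) <= b" "abs (x3 q) <= b" "abs (x4 q) <= b\<^sup>2" "abs (x5 q) <= b\<^sup>2"
  using assms(2,3) ab by (auto simp: nrm_le_iff)
 have x: "abs (x1 p) <= 1" "abs (x2 q) <= 1" using p(1) q(2) assms by linarith+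
 have 1: "abs (k * x1 p * x2 q) <= a * b" "abs (x1 p * x3 q) <= a * b" "abs (x2 p * x3 q) <= a * b"
  using abs_mult_le[OF abs_mult_le[OF assms(1) p(1)] q(2)] abs_mult_le[OF p(1) q(3)] abs_mult_le[OF p(2) q(3)] by simp_all
 have 2: "abs (k * (x1 p)\<^sup>2 * x2 q) <= a * b" "abs (k * x1 p * x2 p * x2 q) <= a * b" "abs (k * x1 p * (x2 q)\<^sup>2) <= a * b"
  using abs_mult_le[OF abs_mult_le[OF assms(1) abs_mult_le[OF p(1) x(1)]] q(2)]
   abs_mult_le[OF abs_mult_le[OF abs_mult_le[OF assms(1) x(1)] p(2)] q(2)]
   abs_mult_le[OF abs_mult_le[OF assms(1) p(1)] abs_mult_le[OF q(2) x(2)]]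
  unfolding power2_eq_square mult_1_left mult_1_right by blast+
 have 3: "0 <= a * b" "a * b <= a" using ab assms by (simp_all add: mult_left_le)
 have 4: "a\<^sup>2 + b\<^sup>2 + 3 * (a * b) <= (2 * (a + b))\<^sup>2"
  using ab 3(1) by (simp add: power2_eq_square algebra_simps)
 have "abs (x3 p + x3 q + k * x1 p * x2 q) <= 2 * (a + b)" using p(3) q(3) 1(1) 3 ab by (simp add: abs_le_iff)
 moreover have "abs (x4 p + x4 q + x1 p * x3 q + k * (x1 p)\<^sup>2 * x2 q / 2) <= (2 * (a + b))\<^sup>2"
  using p(4) q(4) 1(2) 2(1) 3 4 unfolding abs_le_iff by (intro conjI; linarith)
 moreover have "abs (x5 p + x5 q + x2 p * x3 q + k * x1 p * x2 p * x2 q + k * x1 p * (x2 q)\<^sup>2 / 2) <= (2 * (a + b))\<^sup>2"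
  using p(5) q(5) 1(3) 2(2,3) 3 4 unfolding abs_le_iff by (intro conjI; linarith)
 moreover have "abs (x1 p + x1 q) <= 2 * (a + b)" "abs (x2 p + x2 q) <= 2 * (a + b)"
  using p(1,2) q(1,2) ab by (simp_all add: abs_le_iff)
 ultimately show ?thesis using ab by (subst nrm_le_iff) (simp_all add: gm_def)
qed

lemma nrm_gi_le:
 assumes "abs k <= 1" "nrm p <= a" "a <= 1"
 shows "nrm (gi k p) <= 2 * a"
proof -
 have ab: "0 <= a" using assms nrm_nonneg order_trans by blast
 have p: "abs (x1 p) <= a" "abs (x2 p) <= a" "abs (x3 p) <= a" "abs (x4 p) <= a\<^sup>2" "abs (x5 p) <= a\<^sup>2"
  using assms(2) ab by (auto simp: nrm_le_iff)
 have x: "abs (x1 p) <= 1" "abs (x2 p) <= 1" using p(1,2) assms by linarith+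
 have 1: "abs (k * x1 p * x2 p) <= a * a" "abs (x1 p * x3 p) <= a * a" "abs (x2 p * x3 p) <= a * a"
  using abs_mult_le[OF abs_mult_le[OF assms(1) p(1)] p(2)] abs_mult_le[OF p(1) p(3)] abs_mult_le[OF p(2) p(3)] by simp_all
 have 2: "abs (k * (x1 p)\<^sup>2 * x2 p) <= a * a" "abs (k * x1 p * (x2 p)\<^sup>2) <= a * a"
  using abs_mult_le[OF abs_mult_le[OF assms(1) abs_mult_le[OF p(1) x(1)]] p(2)]
   abs_mult_le[OF abs_mult_le[OF assms(1) p(1)] abs_mult_le[OF p(2) x(2)]]
  unfolding power2_eq_square mult_1_left mult_1_right by blast+
 have 3: "0 <= a * a" "a * a <= a" using ab assms by (simp_all add: mult_left_le)
 have 4: "a\<^sup>2 = a * a" "(2 * a)\<^sup>2 = 4 * (a * a)" by (simp_all add: power2_eq_square)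
 have "abs (- x3 p + k * x1 p * x2 p) <= 2 * a"
  using p(3) 1(1) 3 ab unfolding abs_le_iff by (intro conjI; linarith)
 moreover have "abs (- x4 p + x1 p * x3 p - k * (x1 p)\<^sup>2 * x2 p / 2) <= (2 * a)\<^sup>2"
  using p(4) 1(2) 2(1) 3 4 unfolding abs_le_iff by (intro conjI; linarith)
 moreover have "abs (- x5 p + x2 p * x3 p - k * x1 p * (x2 p)\<^sup>2 / 2) <= (2 * a)\<^sup>2"
  using p(5) 1(3) 2(2) 3 4 unfolding abs_le_iff by (intro conjI; linarith)
 ultimately show ?thesis using ab p(1,2) by (subst nrm_le_iff) (simp_all add: gi_def)
qed

lemma rho_le_iff: "0 <= r ==> rho p q <= r \<longleftrightarrow> abs (x1 q - x1 p) <= r & abs (x2 q - x2 p) <= r & abs (x3 q - x3 p) <= r &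
  abs (x4 q - x4 p - x1 p * (x3 q - x3 p)) <= r\<^sup>2 & abs (x5 q - x5 p - x2 p * (x3 q - x3 p)) <= r\<^sup>2"
 unfolding rho_def gm_gi_comp by (simp add: nrm_le_iff)

lemma rho_nonneg [simp]: "0 <= rho p q" by (simp add: rho_def)

lemma rho_comp_le:
 "abs (x1 q - x1 p) <= rho p q" "abs (x2 q - x2 p) <= rho p q" "abs (x3 q - x3 p) <= rho p q"
 "abs (x4 q - x4 p - x1 p * (x3 q - x3 p)) <= (rho p q)\<^sup>2" "abs (x5 q - x5 p - x2 p * (x3 q - x3 p)) <= (rho p q)\<^sup>2"
 using rho_le_iff[of "rho p q" p q] by auto

text \<open>The cross terms are at most \<open>rho p q * rho q r\<close>, and the square of the sum
  has room for two of them. So the triangle inequality holds with constant 1, although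
  \<open>rho\<close> is symmetric only up to a factor 2.\<close>

lemma rho_triangle: "rho p r <= rho p q + rho q r"
proof -
 let ?a = "rho p q" and ?b = "rho q r"
 note a = rho_comp_le[where p = p and q = q] and b = rho_comp_le[where p = q and q = r]
 have 1: "abs ((x1 q - x1 p) * (x3 r - x3 q)) <= ?a * ?b" "abs ((x2 q - x2 p) * (x3 r - x3 q)) <= ?a * ?b"
  using abs_mult_le[OF a(1) b(3)] abs_mult_le[OF a(2) b(3)] by auto
 have sq: "(?a + ?b)\<^sup>2 = ?a\<^sup>2 + ?b\<^sup>2 + ?a * ?b + ?a * ?b" by (simp add: power2_eq_square algebra_simps)
 have ab: "0 <= ?a * ?b" by simp
 have 2: "x4 r - x4 p - x1 p * (x3 r - x3 p) = (x4 q - x4 p - x1 p * (x3 q - x3 p)) + (x4 r - x4 q - x1 q * (x3 r - x3 q)) + (x1 q - x1 p) * (x3 r - x3 q)"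
  "x5 r - x5 p - x2 p * (x3 r - x3 p) = (x5 q - x5 p - x2 p * (x3 q - x3 p)) + (x5 r - x5 q - x2 q * (x3 r - x3 q)) + (x2 q - x2 p) * (x3 r - x3 q)"
  by (simp_all add: algebra_simps)
 have "abs (x4 r - x4 p - x1 p * (x3 r - x3 p)) <= (?a + ?b)\<^sup>2" "abs (x5 r - x5 p - x2 p * (x3 r - x3 p)) <= (?a + ?b)\<^sup>2"
  unfolding 2 using a(4,5) b(4,5) 1 sq ab unfolding abs_le_iff by (intro conjI; linarith)+
 then show ?thesis using a(1-3) b(1-3) by (subst rho_le_iff) (simp, unfold abs_le_iff, linarith)
qed

lemma rho_commute_le: "rho q p <= 2 * rho p q"
proof -
 let ?a = "rho p q"
 note a = rho_comp_le[where p = p and q = q]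
 have 1: "abs ((x1 q - x1 p) * (x3 q - x3 p)) <= ?a * ?a" "abs ((x2 q - x2 p) * (x3 q - x3 p)) <= ?a * ?a"
  using abs_mult_le[OF a(1) a(3)] abs_mult_le[OF a(2) a(3)] by auto
 have sq: "(2 * ?a)\<^sup>2 = ?a\<^sup>2 + ?a\<^sup>2 + ?a * ?a + ?a * ?a" "?a\<^sup>2 = ?a * ?a" by (simp_all add: power2_eq_square)
 have ab: "0 <= ?a * ?a" by simp
 have 2: "x4 p - x4 q - x1 q * (x3 p - x3 q) = - (x4 q - x4 p - x1 p * (x3 q - x3 p)) + (x1 q - x1 p) * (x3 q - x3 p)"
  "x5 p - x5 q - x2 q * (x3 p - x3 q) = - (x5 q - x5 p - x2 p * (x3 q - x3 p)) + (x2 q - x2 p) * (x3 q - x3 p)"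
  by (simp_all add: algebra_simps)
 have "abs (x4 p - x4 q - x1 q * (x3 p - x3 q)) <= (2 * ?a)\<^sup>2" "abs (x5 p - x5 q - x2 q * (x3 p - x3 q)) <= (2 * ?a)\<^sup>2"
  unfolding 2 using a(4,5) 1 sq ab unfolding abs_le_iff by (intro conjI; linarith)+
 then show ?thesis using a(1-3) by (subst rho_le_iff) (simp, unfold abs_le_iff, linarith)
qed

lemma rho_eq_0_iff: "rho p q = 0 \<longleftrightarrow> p = q"
proof
 assume "rho p q = 0"
 then show "p = q" using rho_comp_le[of q p] rho_comp_le[where p=p and q=q] by (auto simp: prod_eq_iff)
qed (simp add: rho_def)

lemma continuous_on_gm [continuous_intros]:
 "continuous_on S a ==> continuous_on S b ==> continuous_on S (%x. gm k (a x) (b x))"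
 unfolding gm_def by (intro continuous_intros) auto

lemma continuous_on_gi [continuous_intros]:
 "continuous_on S a ==> continuous_on S (%x. gi k (a x))" unfolding gi_def by (intro continuous_intros) auto

lemma continuous_on_nrm [continuous_intros]:
 "continuous_on S a ==> continuous_on S (%x. nrm (a x))" unfolding nrm_def by (intro continuous_intros) auto

lemma continuous_on_rho [continuous_intros]:
 "continuous_on S a ==> continuous_on S b ==> continuous_on S (%x. rho (a x) (b x))"
 unfolding rho_def by (intro continuous_intros)

section \<open>Lebesgue measure as Haar measure of both groups\<close>

definition pres :: "('a::euclidean_space => 'a) => bool" where
 "pres T \<longleftrightarrow> T \<in> borel_measurable borel & distr lborel borel T = lborel"

lemma pres_emeasure: "pres T ==> A \<in> sets borel ==> emeasure lborel (T -` A) = emeasure lborel A"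
 unfolding pres_def by (metis emeasure_distr measurable_lborel2 sets_lborel space_lborel Int_UNIV_right measurable_lborel1 space_borel)

lemma pres_nn_integral:
 assumes "pres T" "F \<in> borel_measurable borel"
 shows "(\<integral>\<^sup>+x. F (T x) \<partial>lborel) = (\<integral>\<^sup>+x. F x \<partial>lborel)"
proof -
 have "(\<integral>\<^sup>+x. F x \<partial>lborel) = (\<integral>\<^sup>+x. F x \<partial>distr lborel borel T)"
  using assms by (simp add: pres_def)
 also have "... = (\<integral>\<^sup>+x. F (T x) \<partial>lborel)"
  using assms by (intro nn_integral_distr) (auto simp: pres_def)
 finally show ?thesis by simp
qed

lemma presI:
 assumes "T \<in> borel_measurable borel" "!!F. F \<in> borel_measurable borel ==> (\<integral>\<^sup>+x. F (T x) \<partial>lborel) = (\<integral>\<^sup>+x. F x \<partial>lborel)"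
 shows "pres T"
proof -
 have "distr lborel borel T = lborel"
 proof (rule measure_eqI)
  fix A assume "A \<in> sets (distr lborel borel T)"
  then have A: "A \<in> sets borel" by simp
  have "emeasure (distr lborel borel T) A = (\<integral>\<^sup>+x. indicator A x \<partial>distr lborel borel T)"
   using A by simp
  also have "... = (\<integral>\<^sup>+x. indicator A (T x) \<partial>lborel)"
   using A assms(1) by (intro nn_integral_distr) auto
  also have "... = emeasure lborel A" using A by (subst assms(2)) auto
  finally show "emeasure (distr lborel borel T) A = emeasure lborel A" .
 qed simp
 then show ?thesis using assms by (simp add: pres_def)
qed

lemma pres_plus: "pres (%x. x + c :: real)"
 unfolding pres_def using lborel_distr_plus[of c] by (auto simp: add.commute[of _ c])

text \<open>Fubini: first each fibre is transported by \<open>g x\<close>, then the base by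
  \<open>h\<close>.\<close>

lemma pres_skew:
 fixes h :: "'a::euclidean_space => 'a" and g :: "'a => 'b::euclidean_space => 'b"
 assumes "pres h" "!!x. pres (g x)" "continuous_on UNIV (%z. g (fst z) (snd z))"
 shows "pres (%z. (h (fst z), g (fst z) (snd z)))"
proof (rule presI)
 have [measurable]: "h \<in> borel_measurable borel" using assms by (simp add: pres_def)
 have [measurable]: "(%z. g (fst z) (snd z)) \<in> borel_measurable borel"
  using assms by (intro borel_measurable_continuous_onI)
 show m: "(%z. (h (fst z), g (fst z) (snd z))) \<in> borel_measurable borel"
  by (intro borel_measurable_Pair measurable_compose[OF _ \<open>h \<in> _\<close>] borel_measurable_continuous_onI continuous_intros assms)
 fix F :: "'a \<times> 'b => ennreal" assume F [measurable]: "F \<in> borel_measurable borel"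
 have Fp [measurable]: "F \<in> borel_measurable (borel \<Otimes>\<^sub>M borel)" using F by (simp add: borel_prod)
 have m2: "(%z. F (h (fst z), g (fst z) (snd z))) \<in> borel_measurable borel"
  using measurable_compose[OF m F] .
 have "(\<integral>\<^sup>+z. F (h (fst z), g (fst z) (snd z)) \<partial>lborel) = (\<integral>\<^sup>+x. \<integral>\<^sup>+y. F (h x, g x y) \<partial>lborel \<partial>lborel)"
  using lborel.nn_integral_fst[of "%z. F (h (fst z), g (fst z) (snd z))" lborel] m2
  by (simp add: lborel_prod borel_prod)
 also have "... = (\<integral>\<^sup>+x. \<integral>\<^sup>+y. F (h x, y) \<partial>lborel \<partial>lborel)"
 proof (rule nn_integral_cong)
  fix x
  have "(%y. F (h x, y)) \<in> borel_measurable borel" by measurable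
  then show "(\<integral>\<^sup>+y. F (h x, g x y) \<partial>lborel) = (\<integral>\<^sup>+y. F (h x, y) \<partial>lborel)"
   by (rule pres_nn_integral[OF assms(2)])
 qed
 also have "... = (\<integral>\<^sup>+x. \<integral>\<^sup>+y. F (x, y) \<partial>lborel \<partial>lborel)"
  by (intro pres_nn_integral[OF assms(1)]) measurable
 also have "... = (\<integral>\<^sup>+z. F z \<partial>lborel)"
  using lborel.nn_integral_fst[of F lborel] F by (simp add: lborel_prod borel_prod)
 finally show "(\<integral>\<^sup>+z. F (h (fst z), g (fst z) (snd z)) \<partial>lborel) = (\<integral>\<^sup>+z. F z \<partial>lborel)" .
qed

text \<open>Translations are triangular: each coordinate is shifted by an amount that depends only
  on earlier ones. The same holds on the right, so Lebesgue measure is bi-invariant.\<close>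

lemma pres_gm_left: "pres (gm k p)"
proof -
 have "pres (%z :: r5. (fst z + x1 p, (%a b. (fst b + x2 p,
   (%c d. (fst d + (x3 p + k * x1 p * c), (%e f. (fst f + (x4 p + x1 p * e + k * (x1 p)\<^sup>2 * c / 2),
    snd f + (x5 p + x2 p * e + k * x1 p * x2 p * c + k * x1 p * c\<^sup>2 / 2))) (fst d) (snd d))) (fst b) (snd b))) (fst z) (snd z)))"
  by (rule pres_skew, rule pres_plus, rule pres_skew, rule pres_plus, rule pres_skew, rule pres_plus,
    rule pres_skew, rule pres_plus, rule pres_plus) (auto intro!: continuous_intros)
 then show ?thesis by (simp add: gm_def[abs_def] ac_simps)
qed

lemma pres_gm_right: "pres (%p. gm k p q)"
proof -
 have "pres (%z :: r5. (fst z + x1 q, (%a b. (fst b + x2 q,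
   (%c d. (fst d + (x3 q + k * a * x2 q), (%e f. (fst f + (x4 q + a * x3 q + k * a\<^sup>2 * x2 q / 2),
    snd f + (x5 q + c * x3 q + k * a * c * x2 q + k * a * (x2 q)\<^sup>2 / 2))) (fst d) (snd d))) (fst b) (snd b))) (fst z) (snd z)))"
  by (rule pres_skew, rule pres_plus, rule pres_skew, rule pres_plus, rule pres_skew, rule pres_plus,
    rule pres_skew, rule pres_plus, rule pres_plus) (auto intro!: continuous_intros)
 then show ?thesis by (simp add: gm_def[abs_def] ac_simps)
qed

lemma open_nrm_ball: "open {h. nrm h < r}" by (intro open_Collect_less continuous_intros)

text \<open>The ball is a box; 7 = 1 + 1 + 1 + 2 + 2 is the homogeneous dimension.\<close>

lemma emeasure_nrm_ball:
 assumes "0 <= r"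
 shows "emeasure lborel {h. nrm h < r} = ennreal (32 * r ^ 7)"
proof (cases "r = 0")
 case True
 have "\<not> nrm h < r" for h unfolding True using nrm_nonneg[of h] by (simp add: not_less)
 then have "{h. nrm h < r} = {}" by blast
 then show ?thesis using True by (metis emeasure_empty ennreal_0 mult_zero_right power_0_left zero_neq_numeral)
next
 case False
 then have r: "0 < r" using assms by simp
 have eq: "{h. nrm h < r} = {-r<..<r} \<times> {-r<..<r} \<times> {-r<..<r} \<times> {-r\<^sup>2<..<r\<^sup>2} \<times> {-r\<^sup>2<..<r\<^sup>2}"
  using r by (auto simp: nrm_less_iff abs_less_iff)
 have T: "emeasure lborel (A \<times> B) = emeasure lborel A * emeasure lborel B" if "A \<in> sets borel" "B \<in> sets borel"
  for A :: "'a::euclidean_space set" and B :: "'b::euclidean_space set"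
  using that by (simp add: lborel_prod[symmetric] lborel.emeasure_pair_measure_Times)
 have I: "emeasure lborel {-a<..<a} = ennreal (2 * a)" if "0 < a" for a :: real using that by simp
 have "emeasure lborel {h. nrm h < r} = ennreal (2*r) * (ennreal (2*r) * (ennreal (2*r) * (ennreal (2*r\<^sup>2) * ennreal (2*r\<^sup>2))))"
  unfolding eq using r by (simp add: T I borel_Times del: emeasure_lborel_Ioo)
 also have "... = ennreal (32 * r ^ 7)"
  using r by (simp flip: ennreal_mult') (simp add: power_def numeral_eq_Suc)
 finally show ?thesis .
qed

lemma emeasure_gm_ball:
 assumes "0 <= r"
 shows "emeasure lborel {q. nrm (gm k (gi k p) q) < r} = ennreal (32 * r ^ 7)"
proof -
 have "{q. nrm (gm k (gi k p) q) < r} = gm k (gi k p) -` {h. nrm h < r}" by auto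
 then show ?thesis
  using pres_emeasure[OF pres_gm_left[of k "gi k p"], of "{h. nrm h < r}"] emeasure_nrm_ball[OF assms] open_nrm_ball
  by (simp add: borel_open)
qed

lemma emeasure_rho_ball: "0 <= r ==> emeasure lborel {q. rho p q < r} = ennreal (32 * r ^ 7)"
 unfolding rho_def by (rule emeasure_gm_ball)

text \<open>The set of centres whose ball contains \<open>q\<close>: inversion carries it into a
  ball about \<open>q\<close> of radius \<open>2 * r\<close>.\<close>

lemma emeasure_gm_ball_center:
 assumes "abs k <= 1" "0 <= r" "r <= 1"
 shows "emeasure lborel {p. nrm (gm k (gi k p) q) < r} <= ennreal (32 * (2 * r) ^ 7)"
proof (cases "r = 0")
 case True
 have "\<not> nrm (gm k (gi k p) q) < r" for p unfolding True using nrm_nonneg[of "gm k (gi k p) q"] by (simp add: not_less)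
 then have "{p. nrm (gm k (gi k p) q) < r} = {}" by blast
 then show ?thesis by (metis emeasure_empty zero_le)
next
 case False
 have "nrm (gm k (gi k q) p) < 2 * r" if "nrm (gm k (gi k p) q) < r" for p
 proof -
  have "gm k (gi k q) p = gi k (gm k (gi k p) q)"
   unfolding gm_gi_comp by (simp add: gi_def prod_eq_iff field_simps power2_eq_square)
  then show ?thesis using nrm_gi_le[OF assms(1) order_refl, of "gm k (gi k p) q"] that assms by simp
 qed
 then have "emeasure lborel {p. nrm (gm k (gi k p) q) < r} <= emeasure lborel {p. nrm (gm k (gi k q) p) < 2 * r}"
  by (intro emeasure_mono) (auto intro!: borel_open open_Collect_less continuous_intros)
 also have "... = ennreal (32 * (2 * r) ^ 7)" using assms by (intro emeasure_gm_ball) auto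
 finally show ?thesis .
qed

section \<open>Flows of the generating fields and small translations\<close>

text \<open>One-parameter subgroups of X1 (\<open>True\<close>) and X2 (\<open>False\<close>). Right
  multiplication by them is the flow of the left invariant field.\<close>

definition gg :: "bool => real => r5" where
 "gg j s = (if j then (s, 0, 0, 0, 0) else (0, s, 0, 0, 0))"

lemma gg_add: "gm k (gg j s) (gg j t) = gg j (s + t)" by (simp add: gg_def gm_def)

lemma gg_0 [simp]: "gg j 0 = 0" by (simp add: gg_def zero_prod_def)

lemma nrm_gg [simp]: "nrm (gg j s) = abs s" by (simp add: gg_def nrm_def)

abbreviation fl :: "r5 => bool => real => r5" where "fl p j s \<equiv> gm 1 p (gg j s)"

lemma continuous_on_gg [continuous_intros]: "continuous_on S a ==> continuous_on S (%x. gg j (a x))"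
 unfolding gg_def by (cases j) (auto intro!: continuous_intros)

lemma norm_le_nrm: "nrm h <= 1 ==> norm h <= 5 * nrm h"
proof -
 assume h: "nrm h <= 1"
 obtain a b c d e where hh: "h = (a, b, c, d, e)" by (cases h rule: prod_cases5) auto
 have 1: "norm h <= abs a + (abs b + (abs c + (abs d + abs e)))" unfolding hh
  by (intro order_trans[OF norm_Pair_le] add_mono) (auto intro!: order_trans[OF norm_Pair_le] add_mono)
 have "(nrm h)\<^sup>2 <= nrm h" using h by (simp add: power2_eq_square mult_left_le)
 then show ?thesis using 1 nrm_comp_le[of h] by (simp add: hh)
qed

text \<open>A neighbourhood with a uniform margin in the gauge; domains are nested in this way so
  that flows and small displacements stay inside them.\<close>

lemma gm_nest:
 assumes "open A" "p0 \<in> A"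
 obtains B r where "open B" "p0 \<in> B" "0 < r" "r <= 1" "!!p h. p \<in> B ==> nrm h <= r ==> gm k p h \<in> A"
proof -
 let ?g = "%z. gm k (fst z) (snd z)"
 have "open (?g -` A)" using assms(1) by (intro open_vimage) (auto intro!: continuous_intros)
 moreover have "(p0, 0) \<in> ?g -` A" using assms by simp
 ultimately obtain B C where BC: "open B" "open C" "(p0, 0) \<in> B \<times> C" "B \<times> C \<subseteq> ?g -` A"
  by (rule open_prod_elim) ((rule that | assumption)+)
 then have "0 \<in> C" by auto
 then obtain e where e: "e > 0" "ball 0 e \<subseteq> C" using openE[OF BC(2)] by blast
 let ?r = "min 1 (e / 6)"
 have "gm k p h \<in> A" if "p \<in> B" "nrm h <= ?r" for p h
 proof -
  have "norm h <= 5 * nrm h" using that by (intro norm_le_nrm) auto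
  then have "h \<in> ball 0 e" using that e by (auto simp: dist_norm)
  then show ?thesis using BC e that by force
 qed
 then show ?thesis using BC e by (intro that[of B ?r]) auto
qed

text \<open>Replace \<open>E\<close> by a compact \<open>T\<close> of positive measure and take an
  open \<open>W\<close> around \<open>T\<close> with excess below \<open>e\<close>. Small right
  translations keep \<open>T\<close> inside \<open>W\<close> and preserve measure, so each moves at
  most measure \<open>e\<close> of \<open>T\<close> out of \<open>T\<close>; by the choice of
  \<open>e\<close> these finitely many bad parts do not cover \<open>T\<close>.\<close>

lemma gm_steinhaus:
 assumes E: "E \<in> sets borel" "0 < emeasure lborel E" and I: "finite I"
  and h: "!!i. i \<in> I ==> (h i \<longlongrightarrow> 0) (at_right (0::real))"
 shows "eventually (%r. \<exists>p\<in>E. \<forall>i\<in>I. gm k p (h i r) \<in> E) (at_right 0)"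
proof -
 have "\<exists>n::nat. 0 < emeasure lborel (E \<inter> cball 0 n)"
 proof (rule ccontr)
  assume *: "\<not> ?thesis"
  have "E = (\<Union>n::nat. E \<inter> cball 0 n)"
  proof -
   have "\<exists>n::nat. p \<in> cball 0 (real n)" for p :: r5
    using real_arch_simple[of "norm p"] by (simp add: mem_cball_0)
   then show ?thesis by blast
  qed
  moreover have "emeasure lborel (\<Union>n::nat. E \<inter> cball 0 (real n)) = 0"
   using * E by (intro emeasure_UN_eq_0) (auto simp: not_gr_zero)
  ultimately show False using E by simp
 qed
 then obtain n :: nat where n: "0 < emeasure lborel (E \<inter> cball 0 n)" by blast
 let ?S = "E \<inter> cball 0 (real n)"
 have S: "?S \<in> sets lebesgue" "?S \<in> sets borel" using E by auto
 have Sfin: "emeasure lborel ?S < \<infinity>"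
  by (rule le_less_trans[OF emeasure_mono[of _ "cball 0 (real n)"]]) (auto intro!: emeasure_bounded_finite simp flip: infinity_ennreal_def)
 define s where "s = measure lborel ?S"
 have s: "emeasure lborel ?S = ennreal s" "s > 0"
 proof -
  show 1: "emeasure lborel ?S = ennreal s" using Sfin by (simp add: s_def emeasure_eq_ennreal_measure less_top[symmetric])
  show "s > 0" using n unfolding 1 by (simp add: ennreal_less_zero_iff)
 qed
 obtain T where T: "closed T" "T \<subseteq> ?S" "?S - T \<in> lmeasurable" "emeasure lebesgue (?S - T) < ennreal s"
  by (rule sets_lebesgue_inner_closed[OF S(1) s(2)]) ((rule that | assumption)+)
 have Tc: "compact T" using T(1,2) bounded_cball bounded_subset by (metis compact_eq_bounded_closed le_inf_iff)
 have Tb: "T \<in> sets borel" using T by auto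
 have Tpos: "0 < emeasure lborel T"
 proof (rule ccontr)
  assume "\<not> ?thesis"
  then have "emeasure lborel T = 0" by simp
  moreover have "emeasure lborel ?S = emeasure lborel T + emeasure lborel (?S - T)"
   using T S Tb by (subst plus_emeasure) (auto simp: Un_absorb1)
  ultimately show False using T(4) s S Tb by simp
 qed
 have Tfin: "emeasure lborel T < \<infinity>" using emeasure_compact_finite[OF Tc] by simp
 define t where "t = measure lborel T"
 have t: "emeasure lborel T = ennreal t" "t > 0"
 proof -
  show 1: "emeasure lborel T = ennreal t" using Tfin by (simp add: t_def emeasure_eq_ennreal_measure less_top[symmetric])
  show "t > 0" using Tpos unfolding 1 by (simp add: ennreal_less_zero_iff)
 qed
 define e where "e = t / (real (card I) + 1)"
 have e: "e > 0" using t by (simp add: e_def)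
 have TL: "T \<in> sets lebesgue" using Tb by simp
 obtain W where W: "open W" "T \<subseteq> W" "W - T \<in> lmeasurable" "emeasure lebesgue (W - T) < ennreal e"
  by (rule sets_lebesgue_outer_open[OF TL e]) ((rule that | assumption)+)
 have "open ((%z. gm k (snd z) (fst z)) -` W)"
  using W(1) by (intro open_vimage) (auto intro!: continuous_intros)
 moreover have "{0} \<times> T \<subseteq> (%z. gm k (snd z) (fst z)) -` W" using W(2) by auto
 ultimately have "\<exists>X. 0 \<in> X & open X & X \<times> T \<subseteq> (%z. gm k (snd z) (fst z)) -` W"
  by (rule Elementary_Topology.tube_lemma[OF Tc])
 then obtain X where X: "0 \<in> X" "open X" "X \<times> T \<subseteq> (%z. gm k (snd z) (fst z)) -` W" by blast
 have "eventually (%r. \<forall>i\<in>I. h i r \<in> X) (at_right 0)"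
  using h X(1,2) I by (auto simp: tendsto_def intro!: eventually_ball_finite)
 then show ?thesis
 proof (rule eventually_mono)
  fix r assume r: "\<forall>i\<in>I. h i r \<in> X"
  show "\<exists>p\<in>E. \<forall>i\<in>I. gm k p (h i r) \<in> E"
  proof (rule ccontr)
  assume no: "\<not> (\<exists>p\<in>E. \<forall>i\<in>I. gm k p (h i r) \<in> E)"
  define Q where "Q i = T \<inter> (%p. gm k p (h i r)) -` (- T)" for i
  have mQ: "(%p. gm k p (h i r)) -` B \<in> sets borel" if "B \<in> sets borel" for i B
   using that measurable_sets_borel[OF conjunct1[OF pres_gm_right[unfolded pres_def]]] by auto
  have "T \<subseteq> (\<Union>i\<in>I. Q i)"
  proof
   fix p assume p: "p \<in> T"
   then have "p \<in> E" using T(2) by blast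
   then obtain i where i: "i \<in> I" "gm k p (h i r) \<notin> E" using no by blast
   then have "gm k p (h i r) \<notin> T" using T(2) by blast
   then show "p \<in> (\<Union>i\<in>I. Q i)" using i(1) p by (auto simp: Q_def)
  qed
  then have "emeasure lborel T <= emeasure lborel (\<Union>i\<in>I. Q i)"
   using I Tb mQ by (intro emeasure_mono) (auto simp: Q_def)
  also have "... <= (\<Sum>i\<in>I. emeasure lborel (Q i))"
   using I Tb mQ by (intro emeasure_subadditive_finite) (auto simp: Q_def)
  also have "... <= (\<Sum>i\<in>I. ennreal e)"
  proof (rule sum_mono)
   fix i assume i: "i \<in> I"
   have "Q i \<subseteq> (%p. gm k p (h i r)) -` (W - T)"
   proof
    fix p assume p: "p \<in> Q i"
    then have "(h i r, p) \<in> X \<times> T" using r i by (simp add: Q_def)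
    then have "gm k p (h i r) \<in> W" using X(3) by auto
    then show "p \<in> (%p. gm k p (h i r)) -` (W - T)" using p by (simp add: Q_def)
   qed
   then have "emeasure lborel (Q i) <= emeasure lborel ((%p. gm k p (h i r)) -` (W - T))"
    using W(1) Tb mQ by (intro emeasure_mono) auto
   also have "... = emeasure lborel (W - T)" using W(1) Tb by (intro pres_emeasure pres_gm_right) auto
   also have "... <= ennreal e" using W(1,4) Tb by simp
   finally show "emeasure lborel (Q i) <= ennreal e" .
  qed
  also have "... = ennreal (real (card I) * e)"
   using e by (simp add: ennreal_mult' ennreal_of_nat_eq_real_of_nat)
  finally have "t <= real (card I) * e" using t e by (simp add: ennreal_le_iff)
  moreover have "real (card I) * e < t" using t by (simp add: e_def field_simps)
  ultimately show False by simp
  qed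
 qed
qed

section \<open>Quasiconformal maps into the cone\<close>

text \<open>For situations where \<open>h s\<close> is covered only from some \<open>n\<close> on
  that depends on \<open>s\<close>. By the intermediate value theorem the values fill
  \<open>{0<..<h y}\<close>, and continuity of measure from below turns the pointwise covering into
  an eventual lower bound for the measure.\<close>

lemma measure_ge_of_eventually_covered:
 fixes h :: "real => real"
 assumes xy: "x < y" and h: "continuous_on {x..y} h" "h x = 0"
  and A: "!!n. A n \<in> fmeasurable lborel"
  and ev: "!!s. x < s ==> s < y ==> eventually (%n. h s \<in> A n) sequentially" and "0 < e"
 shows "eventually (%n. h y <= measure lborel (A n) + e) sequentially"
proof (cases "0 < h y")
 case False
 then show ?thesis using \<open>0 < e\<close> by (intro always_eventually allI) (smt (verit) measure_nonneg)
next
 case True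
 define B where "B m = (\<Inter>n\<in>{m..}. A n) \<inter> {0<..<h y}" for m
 have A': "A n \<in> sets borel" for n using fmeasurableD[OF A] by simp
 have Bs: "B m \<in> sets lborel" for m unfolding B_def using A' by (intro sets.Int sets.countable_INT') auto
 have incB: "incseq B" by (fastforce simp: incseq_def B_def)
 have "{0<..<h y} \<subseteq> (\<Union>m. B m)"
 proof
  fix t assume t: "t \<in> {0<..<h y}"
  obtain s where s: "x <= s" "s <= y" "h s = t" using IVT'[of h x t y] h t xy by auto
  then have "x < s" "s < y" using t h(2) by (auto simp: less_le)
  from ev[OF this] obtain m where "\<forall>n\<ge>m. h s \<in> A n" by (auto simp: eventually_sequentially)
  then show "t \<in> (\<Union>m. B m)" using s t by (auto simp: B_def)
 qed
 moreover have "(\<Union>m. B m) \<subseteq> {0<..<h y}" by (auto simp: B_def)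
 ultimately have UB: "(\<Union>m. B m) = {0<..<h y}" by blast
 have "(%m. emeasure lborel (B m)) \<longlonglongrightarrow> emeasure lborel (\<Union>m. B m)"
  using Bs incB by (intro Lim_emeasure_incseq) auto
 then have "(%m. emeasure lborel (B m)) \<longlonglongrightarrow> ennreal (h y)" using True by (simp add: UB)
 moreover have "ennreal (h y - e) < ennreal (h y)" using True \<open>0 < e\<close> by (simp add: ennreal_less_iff ennreal_lessI)
 ultimately have "eventually (%m. ennreal (h y - e) < emeasure lborel (B m)) sequentially"
  by (rule order_tendstoD(1))
 then show ?thesis
 proof (rule eventually_mono)
  fix m assume "ennreal (h y - e) < emeasure lborel (B m)"
  also have "... <= emeasure lborel (A m)" using A' by (intro emeasure_mono) (auto simp: B_def)
  also have "... = ennreal (measure lborel (A m))" using A by (simp add: emeasure_eq_measure2)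
  finally have lt: "ennreal (h y - e) < ennreal (measure lborel (A m))" .
  show "h y <= measure lborel (A m) + e"
  proof (cases "e <= h y")
   case True
   then show ?thesis using lt by (simp add: ennreal_less_iff)
  next
   case False
   then show ?thesis using measure_nonneg[of lborel "A m"] by linarith
  qed
 qed
qed

lemma card_pieces_le:
 fixes r :: real
 assumes "0 < r" "x <= y" "finite J" "!!i. i \<in> J ==> x <= real i * r & real (Suc i) * r <= y"
 shows "real (card J) * r <= y - x"
proof (cases "J = {}")
 case False
 have "J \<subseteq> {Min J..Max J}" using assms(3) by auto
 then have "card J <= Suc (Max J) - Min J" using card_mono[of "{Min J..Max J}" J] by simp
 moreover have "Min J <= Max J" using assms(3) False by simp
 ultimately have "real (card J) <= real (Suc (Max J)) - real (Min J)" by (simp flip: of_nat_diff)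
 then have "real (card J) * r <= (real (Suc (Max J)) - real (Min J)) * r" using assms(1) by (intro mult_right_mono) auto
 also have "... <= y - x"
  using assms(4)[of "Max J"] assms(4)[of "Min J"] assms(3) False by (simp add: left_diff_distrib)
 finally show ?thesis .
qed (use assms in auto)

text \<open>Either \<open>x\<close> is below the threshold \<open>A\<close> or \<open>x / A\<close>
  is at least 1 and its sixth power helps. This is the Young inequality for the exponent 7, used to
  trade lengths for measures of balls.\<close>

lemma young_seven:
 fixes x A :: real
 assumes "0 <= x" "0 < A"
 shows "x <= A + x ^ 7 / A ^ 6"
proof (cases "x <= A")
 case True
 moreover have "0 <= x ^ 7 / A ^ 6" using assms by simp
 ultimately show ?thesis by simp
next
 case False
 have "A ^ 6 * x <= x ^ 6 * x" using False assms by (intro mult_right_mono power_mono) auto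
 also have "x ^ 6 * x = x ^ 7" by (simp add: eval_nat_numeral)
 finally have "x <= x ^ 7 / A ^ 6" using assms by (simp add: field_simps)
 then show ?thesis using assms by simp
qed

lemma ennreal_mult_three: "0 <= a ==> 0 <= b ==> 0 <= c ==> ennreal a * ennreal b * ennreal c = ennreal (a * b * c)"
 by (simp add: ennreal_mult)

lemma uniform_rho_small:
 fixes a b :: real
 assumes "continuous_on {a..b} H" "0 < e"
 shows "\<exists>d>0. \<forall>s\<in>{a..b}. \<forall>t\<in>{a..b}. abs (s - t) < d --> rho (H s) (H t) < e"
proof -
 let ?S = "{a..b} \<times> {a..b}"
 have "continuous_on ?S (%z. rho (H (fst z)) (H (snd z)))"
  by (intro continuous_intros continuous_on_compose2[OF assms(1)]) auto
 then have "uniformly_continuous_on ?S (%z. rho (H (fst z)) (H (snd z)))"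
  by (intro compact_uniformly_continuous compact_Times) auto
 then obtain d where d: "d > 0" "!!z z'. z \<in> ?S ==> z' \<in> ?S ==> dist z' z < d ==>
   dist (rho (H (fst z')) (H (snd z'))) (rho (H (fst z)) (H (snd z))) < e"
  unfolding uniformly_continuous_on_def using assms(2) by metis
 have "rho (H s) (H t) < e" if "s \<in> {a..b}" "t \<in> {a..b}" "abs (s - t) < d" for s t
  using d(2)[of "(s, s)" "(s, t)"] that
  by (simp add: dist_Pair_Pair dist_real_def abs_minus_commute rho_eq_0_iff[THEN iffD2])
 then show ?thesis using d(1) by blast
qed

text \<open>\<open>D\<close> stands for the Carnot-Caratheodory gauge of the source group, of which
  only the comparison with \<open>nrm\<close> near the identity is kept. The radius in the last
  assumption depends on \<open>p\<close>, as in the definition by a pointwise upper limit.\<close>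

locale qc_setup =
 fixes U :: "r5 set" and f :: "r5 => r5" and D :: "r5 => real" and K C :: real
 assumes U: "open U" and cont: "continuous_on U f" and inj: "inj_on f U"
  and D_le: "!!g. nrm g <= 1 ==> D g <= C * nrm g"
  and D_ge: "!!g. D g < 1 ==> nrm g <= 2 * D g" and C: "1 <= C" and K: "1 <= K"
  and qc: "!!p. p \<in> U ==> \<exists>d>0. \<forall>g h. gm 1 p g \<in> U --> gm 1 p h \<in> U --> D g < d --> D g <= D h -->
    rho (f p) (f (gm 1 p g)) <= K * rho (f p) (f (gm 1 p h))"
begin

text \<open>The radius is made a parameter, so that the points sharing one radius form a measurable
  set.\<close>

definition qcat :: "real => r5 => bool" where
 "qcat d p \<longleftrightarrow> (\<forall>g h. gm 1 p g \<in> U --> gm 1 p h \<in> U --> D g < d --> D g <= D h -->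
    rho (f p) (f (gm 1 p g)) <= K * rho (f p) (f (gm 1 p h)))"

definition bl :: "r5 set => r5 => real => r5 set" where
 "bl W q r = {x \<in> W. nrm (gm 1 (gi 1 q) x) < r}"

lemma bl_subset: "bl W q r \<subseteq> W" by (auto simp: bl_def)

lemma open_bl:
 assumes "open W"
 shows "open (bl W q r)"
proof -
 have "open {x. nrm (gm 1 (gi 1 q) x) < r}" by (intro open_Collect_less continuous_intros)
 then have "open (W \<inter> {x. nrm (gm 1 (gi 1 q) x) < r})" using assms by (rule open_Int[rotated])
 then show ?thesis by (simp add: bl_def Int_def)
qed

lemma open_image: "open W ==> W \<subseteq> U ==> open (f ` W)"
 by (rule invariance_of_domain) (auto intro: continuous_on_subset[OF cont] inj_on_subset[OF inj])

lemma image_bl_sets: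
 assumes "open W" "W \<subseteq> U"
 shows "f ` bl W q r \<in> sets borel"
 using open_image[OF open_bl[OF assms(1)] order_trans[OF bl_subset assms(2)]] by (rule borel_open)

text \<open>A point of \<open>W\<close> whose image is closer to \<open>f q\<close> than a
  \<open>K\<close>-th of the displacement of \<open>gm 1 q g\<close> must itself be closer to
  \<open>q\<close> than \<open>gm 1 q g\<close>, by quasiconformality. So the image of a ball
  contains a \<open>rho\<close>-ball, of measure the seventh power of its radius up to a
  constant.\<close>

lemma image_ball_lower:
 assumes q: "qcat d q" and g: "gm 1 q g \<in> U" "D g < d" "D g < 1" and W: "open W" "W \<subseteq> U"
  and sub: "{y. rho (f q) y < rho (f q) (f (gm 1 q g)) / K} \<subseteq> f ` W"
 shows "ennreal (32 * (rho (f q) (f (gm 1 q g)) / K) ^ 7) <= emeasure lborel (f ` bl W q (2 * D g))"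
proof -
 let ?l = "rho (f q) (f (gm 1 q g))"
 have "{y. rho (f q) y < ?l / K} \<subseteq> f ` bl W q (2 * D g)"
 proof
  fix y assume y: "y \<in> {y. rho (f q) y < ?l / K}"
  then obtain x where x: "x \<in> W" "y = f x" using sub by auto
  define h where "h = gm 1 (gi 1 q) x"
  have xh: "x = gm 1 q h" by (simp add: h_def)
  have "K * rho (f q) (f (gm 1 q h)) < ?l" using y x xh K by (simp add: field_simps)
  moreover have "gm 1 q h \<in> U" using x W xh by auto
  ultimately have "\<not> D g <= D h" using q g unfolding qcat_def by (metis not_less)
  then have "nrm h < 2 * D g" using D_ge[of h] g by linarith
  then show "y \<in> f ` bl W q (2 * D g)" using x by (auto simp: bl_def h_def)
 qed
 then have "emeasure lborel {y. rho (f q) y < ?l / K} <= emeasure lborel (f ` bl W q (2 * D g))"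
  using image_bl_sets[OF W] by (intro emeasure_mono) auto
 then show ?thesis using K by (simp add: emeasure_rho_ball)
qed

text \<open>Exchange the integrations over \<open>p\<close> and over the image: for fixed
  \<open>y = f x\<close> the centres whose ball contains \<open>x\<close> have measure of order
  \<open>r ^ 7\<close>, and shifting the centre by \<open>c\<close> on the right does not change
  it.\<close>

lemma flow_ball_integral:
 assumes W: "open W" "W \<subseteq> U" and r: "0 <= r" "r <= 1"
 shows "(%p. emeasure lborel (f ` bl W (gm 1 p c) r)) \<in> borel_measurable borel" (is ?P1)
  "(\<integral>\<^sup>+p. emeasure lborel (f ` bl W (gm 1 p c) r) \<partial>lborel) <= ennreal (32 * (2 * r) ^ 7) * emeasure lborel (f ` W)" (is ?P2)
proof -
 have "continuous_on W f" "inj_on f W" using W cont inj by (auto intro: continuous_on_subset inj_on_subset)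
 then obtain g where g: "homeomorphism W (f ` W) f g"
  using invariance_of_domain_homeomorphism[of W f] W(1) by auto
 have gc: "continuous_on (f ` W) g" and gf: "!!x. x \<in> W ==> g (f x) = x" using g by (auto simp: homeomorphism_def)
 have oW: "open (f ` W)" using W by (rule open_image)
 define X where "X = {z. snd z \<in> f ` W & nrm (gm 1 (gi 1 (gm 1 (fst z) c)) (g (snd z))) < r}"
 have "open X"
 proof -
  have c: "continuous_on (UNIV \<times> f ` W) (%z. nrm (gm 1 (gi 1 (gm 1 (fst z) c)) (g (snd z))))"
   by (intro continuous_intros continuous_on_compose2[OF gc]) auto
  have "open ((UNIV \<times> f ` W) \<inter> (%z. nrm (gm 1 (gi 1 (gm 1 (fst z) c)) (g (snd z)))) -` {..<r})"
   by (rule continuous_open_preimage[OF c]) (auto intro!: open_Times oW)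
  also have "... = X" by (auto simp: X_def)
  finally show ?thesis .
 qed
 then have X: "X \<in> sets (lborel \<Otimes>\<^sub>M lborel)"
  unfolding lborel_prod sets_lborel by (rule borel_open)
 have sec: "Pair p -` X = f ` bl W (gm 1 p c) r" for p using gf by (force simp: X_def bl_def)
 show ?P1 using lborel.measurable_emeasure_Pair[OF X] by (simp add: sec)
 have "(\<integral>\<^sup>+p. emeasure lborel (f ` bl W (gm 1 p c) r) \<partial>lborel) = emeasure (lborel \<Otimes>\<^sub>M lborel) X"
  using lborel.emeasure_pair_measure_alt[OF X] by (simp add: sec)
 also have "... = (\<integral>\<^sup>+y. emeasure lborel ((%p. (p, y)) -` X) \<partial>lborel)"
  by (rule lborel_pair.emeasure_pair_measure_alt2[OF X])
 also have "... <= (\<integral>\<^sup>+y. ennreal (32 * (2 * r) ^ 7) * indicator (f ` W) y \<partial>lborel)"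
 proof (rule nn_integral_mono)
  fix y
  show "emeasure lborel ((%p. (p, y)) -` X) <= ennreal (32 * (2 * r) ^ 7) * indicator (f ` W) y"
  proof (cases "y \<in> f ` W")
   case True
   let ?A = "{p. nrm (gm 1 (gi 1 p) (g y)) < r}"
   have A: "?A \<in> sets borel" by (intro borel_open open_Collect_less continuous_intros)
   have "(%p. (p, y)) -` X = (%p. gm 1 p c) -` ?A" using True by (auto simp: X_def)
   then have "emeasure lborel ((%p. (p, y)) -` X) = emeasure lborel ?A"
    using pres_emeasure[OF pres_gm_right A] by simp
   also have "... <= ennreal (32 * (2 * r) ^ 7)" using r by (intro emeasure_gm_ball_center) auto
   finally show ?thesis using True by simp
  next
   case False
   then have "(%p. (p, y)) -` X = {}" by (auto simp: X_def)
   then show ?thesis by simp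
  qed
 qed
 also have "... = ennreal (32 * (2 * r) ^ 7) * emeasure lborel (f ` W)"
  using oW by (subst nn_integral_cmult) (auto simp: borel_open)
 finally show ?P2 .
qed

text \<open>The mean over \<open>p\<close> of the sum of \<open>Suc n\<close> image measures is of
  order \<open>Suc n * r ^ 7\<close>, that is \<open>s0 * r ^ 6\<close>. So the sums divided by
  \<open>r ^ 6\<close> have bounded integrals, and Fatou's lemma applies.\<close>

lemma liminf_tube_finite:
 assumes W: "open W" "W \<subseteq> U" and fin: "emeasure lborel (f ` W) < \<infinity>" and s0: "0 < s0" "B * s0 <= 1" "0 < B"
 shows "AE p in lborel. liminf (%n. (\<Sum>i<Suc n. emeasure lborel (f ` bl W (fl p j (real i * (s0 / real (Suc n)))) (B * (s0 / real (Suc n))))) *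
   ennreal (1 / (s0 / real (Suc n)) ^ 6)) < \<infinity>"
proof -
 define r where "r n = s0 / real (Suc n)" for n
 have r: "0 < r n" "B * r n <= 1" for n
 proof -
  show "0 < r n" using s0 by (simp add: r_def)
  have "r n <= s0" using s0 by (simp add: r_def field_simps)
  then show "B * r n <= 1" using s0 by (meson mult_left_mono less_imp_le order_trans)
 qed
 have Br: "0 <= B * r n" for n using r(1)[of n] s0(3) by simp
 note fm = flow_ball_integral(1)[OF W Br r(2)]
 define S where "S n p = (\<Sum>i<Suc n. emeasure lborel (f ` bl W (fl p j (real i * r n)) (B * r n))) * ennreal (1 / r n ^ 6)" for n p
 have Sm: "S n \<in> borel_measurable borel" for n
  unfolding S_def by (intro borel_measurable_times_ennreal borel_measurable_sum fm) auto
 have I: "(\<integral>\<^sup>+p. S n p \<partial>lborel) <= ennreal (s0 * 32 * (2 * B) ^ 7) * emeasure lborel (f ` W)" for n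
 proof -
  have "(\<integral>\<^sup>+p. S n p \<partial>lborel) = (\<Sum>i<Suc n. \<integral>\<^sup>+p. emeasure lborel (f ` bl W (fl p j (real i * r n)) (B * r n)) \<partial>lborel) * ennreal (1 / r n ^ 6)"
  proof -
   have "(\<integral>\<^sup>+p. S n p \<partial>lborel) = (\<integral>\<^sup>+p. (\<Sum>i<Suc n. emeasure lborel (f ` bl W (fl p j (real i * r n)) (B * r n))) \<partial>lborel) * ennreal (1 / r n ^ 6)"
    unfolding S_def by (rule nn_integral_multc) (unfold measurable_lborel2, intro borel_measurable_sum fm)
   also have "(\<integral>\<^sup>+p. (\<Sum>i<Suc n. emeasure lborel (f ` bl W (fl p j (real i * r n)) (B * r n))) \<partial>lborel) =
     (\<Sum>i<Suc n. \<integral>\<^sup>+p. emeasure lborel (f ` bl W (fl p j (real i * r n)) (B * r n)) \<partial>lborel)"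
    by (rule nn_integral_sum) (unfold measurable_lborel2, rule fm)
   finally show ?thesis .
  qed
  also have "... <= (\<Sum>i<Suc n. ennreal (32 * (2 * (B * r n)) ^ 7) * emeasure lborel (f ` W)) * ennreal (1 / r n ^ 6)"
   by (intro mult_right_mono sum_mono flow_ball_integral(2)[OF W Br r(2)]) simp
  also have "... = (ennreal (real (Suc n)) * ennreal (32 * (2 * (B * r n)) ^ 7) * ennreal (1 / r n ^ 6)) * emeasure lborel (f ` W)"
   by (simp add: ennreal_of_nat_eq_real_of_nat ac_simps del: of_nat_Suc)
  also have "ennreal (real (Suc n)) * ennreal (32 * (2 * (B * r n)) ^ 7) * ennreal (1 / r n ^ 6) = ennreal (real (Suc n) * (32 * (2 * (B * r n)) ^ 7) * (1 / r n ^ 6))"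
   using r[of n] s0 by (intro ennreal_mult_three) auto
  also have "real (Suc n) * (32 * (2 * (B * r n)) ^ 7) * (1 / r n ^ 6) = (real (Suc n) * r n) * 32 * (2 * B) ^ 7"
   using r(1)[of n] by (simp add: power_mult_distrib field_simps eval_nat_numeral del: of_nat_Suc)
  also have "real (Suc n) * r n = s0" by (simp add: r_def)
  finally show ?thesis .
 qed
 have "(\<integral>\<^sup>+p. liminf (%n. S n p) \<partial>lborel) <= liminf (%n. \<integral>\<^sup>+p. S n p \<partial>lborel)"
  using Sm by (intro nn_integral_liminf) auto
 also have "... <= ennreal (s0 * 32 * (2 * B) ^ 7) * emeasure lborel (f ` W)"
 proof -
  have "liminf (%n. \<integral>\<^sup>+p. S n p \<partial>lborel) <= liminf (%n::nat. ennreal (s0 * 32 * (2 * B) ^ 7) * emeasure lborel (f ` W))"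
   by (intro Liminf_mono always_eventually allI I)
  then show ?thesis by (simp add: Liminf_const)
 qed
 also have "... < \<infinity>" using fin by (simp add: ennreal_mult_less_top)
 finally have "AE p in lborel. liminf (%n. S n p) ~= \<infinity>" using Sm by (intro nn_integral_PInf_AE) auto
 then show ?thesis by (simp add: S_def r_def less_top)
qed

text \<open>Over a cell of the grid the seventh power of the oscillation is at most a constant times
  the image measure of a ball, and these measures add up to at most \<open>M * r ^ 6\<close>. In the
  form \<open>young_seven\<close>, Hoelder's inequality bounds the total oscillation by
  \<open>A * tlen I + c * M / A ^ 6\<close> for every \<open>A\<close>, which gives absolute
  continuity. Since the admissible radius varies from point to point, the oscillation of a piece is
  estimated through a covering of the values of \<open>rho\<close>.\<close>

lemma curve_ac:
 assumes W: "open W" "W \<subseteq> U" and fin: "emeasure lborel (f ` W) < \<infinity>" and s0: "0 < s0"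
  and B: "B = 2 * (1 + 2 * C)"
  and pW: "!!s. 0 <= s ==> s <= s0 ==> fl p j s \<in> W"
  and lim: "liminf (%n. (\<Sum>i<Suc n. emeasure lborel (f ` bl W (fl p j (real i * (s0 / real (Suc n)))) (B * (s0 / real (Suc n))))) *
   ennreal (1 / (s0 / real (Suc n)) ^ 6)) < \<infinity>"
 shows "pair_ac 0 s0 (%s t. rho (f (fl p j s)) (f (fl p j t)))"
proof -
 define ph where "ph s = fl p j s" for s
 define F where "F s = f (ph s)" for s
 define r where "r n = s0 / real (Suc n)" for n
 have r0: "0 < r n" for n using s0 by (simp add: r_def)
 have rlim: "r \<longlonglongrightarrow> 0" unfolding r_def by (intro LIMSEQ_Suc lim_const_over_n)
 have phW: "ph s \<in> W" if "0 <= s" "s <= s0" for s using pW that by (simp add: ph_def)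
 have Fc: "continuous_on {0..s0} F" unfolding F_def ph_def
  by (rule continuous_on_compose2[OF cont]) (use pW W in \<open>auto intro!: continuous_intros\<close>)
 have ph_shift: "ph t = fl (ph s) j (t - s)" for s t by (simp add: ph_def gm_assoc gg_add)
 \<comment> \<open>A uniform radius, from compactness of the image curve, for which
   \<open>rho\<close>-balls about the curve stay in the image of \<open>W\<close>;
   \<open>image_ball_lower\<close> requires this.\<close>
 obtain rh0 where rh0: "rh0 > 0" "!!s. 0 <= s ==> s <= s0 ==> {y. rho (F s) y < rh0} \<subseteq> f ` W"
 proof -
  have "compact (F ` {0..s0})" using Fc by (intro compact_continuous_image) auto
  moreover have "open ((%z. gm 0 (snd z) (fst z)) -` (f ` W))"
   using open_image[OF W] by (intro open_vimage) (auto intro!: continuous_intros)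
  moreover have "{0} \<times> F ` {0..s0} \<subseteq> (%z. gm 0 (snd z) (fst z)) -` (f ` W)"
   using phW by (auto simp: F_def)
  ultimately have "\<exists>X. 0 \<in> X & open X & X \<times> F ` {0..s0} \<subseteq> (%z. gm 0 (snd z) (fst z)) -` (f ` W)"
   by (rule Elementary_Topology.tube_lemma)
  then obtain X where X: "0 \<in> X" "open X" "X \<times> F ` {0..s0} \<subseteq> (%z. gm 0 (snd z) (fst z)) -` (f ` W)" by blast
  obtain e where e: "e > 0" "ball 0 e \<subseteq> X" using openE[OF X(2,1)] by blast
  show ?thesis
  proof (rule that[of "min 1 (e / 6)"])
   fix s assume s: "0 <= s" "s <= s0"
   show "{y. rho (F s) y < min 1 (e / 6)} \<subseteq> f ` W"
   proof
    fix y assume "y \<in> {y. rho (F s) y < min 1 (e / 6)}"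
    define h where "h = gm 0 (gi 0 (F s)) y"
    have h: "nrm h < 1" "nrm h < e / 6" using \<open>y \<in> _\<close> by (auto simp: h_def rho_def)
    then have "norm h < e" using norm_le_nrm[of h] e by linarith
    then have "h \<in> X" using e by (auto simp: dist_norm)
    then have "(h, F s) \<in> X \<times> F ` {0..s0}" using s by simp
    then have "(h, F s) \<in> (%z. gm 0 (snd z) (fst z)) -` (f ` W)" by (rule subsetD[OF X(3)])
    then have "gm 0 (F s) h \<in> f ` W" by simp
    then show "y \<in> f ` W" by (simp add: h_def)
   qed
  qed (use e in auto)
 qed
 obtain et where et: "et > 0" "!!s t. 0 <= s ==> s <= s0 ==> 0 <= t ==> t <= s0 ==> abs (s - t) < et ==> rho (F s) (F t) < rh0"
  using uniform_rho_small[OF Fc rh0(1)] by auto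
 define m where "m n i = measure lborel (f ` bl W (ph (real i * r n)) (B * r n))" for n i
 have m_em: "emeasure lborel (f ` bl W q rh) = ennreal (measure lborel (f ` bl W q rh))" for q rh
 proof -
  have "emeasure lborel (f ` bl W q rh) <= emeasure lborel (f ` W)"
   using open_image[OF W] by (intro emeasure_mono) (auto simp: bl_def)
  then show ?thesis using fin by (intro emeasure_eq_ennreal_measure) (auto simp: top_unique)
 qed
 have m0: "0 <= m n i" for n i by (simp add: m_def)
 have local: "(rho (F s) (F t)) ^ 7 <= K ^ 7 * m n i"
  if st: "real i * r n <= s" "s <= real (Suc i) * r n" "real i * r n <= t" "t <= real (Suc i) * r n" "real (Suc i) * r n <= s0"
  and q: "qcat dl (ph s)" "C * r n < dl" and small: "2 * C * r n <= 1" "r n < et" for s t n i dl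
 proof -
  have i0: "0 <= real i * r n" using r0[of n] by simp
  have st0: "0 <= s" "s <= s0" "0 <= t" "t <= s0" using st i0 by linarith+
  have d: "abs (t - s) <= r n" using st by (simp add: abs_le_iff algebra_simps)
  define g where "g = gg j (t - s)"
  have Ft: "f (gm 1 (ph s) g) = F t" "gm 1 (ph s) g = ph t" by (simp_all add: g_def F_def ph_shift[of t s])
  have Cr: "r n <= C * r n" using C r0[of n] by simp
  have "D g <= C * nrm g" using d Cr small by (intro D_le) (simp add: g_def)
  also have "... <= C * r n" using d C by (intro mult_left_mono) (auto simp: g_def)
  finally have Dg: "D g <= C * r n" .
  have K0: "K > 0" using K by simp
  have lt: "rho (F s) (F t) < rh0" using et(2) st0 d small by (simp add: abs_minus_commute)
  have "rho (F s) (F t) * 1 <= rho (F s) (F t) * K" using K by (intro mult_left_mono) auto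
  then have "rho (F s) (F t) / K <= rho (F s) (F t)" using K0 by (simp add: divide_le_eq)
  then have sub: "{y. rho (f (ph s)) y < rho (f (ph s)) (f (gm 1 (ph s) g)) / K} \<subseteq> f ` W"
   using rh0(2)[OF st0(1,2)] lt unfolding Ft by (force simp: F_def)
  have "ennreal (32 * (rho (F s) (F t) / K) ^ 7) <= emeasure lborel (f ` bl W (ph s) (2 * D g))"
   using image_ball_lower[OF q(1) _ _ _ W sub] Dg q small phW[OF st0(3,4)] W(2) r0[of n] C unfolding Ft
   by (auto simp: F_def)
  \<comment> \<open>This is where \<open>B = 2 * (1 + 2 * C)\<close> comes from: a ball of radius
    \<open>2 * C * r n\<close> about a point of the cell, shifted by at most \<open>r n\<close> to
    the grid point, with the factor 2 of \<open>nrm_gm_le\<close>.\<close>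
  also have "... <= emeasure lborel (f ` bl W (ph (real i * r n)) (B * r n))"
  proof (rule emeasure_mono)
   show "f ` bl W (ph (real i * r n)) (B * r n) \<in> sets lborel" using image_bl_sets[OF W] by simp
   show "f ` bl W (ph s) (2 * D g) \<subseteq> f ` bl W (ph (real i * r n)) (B * r n)"
   proof (rule image_mono, rule subsetI)
    fix x assume x: "x \<in> bl W (ph s) (2 * D g)"
    define h where "h = gm 1 (gi 1 (ph s)) x"
    have h: "nrm h < 2 * C * r n" "nrm h <= 1" using x Dg small by (auto simp: bl_def h_def)
    have "gm 1 (gi 1 (ph (real i * r n))) x = gm 1 (gg j (s - real i * r n)) h"
    proof -
     have "x = gm 1 (ph s) h" by (simp add: h_def)
     also have "... = gm 1 (ph (real i * r n)) (gm 1 (gg j (s - real i * r n)) h)"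
      by (simp add: ph_shift[of s "real i * r n"] gm_assoc)
     finally show ?thesis by simp
    qed
    moreover have "nrm (gg j (s - real i * r n)) <= r n" using st by (simp add: abs_le_iff algebra_simps)
    then have "nrm (gm 1 (gg j (s - real i * r n)) h) <= 2 * (r n + nrm h)"
     using h small Cr by (intro nrm_gm_le) auto
    ultimately have "nrm (gm 1 (gi 1 (ph (real i * r n))) x) < B * r n"
     using h unfolding B by (simp add: algebra_simps)
    then show "x \<in> bl W (ph (real i * r n)) (B * r n)" using x by (auto simp: bl_def)
   qed
  qed
  finally have "32 * (rho (F s) (F t) / K) ^ 7 <= m n i"
   unfolding m_em m_def[symmetric] using m0 by (subst (asm) ennreal_le_iff) auto
  moreover have "(rho (F s) (F t) / K) ^ 7 <= 32 * (rho (F s) (F t) / K) ^ 7" using K0 by simp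
  ultimately have "(rho (F s) (F t) / K) ^ 7 <= m n i" by linarith
  then show ?thesis using K0 by (simp add: power_divide divide_le_eq mult.commute)
 qed
 \<comment> \<open>A finite lower limit bounds the sums for infinitely many \<open>n\<close> only.
   This is enough, because the coverings below hold for all large \<open>n\<close>.\<close>
 have "\<exists>M::real. 0 <= M & (\<exists>\<^sub>F n in sequentially. (\<Sum>i<Suc n. m n i) <= M * r n ^ 6)"
 proof -
  have eq: "emeasure lborel (f ` bl W (fl p j (real i * r n)) (B * r n)) = ennreal (m n i)" for n i
   unfolding m_em by (simp add: m_def ph_def)
  have lim': "liminf (%n. (\<Sum>i<Suc n. ennreal (m n i)) * ennreal (1 / r n ^ 6)) < \<infinity>"
   using lim unfolding eq r_def[symmetric] .
  then obtain L where L: "liminf (%n. (\<Sum>i<Suc n. ennreal (m n i)) * ennreal (1 / r n ^ 6)) = ennreal L" "0 <= L"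
   by (cases "liminf (%n. (\<Sum>i<Suc n. ennreal (m n i)) * ennreal (1 / r n ^ 6))" rule: ennreal_cases) auto
  define M where "M = L + 1"
  have M: "liminf (%n. (\<Sum>i<Suc n. ennreal (m n i)) * ennreal (1 / r n ^ 6)) < ennreal M" "0 <= M"
   using L by (simp_all add: M_def ennreal_lessI)
  have "\<exists>\<^sub>F n in sequentially. (\<Sum>i<Suc n. ennreal (m n i)) * ennreal (1 / r n ^ 6) < ennreal M"
  proof (rule ccontr)
   assume "\<not> ?thesis"
   then have "\<forall>\<^sub>F n in sequentially. ennreal M <= (\<Sum>i<Suc n. ennreal (m n i)) * ennreal (1 / r n ^ 6)"
    by (simp add: not_frequently not_less)
   then have "ennreal M <= liminf (%n. (\<Sum>i<Suc n. ennreal (m n i)) * ennreal (1 / r n ^ 6))"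
    by (rule Liminf_bounded)
   then show False using M(1) by simp
  qed
  then have "\<exists>\<^sub>F n in sequentially. (\<Sum>i<Suc n. m n i) <= M * r n ^ 6"
  proof (rule frequently_elim1)
   fix n assume "(\<Sum>i<Suc n. ennreal (m n i)) * ennreal (1 / r n ^ 6) < ennreal M"
   moreover have "(\<Sum>i<Suc n. ennreal (m n i)) * ennreal (1 / r n ^ 6) = ennreal ((\<Sum>i<Suc n. m n i) * (1 / r n ^ 6))"
    using m0 r0[of n] by (subst sum_ennreal, simp, subst ennreal_mult) (auto simp: sum_nonneg)
   ultimately have "ennreal ((\<Sum>i<Suc n. m n i) * (1 / r n ^ 6)) < ennreal M" by metis
   then have "(\<Sum>i<Suc n. m n i) * (1 / r n ^ 6) <= M"
    using M(2) m0 r0[of n] by (simp add: ennreal_less_iff sum_nonneg del: sum.lessThan_Suc)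
   then show "(\<Sum>i<Suc n. m n i) <= M * r n ^ 6" using r0[of n] by (simp add: field_simps del: sum.lessThan_Suc)
  qed
  then show ?thesis using M(2) by blast
 qed
 then obtain M where M: "0 <= M" "\<exists>\<^sub>F n in sequentially. (\<Sum>i<Suc n. m n i) <= M * r n ^ 6" by blast
 define c where "c = 4 ^ 7 * K ^ 7"
 have c: "c > 0" using K by (simp add: c_def)
 have main: "(\<Sum>(x, y)\<in>I. rho (F x) (F y)) <= A * tlen I + c * M / A ^ 6"
  if I: "finite I" "\<forall>(x, y)\<in>I. 0 <= x & x < y & y <= s0"
   "pairwise (%(x, y) (x', y'). disjnt {x<..<y} {x'<..<y'}) I" and A: "A > 0" for I A
 proof -
  \<comment> \<open>Window widths: by \<open>young_seven\<close> with threshold \<open>A\<close>,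
    four times the distance from the selected point of a cell to another good point is at most
    \<open>w n i\<close>. The 4 accounts for \<open>4 ^ 7\<close> in \<open>c\<close>.\<close>
  define w where "w n i = A * r n + c * m n i / (A ^ 6 * r n ^ 6)" for n i
  define J where "J n z = {i :: nat. fst z <= real i * r n & real (Suc i) * r n <= snd z}" for n and z :: "real \<times> real"
  define Q where "Q n i s \<longleftrightarrow> real i * r n <= s & s <= real (Suc i) * r n & qcat (2 * C * r n) (ph s)" for n i s
  \<comment> \<open>One point per cell, chosen before \<open>s\<close> varies, so that the windows
    in \<open>T\<close> do not depend on \<open>s\<close>. It is meaningful only for cells that
    contain a point satisfying \<open>qcat\<close> at the scale of the grid.\<close>
  define sel where "sel n i = (SOME s. Q n i s)" for n i
  have sel: "Q n i (sel n i)" if "Q n i s" for n i s unfolding sel_def using that by (rule someI)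
  define T where "T n z = (\<Union>i\<in>J n z. {rho (F (fst z)) (F (sel n i)) - w n i / 2 .. rho (F (fst z)) (F (sel n i)) + w n i / 2})" for n and z :: "real \<times> real"
  have w0: "0 <= w n i" for n i using A c m0 r0[of n] by (simp add: w_def)
  have Jsub: "J n z \<subseteq> {..<Suc n}" if "snd z <= s0" for n z
  proof
   fix i assume "i \<in> J n z"
   then have "real (Suc i) * r n <= real (Suc n) * r n" using that by (auto simp: J_def r_def)
   then have "real (Suc i) <= real (Suc n)" using r0[of n] by (rule mult_right_le_imp_le)
   then show "i \<in> {..<Suc n}" by simp
  qed
  have Jfin: "finite (J n z)" if "snd z <= s0" for n z using finite_subset[OF Jsub[OF that]] by simp
  have Tm: "T n z \<in> fmeasurable lborel & measure lborel (T n z) <= (\<Sum>i\<in>J n z. w n i)" if z: "snd z <= s0" for n z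
  proof
   show "T n z \<in> fmeasurable lborel" unfolding T_def using Jfin[OF z] by (intro fmeasurable.finite_UN) (auto intro!: fmeasurableI simp: emeasure_lborel_Icc_eq)
   have "measure lborel (T n z) <= (\<Sum>i\<in>J n z. measure lborel {rho (F (fst z)) (F (sel n i)) - w n i / 2 .. rho (F (fst z)) (F (sel n i)) + w n i / 2})"
    unfolding T_def using Jfin[OF z] by (intro measure_UNION_le) auto
   also have "... = (\<Sum>i\<in>J n z. w n i)" using w0 by (intro sum.cong) auto
   finally show "measure lborel (T n z) <= (\<Sum>i\<in>J n z. w n i)" .
  qed
  have ev: "eventually (%n. rho (F (fst z)) (F s) \<in> T n z) sequentially"
   if z: "0 <= fst z" "snd z <= s0" and s: "fst z < s" "s < snd z" for z s
  proof -
   have "ph s \<in> U" using phW[of s] z s W by auto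
   then obtain dl where dl: "dl > 0" "qcat dl (ph s)" using qc unfolding qcat_def by blast
   have lim0: "(%n. 2 * C * r n) \<longlonglongrightarrow> 0" using tendsto_mult_right_zero[OF rlim] by simp
   have "eventually (%n. r n < et & r n < s - fst z & r n < snd z - s & 2 * C * r n < 1 & 2 * C * r n < dl) sequentially"
    using et(1) s dl(1) by (intro eventually_conj order_tendstoD(2)[OF rlim] order_tendstoD(2)[OF lim0]) auto
   then show ?thesis
   proof (rule eventually_mono, elim conjE)
    fix n assume n: "r n < et" "r n < s - fst z" "r n < snd z - s" "2 * C * r n < 1" "2 * C * r n < dl"
    define i where "i = nat \<lfloor>s / r n\<rfloor>"
    have "0 <= s / r n" using s z r0[of n] by simp
    then have "real i <= s / r n" "s / r n < real (Suc i)" unfolding i_def by linarith+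
    then have i: "real i * r n <= s" "s <= real (Suc i) * r n" using r0[of n] by (simp_all add: field_simps)
    have iJ: "i \<in> J n z" using i n unfolding J_def by (simp add: algebra_simps)
    have "Q n i s" using i dl(2) n(5) by (auto simp: Q_def qcat_def)
    then have Q: "Q n i (sel n i)" by (rule sel)
    define l where "l = rho (F (sel n i)) (F s)"
    have "real (Suc i) * r n <= s0" using iJ z by (simp add: J_def)
    moreover have "C * r n < 2 * C * r n" using C r0[of n] by simp
    ultimately have l7: "l ^ 7 <= K ^ 7 * m n i"
     unfolding l_def using Q i n by (intro local[where dl = "2 * C * r n"]) (auto simp: Q_def)
    have l0: "0 <= l" by (simp add: l_def)
    have "4 * l / r n <= A + (4 * l / r n) ^ 7 / A ^ 6" using l0 r0[of n] A by (intro young_seven) auto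
    then have "4 * l / r n * r n <= (A + (4 * l / r n) ^ 7 / A ^ 6) * r n" using r0[of n] by (intro mult_right_mono) auto
    moreover have "(4 * l / r n) ^ 7 / A ^ 6 * r n = 4 ^ 7 * l ^ 7 / (A ^ 6 * r n ^ 6)"
    proof -
     have r7: "r n ^ 7 = r n ^ 6 * r n" by (simp add: eval_nat_numeral)
     show ?thesis unfolding power_divide power_mult_distrib r7 using r0[of n] by simp
    qed
    ultimately have "4 * l <= A * r n + 4 ^ 7 * l ^ 7 / (A ^ 6 * r n ^ 6)"
     using r0[of n] by (simp only: distrib_right) simp
    also have "4 ^ 7 * l ^ 7 / (A ^ 6 * r n ^ 6) <= c * m n i / (A ^ 6 * r n ^ 6)"
     using l7 r0[of n] A unfolding c_def by (intro divide_right_mono) auto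
    finally have "4 * l <= w n i" by (simp add: w_def)
    moreover have "rho (F (fst z)) (F s) <= rho (F (fst z)) (F (sel n i)) + l"
     unfolding l_def by (rule rho_triangle)
    moreover have "rho (F (fst z)) (F (sel n i)) <= rho (F (fst z)) (F s) + 2 * l"
     using rho_triangle[of "F (fst z)" "F (sel n i)" "F s"] rho_commute_le[of "F s" "F (sel n i)"] by (simp add: l_def)
    ultimately show "rho (F (fst z)) (F s) \<in> T n z" unfolding T_def using iJ l0 by (intro UN_I[of i]) auto
   qed
  qed
  have Ib: "0 <= fst z" "fst z < snd z" "snd z <= s0" if "z \<in> I" for z
   using I(2) that by (auto simp: split_def)
  have ev2: "eventually (%n. rho (F (fst z)) (F (snd z)) <= measure lborel (T n z) + e) sequentially" if z: "z \<in> I" and e: "e > 0" for z e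
  proof (rule measure_ge_of_eventually_covered[where h = "%s. rho (F (fst z)) (F s)" and x = "fst z"])
   show "continuous_on {fst z..snd z} (%s. rho (F (fst z)) (F s))"
    using Ib[OF z] by (intro continuous_intros continuous_on_subset[OF Fc]) auto
   show "rho (F (fst z)) (F (fst z)) = 0" by (simp add: rho_eq_0_iff)
   show "T n z \<in> fmeasurable lborel" for n using Tm[OF Ib(3)[OF z]] by blast
  qed (use Ib[OF z] ev[of z] e in auto)
  show ?thesis
  proof (rule field_le_epsilon)
   fix e :: real assume e: "0 < e"
   define e' where "e' = e / (real (card I) + 1)"
   have e': "e' > 0" using e by (simp add: e'_def)
   have evI: "eventually (%n. \<forall>z\<in>I. rho (F (fst z)) (F (snd z)) <= measure lborel (T n z) + e') sequentially"
    using I(1) ev2 e' by (intro eventually_ball_finite) auto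
   obtain n where n: "(\<Sum>i<Suc n. m n i) <= M * r n ^ 6" "\<forall>z\<in>I. rho (F (fst z)) (F (snd z)) <= measure lborel (T n z) + e'"
   proof -
    have "\<exists>\<^sub>F n in sequentially. (\<Sum>i<Suc n. m n i) <= M * r n ^ 6 & (\<forall>z\<in>I. rho (F (fst z)) (F (snd z)) <= measure lborel (T n z) + e')"
     by (rule frequently_rev_mp[OF M(2)], rule eventually_mono[OF evI]) auto
    then show thesis using that frequently_ex by blast
   qed
   have "(\<Sum>(x, y)\<in>I. rho (F x) (F y)) = (\<Sum>z\<in>I. rho (F (fst z)) (F (snd z)))" by (simp add: split_def)
   also have "... <= (\<Sum>z\<in>I. (\<Sum>i\<in>J n z. w n i) + e')"
    using n(2) Tm Ib(3) by (intro sum_mono) (meson add_right_mono order_trans)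
   also have "... = (\<Sum>z\<in>I. \<Sum>i\<in>J n z. A * r n) + (\<Sum>z\<in>I. \<Sum>i\<in>J n z. c * m n i / (A ^ 6 * r n ^ 6)) + real (card I) * e'"
    by (simp add: w_def sum.distrib)
   also have "(\<Sum>z\<in>I. \<Sum>i\<in>J n z. A * r n) <= (\<Sum>z\<in>I. A * (snd z - fst z))"
   proof (rule sum_mono)
    fix z assume z: "z \<in> I"
    have "real (card (J n z)) * r n <= snd z - fst z"
     using Ib[OF z] Jfin r0 by (intro card_pieces_le) (auto simp: J_def)
    then have "A * (real (card (J n z)) * r n) <= A * (snd z - fst z)" using A by (intro mult_left_mono) auto
    then show "(\<Sum>i\<in>J n z. A * r n) <= A * (snd z - fst z)" by (simp add: algebra_simps)
   qed
   also have "... = A * (tlen I)" by (simp add: sum_distrib_left split_def)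
   also have "(\<Sum>z\<in>I. \<Sum>i\<in>J n z. c * m n i / (A ^ 6 * r n ^ 6)) = (\<Sum>i\<in>(\<Union>z\<in>I. J n z). c * m n i / (A ^ 6 * r n ^ 6))"
   proof (rule sum.UNION_disjoint[symmetric])
    show "\<forall>z\<in>I. \<forall>z'\<in>I. z ~= z' --> J n z \<inter> J n z' = {}"
    proof (intro ballI impI)
     fix z z' assume z: "z \<in> I" "z' \<in> I" "z ~= z'"
     have d: "disjnt {fst z<..<snd z} {fst z'<..<snd z'}" using pairwiseD[OF I(3) z] by (simp add: split_def)
     show "J n z \<inter> J n z' = {}"
     proof (rule ccontr)
      assume "J n z \<inter> J n z' ~= {}"
      then obtain i where i: "i \<in> J n z" "i \<in> J n z'" by blast
      let ?t = "real i * r n + r n / 2"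
      have "?t \<in> {fst z<..<snd z}" "?t \<in> {fst z'<..<snd z'}"
       using i r0[of n] by (auto simp: J_def algebra_simps)
      then show False using d by (auto simp: disjnt_def)
     qed
    qed
   qed (use I Jfin Ib in auto)
   also have "... <= (\<Sum>i<Suc n. c * m n i / (A ^ 6 * r n ^ 6))"
   proof (rule sum_mono2)
    show "(\<Union>z\<in>I. J n z) \<subseteq> {..<Suc n}" using Jsub[OF Ib(3)] by (rule UN_least)
    show "0 <= c * m n i / (A ^ 6 * r n ^ 6)" for i using A c m0 r0[of n] by simp
   qed simp
   also have "... = c / (A ^ 6 * r n ^ 6) * (\<Sum>i<Suc n. m n i)" by (simp only: sum_distrib_left times_divide_eq_left)
   also have "... <= c / (A ^ 6 * r n ^ 6) * (M * r n ^ 6)"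
    using n(1) A c r0[of n] by (intro mult_left_mono) auto
   also have "... = c * M / A ^ 6" using r0[of n] by simp
   also have "real (card I) * e' <= e" using e by (simp add: e'_def field_simps)
   finally show "(\<Sum>(x, y)\<in>I. rho (F x) (F y)) <= A * tlen I + c * M / A ^ 6 + e" by simp
  qed
 qed
 show ?thesis unfolding pair_ac_def F_def[symmetric] ph_def[symmetric]
 proof (intro allI impI)
  fix e :: real assume e: "0 < e"
  \<comment> \<open>With \<open>A >= 1\<close> this gives
    \<open>c * M / A ^ 6 <= c * M / A <= e / 2\<close>; the length bound then makes the linear term
    less than \<open>e / 2\<close>.\<close>
  define A where "A = 1 + 2 * c * M / e"
  have A: "A \<ge> 1" using c M e by (simp add: A_def)
  show "\<exists>dl>0. \<forall>I. ac_family 0 s0 I & tlen I < dl -->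
    (\<Sum>(x, y)\<in>I. rho (F x) (F y)) < e"
  proof (intro exI[of _ "e / (2 * A)"] conjI allI impI; (elim conjE)?)
   show "0 < e / (2 * A)" using e A by simp
   fix I assume I: "finite I" "\<forall>(x, y)\<in>I. 0 <= x & x < y & y <= s0"
    "pairwise (%(x, y) (x', y'). disjnt {x<..<y} {x'<..<y'}) I" and s: "tlen I < e / (2 * A)"
   have "A * tlen I < e / 2" using s A by (simp add: field_simps)
   moreover have "c * M / A ^ 6 <= e / 2"
   proof -
    have "A ^ 1 <= A ^ 6" using A by (intro power_increasing) auto
    then have "c * M / A ^ 6 <= c * M / A" using A c M by (intro divide_left_mono) auto
    also have "... <= e / 2"
    proof -
     have "2 * (c * M) <= e * A" using e by (simp add: A_def distrib_left)
     then show ?thesis using A by (simp add: field_simps)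
    qed
    finally show ?thesis .
   qed
   ultimately show "(\<Sum>(x, y)\<in>I. rho (F x) (F y)) < e" using main[OF I, of A] A by linarith
  qed
 qed
qed

end

section \<open>Contact forms along curves in the cone\<close>

lemma sum_by_parts: "(\<Sum>i<n. real i * (u (Suc i) - u i)) = real n * u n - (\<Sum>i<n. u (Suc i))"
 by (induction n) (simp_all add: algebra_simps)

abbreviation ct4 :: "r5 => r5 => real" where "ct4 p q \<equiv> x4 q - x4 p - x1 p * (x3 q - x3 p)"
abbreviation ct5 :: "r5 => r5 => real" where "ct5 p q \<equiv> x5 q - x5 p - x2 p * (x3 q - x3 p)"

text \<open>\<open>z\<close> changes like the integral of \<open>v\<close> with respect to
  \<open>u\<close> along a curve of bounded variation. Over a fine partition the sum splits into the
  quadratic defects \<open>T1\<close>, at most the mesh times \<open>V\<close>; the deviation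
  \<open>T2\<close> of \<open>v\<close> from linear, at most \<open>e * V\<close>; and
  \<open>a * T3\<close>, where summation by parts needs only that \<open>u\<close> is uniformly
  close to linear and gives \<open>T3\<close> close to \<open>c / 2\<close>.\<close>

lemma contact_increment:
 fixes u v z :: "real => real" and R :: "real => real => real"
 assumes R: "!!s t. 0 <= R s t" "!!s t. abs (u t - u s) <= R s t" "!!s t. abs (z t - z s - v s * (u t - u s)) <= (R s t)\<^sup>2"
  and V: "!!n. (\<Sum>i<n. R (real i / real n) (real (Suc i) / real n)) <= V"
  and small: "!!m. 0 < m ==> \<exists>N. \<forall>n\<ge>N. \<forall>i<n. R (real i / real n) (real (Suc i) / real n) <= m"
  and u: "!!t. 0 <= t ==> t <= 1 ==> abs (u t - u 0 - c * t) <= e"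
  and v: "!!t. 0 <= t ==> t <= 1 ==> abs (v t - v 0 - a * t) <= e"
 shows "abs (z 1 - z 0 - v 0 * (u 1 - u 0) - a * c / 2) <= e * V + 2 * abs a * e"
proof (rule field_le_epsilon)
 fix d :: real assume d: "0 < d"
 have V0: "0 <= V" using V[of 0] by simp
 have e0: "0 <= e" using u[of 0] by simp
 define m where "m = d / (2 * (V + 1))"
 have m: "m > 0" "m * V <= d / 2" using d V0 by (simp_all add: m_def field_simps)
 obtain N where N: "!!n i. n \<ge> N ==> i < n ==> R (real i / real n) (real (Suc i) / real n) <= m"
  using small[OF m(1)] by blast
 \<comment> \<open>Makes the discretisation error \<open>abs (a * c) / (2 * n)\<close> of the linear
   part at most \<open>d / 2\<close>.\<close>
 obtain N' :: nat where N': "abs (a * c) / d < real N'" using reals_Archimedean2 by blast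
 define n where "n = Suc (N + N')"
 have n: "n \<ge> N" "real n > 0" "abs (a * c) / d < real n" using N' by (auto simp: n_def)
 define U where "U i = u (real i / real n)" for i
 define Vv where "Vv i = v (real i / real n)" for i
 define Z where "Z i = z (real i / real n)" for i
 define r where "r i = R (real i / real n) (real (Suc i) / real n)" for i
 have ends: "U 0 = u 0" "U n = u 1" "Vv 0 = v 0" "Z 0 = z 0" "Z n = z 1" using n by (simp_all add: U_def Vv_def Z_def)
 have r: "0 <= r i" "abs (U (Suc i) - U i) <= r i" "abs (Z (Suc i) - Z i - Vv i * (U (Suc i) - U i)) <= (r i)\<^sup>2" for i
  unfolding r_def U_def Z_def Vv_def using R by blast+
 have rm: "r i <= m" if "i < n" for i using N[OF n(1) that] by (simp add: r_def)
 have rV: "(\<Sum>i<n. r i) <= V" using V[of n] by (simp add: r_def)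
 have frac: "0 <= real i / real n" "real i / real n <= 1" if "i <= n" for i using that n by simp_all
 have tel: "(\<Sum>i<n. g (Suc i) - g i) = g n - g 0" for g :: "nat => real" by (rule sum_lessThan_telescope)
 define T1 where "T1 = (\<Sum>i<n. Z (Suc i) - Z i - Vv i * (U (Suc i) - U i))"
 define T2 where "T2 = (\<Sum>i<n. (Vv i - Vv 0 - a * (real i / real n)) * (U (Suc i) - U i))"
 define T3 where "T3 = (\<Sum>i<n. real i * (U (Suc i) - U i)) / real n"
 have "abs T1 <= (\<Sum>i<n. (r i)\<^sup>2)" unfolding T1_def by (rule order_trans[OF sum_abs sum_mono]) (rule r(3))
 also have "... <= (\<Sum>i<n. m * r i)"
  using r(1) rm by (intro sum_mono) (simp add: power2_eq_square mult_right_mono)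
 also have "... <= m * V" using rV m(1) by (simp add: sum_distrib_left[symmetric] mult_left_mono)
 finally have T1: "abs T1 <= d / 2" using m(2) by simp
 have "abs T2 <= (\<Sum>i<n. e * r i)" unfolding T2_def
 proof (rule order_trans[OF sum_abs sum_mono])
  fix i assume "i \<in> {..<n}"
  then have "abs (Vv i - Vv 0 - a * (real i / real n)) <= e" using v[OF frac, of i] ends by (simp add: Vv_def)
  then show "abs ((Vv i - Vv 0 - a * (real i / real n)) * (U (Suc i) - U i)) <= e * r i"
   using r(2) by (rule abs_mult_le)
 qed
 also have "... <= e * V" using rV e0 by (simp add: sum_distrib_left[symmetric] mult_left_mono)
 finally have T2: "abs T2 <= e * V" .
 define ze where "ze i = U i - U 0 - c * (real i / real n)" for i
 have ze: "abs (ze i) <= e" if "i <= n" for i using u[OF frac[OF that]] ends by (simp add: ze_def U_def)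
 have "U (Suc i) = U 0 + c / real n * real (Suc i) + ze (Suc i)" for i by (simp add: ze_def)
 then have "(\<Sum>i<n. U (Suc i)) = (\<Sum>i<n. U 0 + c / real n * real (Suc i) + ze (Suc i))" by metis
 also have "... = real n * U 0 + c / real n * (\<Sum>i<n. real (Suc i)) + (\<Sum>i<n. ze (Suc i))"
  by (simp only: sum.distrib sum_distrib_left sum_constant card_lessThan)
 also have "(\<Sum>i<n. real (Suc i)) = real n * (real n + 1) / 2"
  by (induction n) (simp_all add: field_simps)
 also have "c / real n * (real n * (real n + 1) / 2) = c * (real n + 1) / 2" using n(2) by simp
 finally have S: "(\<Sum>i<n. U (Suc i)) = real n * U 0 + c * (real n + 1) / 2 + (\<Sum>i<n. ze (Suc i))" .
 have "real n * T3 = real n * U n - (\<Sum>i<n. U (Suc i))" using n(2) unfolding T3_def sum_by_parts by simp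
 moreover have "U n = U 0 + c + ze n" using n by (simp add: ze_def)
 ultimately have "real n * T3 = c * (real n - (real n + 1) / 2) + real n * ze n - (\<Sum>i<n. ze (Suc i))"
  unfolding S by (simp add: algebra_simps add_divide_distrib)
 then have "real n * (T3 - c / 2) = - (c / 2) + real n * ze n - (\<Sum>i<n. ze (Suc i))"
  by (simp add: field_simps)
 moreover have "abs (\<Sum>i<n. ze (Suc i)) <= real n * e"
 proof -
  have "abs (\<Sum>i<n. ze (Suc i)) <= (\<Sum>i<n. e)" using ze by (intro order_trans[OF sum_abs sum_mono]) auto
  then show ?thesis by simp
 qed
 moreover have "abs (real n * ze n) <= real n * e" using ze[of n] by (intro abs_mult_le) auto
 moreover have "abs (- (c / 2) + x - y) <= abs c / 2 + 2 * w" if "abs x <= w" "abs y <= w" for x y w :: real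
  using that by linarith
 ultimately have "abs (real n * (T3 - c / 2)) <= abs c / 2 + 2 * (real n * e)" by presburger
 moreover have "abs (real n * (T3 - c / 2)) = abs (T3 - c / 2) * real n" by (simp only: abs_mult abs_of_nat mult.commute)
 moreover have "abs c / 2 + 2 * (real n * e) = (abs c / (2 * real n) + 2 * e) * real n" using n(2) by (simp add: distrib_right)
 ultimately have "abs (T3 - c / 2) * real n <= (abs c / (2 * real n) + 2 * e) * real n" by metis
 then have "abs (T3 - c / 2) <= abs c / (2 * real n) + 2 * e" using n(2) by (rule mult_right_le_imp_le)
 then have "abs (a * (T3 - c / 2)) <= abs a * (abs c / (2 * real n) + 2 * e)" by (intro abs_mult_le) auto
 moreover have "abs a * (abs c / (2 * real n)) <= d / 2" using n(2,3) d by (simp add: abs_mult field_simps)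
 ultimately have T3: "abs (a * (T3 - c / 2)) <= d / 2 + 2 * abs a * e" by (simp add: algebra_simps)
 have "T1 + T2 + a * T3 = (\<Sum>i<n. Z (Suc i) - Z i) - Vv 0 * (\<Sum>i<n. U (Suc i) - U i)"
  unfolding T1_def T2_def T3_def
  by (simp add: sum_distrib_left sum_divide_distrib sum.distrib[symmetric] sum_subtractf[symmetric] algebra_simps)
 then have "z 1 - z 0 - v 0 * (u 1 - u 0) = T1 + T2 + a * T3" using ends by (simp only: tel)
 then have "z 1 - z 0 - v 0 * (u 1 - u 0) - a * c / 2 = T1 + T2 + a * (T3 - c / 2)" by (simp add: algebra_simps)
 then show "abs (z 1 - z 0 - v 0 * (u 1 - u 0) - a * c / 2) <= e * V + 2 * abs a * e + d"
  using T1 T2 T3 by linarith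
qed

lemma uniform_partition_small:
 assumes "continuous_on {0..1} H" "0 < e"
 shows "\<exists>N. \<forall>n\<ge>N. \<forall>i<n. rho (H (real i / real n)) (H (real (Suc i) / real n)) <= e"
proof -
 obtain d where d: "d > 0" "!!s t. s \<in> {0..1} ==> t \<in> {0..1} ==> abs (s - t) < d ==> rho (H s) (H t) < e"
  using uniform_rho_small[OF assms] by blast
 obtain N :: nat where N: "1 / d < real N" using reals_Archimedean2 by blast
 have "rho (H (real i / real n)) (H (real (Suc i) / real n)) <= e" if n: "n \<ge> N" "i < n" for n i
 proof -
  have "1 / d < real n" using N n by (meson less_le_trans of_nat_mono)
  then have "1 / real n < d" using d(1) n by (simp add: field_simps)
  moreover have "abs (real i / real n - real (Suc i) / real n) = 1 / real n" by (simp add: diff_divide_distrib[symmetric])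
  ultimately show ?thesis using n by (intro less_imp_le d(2)) auto
 qed
 then show ?thesis by blast
qed

lemma curve_contact_increment:
 assumes H: "continuous_on {0..1} H"
  and V: "!!n. (\<Sum>i<n. rho (H (real i / real n)) (H (real (Suc i) / real n))) <= V"
  and u: "!!t. 0 <= t ==> t <= 1 ==> abs (x3 (H t) - x3 (H 0) - c * t) <= e"
 shows "(!!t. 0 <= t ==> t <= 1 ==> abs (x1 (H t) - x1 (H 0) - a * t) <= e) ==>
   abs (ct4 (H 0) (H 1) - a * c / 2) <= e * V + 2 * abs a * e"
  "(!!t. 0 <= t ==> t <= 1 ==> abs (x2 (H t) - x2 (H 0) - a * t) <= e) ==>
   abs (ct5 (H 0) (H 1) - a * c / 2) <= e * V + 2 * abs a * e"
proof -
 note small = uniform_partition_small[OF H]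
 show "abs (ct4 (H 0) (H 1) - a * c / 2) <= e * V + 2 * abs a * e"
  if "!!t. 0 <= t ==> t <= 1 ==> abs (x1 (H t) - x1 (H 0) - a * t) <= e"
  by (rule contact_increment[where R = "%s t. rho (H s) (H t)" and u = "%t. x3 (H t)" and v = "%t. x1 (H t)" and z = "%t. x4 (H t)"])
   (rule rho_nonneg rho_comp_le V u that | erule small | assumption)+
 show "abs (ct5 (H 0) (H 1) - a * c / 2) <= e * V + 2 * abs a * e"
  if "!!t. 0 <= t ==> t <= 1 ==> abs (x2 (H t) - x2 (H 0) - a * t) <= e"
  by (rule contact_increment[where R = "%s t. rho (H s) (H t)" and u = "%t. x3 (H t)" and v = "%t. x2 (H t)" and z = "%t. x5 (H t)"])
   (rule rho_nonneg rho_comp_le V u that | erule small | assumption)+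
qed

text \<open>The change of \<open>v\<close> along the first segment multiplies the change of
  \<open>u\<close> along the second. This gives the term \<open>a * c' * s * t\<close>, the only
  quadratic term that depends on the order of the segments.\<close>

lemma two_step_increment:
 fixes M e :: real
 assumes M: "1 <= M" and e: "0 <= e" "e <= 1" and st: "abs s <= r" "abs t <= r"
  and ac: "abs a <= M + 1" "abs a' <= M + 1" "abs c' <= M + 1"
  and u: "abs (u1 - u0 - c * s) <= e * abs s" "abs (u2 - u1 - c' * t) <= e * abs t"
  and v: "abs (v1 - v0 - a * s) <= e * abs s"
  and z: "abs (z1 - z0 - v0 * (u1 - u0) - a * c * s\<^sup>2 / 2) <= (M + 2 * abs a) * e * s\<^sup>2"
   "abs (z2 - z1 - v1 * (u2 - u1) - a' * c' * t\<^sup>2 / 2) <= (M + 2 * abs a') * e * t\<^sup>2"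
 shows "abs (z2 - z0 - v0 * (u2 - u0) - (a * c * s\<^sup>2 / 2 + a' * c' * t\<^sup>2 / 2 + a * c' * s * t)) <= 15 * M * e * r\<^sup>2"
proof -
 have r0: "0 <= r" using st by linarith
 have sq: "s\<^sup>2 <= r\<^sup>2" "t\<^sup>2 <= r\<^sup>2" using st by (simp_all add: abs_le_square_iff[symmetric])
 have es: "e * abs s <= e * r" "e * abs t <= e * r" using st e by (simp_all add: mult_left_mono)
 have b: "(M + 2 * abs x) * e * y\<^sup>2 <= (3 * M + 2) * e * r\<^sup>2" if "abs x <= M + 1" "y\<^sup>2 <= r\<^sup>2" for x y
  using that M e by (intro mult_mono) auto
 have "abs (c' * t) <= (M + 1) * r" using ac(3) st(2) by (rule abs_mult_le)
 moreover have "e * r <= 1 * r" using e r0 by (intro mult_right_mono) auto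
 ultimately have u21: "abs (u2 - u1) <= (M + 2) * r" using u(2) es(2) by (simp add: abs_le_iff algebra_simps)
 have as: "abs (a * s) <= (M + 1) * r" using ac(1) st(1) by (rule abs_mult_le)
 have p1: "abs ((v1 - v0 - a * s) * (u2 - u1)) <= (e * r) * ((M + 2) * r)"
  using order_trans[OF v es(1)] u21 by (rule abs_mult_le)
 have p2: "abs ((a * s) * (u2 - u1 - c' * t)) <= ((M + 1) * r) * (e * r)"
  using as order_trans[OF u(2) es(2)] by (rule abs_mult_le)
 have eq: "z2 - z0 - v0 * (u2 - u0) - (a * c * s\<^sup>2 / 2 + a' * c' * t\<^sup>2 / 2 + a * c' * s * t)
   = (z1 - z0 - v0 * (u1 - u0) - a * c * s\<^sup>2 / 2) + (z2 - z1 - v1 * (u2 - u1) - a' * c' * t\<^sup>2 / 2)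
   + (v1 - v0 - a * s) * (u2 - u1) + (a * s) * (u2 - u1 - c' * t)"
  by (simp add: algebra_simps)
 have "abs (z2 - z0 - v0 * (u2 - u0) - (a * c * s\<^sup>2 / 2 + a' * c' * t\<^sup>2 / 2 + a * c' * s * t))
   <= (3 * M + 2) * e * r\<^sup>2 + (3 * M + 2) * e * r\<^sup>2 + (e * r) * ((M + 2) * r) + ((M + 1) * r) * (e * r)"
 proof -
  have 4: "abs (x + y + z + w) <= abs x + abs y + abs z + abs w" for x y z w :: real by linarith
  show ?thesis unfolding eq
   by (rule order_trans[OF 4 add_mono[OF add_mono[OF add_mono[OF order_trans[OF z(1) b[OF ac(1) sq(1)]] order_trans[OF z(2) b[OF ac(2) sq(2)]]] p1] p2]])
 qed
 also have "... = (8 * M + 7) * (e * r\<^sup>2)" by (simp add: algebra_simps power2_eq_square)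
 also have "... <= (15 * M) * (e * r\<^sup>2)" using M e by (intro mult_right_mono) auto
 finally show ?thesis by (simp add: mult.assoc)
qed

text \<open>Both orders of the two steps have the same square terms, so their difference isolates
  \<open>aF * cT - aT * cF\<close>. The endpoints are close: the contact form between them is of
  order \<open>e\<^sup>2\<close>, and moving its base point from \<open>v0\<close> to
  \<open>vA\<close> costs order \<open>e\<close>.\<close>

lemma commutator_bound:
 fixes M e r K :: real
 assumes M: "1 <= M" and e: "0 < e" "e <= 1" and r: "0 < r"
  and ac: "abs aT <= M + 1" "abs aF <= M + 1"
  and uA: "abs (uA - u0 - (cT * r + cF * r)) <= 2 * e * r" and uB: "abs (uB - u0 - (cF * r + cT * r)) <= 2 * e * r"
  and vA: "abs (vA - v0 - (aT * r + aF * r)) <= 2 * e * r"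
  and zA: "abs (zA - z0 - v0 * (uA - u0) - (aT * cT * r\<^sup>2 / 2 + aF * cF * r\<^sup>2 / 2 + aT * cF * r * r)) <= 15 * M * e * r\<^sup>2"
  and zB: "abs (zB - z0 - v0 * (uB - u0) - (aF * cF * r\<^sup>2 / 2 + aT * cT * r\<^sup>2 / 2 + aF * cT * r * r)) <= 15 * M * e * r\<^sup>2"
  and zAB: "abs (zB - zA - vA * (uB - uA)) <= (K * (M * (e * r)))\<^sup>2"
 shows "abs (aF * cT - aT * cF) <= (54 * M + K\<^sup>2 * M\<^sup>2) * e"
proof -
 have "abs (aT * r) <= (M + 1) * r" "abs (aF * r) <= (M + 1) * r" using abs_mult_le[OF ac(1), of r r] abs_mult_le[OF ac(2), of r r] r by auto
 moreover have "e * r <= M * r" "1 * r <= M * r" using e M r by (intro mult_right_mono; linarith)+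
 ultimately have "abs (vA - v0) <= 6 * M * r" using vA by (simp add: abs_le_iff algebra_simps)
 moreover have "abs (uB - uA) <= 4 * e * r" using uA uB by (simp add: abs_le_iff)
 ultimately have vu: "abs ((vA - v0) * (uB - uA)) <= (6 * M * r) * (4 * e * r)" by (rule abs_mult_le)
 have eq: "(aF * cT - aT * cF) * r\<^sup>2 = (zB - zA - vA * (uB - uA)) + (vA - v0) * (uB - uA)
   + (zA - z0 - v0 * (uA - u0) - (aT * cT * r\<^sup>2 / 2 + aF * cF * r\<^sup>2 / 2 + aT * cF * r * r))
   - (zB - z0 - v0 * (uB - u0) - (aF * cF * r\<^sup>2 / 2 + aT * cT * r\<^sup>2 / 2 + aF * cT * r * r))"
  by (simp add: algebra_simps power2_eq_square)
 have 4: "abs (x + y + z - w) <= abs x + abs y + abs z + abs w" for x y z w :: real by linarith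
 have "abs ((aF * cT - aT * cF) * r\<^sup>2) <= (K * (M * (e * r)))\<^sup>2 + (6 * M * r) * (4 * e * r) + 15 * M * e * r\<^sup>2 + 15 * M * e * r\<^sup>2"
  unfolding eq by (rule order_trans[OF 4 add_mono[OF add_mono[OF add_mono[OF zAB vu] zA] zB]])
 also have "... = (54 * M * e + K\<^sup>2 * M\<^sup>2 * (e * e)) * r\<^sup>2" by (simp add: algebra_simps power2_eq_square)
 finally have "abs (aF * cT - aT * cF) * r\<^sup>2 <= (54 * M * e + K\<^sup>2 * M\<^sup>2 * (e * e)) * r\<^sup>2" by (simp add: abs_mult)
 then have "abs (aF * cT - aT * cF) <= 54 * M * e + K\<^sup>2 * M\<^sup>2 * (e * e)" by (rule mult_right_le_imp_le) (use r in simp)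
 also have "K\<^sup>2 * M\<^sup>2 * (e * e) <= K\<^sup>2 * M\<^sup>2 * (e * 1)" using e by (intro mult_left_mono) auto
 finally show ?thesis by (simp add: algebra_simps)
qed

text \<open>Steps proportional to \<open>cF\<close> and \<open>- cT\<close> annihilate the
  first-order change of \<open>u\<close>. The first-order change of \<open>v\<close> and the
  quadratic term are then multiples of \<open>aF * cT - aT * cF\<close>, which is small by
  assumption. The divisor \<open>2 * M\<close> keeps the steps at most \<open>r\<close>.\<close>

lemma endpoint_bound:
 fixes M e r :: real
 assumes M: "1 <= M" and e: "0 < e" "e <= 1" and r: "0 < r" and C2: "0 <= C2"
  and comm: "abs (aF * cT - aT * cF) <= C2 * e" and c: "abs cT <= 2 * M" "abs cF <= 2 * M"
  and s: "s = r * (cF / (2 * M))" and t: "t = - (r * (cT / (2 * M)))"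
  and v: "abs (v2 - v0 - (aT * s + aF * t)) <= 2 * e * r"
  and z: "abs (z2 - z0 - v0 * (u2 - u0) - (aT * cT * s\<^sup>2 / 2 + aF * cF * t\<^sup>2 / 2 + aT * cF * s * t)) <= 15 * M * e * r\<^sup>2"
 shows "abs (v2 - v0) <= (C2 + 2) * e * r" (is ?P1) "abs (z2 - z0 - v0 * (u2 - u0)) <= (C2 + 15 * M) * e * r\<^sup>2" (is ?P2)
proof -
 have 1: "aT * s + aF * t = - (r / (2 * M)) * (aF * cT - aT * cF)" using M by (simp add: s t field_simps)
 have "r / (2 * M) <= r / 1" using M r by (intro divide_left_mono) auto
 then have "abs (- (r / (2 * M))) <= r" using r M by simp
 then have "abs (aT * s + aF * t) <= r * (C2 * e)" unfolding 1 using comm by (rule abs_mult_le)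
 then show ?P1 using v by (simp add: abs_le_iff algebra_simps)
 have 2: "aT * cT * s\<^sup>2 / 2 + aF * cF * t\<^sup>2 / 2 + aT * cF * s * t = ((cT / (2 * M)) * (cF / (2 * M)) * r\<^sup>2 / 2) * (aF * cT - aT * cF)"
  using M by (simp add: s t field_simps power2_eq_square)
 have "abs (cT / (2 * M)) <= 1" "abs (cF / (2 * M)) <= 1" using c M by (simp_all add: abs_divide)
 then have "abs ((cT / (2 * M)) * (cF / (2 * M))) <= 1 * 1" by (rule abs_mult_le)
 then have "abs ((cT / (2 * M)) * (cF / (2 * M)) * (r\<^sup>2 / 2)) <= 1 * 1 * r\<^sup>2" by (rule abs_mult_le) simp
 then have "abs ((cT / (2 * M)) * (cF / (2 * M)) * r\<^sup>2 / 2) <= r\<^sup>2" by simp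
 then have "abs (aT * cT * s\<^sup>2 / 2 + aF * cF * t\<^sup>2 / 2 + aT * cF * s * t) <= r\<^sup>2 * (C2 * e)"
  unfolding 2 using comm by (rule abs_mult_le)
 then show ?P2 using z by (simp add: abs_le_iff algebra_simps)
qed

section \<open>Slopes at a fixed scale and the tame sets\<close>

context qc_setup
begin

text \<open>The bound \<open>V\<close> that \<open>contact_increment\<close> asks for, over uniform
  partitions of short segments from \<open>q\<close> in both directions.\<close>

definition varc :: "bool => real => real => r5 => bool" where
 "varc j M d q \<longleftrightarrow> (\<forall>n s. abs s <= d -->
   (\<Sum>i<n. rho (f (fl q j (real i / real n * s))) (f (fl q j (real (Suc i) / real n * s)))) <= M * abs s)"

text \<open>Differentiability with slope, error and scale fixed. Unlike a derivative, such data can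
  be shared by many points, and for fixed data the condition is relatively closed.\<close>

definition derc :: "(r5 => real) => bool => real => real => real => r5 => bool" where
 "derc g j e d c q \<longleftrightarrow> (\<forall>s. abs s <= d --> abs (g (f (fl q j s)) - g (f q) - c * s) <= e * abs s)"

lemma qcatD: "qcat d q ==> gm 1 q g \<in> U ==> gm 1 q h \<in> U ==> D g < d ==> D g <= D h ==>
  rho (f q) (f (gm 1 q g)) <= K * rho (f q) (f (gm 1 q h))"
 unfolding qcat_def by blast

lemma varc_1: "varc j M d q ==> abs s <= d ==> rho (f q) (f (fl q j s)) <= M * abs s"
 unfolding varc_def by (drule spec[of _ 1]) auto

lemma derc_bound:
 assumes "varc j M d q" "derc g j e d c q" "0 < d" and g: "!!p q. abs (g q - g p) <= rho p q"
 shows "abs c <= M + e"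
proof -
 have "abs (g (f (fl q j d)) - g (f q)) <= M * d"
  using order_trans[OF g varc_1[OF assms(1), of d]] assms(3) by simp
 moreover have "abs (g (f (fl q j d)) - g (f q) - c * d) <= e * d"
  using assms(2,3) unfolding derc_def by (metis abs_of_pos order_refl)
 ultimately have "abs (c * d) <= (M + e) * d" by (simp add: abs_le_iff algebra_simps)
 then show ?thesis using assms(3) by (simp add: abs_mult)
qed

text \<open>The segment is rescaled to unit time, which treats both signs of \<open>s\<close> at
  once.\<close>

lemma one_step:
 assumes vc: "varc j M d q" and u: "derc x3 j e d c q" and s: "abs s <= d" and e: "0 <= e"
  and W: "W \<subseteq> U" "!!s. abs s <= d ==> fl q j s \<in> W"
 shows "derc x1 j e d a q ==> abs (ct4 (f q) (f (fl q j s)) - a * c * s\<^sup>2 / 2)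
   <= (M + 2 * abs a) * e * s\<^sup>2"
  and "derc x2 j e d a q ==> abs (ct5 (f q) (f (fl q j s)) - a * c * s\<^sup>2 / 2)
   <= (M + 2 * abs a) * e * s\<^sup>2"
proof -
 define H where "H t = f (fl q j (t * s))" for t
 have ts: "abs (t * s) <= d" "abs (t * s) <= abs s" (is ?P1) if "0 <= t" "t <= 1" for t
 proof -
  show ?P1 using that by (simp add: abs_mult mult_left_le_one_le)
  then show "abs (t * s) <= d" using s by simp
 qed
 have H: "continuous_on {0..1} H" unfolding H_def
  by (rule continuous_on_compose2[OF cont]) (use W ts in \<open>auto intro!: continuous_intros\<close>)
 have V: "(\<Sum>i<n. rho (H (real i / real n)) (H (real (Suc i) / real n))) <= M * abs s" for n
  using vc s unfolding varc_def H_def by blast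
 have der: "abs (g (H t) - g (H 0) - (k * s) * t) <= e * abs s" if "derc g j e d k q" "0 <= t" "t <= 1" for g k t
 proof -
  have "abs (g (H t) - g (H 0) - k * (t * s)) <= e * abs (t * s)"
   using that(1) ts[OF that(2,3)] unfolding derc_def H_def by simp
  also have "... <= e * abs s" using ts[OF that(2,3)] e by (intro mult_left_mono) auto
  finally show ?thesis by (simp add: ac_simps)
 qed
 have eq: "H 1 = f (fl q j s)" "H 0 = f q" "(a * s) * (c * s) / 2 = a * c * s\<^sup>2 / 2"
   "(e * abs s) * (M * abs s) + 2 * abs (a * s) * (e * abs s) = (M + 2 * abs a) * e * s\<^sup>2"
  by (simp_all add: H_def abs_mult algebra_simps power2_eq_square)
 show "abs (ct4 (f q) (f (fl q j s)) - a * c * s\<^sup>2 / 2)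
   <= (M + 2 * abs a) * e * s\<^sup>2" if "derc x1 j e d a q"
  using curve_contact_increment(1)[OF H V der[OF u] der[OF that]] unfolding eq by blast
 show "abs (ct5 (f q) (f (fl q j s)) - a * c * s\<^sup>2 / 2)
   <= (M + 2 * abs a) * e * s\<^sup>2" if "derc x2 j e d a q"
  using curve_contact_increment(2)[OF H V der[OF u] der[OF that]] unfolding eq by blast
qed

text \<open>None of the parameters depends on \<open>q\<close>, so the estimates at different points
  of one tame set can be combined.\<close>

definition tame :: "real => real => real => (bool => real) => (bool => real) => (bool => real) => r5 => bool" where
 "tame M d e c a b q \<longleftrightarrow> qcat d q & (\<forall>j. varc j M d q & derc x3 j e d (c j) q & derc x1 j e d (a j) q & derc x2 j e d (b j) q)"

text \<open>Along the path with steps \<open>sa\<close>, \<open>sb\<close> the image moves by at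
  most \<open>X * r\<close> in \<open>rho\<close>. Quasiconformality transfers this, with the factor
  \<open>K\<close>, to the smaller step \<open>lam * r\<close> along the field \<open>j0\<close>,
  where the third coordinate moves by about \<open>c j0 * lam * r\<close>. For small
  \<open>d\<close> the resulting inequality is impossible.\<close>

lemma tame_contradiction:
 assumes W: "open W" "W \<subseteq> U" and A: "!!q h. q \<in> A ==> nrm h <= r1 ==> gm 1 q h \<in> W" and r1: "r1 <= 1"
  and M: "1 <= M" and d: "0 < d" "d <= 1" and dl: "0 < dl" "dl <= r1"
  and E: "E \<in> sets borel" "0 < emeasure lborel E" "E \<subseteq> A" and tame: "!!q. q \<in> E ==> tame M dl d c a b q"
  and m: "0 < abs (c j0)" "!!j. abs (c j) <= abs (c j0)"
 shows "(abs (c j0) - d) * (abs (c j0) / (8 * M * C)) <= K * sqrt ((54 * M + K\<^sup>2 * M\<^sup>2 + 15 * M + 2)\<^sup>2 * d)"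
proof -
 \<comment> \<open>The corners that must lie in \<open>E\<close> together with \<open>p\<close>: the
   first corner of each commutator path, the endpoint \<open>qA\<close> of the first path, where
   quasiconformality is applied, and the first corner of the path with steps \<open>sa\<close>,
   \<open>sb\<close>.\<close>
 define h where "h i r = (if i = 0 then gg True r else if i = 1 then gg False r else
   if i = 2 then fl (gg True r) False r else gg True (r * (c False / (2 * M))))" for i :: nat and r
 have hc: "continuous_on UNIV (h i)" for i
  unfolding h_def[abs_def] using M by (cases "i = 0"; cases "i = 1"; cases "i = 2") (auto intro!: continuous_intros)
 have hlim: "(h i \<longlongrightarrow> 0) (at_right 0)" for i
 proof -
  have "(h i \<longlongrightarrow> h i 0) (at 0)" using hc[of i] by (simp add: continuous_on_def)
  then have "(h i \<longlongrightarrow> h i 0) (at_right 0)" by (rule tendsto_within_subset) simp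
  moreover have "h i 0 = 0" by (simp add: h_def)
  ultimately show ?thesis by simp
 qed
 have ev1: "eventually (%r. \<exists>p\<in>E. \<forall>i\<in>{0,1,2,3::nat}. gm 1 p (h i r) \<in> E) (at_right 0)"
  using E hlim by (intro gm_steinhaus) auto
 \<comment> \<open>The second bound gives \<open>C * sqrt r <= d / 2\<close>, so that a displacement
   of gauge \<open>r * sqrt r\<close> has \<open>D\<close> at most \<open>d * r / 2\<close>.\<close>
 define rr where "rr = min dl ((d / (2 * C))\<^sup>2)"
 have "rr > 0" using dl d C by (simp add: rr_def)
 then have "eventually (%r. r < rr) (at_right 0)" by (rule eventually_at_right_less[THEN eventually_mono, of _ _, rotated] | simp add: eventually_at_right_field, intro exI[of _ rr], simp)
 moreover have "eventually (%r. (0::real) < r) (at_right 0)" by (rule eventually_at_right_less)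
 ultimately have "eventually (%r. 0 < r & r < rr & (\<exists>p\<in>E. \<forall>i\<in>{0,1,2,3::nat}. gm 1 p (h i r) \<in> E)) (at_right 0)"
  using ev1 by eventually_elim auto
 then obtain r p where r: "0 < r" "r < rr" and p: "p \<in> E" and hE: "\<forall>i\<in>{0,1,2,3::nat}. gm 1 p (h i r) \<in> E"
  using eventually_happens'[OF trivial_limit_at_right_real] by blast
 have rd: "r < dl" "r <= 1" "r <= r1" using r dl r1 by (auto simp: rr_def)
 have Cr: "C * sqrt r <= d / 2"
 proof -
  have "sqrt r <= sqrt ((d / (2 * C))\<^sup>2)" using r by (simp add: rr_def del: real_sqrt_abs)
  also have "... = d / (2 * C)" using d C by simp
  finally show ?thesis using C by (simp add: field_simps)
 qed
 define sa where "sa = r * (c False / (2 * M))"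
 define sb where "sb = - (r * (c True / (2 * M)))"
 have E1: "fl p True r \<in> E" "fl p False r \<in> E" "fl (fl p True r) False r \<in> E" "fl p True sa \<in> E"
  using hE by (auto simp: h_def sa_def gm_assoc)
 have EW: "fl q j s \<in> W" if "q \<in> E" "abs s <= dl" for q j s
  using A[of q "gg j s"] E(3) that dl by auto
 have tm: "qcat dl q" "varc j M dl q" "derc x3 j d dl (c j) q" "derc x1 j d dl (a j) q" "derc x2 j d dl (b j) q" if "q \<in> E" for q j
  using tame[OF that] by (auto simp: tame_def)
 have bd: "abs (c j) <= M + 1" "abs (a j) <= M + 1" "abs (b j) <= M + 1" for j
  using derc_bound[OF tm(2) tm(3) dl(1), OF p p rho_comp_le(3), of j] derc_bound[OF tm(2) tm(4) dl(1), OF p p rho_comp_le(1), of j]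
   derc_bound[OF tm(2) tm(5) dl(1), OF p p rho_comp_le(2), of j] d by auto
 then have c2M: "abs (c j) <= 2 * M" for j using M by (smt (verit))
 have d1: "abs (g (f (fl q j s)) - g (f q) - k * s) <= d * abs s" if "derc g j d dl k q" "abs s <= r" for g j k q s
  using that rd unfolding derc_def by simp
 have two: "abs (x3 (f (fl (fl q j s) l t)) - x3 (f q) - (c j * s + c l * t)) <= 2 * d * r" (is ?P1)
   "abs (x1 (f (fl (fl q j s) l t)) - x1 (f q) - (a j * s + a l * t)) <= 2 * d * r" (is ?P2)
   "abs (x2 (f (fl (fl q j s) l t)) - x2 (f q) - (b j * s + b l * t)) <= 2 * d * r" (is ?P3)
   "abs (ct4 (f q) (f (fl (fl q j s) l t))
    - (a j * c j * s\<^sup>2 / 2 + a l * c l * t\<^sup>2 / 2 + a j * c l * s * t)) <= 15 * M * d * r\<^sup>2" (is ?P4)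
   "abs (ct5 (f q) (f (fl (fl q j s) l t))
    - (b j * c j * s\<^sup>2 / 2 + b l * c l * t\<^sup>2 / 2 + b j * c l * s * t)) <= 15 * M * d * r\<^sup>2" (is ?P5)
  if q: "q \<in> E" "fl q j s \<in> E" and st: "abs s <= r" "abs t <= r" for q j s l t
 proof -
  have e: "d * abs s <= d * r" "d * abs t <= d * r" using st d by (auto intro: mult_left_mono)
  have sum: "abs (y2 - y0 - (k * s + k' * t)) <= 2 * d * r"
   if "abs (y1 - y0 - k * s) <= d * abs s" "abs (y2 - y1 - k' * t) <= d * abs t" for y0 y1 y2 k k'
   using that e by (simp add: abs_le_iff)
  note u1 = d1[OF tm(3)[OF q(1)] st(1), of j] and u2 = d1[OF tm(3)[OF q(2)] st(2), of l]
  note v1 = d1[OF tm(4)[OF q(1)] st(1), of j] and v2 = d1[OF tm(4)[OF q(2)] st(2), of l]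
  note w1 = d1[OF tm(5)[OF q(1)] st(1), of j] and w2 = d1[OF tm(5)[OF q(2)] st(2), of l]
  show ?P1 by (rule sum[OF u1 u2])
  show ?P2 by (rule sum[OF v1 v2])
  show ?P3 by (rule sum[OF w1 w2])
  have sd: "abs s <= dl" "abs t <= dl" using st rd by auto
  have e0: "0 <= d" using d by simp
  note o1 = one_step[OF tm(2)[OF q(1)] tm(3)[OF q(1)] sd(1) e0 W(2) EW[OF q(1)], of j]
  note o2 = one_step[OF tm(2)[OF q(2)] tm(3)[OF q(2)] sd(2) e0 W(2) EW[OF q(2)], of l]
  show ?P4
   by (rule two_step_increment[OF M e0 d(2) st bd(2) bd(2) bd(1) u1 u2 v1 o1(1)[OF _ tm(4)[OF q(1)]] o2(1)[OF _ tm(4)[OF q(2)]]])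
  show ?P5
   by (rule two_step_increment[OF M e0 d(2) st bd(3) bd(3) bd(1) u1 u2 w1 o1(2)[OF _ tm(5)[OF q(1)]] o2(2)[OF _ tm(5)[OF q(2)]]])
 qed
 have rabs: "abs r <= r" using r by simp
 define qA where "qA = fl (fl p True r) False r"
 define qB where "qB = fl (fl p False r) True r"
 note tA = two[OF p E1(1) rabs rabs, of False, folded qA_def]
 note tB = two[OF p E1(2) rabs rabs, of True, folded qB_def]
 define C2 where "C2 = 54 * M + K\<^sup>2 * M\<^sup>2"
 have C20: "0 <= C2" using M by (simp add: C2_def)
 have AB: "rho (f qA) (f qB) <= K * (M * (d * r))"
 proof -
  \<comment> \<open>The displacement from \<open>qA\<close> to \<open>qB\<close>. Its third
    coordinate is of weight 1, so \<open>r\<^sup>2\<close> counts as it stands; the cubic vertical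
    terms have gauge of order \<open>r * sqrt r\<close>. Both are o(r).\<close>
  define h0 where "h0 = ((0, 0, - r\<^sup>2, r ^ 3 / 2, r ^ 3 / 2) :: r5)"
  have "gm 1 (gg True r) (gm 1 (gg False r) h0) = fl (gg False r) True r"
   by (simp add: gg_def gm_def h0_def power2_eq_square power3_eq_cube)
  then have qB: "qB = gm 1 qA h0" by (simp add: qA_def qB_def gm_assoc)
  have r3: "r ^ 3 / 2 <= (r * sqrt r)\<^sup>2"
  proof -
   have "(r * sqrt r)\<^sup>2 = r ^ 3" using r by (simp add: power_mult_distrib) (simp add: power3_eq_cube power2_eq_square)
   then show ?thesis using r by simp
  qed
  have "r * r <= r * sqrt r"
  proof (rule mult_left_mono)
   have "sqrt r * sqrt r <= sqrt r * 1" using rd r by (intro mult_left_mono) auto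
   then show "r <= sqrt r" using r by simp
  qed (use r in simp)
  then have n0: "nrm h0 <= r * sqrt r" using r r3 by (subst nrm_le_iff) (auto simp: h0_def power2_eq_square)
  have sr: "sqrt r <= 1" using rd by simp
  have "r * sqrt r <= r * 1" using sr r by (intro mult_left_mono) auto
  then have n1: "nrm h0 <= 1" "nrm h0 <= r1" using n0 rd by auto
  have "D h0 <= C * (r * sqrt r)" using D_le[OF n1(1)] n0 C by (meson mult_left_mono order_trans zero_le_one)
  also have "... = r * (C * sqrt r)" by simp
  also have "... <= r * (d / 2)" using Cr r by (intro mult_left_mono) auto
  finally have D0: "D h0 <= d * r / 2" by (simp add: mult.commute)
  have er: "d * r <= r" using d r by simp
  \<comment> \<open>The comparison point for quasiconformality: a step of \<open>d * r\<close> along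
    X1 is at least as long as the defect, and \<open>varc\<close> bounds how far its image
    moves.\<close>
  have Dg: "d * r / 2 <= D (gg True (d * r))"
  proof (cases "D (gg True (d * r)) < 1")
   case True
   then show ?thesis using D_ge[OF True] d r by simp
  next
   case False
   then show ?thesis using er rd by linarith
  qed
  have qAE: "qA \<in> E" using E1(3) by (simp add: qA_def)
  have "rho (f qA) (f (gm 1 qA h0)) <= K * rho (f qA) (f (fl qA True (d * r)))"
  proof (rule qcatD[OF tm(1)[OF qAE]])
   show "gm 1 qA h0 \<in> U" using A[of qA h0] qAE E(3) n1 W by auto
   show "fl qA True (d * r) \<in> U" using EW[OF qAE, of "d * r" True] er d r rd W by auto
   show "D h0 < dl" using D0 er rd r by linarith
   show "D h0 <= D (gg True (d * r))" using D0 Dg by linarith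
  qed
  also have "... <= K * (M * (d * r))"
   using varc_1[OF tm(2)[OF qAE], of "d * r" True] er d r rd K by (intro mult_left_mono) auto
  finally show ?thesis by (simp add: qB)
 qed
 have AB2: "(rho (f qA) (f qB))\<^sup>2 <= (K * (M * (d * r)))\<^sup>2" using AB by (intro power_mono) auto
 have ca: "abs (a False * c True - a True * c False) <= C2 * d" unfolding C2_def
  by (rule commutator_bound[OF M d r(1) bd(2) bd(2) tA(1) tB(1) tA(2) tA(4) tB(4) order_trans[OF rho_comp_le(4) AB2]])
 have cb: "abs (b False * c True - b True * c False) <= C2 * d" unfolding C2_def
  by (rule commutator_bound[OF M d r(1) bd(3) bd(3) tA(1) tB(1) tA(3) tA(5) tB(5) order_trans[OF rho_comp_le(5) AB2]])
 have sl: "abs (r * (c j / (2 * M))) <= r" for j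
 proof -
  have "abs (c j / (2 * M)) <= 1" using c2M[of j] M by (simp add: abs_divide)
  then have "abs (r * (c j / (2 * M))) <= r * 1" using r by (intro abs_mult_le) auto
  then show ?thesis by simp
 qed
 have sab: "abs sa <= r" "abs sb <= r" using sl[of False] sl[of True] by (simp_all add: sa_def sb_def)
 define q where "q = fl (fl p True sa) False sb"
 note tq = two[OF p E1(4) sab, of False, folded q_def]
 note ea = endpoint_bound[OF M d r(1) C20 ca c2M c2M sa_def sb_def tq(2) tq(4)]
 note eb = endpoint_bound[OF M d r(1) C20 cb c2M c2M sa_def sb_def tq(3) tq(5)]
 have u0: "c True * sa + c False * sb = 0" by (simp add: sa_def sb_def)
 \<comment> \<open>The square root reflects the gauge: the last two coordinates are of order
   \<open>d * r\<^sup>2\<close>, and \<open>rho\<close> takes their root.\<close>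
 define X where "X = sqrt ((C2 + 15 * M + 2)\<^sup>2 * d)"
 have X2: "X\<^sup>2 = (C2 + 15 * M + 2)\<^sup>2 * d" using d by (simp add: X_def)
 have X0: "0 <= X" using d by (simp add: X_def)
 have k1: "(C2 + 15 * M + 2) * d <= X"
 proof (rule power2_le_imp_le[OF _ X0])
  have "((C2 + 15 * M + 2) * d)\<^sup>2 = (C2 + 15 * M + 2)\<^sup>2 * (d * d)" by (simp add: power2_eq_square)
  also have "... <= (C2 + 15 * M + 2)\<^sup>2 * (d * 1)" using d by (intro mult_left_mono) auto
  finally show "((C2 + 15 * M + 2) * d)\<^sup>2 <= X\<^sup>2" by (simp add: X2)
 qed
 have k2: "(C2 + 15 * M) * d <= X\<^sup>2"
 proof -
  have "C2 + 15 * M <= (C2 + 15 * M + 2) * 1" by simp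
  also have "... <= (C2 + 15 * M + 2) * (C2 + 15 * M + 2)" using C20 M by (intro mult_left_mono) auto
  finally show ?thesis unfolding X2 using d by (intro mult_right_mono) (auto simp: power2_eq_square)
 qed
 have "rho (f p) (f q) <= X * r"
 proof (subst rho_le_iff, use X0 r in simp, intro conjI)
  have "(C2 + 2) * d * r <= (C2 + 15 * M + 2) * d * r" using M d r by (intro mult_right_mono) auto
  also have "... <= X * r" using k1 r by (intro mult_right_mono) auto
  finally show "abs (x1 (f q) - x1 (f p)) <= X * r" "abs (x2 (f q) - x2 (f p)) <= X * r" using ea(1) eb(1) by linarith+
  have "2 * d * r <= (C2 + 15 * M + 2) * d * r" using C20 M d r by (intro mult_right_mono) auto
  also have "... <= X * r" using k1 r by (intro mult_right_mono) auto
  finally show "abs (x3 (f q) - x3 (f p)) <= X * r" using tq(1) unfolding u0 by simp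
  have "(C2 + 15 * M) * d * r\<^sup>2 <= X\<^sup>2 * r\<^sup>2" using k2 by (intro mult_right_mono) auto
  then show "abs (ct4 (f p) (f q)) <= (X * r)\<^sup>2"
   "abs (ct5 (f p) (f q)) <= (X * r)\<^sup>2" using ea(2) eb(2) unfolding power_mult_distrib by linarith+
 qed
 moreover
 \<comment> \<open>Chosen so that \<open>C * (lam * r)\<close> is a quarter of the longer leg
   \<open>abs (c j0) * r / (2 * M)\<close> of the path. Then \<open>D\<close> of this step stays
   below \<open>D\<close> of the whole path in spite of the factor 2 in \<open>D_ge\<close>.\<close>
 define lam where "lam = abs (c j0) / (8 * M * C)"
 have lam0: "0 < lam" using m M C by (simp add: lam_def)
 have Cl: "C * (lam * r) = abs (c j0) * r / (8 * M)" using C M by (simp add: lam_def field_simps)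
 have "abs (c j0) / (8 * M) <= 1 / 4" using c2M[of j0] M by (simp add: field_simps)
 then have "abs (c j0) / (8 * M) * r <= 1 / 4 * r" using r by (intro mult_right_mono) auto
 then have Cl2: "C * (lam * r) <= r / 4" unfolding Cl by simp
 have "1 * (lam * r) <= C * (lam * r)" using C lam0 r by (intro mult_right_mono) auto
 then have lr: "lam * r <= r / 4" "0 < lam * r" using Cl2 mult_pos_pos[OF lam0 r(1)] by linarith+
 have "rho (f p) (f (fl p j0 (lam * r))) <= K * rho (f p) (f q)"
 proof -
  let ?h = "fl (gg True sa) False sb"
  have q: "q = gm 1 p ?h" by (simp add: q_def gm_assoc)
  have "x1 ?h = sa" "x2 ?h = sb" by (simp_all add: gm_def gg_def)
  then have "abs sa <= nrm ?h" "abs sb <= nrm ?h" using nrm_comp_le[of ?h] by auto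
  moreover have "abs (r * (c j0 / (2 * M))) <= max (abs sa) (abs sb)" by (cases j0) (auto simp: sa_def sb_def)
  moreover have "abs (r * (c j0 / (2 * M))) = 4 * (abs (c j0) * r / (8 * M))" using r M by (simp add: abs_mult abs_divide)
  ultimately have nh: "4 * (abs (c j0) * r / (8 * M)) <= nrm ?h" by linarith
  have "nrm (gg j0 (lam * r)) <= 1" using lr rd by simp
  then have "D (gg j0 (lam * r)) <= C * nrm (gg j0 (lam * r))" by (rule D_le)
  also have "... = abs (c j0) * r / (8 * M)" using lr Cl by simp
  finally have Dg: "D (gg j0 (lam * r)) <= abs (c j0) * r / (8 * M)" .
  have Dh: "abs (c j0) * r / (8 * M) <= D ?h"
  proof (cases "D ?h < 1")
   case True
   have "0 <= abs (c j0) * r / (8 * M)" using r M by simp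
   then show ?thesis using D_ge[OF True] nh by linarith
  next
   case False
   then show ?thesis using Cl2 rd r unfolding Cl by linarith
  qed
  show ?thesis unfolding q
  proof (rule qcatD[OF tm(1)[OF p]])
   show "fl p j0 (lam * r) \<in> U" using EW[OF p, of "lam * r" j0] lr rd W by auto
   show "gm 1 p ?h \<in> U" using EW[OF E1(4), of sb False] sab rd W by (auto simp: gm_assoc)
   show "D (gg j0 (lam * r)) < dl" using Dg Cl2 rd r unfolding Cl by linarith
   show "D (gg j0 (lam * r)) <= D ?h" using Dg Dh by linarith
  qed
 qed
 ultimately have "rho (f p) (f (fl p j0 (lam * r))) <= K * (X * r)"
  using K by (meson mult_left_mono order_trans zero_le_one)
 moreover have "abs (x3 (f (fl p j0 (lam * r))) - x3 (f p)) <= rho (f p) (f (fl p j0 (lam * r)))" by (rule rho_comp_le)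
 moreover have "abs (x3 (f (fl p j0 (lam * r))) - x3 (f p) - c j0 * (lam * r)) <= d * (lam * r)"
  using d1[OF tm(3)[OF p], of "lam * r" j0] lr r by simp
 moreover have "abs (c j0 * (lam * r)) = abs (c j0) * (lam * r)" using abs_of_pos[OF lr(2)] by (simp only: abs_mult)
 ultimately have "abs (c j0) * (lam * r) - d * (lam * r) <= K * (X * r)" by linarith
 then have "((abs (c j0) - d) * lam) * r <= (K * X) * r" by (simp add: algebra_simps)
 then have "(abs (c j0) - d) * lam <= K * X" using r(1) by (rule mult_right_le_imp_le)
 then show ?thesis by (simp add: lam_def X_def C2_def)
qed

end

section \<open>Measurability and vanishing of the slopes almost everywhere\<close>

text \<open>The family may be uncountable: violating one condition is an open property in
  \<open>A\<close>, and every union of open sets is open.\<close>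

lemma borel_family_le:
 fixes h :: "'i => 'a::euclidean_space => real"
 assumes "open A" "!!i. i \<in> I ==> continuous_on A (h i)"
 shows "{q \<in> A. \<forall>i\<in>I. h i q <= 0} \<in> sets borel"
proof -
 have "open (A \<inter> h i -` {0<..})" if "i \<in> I" for i
  using assms that by (intro continuous_open_preimage) auto
 then have "open (\<Union>i\<in>I. A \<inter> h i -` {0<..})" by blast
 moreover have "{q \<in> A. \<forall>i\<in>I. h i q <= 0} = A - (\<Union>i\<in>I. A \<inter> h i -` {0<..})"
  by (auto simp: not_le[symmetric])
 ultimately show ?thesis using assms(1) by simp
qed

lemma pres_AE:
 assumes "pres T" "AE x in lborel. P x"
 shows "AE x in lborel. P (T x)"
proof -
 have "AE x in distr lborel borel T. P x" using assms by (metis pres_def)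
 then show ?thesis using assms(1) by (intro AE_distrD[of T lborel borel P]) (auto simp: pres_def)
qed

lemma AE_open_imp_all:
 fixes g :: "'a::euclidean_space => real"
 assumes "open A" "continuous_on A g" "AE p in lborel. p \<in> A --> g p = 0" "p \<in> A"
 shows "g p = 0"
proof (rule ccontr)
 assume "g p ~= 0"
 let ?S = "A \<inter> g -` (- {0})"
 have S: "open ?S" using assms by (intro continuous_open_preimage) auto
 have "AE p in lborel. p \<notin> ?S" using assms(3) by eventually_elim auto
 then have "emeasure lborel ?S = 0" using S by (subst (asm) AE_iff_measurable[where N = ?S]) auto
 then have "negligible ?S" using S by (simp add: negligible_iff_emeasure0 borel_open)
 then show False using open_not_negligible[OF S] assms(4) \<open>g p ~= 0\<close> by auto
qed

text \<open>The left side is of order \<open>sqrt d\<close>, while \<open>d <= c0 / 2\<close> keeps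
  the right side above \<open>c0\<^sup>2 / (16 * M * C)\<close>. One \<open>d\<close> serves all
  \<open>c >= c0\<close>, so it can be fixed before the slopes are known.\<close>

lemma epsilon_exists:
 fixes c0 M C K X :: real
 assumes "0 < c0" "1 <= M" "1 <= C" "1 <= K" "0 < X"
 shows "\<exists>d>0. d <= 1 & d <= c0 / 2 & (\<forall>c\<ge>c0. K * sqrt (X * d) < (c - d) * (c / (8 * M * C)))"
proof -
 define y where "y = c0\<^sup>2 / (32 * M * C * K)"
 have y: "y > 0" using assms by (simp add: y_def)
 define d where "d = min 1 (min (c0 / 2) (y\<^sup>2 / X))"
 have e: "d > 0" "d <= 1" "d <= c0 / 2" "d <= y\<^sup>2 / X"
  using assms y unfolding d_def by (simp, simp, meson min.cobounded1 min.cobounded2 order_trans, meson min.cobounded2 order_trans)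
 have "X * d <= y\<^sup>2" using e(4) assms by (simp add: field_simps)
 then have "sqrt (X * d) <= y" using y by (intro real_le_lsqrt) auto
 then have 1: "K * sqrt (X * d) <= K * y" using assms by simp
 have 2: "K * y = c0\<^sup>2 / (32 * M * C)" using assms by (simp add: y_def)
 have "K * sqrt (X * d) < (c - d) * (c / (8 * M * C))" if "c \<ge> c0" for c
 proof -
  have "(c0 / 2) * (c0 / (8 * M * C)) <= (c - d) * (c / (8 * M * C))"
   using that e assms by (intro mult_mono divide_right_mono) auto
  moreover have "(c0 / 2) * (c0 / (8 * M * C)) = 2 * (c0\<^sup>2 / (32 * M * C))"
   by (simp add: power2_eq_square)
  moreover have "c0\<^sup>2 / (32 * M * C) > 0" using assms by simp
  ultimately show ?thesis using 1 2 by linarith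
 qed
 then show ?thesis using e by blast
qed

context qc_setup
begin

lemma flow_continuous:
 assumes "!!q. q \<in> A ==> gm 1 q h \<in> U"
 shows "continuous_on A (%q. f (gm 1 q h))"
 by (rule continuous_on_compose2[OF cont]) (use assms in \<open>auto intro!: continuous_intros\<close>)

text \<open>With the radius fixed, failure for one pair \<open>g\<close>, \<open>h\<close> is an
  open condition on \<open>q\<close>.\<close>

lemma borel_qcat:
 assumes "open A" "A \<subseteq> U"
 shows "{q \<in> A. qcat d q} \<in> sets borel"
proof -
 define G where "G g h = {q \<in> A. gm 1 q g \<in> U & gm 1 q h \<in> U & K * rho (f q) (f (gm 1 q h)) < rho (f q) (f (gm 1 q g))}" for g h
 have "open (G g h)" for g h
 proof -
  let ?O = "A \<inter> (%q. gm 1 q g) -` U \<inter> (%q. gm 1 q h) -` U"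
  have O: "open ?O" using assms U by (intro open_Int open_vimage) (auto intro!: continuous_intros)
  have "continuous_on ?O (%q. rho (f q) (f (gm 1 q g)) - K * rho (f q) (f (gm 1 q h)))"
   by (intro continuous_intros flow_continuous continuous_on_subset[OF cont]) (use assms in auto)
  then have "open (?O \<inter> (%q. rho (f q) (f (gm 1 q g)) - K * rho (f q) (f (gm 1 q h))) -` {0<..})"
   using O by (rule continuous_open_preimage) simp
  also have "?O \<inter> (%q. rho (f q) (f (gm 1 q g)) - K * rho (f q) (f (gm 1 q h))) -` {0<..} = G g h"
   by (auto simp: G_def)
  finally show ?thesis .
 qed
 then have "open (\<Union>g\<in>{g. D g < d}. \<Union>h\<in>{h. D g <= D h}. G g h)" by blast
 moreover have "{q \<in> A. qcat d q} = A - (\<Union>g\<in>{g. D g < d}. \<Union>h\<in>{h. D g <= D h}. G g h)" (is "?L = ?R")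
 proof (rule Set.set_eqI)
  fix q
  have "q \<in> ?R \<longleftrightarrow> q \<in> A & (\<forall>g h. D g < d --> D g <= D h --> q \<notin> G g h)"
   by blast
  also have "... \<longleftrightarrow> q \<in> ?L" unfolding qcat_def G_def mem_Collect_eq not_less[symmetric] by blast
  finally show "q \<in> ?L \<longleftrightarrow> q \<in> ?R" by simp
 qed
 ultimately show ?thesis using assms(1) by simp
qed

lemma borel_derc:
 assumes "open A" "A \<subseteq> U" "!!q s. q \<in> A ==> abs s <= d ==> fl q j s \<in> U" "continuous_on UNIV g"
 shows "{q \<in> A. derc g j e d c q} \<in> sets borel"
proof -
 have "{q \<in> A. derc g j e d c q} = {q \<in> A. \<forall>s\<in>{s. abs s <= d}. abs (g (f (fl q j s)) - g (f q) - c * s) - e * abs s <= 0}"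
  by (simp add: derc_def)
 also have "... \<in> sets borel"
  by (intro borel_family_le continuous_intros assms(1) continuous_on_compose2[OF assms(4)] flow_continuous continuous_on_subset[OF cont])
   (use assms in auto)
 finally show ?thesis .
qed

lemma borel_varc:
 assumes "open A" "!!q s. q \<in> A ==> abs s <= d ==> fl q j s \<in> U"
 shows "{q \<in> A. varc j M d q} \<in> sets borel"
proof -
 have sc: "abs (real i / real n * s) <= d" if "abs s <= d" "i <= n" for i n s
 proof -
  have "abs (real i / real n) <= 1" using that by (cases "n = 0") auto
  then have "abs (real i / real n * s) <= 1 * d" using that by (intro abs_mult_le) auto
  then show ?thesis by simp
 qed
 have "{q \<in> A. varc j M d q} = {q \<in> A. \<forall>z\<in>{z. abs (snd z) <= d}.
   (\<Sum>i<fst z. rho (f (fl q j (real i / real (fst z) * snd z))) (f (fl q j (real (Suc i) / real (fst z) * snd z)))) - M * abs (snd z) <= 0}"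
  by (simp add: varc_def)
 also have "... \<in> sets borel" by (intro borel_family_le continuous_intros assms(1) flow_continuous)
   (use assms(2) sc in \<open>auto simp del: of_nat_Suc\<close>)
 finally show ?thesis .
qed

lemma varc_mono: "varc j M d q ==> M <= M' ==> d' <= d ==> varc j M' d' q"
 unfolding varc_def by (meson abs_ge_zero mult_right_mono order_trans)

lemma derc_mono: "derc g j e d c q ==> abs (c' - c) <= e' - e ==> d' <= d ==> derc g j e' d' c' q"
 unfolding derc_def
proof (intro allI impI)
 fix s assume *: "\<forall>s. abs s <= d --> abs (g (f (fl q j s)) - g (f q) - c * s) <= e * abs s"
  "abs (c' - c) <= e' - e" "d' <= d" "abs s <= d'"
 then have "abs (g (f (fl q j s)) - g (f q) - c * s) <= e * abs s" by simp
 moreover have "abs ((c' - c) * s) <= (e' - e) * abs s" using * by (intro abs_mult_le) auto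
 moreover have "abs (x - y) <= a + b" if "abs x <= a" "abs y <= b" for x y a b :: real using that by linarith
 ultimately have "abs ((g (f (fl q j s)) - g (f q) - c * s) - (c' - c) * s) <= e * abs s + (e' - e) * abs s" by blast
 then show "abs (g (f (fl q j s)) - g (f q) - c' * s) <= e' * abs s" by (simp add: algebra_simps)
qed

lemma qcat_mono: "qcat d q ==> d' <= d ==> qcat d' q" unfolding qcat_def by (meson less_le_trans)

text \<open>Finite variation and differentiability along the flow in countable terms: rational
  slopes, errors \<open>1 / Suc l\<close>, scales \<open>r / Suc k\<close>. Hence a Borel
  condition.\<close>

definition good :: "real => bool => r5 => bool" where
 "good r j q \<longleftrightarrow> (\<exists>m::nat. varc j (real m) (r / real (Suc m)) q) &
   (\<forall>g\<in>{x1, x2, x3}. \<forall>l::nat. \<exists>k::nat. \<exists>c\<in>\<rat>. derc g j (1 / real (Suc l)) (r / real (Suc k)) c q)"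

definition flat :: "real => bool => r5 => bool" where
 "flat r j q \<longleftrightarrow> (\<forall>l::nat. \<exists>k::nat. derc x3 j (1 / real (Suc l)) (r / real (Suc k)) 0 q)"

lemma borel_good:
 assumes A: "open A" "A \<subseteq> U" "!!q s. q \<in> A ==> abs s <= r ==> fl q j s \<in> U" and r: "0 < r"
 shows "{q \<in> A. good r j q} \<in> sets borel" (is ?P1) "{q \<in> A. flat r j q} \<in> sets borel" (is ?P2)
proof -
 have rk: "r / real (Suc k) <= r" for k using r by (simp add: divide_le_eq mult_le_cancel_left1)
 have dom: "fl q j s \<in> U" if "q \<in> A" "abs s <= r / real (Suc k)" for q s k
  using A(3)[OF that(1)] that(2) rk[of k] by (meson order_trans)
 have dc: "{q \<in> A. derc g j e (r / real (Suc k)) c q} \<in> sets borel" if "continuous_on UNIV g" for g e k c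
  by (rule borel_derc[OF A(1,2) _ that]) (rule dom)
 have vc: "{q \<in> A. varc j M (r / real (Suc k)) q} \<in> sets borel" for M k
  by (rule borel_varc[OF A(1)]) (rule dom)
 have 1: "(\<Union>k. \<Union>c\<in>\<rat>. {q \<in> A. derc g j e (r / real (Suc k)) c q}) \<in> sets borel" if "continuous_on UNIV g" for g e
  by (intro sets.countable_UN image_subsetI sets.countable_UN'[OF countable_rat] dc that)
 have 2: "continuous_on UNIV g" if "g \<in> {x1, x2, x3}" for g using that by (auto intro!: continuous_intros)
 have "{q \<in> A. good r j q} = (\<Union>m. {q \<in> A. varc j (real m) (r / real (Suc m)) q}) \<inter>
  (\<Inter>g\<in>{x1, x2, x3}. \<Inter>l. \<Union>k. \<Union>c\<in>\<rat>. {q \<in> A. derc g j (1 / real (Suc l)) (r / real (Suc k)) c q})"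
  unfolding good_def by blast
 also have "... \<in> sets borel"
 proof (rule sets.Int)
  show "(\<Union>m. {q \<in> A. varc j (real m) (r / real (Suc m)) q}) \<in> sets borel"
   by (intro sets.countable_UN image_subsetI vc)
  show "(\<Inter>g\<in>{x1, x2, x3}. \<Inter>l. \<Union>k. \<Union>c\<in>\<rat>. {q \<in> A. derc g j (1 / real (Suc l)) (r / real (Suc k)) c q}) \<in> sets borel"
  proof (rule sets.finite_INT)
   show "(\<Inter>l. \<Union>k. \<Union>c\<in>\<rat>. {q \<in> A. derc g j (1 / real (Suc l)) (r / real (Suc k)) c q}) \<in> sets borel"
    if "g \<in> {x1, x2, x3}" for g
    by (intro sets.countable_INT image_subsetI 1 2 that) auto
  qed auto
 qed
 finally show ?P1 .
 have "{q \<in> A. flat r j q} = (\<Inter>l. \<Union>k. {q \<in> A. derc x3 j (1 / real (Suc l)) (r / real (Suc k)) 0 q})"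
  unfolding flat_def by blast
 also have "... \<in> sets borel" by (intro sets.countable_INT image_subsetI sets.countable_UN dc 2) auto
 finally show ?P2 .
qed

text \<open>Where the variation majorant \<open>V\<close> of the curve is differentiable, its
  derivative bounds the variation at small scale; where the coordinates are differentiable as well,
  their slopes are approximated by rationals.\<close>

lemma good_ae_on_curve:
 assumes ac: "pair_ac 0 s0 (%s t. rho (f (fl p j s)) (f (fl p j t)))" and s0: "0 < s0" and r: "0 < r"
 shows "negligible {s. 0 < s & s < s0 & \<not> good r j (fl p j s)}"
proof -
 define F where "F s = f (fl p j s)" for s
 have shift: "fl (fl p j s) j t = fl p j (s + t)" for s t by (simp add: gm_assoc gg_add)
 obtain V where V: "mono V" "continuous_on UNIV V" "!!s t. 0 <= s ==> s < t ==> t <= s0 ==> rho (F s) (F t) <= V t - V s"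
  using s0 by (rule_tac pair_ac_majorant[OF _ ac[folded F_def]]) (auto intro: rho_triangle)
 have neg: "negligible {t. 0 < t & t < s0 & \<not> ((%s. g (F s)) differentiable (at t) & V differentiable (at t))}"
  if "!!p q. abs (g q - g p) <= rho p q" for g :: "r5 => real"
  by (rule majorized_differentiable_ae[OF V(1,2)]) (use V(3) that order_trans in blast)
 have "negligible (\<Union>g\<in>{x1, x2, x3}. {t. 0 < t & t < s0 & \<not> ((%s. g (F s)) differentiable (at t) & V differentiable (at t))})"
 proof (rule negligible_Union)
  fix S assume "S \<in> (%g. {t. 0 < t & t < s0 & \<not> ((%s. g (F s)) differentiable (at t) & V differentiable (at t))}) ` {x1, x2, x3}"
  then obtain g where g: "g \<in> {x1, x2, x3}" "S = {t. 0 < t & t < s0 & \<not> ((%s. g (F s)) differentiable (at t) & V differentiable (at t))}"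
   by blast
  show "negligible S" unfolding g(2) by (rule neg) (use g(1) rho_comp_le in blast)
 qed simp
 then show ?thesis
 proof (rule negligible_subset)
  show "{s. 0 < s & s < s0 & \<not> good r j (fl p j s)} \<subseteq>
   (\<Union>g\<in>{x1, x2, x3}. {t. 0 < t & t < s0 & \<not> ((%s. g (F s)) differentiable (at t) & V differentiable (at t))})"
 proof (intro subsetI; rule ccontr)
  fix s assume s: "s \<in> {s. 0 < s & s < s0 & \<not> good r j (fl p j s)}"
   and "s \<notin> (\<Union>g\<in>{x1, x2, x3}. {t. 0 < t & t < s0 & \<not> ((%s. g (F s)) differentiable (at t) & V differentiable (at t))})"
  then have dg: "(%s. g (F s)) differentiable (at s)" if "g \<in> {x1, x2, x3}" for g using that by auto
  have dV: "V differentiable (at s)" using \<open>s \<notin> _\<close> s by auto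
  have kex: "\<exists>k::nat. r / real (Suc k) < d" if "d > 0" for d
  proof -
   obtain k :: nat where "r / d < real k" using reals_Archimedean2 by blast
   then have "r / real (Suc k) < d" using that by (simp add: field_simps add_strict_increasing2)
   then show ?thesis by blast
  qed
  have der: "\<exists>c d. d > 0 & (\<forall>t. abs t < d --> abs (h (s + t) - h s - c * t) <= e * abs t)"
   if h: "h differentiable (at s)" and e: "e > 0" for h :: "real => real" and e
  proof -
   obtain c where "(h has_real_derivative c) (at s)" using h by (auto simp: real_differentiable_def)
   then have "(h has_derivative (*) c) (at s)" by (simp add: has_field_derivative_def)
   then obtain d where d: "d > 0" "!!y. norm (y - s) < d ==> norm (h y - h s - c * (y - s)) <= e * norm (y - s)"
    using e unfolding has_derivative_at_alt by blast
   show ?thesis using d(1) d(2)[of "s + _"] by (rule_tac exI[of _ c], rule_tac exI[of _ d]) auto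
  qed
  have "good r j (fl p j s)" unfolding good_def
  proof (intro conjI ballI allI)
   obtain c d where d: "d > 0" "!!t. abs t < d ==> abs (V (s + t) - V s - c * t) <= 1 * abs t" using der[OF dV, of 1] by auto
   \<comment> \<open>The factor 2 pays for segments run backwards, since \<open>rho\<close> is
     symmetric only up to 2.\<close>
   define M where "M = 2 * (abs c + 1)"
   obtain m :: nat where m: "M <= real m" "r / real (Suc m) < min d (min s (s0 - s))"
   proof -
    obtain k where k: "r / real (Suc k) < min d (min s (s0 - s))" using kex[of "min d (min s (s0 - s))"] d s by auto
    obtain k' :: nat where k': "M <= real k'" using real_arch_simple by blast
    have "r / real (Suc (max k k')) <= r / real (Suc k)" using r by (intro divide_left_mono) auto
    then show ?thesis using k k' by (intro that[of "max k k'"]) auto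
   qed
   show "\<exists>m. varc j (real m) (r / real (Suc m)) (fl p j s)" unfolding varc_def shift F_def[symmetric]
   proof (intro exI[of _ m] allI impI)
    fix n t assume t: "abs t <= r / real (Suc m)"
    then have t': "abs t < d" "abs t < s" "abs t < s0 - s" using m(2) by auto
    define y where "y i = s + real i / real n * t" for i
    have yb: "0 <= y i & y i <= s0" if "i <= n" for i
    proof -
     have "abs (real i / real n) <= 1" using that by (cases "n = 0") auto
     then have "abs (real i / real n * t) <= 1 * abs t" by (intro abs_mult_le) auto
     then have "real i / real n * t <= abs t" "- abs t <= real i / real n * t" unfolding abs_le_iff by auto
     then show ?thesis using t' unfolding y_def by linarith
    qed
    have le2: "x <= 2 * abs x" for x :: real by simp
    have step: "rho (F (y i)) (F (y (Suc i))) <= 2 * abs (V (y (Suc i)) - V (y i))" if "i < n" for i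
    proof (cases "y i" "y (Suc i)" rule: linorder_cases)
     case less
     then have "rho (F (y i)) (F (y (Suc i))) <= V (y (Suc i)) - V (y i)" using yb[of i] yb[of "Suc i"] that by (intro V(3)) auto
     then show ?thesis using le2[of "V (y (Suc i)) - V (y i)"] by (rule order_trans)
    next
     case equal
     then show ?thesis by (simp add: rho_eq_0_iff[THEN iffD2])
    next
     case greater
     then have "rho (F (y (Suc i))) (F (y i)) <= V (y i) - V (y (Suc i))" using yb[of i] yb[of "Suc i"] that by (intro V(3)) auto
     then have "2 * rho (F (y (Suc i))) (F (y i)) <= 2 * abs (V (y (Suc i)) - V (y i))" by (simp add: abs_if)
     then show ?thesis using rho_commute_le[where p = "F (y (Suc i))" and q = "F (y i)"] by (rule order_trans[rotated])
    qed
    \<comment> \<open>All increments of the monotone \<open>V\<close> along the partition have the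
      sign of \<open>t\<close>, so their absolute values telescope.\<close>
    define sg where "sg = (if 0 <= t then 1 else - 1 :: real)"
    have absV: "abs (V (y (Suc i)) - V (y i)) = sg * (V (y (Suc i)) - V (y i))" for i
    proof -
     have "y (Suc i) - y i = t / real n" by (simp add: y_def algebra_simps add_divide_distrib)
     then have "0 <= t ==> y i <= y (Suc i)" "t <= 0 ==> y (Suc i) <= y i"
      using divide_nonneg_nonneg[of t "real n"] divide_nonpos_nonneg[of t "real n"] by linarith+
     then show ?thesis using monoD[OF V(1), of "y i" "y (Suc i)"] monoD[OF V(1), of "y (Suc i)" "y i"]
      by (auto simp: sg_def split: if_splits)
    qed
    have "(\<Sum>i<n. rho (F (y i)) (F (y (Suc i)))) <= (\<Sum>i<n. 2 * abs (V (y (Suc i)) - V (y i)))"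
     using step by (intro sum_mono) auto
    also have "... = 2 * (sg * (V (y n) - V (y 0)))"
     by (simp only: absV sum_distrib_left[symmetric] sum_lessThan_telescope[of "%i. V (y i)"])
    also have "... <= 2 * abs (V (y n) - V (y 0))" by (auto simp: sg_def)
    also have "... <= M * abs t"
    proof (cases "n = 0")
     case True
     then show ?thesis by (simp add: y_def M_def)
    next
     case False
     then have "y n = s + t" "y 0 = s" by (simp_all add: y_def)
     moreover have "abs (c * t) = abs c * abs t" by (simp add: abs_mult)
     then have "abs (V (s + t) - V s) <= (abs c + 1) * abs t" using d(2)[OF t'(1)] by (simp add: distrib_right)
     ultimately show ?thesis by (simp add: M_def algebra_simps)
    qed
    also have "... <= real m * abs t" using m(1) by (intro mult_right_mono) auto
    finally show "(\<Sum>i<n. rho (F (s + real i / real n * t)) (F (s + real (Suc i) / real n * t))) <= real m * abs t"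
     by (simp only: y_def)
   qed
  next
   fix g and l :: nat assume g: "g \<in> {x1, x2, x3}"
   obtain c d where d: "d > 0" "!!t. abs t < d ==> abs (g (F (s + t)) - g (F s) - c * t) <= 1 / (2 * real (Suc l)) * abs t"
    using der[OF dg[OF g], of "1 / (2 * real (Suc l))"] by auto
   obtain c' where c': "c' \<in> \<rat>" "c - 1 / (2 * real (Suc l)) < c'" "c' < c"
    using Rats_dense_in_real[of "c - 1 / (2 * real (Suc l))" c] by auto
   obtain k where k: "r / real (Suc k) < d" using kex[OF d(1)] by blast
   have "derc g j (1 / (2 * real (Suc l))) (r / real (Suc k)) c (fl p j s)"
    unfolding derc_def shift F_def[symmetric] using d(2) k by (auto simp del: of_nat_Suc)
   then have "derc g j (1 / real (Suc l)) (r / real (Suc k)) c' (fl p j s)"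
    by (rule derc_mono) (use c' in \<open>auto simp: field_simps\<close>)
   then show "\<exists>k. \<exists>c\<in>\<rat>. derc g j (1 / real (Suc l)) (r / real (Suc k)) c (fl p j s)" using c'(1) by blast
  qed
  then show False using s by simp
 qed
 qed
qed

text \<open>Fubini in point and time: it produces single times at which almost every point flows to
  a point outside \<open>N\<close>.\<close>

lemma flow_AE_swap:
 assumes N: "N \<in> sets borel" and A: "open A"
  and "AE p in lborel. p \<in> A --> (AE s in lborel. 0 < s & s < s0 --> fl p j s \<notin> N)"
 shows "AE s in lborel. 0 < s & s < s0 --> (AE p in lborel. p \<in> A --> fl p j s \<notin> N)"
proof -
 have m: "(%z. fl (fst z) j (snd z)) -` N \<in> sets borel"
  by (rule measurable_sets_borel[OF borel_measurable_continuous_onI N]) (intro continuous_intros)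
 have "A \<times> {0<..<s0} \<in> sets borel" using A by (intro borel_open open_Times) auto
 then have "- ((A \<times> {0<..<s0}) \<inter> (%z. fl (fst z) j (snd z)) -` N) \<in> sets borel" using m by auto
 also have "- ((A \<times> {0<..<s0}) \<inter> (%z. fl (fst z) j (snd z)) -` N) =
   {z. fst z \<in> A --> 0 < snd z & snd z < s0 --> fl (fst z) j (snd z) \<notin> N}" by auto
 finally have "{z \<in> space (lborel \<Otimes>\<^sub>M lborel). fst z \<in> A --> 0 < snd z & snd z < s0 --> fl (fst z) j (snd z) \<notin> N} \<in> sets (lborel \<Otimes>\<^sub>M lborel)"
  unfolding lborel_prod by (simp only: sets_lborel space_lborel space_borel UNIV_I simp_thms)
 then have "(AE p in lborel. AE s in lborel. p \<in> A --> 0 < s & s < s0 --> fl p j s \<notin> N) \<longleftrightarrow>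
   (AE s in lborel. AE p in lborel. p \<in> A --> 0 < s & s < s0 --> fl p j s \<notin> N)"
  by (rule lborel_pair.AE_commute)
 moreover have "AE p in lborel. AE s in lborel. p \<in> A --> 0 < s & s < s0 --> fl p j s \<notin> N"
  using assms(3) by eventually_elim auto
 ultimately have "AE s in lborel. AE p in lborel. p \<in> A --> 0 < s & s < s0 --> fl p j s \<notin> N" by blast
 then show ?thesis
 proof eventually_elim
  case (elim s)
  show ?case
  proof
   assume "0 < s & s < s0"
   with elim show "AE p in lborel. p \<in> A --> fl p j s \<notin> N" by auto
  qed
 qed
qed

text \<open>A good point that is not flat lies in one of countably many tame sets with rational
  slopes, one of them at least \<open>1 / Suc l\<close> in the third coordinate. Each such set is
  null, because \<open>d m l\<close> is chosen to violate the inequality of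
  \<open>tame_contradiction\<close>.\<close>

lemma good_imp_flat_ae:
 assumes W: "open W" "W \<subseteq> U" and A: "open A" "!!q h. q \<in> A ==> nrm h <= r ==> gm 1 q h \<in> W" and r: "0 < r" "r <= 1"
 shows "AE q in lborel. q \<in> A --> good r True q --> good r False q --> flat r True q & flat r False q"
proof -
 have AU: "A \<subseteq> U"
 proof
  fix q assume "q \<in> A"
  then have "gm 1 q 0 \<in> W" using r by (intro A(2)) (simp_all add: nrm_eq_0_iff[THEN iffD2])
  then show "q \<in> U" using W by auto
 qed
 have rk: "r / real (Suc k) <= r" "0 < r / real (Suc k)" for k using r by (simp_all add: divide_le_eq mult_le_cancel_left1)
 have dom: "fl q j s \<in> U" if "q \<in> A" "abs s <= r / real (Suc k)" for q s k j
  using A(2)[OF that(1), of "gg j s"] that(2) rk(1)[of k] W by auto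
 define X where "X M = (54 * M + K\<^sup>2 * M\<^sup>2 + 15 * M + 2)\<^sup>2" for M :: real
 have "\<forall>m l. \<exists>d>0. d <= 1 & d <= (1 / real (Suc l)) / 2 &
   (\<forall>c\<ge>1 / real (Suc l). K * sqrt (X (real (Suc m)) * d) < (c - d) * (c / (8 * real (Suc m) * C)))"
 proof (intro allI epsilon_exists C K)
  fix m l :: nat
  have "0 < 54 * real (Suc m) + K\<^sup>2 * (real (Suc m))\<^sup>2 + 15 * real (Suc m) + 2" by (simp add: add_nonneg_pos add_pos_nonneg)
  then show "0 < X (real (Suc m))" unfolding X_def by (rule zero_less_power)
 qed auto
 then obtain d where d: "!!m l. 0 < d m l" "!!m l. d m l <= 1" "!!m l. d m l <= (1 / real (Suc l)) / 2"
  "!!m l c. c \<ge> 1 / real (Suc l) ==> K * sqrt (X (real (Suc m)) * d m l) < (c - d m l) * (c / (8 * real (Suc m) * C))"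
  by metis
 define fn where "fn x y = (%j. if j then x else y)" for x y :: real
 have null: "AE q in lborel. \<not> (q \<in> A & tame (real (Suc m)) (r / real (Suc k)) (d m l) (fn cT cF) (fn aT aF) (fn bT bF) q)"
  if big: "1 / real (Suc l) <= max (abs cT) (abs cF)" for m l k cT cF aT aF bT bF
 proof -
  let ?c = "fn cT cF" and ?a = "fn aT aF" and ?b = "fn bT bF"
  define E where "E = {q \<in> A. tame (real (Suc m)) (r / real (Suc k)) (d m l) ?c ?a ?b q}"
  have dc: "{q \<in> A. derc g j e (r / real (Suc k)) c q} \<in> sets borel" if "continuous_on UNIV g" for g j e c
   by (rule borel_derc[OF A(1) AU _ that]) (rule dom)
  have vc: "{q \<in> A. varc j M (r / real (Suc k)) q} \<in> sets borel" for j M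
   by (rule borel_varc[OF A(1)]) (rule dom)
  have Eb: "E \<in> sets borel"
  proof -
   have "E = {q \<in> A. qcat (r / real (Suc k)) q} \<inter> (\<Inter>j. {q \<in> A. varc j (real (Suc m)) (r / real (Suc k)) q}
    \<inter> {q \<in> A. derc x3 j (d m l) (r / real (Suc k)) (?c j) q} \<inter> {q \<in> A. derc x1 j (d m l) (r / real (Suc k)) (?a j) q}
    \<inter> {q \<in> A. derc x2 j (d m l) (r / real (Suc k)) (?b j) q})"
    unfolding E_def tame_def by blast
   also have "... \<in> sets borel"
    by (intro sets.Int sets.countable_INT image_subsetI borel_qcat[OF A(1) AU] dc vc continuous_intros) simp
   finally show ?thesis .
  qed
  obtain j0 where j0: "abs (?c j0) = max (abs cT) (abs cF)" by (rule that[of "abs cF <= abs cT"]) (auto simp: fn_def)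
  have jm: "abs (?c j) <= abs (?c j0)" for j unfolding j0 by (simp add: fn_def)
  have "emeasure lborel E = 0"
  proof (rule ccontr)
   assume "emeasure lborel E ~= 0"
   then have pos: "0 < emeasure lborel E" by (simp add: zero_less_iff_neq_zero)
   have c0: "1 / real (Suc l) <= abs (?c j0)" using big j0 by simp
   then have c00: "0 < abs (?c j0)" by (rule less_le_trans[rotated]) simp
   have "(abs (?c j0) - d m l) * (abs (?c j0) / (8 * real (Suc m) * C)) <= K * sqrt (X (real (Suc m)) * d m l)"
    unfolding X_def
    by (rule tame_contradiction[OF W A(2) r(2) _ d(1,2) rk(2,1) Eb pos, where a = ?a and b = ?b])
     (use jm c00 in \<open>auto simp: E_def\<close>)
   then show False using d(4)[OF c0, of m] by simp
  qed
  then show ?thesis using Eb by (intro AE_I[of _ _ E]) (auto simp: E_def)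
 qed
 have "AE q in lborel. \<forall>m l k. \<forall>cT\<in>\<rat>. \<forall>cF\<in>\<rat>. \<forall>aT\<in>\<rat>. \<forall>aF\<in>\<rat>. \<forall>bT\<in>\<rat>. \<forall>bF\<in>\<rat>. 1 / real (Suc l) <= max (abs cT) (abs cF) -->
   \<not> (q \<in> A & tame (real (Suc m)) (r / real (Suc k)) (d m l) (fn cT cF) (fn aT aF) (fn bT bF) q)"
  unfolding AE_all_countable AE_ball_countable[OF countable_rat] by (intro allI ballI AE_impI null)
 then show ?thesis
 proof (rule AE_mp, intro AE_I2 impI)
  fix q assume no: "\<forall>m l k. \<forall>cT\<in>\<rat>. \<forall>cF\<in>\<rat>. \<forall>aT\<in>\<rat>. \<forall>aF\<in>\<rat>. \<forall>bT\<in>\<rat>. \<forall>bF\<in>\<rat>. 1 / real (Suc l) <= max (abs cT) (abs cF) -->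
    \<not> (q \<in> A & tame (real (Suc m)) (r / real (Suc k)) (d m l) (fn cT cF) (fn aT aF) (fn bT bF) q)"
   and q: "q \<in> A" and g: "good r True q" "good r False q"
  have g': "good r j q" for j using g by (cases j) auto
  have rmono: "r / real (Suc k') <= r / real (Suc k)" if "k <= k'" for k k' using r that by (intro divide_left_mono) auto
  have "flat r j q" for j
  proof (rule ccontr)
   assume "\<not> flat r j q"
   then obtain l0 where l0: "!!k. \<not> derc x3 j (1 / real (Suc l0)) (r / real (Suc k)) 0 q" unfolding flat_def by blast
   \<comment> \<open>Halves the tolerance: a slope below \<open>1 / Suc l\<close> with an error at
     most \<open>1 / Suc l\<close> would be slope 0 with error \<open>1 / Suc l0\<close>, contrary
     to the choice of \<open>l0\<close>.\<close>
   define l where "l = Suc (2 * l0)"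
   have l: "2 * (1 / real (Suc l)) = 1 / real (Suc l0)" by (simp add: l_def field_simps)
   obtain mm where mm: "!!j. varc j (real (mm j)) (r / real (Suc (mm j))) q" using g' unfolding good_def by metis
   define m where "m = max (mm True) (mm False)"
   have mmm: "mm j <= m" for j by (cases j) (auto simp: m_def)
   obtain l' :: nat where l': "1 / real (Suc l') < d m l" using d(1)[of m l] nat_approx_posE by blast
   have "\<forall>j. \<forall>g\<in>{x1, x2, x3}. \<exists>k. \<exists>c\<in>\<rat>. derc g j (1 / real (Suc l')) (r / real (Suc k)) c q"
    using g' unfolding good_def by blast
   then have "\<forall>j. \<exists>k1 k2 k3. \<exists>a\<in>\<rat>. \<exists>b\<in>\<rat>. \<exists>c\<in>\<rat>. derc x1 j (1 / real (Suc l')) (r / real (Suc k1)) a q &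
     derc x2 j (1 / real (Suc l')) (r / real (Suc k2)) b q & derc x3 j (1 / real (Suc l')) (r / real (Suc k3)) c q" by simp
   then obtain k1 k2 k3 a b c where abc: "!!j. a j \<in> \<rat>" "!!j. b j \<in> \<rat>" "!!j. c j \<in> \<rat>"
     "!!j. derc x1 j (1 / real (Suc l')) (r / real (Suc (k1 j))) (a j) q"
     "!!j. derc x2 j (1 / real (Suc l')) (r / real (Suc (k2 j))) (b j) q"
     "!!j. derc x3 j (1 / real (Suc l')) (r / real (Suc (k3 j))) (c j) q" by metis
   have "q \<in> U" using q AU by blast
   then obtain dl where dl: "dl > 0" "qcat dl q" using qc unfolding qcat_def by blast
   obtain k0 :: nat where k0: "r / dl < real k0" using reals_Archimedean2 by blast
   have k0': "r / real (Suc k0) <= dl" using k0 dl r by (simp add: field_simps add_increasing)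
   define k where "k = m + k0 + k1 True + k1 False + k2 True + k2 False + k3 True + k3 False"
   have kk: "m <= k" "k0 <= k" "k1 j <= k" "k2 j <= k" "k3 j <= k" for j by (cases j; simp add: k_def)+
   have T: "tame (real (Suc m)) (r / real (Suc k)) (d m l) c a b q" unfolding tame_def
   proof (intro conjI allI)
    show "qcat (r / real (Suc k)) q" using qcat_mono[OF dl(2)] k0' rmono[OF kk(2)] by simp
    fix j
    show "varc j (real (Suc m)) (r / real (Suc k)) q"
     using mmm[of j] kk(1) by (intro varc_mono[OF mm[of j]] rmono) auto
    show "derc x3 j (d m l) (r / real (Suc k)) (c j) q" using l' by (intro derc_mono[OF abc(6)[of j]] rmono kk) auto
    show "derc x1 j (d m l) (r / real (Suc k)) (a j) q" using l' by (intro derc_mono[OF abc(4)[of j]] rmono kk) auto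
    show "derc x2 j (d m l) (r / real (Suc k)) (b j) q" using l' by (intro derc_mono[OF abc(5)[of j]] rmono kk) auto
   qed
   have eq: "fn (c True) (c False) = c" "fn (a True) (a False) = a" "fn (b True) (b False) = b"
    by (auto simp: fn_def fun_eq_iff)
   have "1 / real (Suc l) <= abs (c j)"
   proof (rule ccontr)
    assume "\<not> ?thesis"
    then have "abs (c j) < 1 / real (Suc l)" by simp
    moreover have "d m l <= 1 / real (Suc l)" by (rule order_trans[OF d(3)]) (simp add: field_simps)
    ultimately have "abs (0 - c j) <= 1 / real (Suc l0) - d m l" unfolding l[symmetric] by linarith
    moreover have "derc x3 j (d m l) (r / real (Suc k)) (c j) q" using T unfolding tame_def by blast
    ultimately have "derc x3 j (1 / real (Suc l0)) (r / real (Suc k)) 0 q" using derc_mono by blast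
    then show False using l0 by blast
   qed
   then have big: "1 / real (Suc l) <= max (abs (c True)) (abs (c False))" by (cases j) auto
   have "\<not> (q \<in> A & tame (real (Suc m)) (r / real (Suc k)) (d m l) (fn (c True) (c False)) (fn (a True) (a False)) (fn (b True) (b False)) q)"
    using no big abc(1-3) by blast
   then show False using T q unfolding eq by blast
  qed
  then show "flat r True q & flat r False q" by blast
 qed
qed

text \<open>Right translations preserve measure, so almost every flow line meets the null set of
  non-flat points in a null set of times. On such a line the third coordinate is absolutely
  continuous with derivative 0 almost everywhere, hence constant. Continuity in the starting point
  removes the exceptional lines.\<close>

lemma flow_invariant:
 assumes A: "open A" and B: "open B" "!!q h. q \<in> B ==> nrm h <= s1 ==> gm 1 q h \<in> A" and AU: "A \<subseteq> U"
  and r: "0 < r" and dom: "!!q s. q \<in> A ==> abs s <= r ==> fl q j s \<in> U" and s1: "0 < s1"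
  and fl: "AE q in lborel. q \<in> A --> flat r j q"
  and ac: "AE p in lborel. p \<in> B --> pair_ac 0 s1 (%s t. rho (f (fl p j s)) (f (fl p j t)))"
  and pt: "p \<in> B" "0 <= t" "t <= s1"
 shows "x3 (f (fl p j t)) = x3 (f p)"
proof -
 define N where "N = {q \<in> A. \<not> flat r j q}"
 have Nb: "N \<in> sets borel"
 proof -
  have "N = A - {q \<in> A. flat r j q}" by (auto simp: N_def)
  then show ?thesis using borel_good(2)[OF A AU dom r] A by simp
 qed
 have N0: "AE q in lborel. q \<notin> N" using fl by eventually_elim (auto simp: N_def)
 have "{z \<in> space (lborel \<Otimes>\<^sub>M lborel). fl (fst z) j (snd z) \<notin> N} \<in> sets (lborel \<Otimes>\<^sub>M lborel)"
 proof -
  have "(%z. fl (fst z) j (snd z)) -` (- N) \<in> sets borel"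
   by (rule measurable_sets_borel[OF borel_measurable_continuous_onI]) (use Nb in \<open>auto intro!: continuous_intros\<close>)
  moreover have "{z. fl (fst z) j (snd z) \<notin> N} = (%z. fl (fst z) j (snd z)) -` (- N)" by auto
  ultimately have "{z. fl (fst z) j (snd z) \<notin> N} \<in> sets borel" by metis
  then show ?thesis unfolding lborel_prod by (simp only: sets_lborel space_lborel space_borel UNIV_I simp_thms)
 qed
 then have "(AE p in lborel. AE s in lborel. fl p j s \<notin> N) \<longleftrightarrow> (AE s in lborel. AE p in lborel. fl p j s \<notin> N)"
  by (rule lborel_pair.AE_commute)
 moreover have "AE s in lborel. AE p in lborel. fl p j s \<notin> N"
  by (intro AE_I2 pres_AE[OF pres_gm_right N0])
 ultimately have AN: "AE p in lborel. AE s in lborel. fl p j s \<notin> N" by blast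
 have BW: "fl q j s \<in> A" if "q \<in> B" "0 <= s" "s <= s1" for q s
  using B(2)[OF that(1), of "gg j s"] that by simp
 have B0: "q \<in> A" if "q \<in> B" for q using BW[OF that, of 0] s1 by simp
 have key: "x3 (f (fl p j t)) = x3 (f p)"
  if p: "p \<in> B" and ae: "AE s in lborel. fl p j s \<notin> N"
   and pac: "pair_ac 0 s1 (%s t. rho (f (fl p j s)) (f (fl p j t)))" for p
 proof -
  define g where "g s = x3 (f (fl p j s))" for s
  obtain S where S: "{s. fl p j s \<in> N} \<subseteq> S" "S \<in> null_sets lborel"
   using ae by (rule AE_E3) auto
  have "negligible S" using S(2) by (simp add: negligible_iff_null_sets null_sets_completionI)
  have "abs_continuous 0 t g" unfolding abs_continuous_pair_ac
   by (rule pair_ac_mono[OF pac]) (use pt in \<open>auto simp: g_def intro: rho_comp_le\<close>)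
  then have "((%_. 0) has_integral g t - g 0) {0..t}"
  proof (rule abs_continuous_fundamental[OF pt(2)])
   show "negligible S" by fact
   fix s assume s: "s \<in> {0..t} - S"
   then have "fl p j s \<notin> N" using S by auto
   moreover have "fl p j s \<in> A" using s pt p by (intro BW) auto
   ultimately have flat: "flat r j (fl p j s)" by (simp add: N_def)
   have "(g has_derivative (%y. 0)) (at s)" unfolding has_derivative_at_alt
   proof (intro conjI allI impI bounded_linear_zero)
    fix e :: real assume "0 < e"
    then obtain l :: nat where l: "1 / real (Suc l) < e" using nat_approx_posE by blast
    obtain k where k: "derc x3 j (1 / real (Suc l)) (r / real (Suc k)) 0 (fl p j s)" using flat unfolding flat_def by blast
    show "\<exists>d>0. \<forall>y. norm (y - s) < d --> norm (g y - g s - 0) <= e * norm (y - s)"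
    proof (intro exI[of _ "r / real (Suc k)"] conjI allI impI)
     fix y assume y: "norm (y - s) < r / real (Suc k)"
     have "abs (g (s + (y - s)) - g s - 0 * (y - s)) <= 1 / real (Suc l) * abs (y - s)"
      using k y unfolding derc_def g_def gm_assoc gg_add by (metis less_imp_le real_norm_def)
     also have "... <= e * abs (y - s)" using l by (intro mult_right_mono) auto
     finally show "norm (g y - g s - 0) <= e * norm (y - s)" by simp
    qed (use r in simp)
   qed
   then show "(g has_vector_derivative 0) (at s within {0..t})"
    by (simp add: has_vector_derivative_def has_derivative_at_withinI)
  qed
  then have "g t - g 0 = 0" using has_integral_unique has_integral_0 by blast
  then show ?thesis by (simp add: g_def)
 qed
 have "AE p in lborel. p \<in> B --> x3 (f (fl p j t)) - x3 (f p) = 0"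
  using AN ac by eventually_elim (auto simp: key)
 moreover have "continuous_on B (%p. x3 (f (fl p j t)) - x3 (f p))" using BW[OF _ pt(2,3)] B0 AU
  by (intro continuous_intros flow_continuous continuous_on_subset[OF cont]) auto
 ultimately have "x3 (f (fl p j t)) - x3 (f p) = 0" using AE_open_imp_all[OF B(1)] pt(1) by blast
 then show ?thesis by simp
qed

end

section \<open>Reaching a neighbourhood by words in the two flows\<close>

definition word_act :: "(bool \<times> real) list => r5 => r5" where
 "word_act ws p = foldl (%q w. fl q (fst w) (snd w)) p ws"

lemma word_act_simps [simp]:
 "word_act [] p = p" "word_act (w # ws) p = word_act ws (fl p (fst w) (snd w))"
 "word_act (vs @ ws) p = word_act ws (word_act vs p)" by (simp_all add: word_act_def)

text \<open>The group commutator of the two flows, for times \<open>a\<close> and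
  \<open>t\<close>.\<close>

definition loop_word :: "real => real => (bool \<times> real) list" where
 "loop_word a t = [(True, a), (False, t), (True, - a), (False, - t)]"

lemma loop_word_act: "word_act (loop_word a t) p = gm 1 p (0, 0, a * t, a\<^sup>2 * t / 2, a * t\<^sup>2 / 2)"
 by (simp add: loop_word_def gg_def gm_def prod_eq_iff field_simps power2_eq_square)

text \<open>\<open>gz\<close>, \<open>gt\<close> and \<open>ga\<close> measure what is left of
  coordinates three, four and five of \<open>h\<close> after the earlier letters of
  \<open>gen_word\<close>; \<open>e\<close> is a fixed auxiliary loop length.\<close>

definition gz :: "r5 => real" where
 "gz h = x3 h - x1 h * x2 h"

definition gt :: "real => r5 => real" where
 "gt e h = (x4 h - (x1 h)\<^sup>2 * x2 h / 2 - x1 h * gz h - e * gz h / 2) / e\<^sup>2"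

definition ga :: "real => r5 => real" where
 "ga e h = (x5 h - x1 h * (x2 h)\<^sup>2 / 2 - x2 h * gz h - (gz h)\<^sup>2 / (2 * e)) / e\<^sup>2"

definition gen_word :: "real => r5 => (bool \<times> real) list" where
 "gen_word e h = [(True, x1 h), (False, x2 h)] @ loop_word e (gz h / e) @ loop_word e (gt e h) @
   loop_word (- e) (gt e h) @ loop_word (ga e h) e @ loop_word (ga e h) (- e)"

text \<open>Two loops with opposite \<open>d\<close> and the same \<open>t\<close> cancel in
  coordinates three and five and add up to \<open>t * d\<^sup>2\<close> in the fourth; exchanging
  the roles of the flows gives the fifth. Here \<open>k = 1\<close> enters: X1 and X2 generate the
  whole algebra.\<close>

lemma gen_word_act:
 assumes "d ~= 0" shows "word_act (gen_word d h) p = gm 1 p h"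
proof -
 define z where "z = gz h"
 define t where "t = gt d h"
 define a where "a = ga d h"
 have h: "x3 h = z + x1 h * x2 h" "x4 h = t * d\<^sup>2 + (x1 h)\<^sup>2 * x2 h / 2 + x1 h * z + d * z / 2"
  "x5 h = a * d\<^sup>2 + x1 h * (x2 h)\<^sup>2 / 2 + x2 h * z + z\<^sup>2 / (2 * d)"
  using assms by (simp_all add: z_def t_def a_def gz_def gt_def ga_def)
 have e: "d * (z / d) = z" "d\<^sup>2 * (z / d) / 2 = d * z / 2" "d * (z / d)\<^sup>2 / 2 = z\<^sup>2 / (2 * d)"
  using assms by (simp_all add: field_simps power2_eq_square)
 define w where "w = d * z / 2"
 define g where "g = z\<^sup>2 / (2 * d)"
 have "fl (fl p True (x1 h)) False (x2 h) = gm 1 p (x1 h, x2 h, x1 h * x2 h, (x1 h)\<^sup>2 * x2 h / 2, x1 h * (x2 h)\<^sup>2 / 2)"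
  by (simp add: gg_def gm_def prod_eq_iff field_simps power2_eq_square)
 moreover have "gm 1 (gm 1 p (0, 0, d * t, d\<^sup>2 * t / 2, d * t\<^sup>2 / 2)) (0, 0, - d * t, (- d)\<^sup>2 * t / 2, - d * t\<^sup>2 / 2) = gm 1 p (0, 0, 0, t * d\<^sup>2, 0)" for p
  by (simp add: gm_def prod_eq_iff field_simps power2_eq_square)
 moreover have "gm 1 (gm 1 p (0, 0, a * d, a\<^sup>2 * d / 2, a * d\<^sup>2 / 2)) (0, 0, a * - d, a\<^sup>2 * - d / 2, a * (- d)\<^sup>2 / 2) = gm 1 p (0, 0, 0, 0, a * d\<^sup>2)" for p
  by (simp add: gm_def prod_eq_iff field_simps power2_eq_square)
 moreover have "gm 1 (gm 1 (gm 1 (gm 1 p (x1 h, x2 h, x1 h * x2 h, (x1 h)\<^sup>2 * x2 h / 2, x1 h * (x2 h)\<^sup>2 / 2)) (0, 0, z, w, g)) (0, 0, 0, t * d\<^sup>2, 0)) (0, 0, 0, 0, a * d\<^sup>2) = gm 1 p h"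
  unfolding gm_def prod_eq_iff fst_conv snd_conv h w_def[symmetric] g_def[symmetric] by (simp add: field_simps power2_eq_square)
 ultimately show ?thesis unfolding gen_word_def
  by (simp only: word_act_simps loop_word_act e fst_conv snd_conv flip: z_def t_def a_def w_def g_def)
qed

lemma gen_word_length: "length (gen_word e h) = 22" by (simp add: gen_word_def loop_word_def)

lemma loop_word_bounded:
 assumes "abs b1 <= s" "abs b2 <= s" "abs z <= s" "abs t <= s" "abs a <= s"
 shows "list_all (%w. abs (snd w) <= s) ([(True, b1), (False, b2)] @ loop_word s z @ loop_word s t @ loop_word (- s) t @ loop_word a s @ loop_word a (- s))"
 using assms abs_ge_zero[of b1] by (simp add: loop_word_def)

text \<open>The loop length \<open>t\<close> is held fixed; all other step sizes depend continuously
  on \<open>h\<close> and vanish at 0.\<close>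

lemma gen_word_small:
 assumes "0 < t"
 obtains V where "open V" "0 \<in> V" "!!h w. h \<in> V ==> w \<in> set (gen_word t h) ==> abs (snd w) <= t"
proof -
 define P where "P h = max (abs (x1 h)) (max (abs (x2 h)) (max (abs (gz h / t)) (max (abs (gt t h)) (abs (ga t h)))))" for h
 have "continuous_on UNIV P"
  unfolding P_def gt_def ga_def gz_def using assms by (intro continuous_intros) auto
 then have "open (P -` {..<t})" by (intro open_vimage) auto
 moreover have "0 \<in> P -` {..<t}" using assms by (simp add: P_def gt_def ga_def gz_def)
 moreover have "abs (snd w) <= t" if "h \<in> P -` {..<t}" "w \<in> set (gen_word t h)" for h w
 proof -
  have b: "abs (x1 h) <= t" "abs (x2 h) <= t" "abs (gz h / t) <= t" "abs (gt t h) <= t" "abs (ga t h) <= t"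
   using that(1) unfolding vimage_def mem_Collect_eq lessThan_iff P_def max_less_iff_conj by (simp_all only: less_imp_le)
  show ?thesis using that(2) loop_word_bounded[OF b] unfolding gen_word_def by (auto simp: list_all_iff)
 qed
 ultimately show ?thesis by (rule that)
qed

lemma nest_subset:
 assumes "!!p h. p \<in> B ==> nrm h <= r ==> gm k p h \<in> A" "0 < r"
 shows "B \<subseteq> A"
proof
 fix p assume "p \<in> B"
 then have "gm k p 0 \<in> A" using assms(2) by (intro assms(1)) (simp_all add: nrm_eq_0_iff[THEN iffD2])
 then show "p \<in> A" by simp
qed

text \<open>Each further letter of the word needs one more neighbourhood with a margin.\<close>

lemma word_invariance:
 assumes A: "open A" "p0 \<in> A" and s: "0 < s"
  and inv: "!!p j t. p \<in> A ==> abs t <= s ==> fl p j t \<in> A ==> u (fl p j t) = u p"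
 shows "\<exists>B tr. open B & p0 \<in> B & 0 < tr & B \<subseteq> A &
  (\<forall>p\<in>B. \<forall>ws. length ws = n --> (\<forall>w\<in>set ws. abs (snd w) <= tr) --> u (word_act ws p) = u p)"
proof (induction n)
 case 0
 show ?case using A s by (intro exI[of _ A] exI[of _ s]) auto
next
 case (Suc n)
 then obtain B tr where B: "open B" "p0 \<in> B" "0 < tr" "B \<subseteq> A"
  "!!p ws. p \<in> B ==> length ws = n ==> (\<forall>w\<in>set ws. abs (snd w) <= tr) ==> u (word_act ws p) = u p" by blast
 obtain B' r where B': "open B'" "p0 \<in> B'" "0 < r" "r <= 1" "!!p h. p \<in> B' ==> nrm h <= r ==> gm 1 p h \<in> B"
  using gm_nest[OF B(1,2)] by blast
 have B'B: "B' \<subseteq> B" by (rule nest_subset[OF B'(5,3)])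
 have "u (word_act ws p) = u p"
  if p: "p \<in> B'" and ws: "length ws = Suc n" "\<forall>w\<in>set ws. abs (snd w) <= min (min tr r) s" for p ws
 proof -
  obtain w vs where w: "ws = w # vs" using ws by (cases ws) auto
  have "fl p (fst w) (snd w) \<in> B" using ws w by (intro B'(5)[OF p]) (simp add: nrm_gg)
  moreover from this have "u (fl p (fst w) (snd w)) = u p" using ws w B(4) B'B p by (intro inv) auto
  ultimately show ?thesis using B(5)[of _ vs] ws w by simp
 qed
 then show ?case using B' B'B B(3,4) s by (rule_tac exI[of _ B'], rule_tac exI[of _ "min (min tr r) s"]) auto
qed

lemma flow_invariant_const:
 assumes "open A" "p0 \<in> A" "0 < s"
  and "!!p j t. p \<in> A ==> abs t <= s ==> fl p j t \<in> A ==> u (fl p j t) = u p"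
 obtains B where "open B" "p0 \<in> B" "B \<subseteq> A" "!!p. p \<in> B ==> u p = u p0"
proof -
 have "\<exists>B tr. open B & p0 \<in> B & 0 < tr & B \<subseteq> A &
  (\<forall>p\<in>B. \<forall>ws. length ws = 22 --> (\<forall>w\<in>set ws. abs (snd w) <= tr) --> u (word_act ws p) = u p)"
  by (rule word_invariance[OF assms(1-3)]) (rule assms(4))
 then obtain B tr where B: "open B" "p0 \<in> B" "0 < tr" "B \<subseteq> A"
  "\<forall>p\<in>B. \<forall>ws. length ws = 22 --> (\<forall>w\<in>set ws. abs (snd w) <= tr) --> u (word_act ws p) = u p"
  by (elim exE conjE) (rule that)
 obtain V where V: "open V" "0 \<in> V" "!!h w. h \<in> V ==> w \<in> set (gen_word tr h) ==> abs (snd w) <= tr"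
  using gen_word_small[OF B(3)] by blast
 have "open (gm 1 (gi 1 p0) -` V)" using V(1) by (intro open_vimage) (auto intro!: continuous_intros)
 then have "open (gm 1 (gi 1 p0) -` V \<inter> A)" using assms(1) by auto
 moreover have "u p = u p0" if "p \<in> gm 1 (gi 1 p0) -` V \<inter> A" for p
 proof -
  have "u (word_act (gen_word tr (gm 1 (gi 1 p0) p)) p0) = u p0"
   using that by (intro B(5)[rule_format, OF B(2)] V(3)) (auto simp only: gen_word_length)
  then show ?thesis using B(3) by (simp add: gen_word_act)
 qed
 moreover have "p0 \<in> gm 1 (gi 1 p0) -` V \<inter> A" using V(2) assms(2) by simp
 ultimately show ?thesis by (rule_tac that[of "gm 1 (gi 1 p0) -` V \<inter> A"]) (assumption | blast)+
qed

section \<open>The contradiction\<close>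

context qc_setup begin

theorem no_qc: assumes "U ~= {}" shows False
proof -
 obtain p0 where p0: "p0 \<in> U" using assms by blast
 obtain R where R: "0 < R" "cball p0 R \<subseteq> U" using U p0 open_contains_cball by blast
 define W where "W = ball p0 R"
 have W: "open W" "W \<subseteq> U" "p0 \<in> W" using R ball_subset_cball by (auto simp: W_def)
 have "compact (f ` cball p0 R)" by (intro compact_continuous_image continuous_on_subset[OF cont] R) auto
 then have "bounded (f ` W)" by (rule bounded_subset[OF compact_imp_bounded]) (auto simp: W_def)
 then have fin: "emeasure lborel (f ` W) < \<infinity>" by (rule emeasure_bounded_finite)
 \<comment> \<open>Absolute continuity holds on almost every flow line from \<open>A1\<close>,
   flatness almost everywhere in \<open>A2\<close>, and invariance along the flow from
   \<open>A3\<close>.\<close>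
 obtain A1 r1 where A1: "open A1" "p0 \<in> A1" "0 < r1" "r1 <= 1" "!!p h. p \<in> A1 ==> nrm h <= r1 ==> gm 1 p h \<in> W"
  using gm_nest[OF W(1,3)] by blast
 obtain A2 r2 where A2: "open A2" "p0 \<in> A2" "0 < r2" "r2 <= 1" "!!p h. p \<in> A2 ==> nrm h <= r2 ==> gm 1 p h \<in> A1"
  using gm_nest[OF A1(1,2)] by blast
 obtain A3 r3 where A3: "open A3" "p0 \<in> A3" "0 < r3" "r3 <= 1" "!!p h. p \<in> A3 ==> nrm h <= r3 ==> gm 1 p h \<in> A2"
  using gm_nest[OF A2(1,2)] by blast
 have sub1: "A1 \<subseteq> W" by (rule nest_subset[OF A1(5,3)])
 have sub2: "A2 \<subseteq> A1" by (rule nest_subset[OF A2(5,3)])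
 have sub3: "A3 \<subseteq> A2" by (rule nest_subset[OF A3(5,3)])
 note sub = sub1 sub2 sub3
 define B where "B = 2 * (1 + 2 * C)"
 have B: "0 < B" using C by (simp add: B_def)
 define s0 where "s0 = min r1 (min r2 (min r3 (1 / B)))"
 have s0: "0 < s0" "s0 <= r1" "s0 <= r2" "s0 <= r3" using B A1 A2 A3 by (auto simp: s0_def)
 have "B * s0 <= B * (1 / B)" using B by (intro mult_left_mono) (auto simp: s0_def)
 then have Bs: "B * s0 <= 1" using B by simp
 have ac: "AE p in lborel. p \<in> A1 --> pair_ac 0 s0 (%s t. rho (f (fl p j s)) (f (fl p j t)))" for j
  using liminf_tube_finite[OF W(1,2) fin s0(1) Bs B, of j]
 proof eventually_elim
  case (elim p)
  show ?case
  proof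
   assume "p \<in> A1"
   then show "pair_ac 0 s0 (%s t. rho (f (fl p j s)) (f (fl p j t)))"
    using s0 by (intro curve_ac[OF W(1,2) fin s0(1) B_def _ elim] A1(5)) (auto simp: nrm_gg)
  qed
 qed
 have dom: "fl q j s \<in> U" if "q \<in> A1" "abs s <= r1" for q j s
  using A1(5)[OF that(1), of "gg j s"] that(2) W by (auto simp: nrm_gg)
 have gd: "AE q in lborel. q \<in> A2 --> good r1 j q" for j
 proof -
  define N where "N = A1 - {q \<in> A1. good r1 j q}"
  have "N \<in> sets borel" unfolding N_def
   using borel_good(1)[OF A1(1) _ dom A1(3), of j] sub W A1(1) by auto
  moreover have "AE p in lborel. p \<in> A1 --> (AE s in lborel. 0 < s & s < s0 --> fl p j s \<notin> N)"
   using ac[of j]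
  proof eventually_elim
   case (elim p)
   show ?case
   proof
    assume p: "p \<in> A1"
    have "negligible {s. 0 < s & s < s0 & \<not> good r1 j (fl p j s)}"
     using good_ae_on_curve[OF _ s0(1) A1(3)] elim p by blast
    then have "AE s in lebesgue. s \<notin> {s. 0 < s & s < s0 & \<not> good r1 j (fl p j s)}"
     by (intro AE_not_in) (simp add: negligible_iff_null_sets)
    then have "AE s in lborel. s \<notin> {s. 0 < s & s < s0 & \<not> good r1 j (fl p j s)}"
     by (simp add: AE_completion_iff)
    then show "AE s in lborel. 0 < s & s < s0 --> fl p j s \<notin> N" by eventually_elim (auto simp: N_def)
   qed
  qed
  ultimately have "AE s in lborel. 0 < s & s < s0 --> (AE p in lborel. p \<in> A1 --> fl p j s \<notin> N)"
   using A1(1) by (intro flow_AE_swap) auto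
  then have *: "AE s in lborel. s \<in> {0<..<s0} --> (AE p in lborel. p \<in> A1 --> fl p j s \<notin> N)" by simp
  have "\<exists>s\<in>{0<..<s0}. AE p in lborel. p \<in> A1 --> fl p j s \<notin> N"
  proof (rule ccontr)
   assume no: "\<not> ?thesis"
   have "AE s in lborel. s \<in> {0<..<s0} --> (1::real) = 0" using * by eventually_elim (use no in blast)
   then have "(1::real) = 0"
    by (rule AE_open_imp_all[of "{0<..<s0}" "%_. 1" "s0 / 2", rotated 2]) (use s0 in auto)
   then show False by simp
  qed
  \<comment> \<open>At one time \<open>s\<close> almost every flow point is good. Flowing back by
    \<open>- s\<close> preserves null sets, so almost every point of \<open>A2\<close> is itself
    good.\<close>
  then obtain s where s: "0 < s" "s < s0" "AE p in lborel. p \<in> A1 --> fl p j s \<notin> N"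
   unfolding Bex_def greaterThanLessThan_iff by (elim exE conjE) (rule that)
  have "AE p in lborel. fl p j (- s) \<in> A1 --> fl (fl p j (- s)) j s \<notin> N"
   by (rule pres_AE[OF pres_gm_right s(3)])
  then show ?thesis
  proof eventually_elim
   case (elim p)
   have "fl (fl p j (- s)) j s = p" by (simp add: gm_assoc gg_add)
   moreover have "p \<in> A2 ==> fl p j (- s) \<in> A1" using s s0 by (intro A2(5)) (auto simp: nrm_gg)
   ultimately show ?case using elim sub by (auto simp: N_def)
  qed
 qed
 have A2W: "gm 1 q h \<in> W" if "q \<in> A2" "nrm h <= r1" for q h using A1(5) sub that by blast
 have fl: "AE q in lborel. q \<in> A2 --> flat r1 j q" for j
 proof -
  have "AE q in lborel. q \<in> A2 --> good r1 True q --> good r1 False q --> flat r1 True q & flat r1 False q"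
   by (rule good_imp_flat_ae[OF W(1,2) A2(1) A2W A1(3,4)])
  then show ?thesis using gd[of True] gd[of False] by eventually_elim (cases j; auto)
 qed
 have inv: "x3 (f (fl p j t)) = x3 (f p)" if "p \<in> A3" "0 <= t" "t <= s0" for p j t
 proof (rule flow_invariant[OF A2(1) A3(1) _ _ A1(3) _ s0(1) fl _ that])
  show "gm 1 q h \<in> A2" if "q \<in> A3" "nrm h <= s0" for q h using A3(5) that s0 by auto
  show "A2 \<subseteq> U" using sub W by auto
  show "fl q j s \<in> U" if "q \<in> A2" "abs s <= r1" for q s using dom sub that by blast
  show "AE p in lborel. p \<in> A3 --> pair_ac 0 s0 (%s t. rho (f (fl p j s)) (f (fl p j t)))"
   using ac[of j] by eventually_elim (use sub in auto)
 qed
 have inv': "x3 (f (fl p j t)) = x3 (f p)" if "p \<in> A3" "abs t <= s0" "fl p j t \<in> A3" for p j t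
 proof (cases "0 <= t")
  case True then show ?thesis using inv that by simp
 next
  case False
  have "x3 (f (fl (fl p j t) j (- t))) = x3 (f (fl p j t))" using that False by (intro inv) auto
  then show ?thesis by (simp add: gm_assoc gg_add)
 qed
 obtain Q where Q: "open Q" "p0 \<in> Q" "Q \<subseteq> A3" "!!p. p \<in> Q ==> x3 (f p) = x3 (f p0)"
  by (rule flow_invariant_const[OF A3(1,2) s0(1), of "%p. x3 (f p)"]) ((rule that inv' | assumption)+)
 have "open (f ` Q)" using Q sub W by (intro open_image) auto
 then have "open (fst ` snd ` snd ` f ` Q)" by (intro open_image_fst open_image_snd)
 moreover have "fst ` snd ` snd ` f ` Q = (%p. x3 (f p)) ` Q" by (simp only: image_image)
 moreover have "(%p. x3 (f p)) ` Q = (%p. x3 (f p0)) ` Q" by (rule image_cong) (rule refl, rule Q(4))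
 moreover have "(%p. x3 (f p0)) ` Q = {x3 (f p0)}" by (rule image_constant[OF Q(2)])
 ultimately show False using not_open_singleton by metis
qed

end

section \<open>Smooth functions on Euclidean space\<close>

abbreviation Es :: "nat => (nat => real) set" where
 "Es n \<equiv> topspace (Euclidean_space n)"

abbreviation eopen :: "nat => (nat => real) set => bool" where
 "eopen n S \<equiv> openin (Euclidean_space n) S"

definition pdv :: "nat => ((nat => real) => real) => (nat => real) => real" where
 "pdv i f x = deriv (%t. f (x(i := t))) (x i)"

lemma Es_iff: "x \<in> Es n \<longleftrightarrow> (\<forall>i\<ge>n. x i = 0)"
 by (simp add: topspace_Euclidean_space)

lemma Euclidean_space_top_of_set: "Euclidean_space n = top_of_set (Es n)"
 by (simp add: topspace_Euclidean_space) (simp add: Euclidean_space_def euclidean_product_topology)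

lemma openin_Es_iff: "eopen n S \<longleftrightarrow> (\<exists>T. open T & S = Es n \<inter> T)"
 by (subst Euclidean_space_top_of_set) (rule openin_open)

lemma openin_Es_subset: "eopen n S ==> S \<subseteq> Es n" by (rule openin_subset)

lemma fun_upd_Es [simp]: "x \<in> Es n ==> i < n ==> x(i := t) \<in> Es n" by (simp add: Es_iff)

lemma continuous_map_Es: "S \<subseteq> Es n ==> continuous_map (subtopology (Euclidean_space n) S) euclideanreal f \<longleftrightarrow> continuous_on S f"
 by (subst Euclidean_space_top_of_set) (simp add: subtopology_subtopology Int_absorb1)

lemma continuous_on_fun_upd [continuous_intros]: "continuous_on S (%t. (x :: nat => real)(i := t))"
 by (intro continuous_on_coordinatewise_then_product) (rename_tac j, case_tac "j = i"; simp add: continuous_on_id)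

text \<open>Coordinates from \<open>n\<close> on vanish and agree automatically, so the minimum of
  finitely many radii suffices.\<close>

lemma openin_Es_box:
 assumes "eopen n S" "x \<in> S"
 shows "\<exists>e>0. \<forall>y\<in>Es n. (\<forall>i<n. abs (y i - x i) < e) --> y \<in> S"
proof -
 obtain T where T: "open T" "S = Es n \<inter> T" using assms(1) by (auto simp: openin_Es_iff)
 then have "\<exists>U. finite {i. U i ~= topspace euclideanreal} & (\<forall>i. openin euclideanreal (U i)) & x \<in> PiE UNIV U & PiE UNIV U \<subseteq> T"
  using assms(2) unfolding open_fun_def openin_product_topology_alt by auto
 then obtain U where U: "!!i. open (U i)" "x \<in> PiE UNIV U" "PiE UNIV U \<subseteq> T" by auto
 have "\<exists>d>0. \<forall>y. abs (y - x i) < d --> y \<in> U i" for i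
  using U(1)[of i] U(2) unfolding open_dist dist_real_def PiE_iff by auto
 then obtain d where d: "!!i. 0 < d i" "!!i y. abs (y - x i) < d i ==> y \<in> U i" by metis
 define e where "e = Min (insert 1 (d ` {..<n}))"
 have "0 < e" using d(1) by (simp add: e_def)
 moreover have "y \<in> S" if y: "y \<in> Es n" "\<forall>i<n. abs (y i - x i) < e" for y
 proof -
  have "y i \<in> U i" for i
  proof (cases "i < n")
   case True
   then have "e <= d i" by (simp add: e_def)
   then show ?thesis using d(2) y(2) True by force
  next
   case False
   then have "y i = x i" using y(1) assms T by (auto simp: Es_iff)
   then show ?thesis using U(2) by (simp add: PiE_iff)
  qed
  then show ?thesis using U(3) y(1) T(2) by (auto simp: PiE_iff)
 qed
 ultimately show ?thesis by blast
qed

lemma openin_Es_boxI: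
 assumes "S \<subseteq> Es n" "!!x. x \<in> S ==> \<exists>d>0. \<forall>y\<in>Es n. (\<forall>i<n. abs (y i - x i) < d) --> y \<in> S"
 shows "eopen n S"
proof (subst openin_subopen, intro ballI)
 fix x assume x: "x \<in> S"
 obtain d where d: "0 < d" "!!y. y \<in> Es n ==> (\<forall>i<n. abs (y i - x i) < d) ==> y \<in> S" using assms(2)[OF x] by blast
 have "open (\<Inter>i<n. {y :: nat => real. abs (y i - x i) < d})"
  by (intro open_INT open_Collect_less continuous_intros ballI finite_lessThan continuous_on_product_coordinates) 
 then have "eopen n (Es n \<inter> (\<Inter>i<n. {y. abs (y i - x i) < d}))" unfolding openin_Es_iff by blast
 then show "\<exists>T. eopen n T & x \<in> T & T \<subseteq> S"
  by (rule_tac exI[of _ "Es n \<inter> (\<Inter>i<n. {y. abs (y i - x i) < d})"]) (use d x assms(1) in auto)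
qed

lemma openin_Es_upd:
 assumes "eopen n S" "x \<in> S" "i < n"
 shows "eventually (%t. x(i := t) \<in> S) (nhds (x i))"
proof -
 obtain d where d: "0 < d" "!!y. y \<in> Es n ==> (\<forall>i<n. abs (y i - x i) < d) ==> y \<in> S"
  using openin_Es_box[OF assms(1,2)] by blast
 have "x \<in> Es n" using assms openin_Es_subset by auto
 then have "x(i := t) \<in> S" if "abs (t - x i) < d" for t using that d(1) assms(3) by (intro d(2)) auto
 then show ?thesis unfolding eventually_nhds_metric dist_real_def using d(1) by blast
qed

lemma pdv_cong:
 assumes "eopen n S" "!!x. x \<in> S ==> f x = g x" "x \<in> S" "i < n"
 shows "pdv i f x = pdv i g x"
  and "(%t. f (x(i := t))) differentiable (at (x i)) \<longleftrightarrow> (%t. g (x(i := t))) differentiable (at (x i))" (is ?P1)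
proof -
 have ev: "eventually (%t. f (x(i := t)) = g (x(i := t))) (nhds (x i))"
  using openin_Es_upd[OF assms(1,3,4)] by eventually_elim (rule assms(2))
 show "pdv i f x = pdv i g x" unfolding pdv_def by (rule deriv_cong_ev[OF ev refl])
 show ?P1 unfolding real_differentiable_def using DERIV_cong_ev[OF refl ev refl] by simp
qed

lemma Ck_simps:
 assumes "S \<subseteq> Es n"
 shows "Ck n 0 S f \<longleftrightarrow> continuous_on S f"
  and "Ck n (Suc k) S f \<longleftrightarrow> continuous_on S f &
   (\<forall>i<n. (\<forall>x\<in>S. (%t. f (x(i := t))) differentiable (at (x i))) & Ck n k S (pdv i f))"
 using assms by (simp_all add: continuous_map_Es pdv_def[abs_def])

declare Ck.simps [simp del]

lemma Ck_continuous: "S \<subseteq> Es n ==> Ck n k S f ==> continuous_on S f"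
 by (cases k) (simp_all add: Ck_simps)

lemma Ck_Suc_imp: "S \<subseteq> Es n ==> Ck n (Suc k) S f ==> Ck n k S f"
 by (induction k arbitrary: f) (simp_all add: Ck_simps)

lemma Ck_subset: "T \<subseteq> S ==> S \<subseteq> Es n ==> Ck n k S f ==> Ck n k T f"
proof (induction k arbitrary: f)
 case 0
 then show ?case by (simp add: Ck_simps order_trans[OF 0(1,2)]) (rule continuous_on_subset)
next
 case (Suc k)
 then show ?case using continuous_on_subset[OF _ Suc(2)] by (simp add: Ck_simps order_trans[OF Suc(2,3)]) blast
qed

lemma Ck_cong:
 assumes "eopen n S" "!!x. x \<in> S ==> f x = g x"
 shows "Ck n k S f \<longleftrightarrow> Ck n k S g" using assms(2)
proof (induction k arbitrary: f g)
 case 0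
 then show ?case using continuous_on_cong[OF refl, of S f g] by (simp add: Ck_simps openin_Es_subset[OF assms(1)])
next
 case (Suc k)
 note s = openin_Es_subset[OF assms(1)]
 have "Ck n k S (pdv i f) = Ck n k S (pdv i g)" if "i < n" for i
  by (rule Suc(1), rule pdv_cong(1)[OF assms(1)]) (use Suc(2) that in auto)
 moreover have "continuous_on S f = continuous_on S g" by (rule continuous_on_cong[OF refl Suc(2)])
 moreover have "!!i x. i < n ==> x \<in> S ==> (%t. f (x(i := t))) differentiable (at (x i)) \<longleftrightarrow> (%t. g (x(i := t))) differentiable (at (x i))"
  by (rule pdv_cong(2)[OF assms(1) Suc(2)])
 ultimately show ?case unfolding Ck_simps(2)[OF s] by blast
qed

lemma pdv_const [simp]: "pdv i (%x. c) = (%x. 0)" by (simp add: pdv_def fun_eq_iff)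

lemma pdv_coord: "pdv i (%x. x j) = (%x. if i = j then 1 else 0)" by (auto simp: pdv_def fun_eq_iff)

lemma Ck_const: "S \<subseteq> Es n ==> Ck n k S (%x. c)"
 by (induction k arbitrary: c) (simp_all add: Ck_simps)

lemma Ck_coord: "S \<subseteq> Es n ==> Ck n k S (%x. x j)"
proof (cases k)
 case 0 assume "S \<subseteq> Es n"
 then show ?thesis using 0 by (simp add: Ck_simps continuous_on_subset[OF continuous_on_product_coordinates])
next
 case (Suc k) assume S: "S \<subseteq> Es n"
 have "(%t. (x(i := t)) j) differentiable (at (x i))" for x :: "nat => real" and i by (cases "i = j") auto
 then show ?thesis using S Suc
  by (simp add: Ck_simps pdv_coord continuous_on_subset[OF continuous_on_product_coordinates] Ck_const del: fun_upd_apply)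
qed

lemma pdv_DERIV:
 "(%t. f (x(i := t))) differentiable (at (x i)) ==> ((%t. f (x(i := t))) has_real_derivative pdv i f x) (at (x i))"
 unfolding pdv_def by (metis DERIV_imp_deriv real_differentiable_def)

lemma pdv_eqI: "((%t. f (x(i := t))) has_real_derivative d) (at (x i)) ==> pdv i f x = d"
 unfolding pdv_def by (rule DERIV_imp_deriv)

lemma Ck_diff_DERIV:
 assumes "S \<subseteq> Es n" "Ck n (Suc k) S f" "i < n" "x \<in> S"
 shows "((%t. f (x(i := t))) has_real_derivative pdv i f x) (at (x i))"
 using assms by (intro pdv_DERIV) (simp add: Ck_simps)

lemma Ck_SucI:
 assumes S: "eopen n S" and "continuous_on S f"
  and "!!i x. i < n ==> x \<in> S ==> ((%t. f (x(i := t))) has_real_derivative d i x) (at (x i))"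
  and "!!i. i < n ==> Ck n k S (d i)"
 shows "Ck n (Suc k) S f"
proof -
 have "Ck n k S (pdv i f)" if "i < n" for i
 proof (subst Ck_cong[OF S])
  show "pdv i f x = d i x" if "x \<in> S" for x using assms(3)[OF \<open>i < n\<close> that] by (rule pdv_eqI)
 qed (rule assms(4)[OF that])
 then show ?thesis using assms openin_Es_subset[OF S] unfolding Ck_simps(2)[OF openin_Es_subset[OF S]] real_differentiable_def by blast
qed

lemma Ck_add:
 assumes S: "eopen n S" and "Ck n k S f" "Ck n k S g"
 shows "Ck n k S (%x. f x + g x)" using assms(2,3)
proof (induction k arbitrary: f g)
 case 0
 then show ?case by (simp add: Ck_simps openin_Es_subset[OF S] continuous_on_add)
next
 case (Suc k)
 note s = openin_Es_subset[OF S]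
 show ?case
 proof (rule Ck_SucI[OF S])
  show "continuous_on S (%x. f x + g x)" using Suc(2,3) by (intro continuous_on_add Ck_continuous[OF s])
  show "((%t. f (x(i := t)) + g (x(i := t))) has_real_derivative pdv i f x + pdv i g x) (at (x i))" if "i < n" "x \<in> S" for i x
   using Ck_diff_DERIV[OF s Suc(2) that] Ck_diff_DERIV[OF s Suc(3) that] by (rule DERIV_add)
  show "Ck n k S (%x. pdv i f x + pdv i g x)" if "i < n" for i
   using Suc(2,3) that by (intro Suc(1)) (simp_all add: Ck_simps s)
 qed
qed

lemma Ck_mult:
 assumes S: "eopen n S" and "Ck n k S f" "Ck n k S g"
 shows "Ck n k S (%x. f x * g x)" using assms(2,3)
proof (induction k arbitrary: f g)
 case 0
 then show ?case by (simp add: Ck_simps openin_Es_subset[OF S] continuous_on_mult)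
next
 case (Suc k)
 note s = openin_Es_subset[OF S]
 show ?case
 proof (rule Ck_SucI[OF S])
  show "continuous_on S (%x. f x * g x)" using Suc(2,3) by (intro continuous_on_mult Ck_continuous[OF s])
  show "((%t. f (x(i := t)) * g (x(i := t))) has_real_derivative pdv i f x * g x + pdv i g x * f x) (at (x i))" if "i < n" "x \<in> S" for i x
   using DERIV_mult[OF Ck_diff_DERIV[OF s Suc(2) that] Ck_diff_DERIV[OF s Suc(3) that]] unfolding fun_upd_triv .
  show "Ck n k S (%x. pdv i f x * g x + pdv i g x * f x)" if "i < n" for i
   using Ck_Suc_imp[OF s Suc(2)] Ck_Suc_imp[OF s Suc(3)] Suc(2,3) that by (intro Ck_add[OF S] Suc(1)) (simp_all add: Ck_simps s)
 qed
qed

lemma Ck_sum: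
 assumes S: "eopen n S" and "!!j. j \<in> J ==> Ck n k S (f j)"
 shows "Ck n k S (%x. \<Sum>j\<in>J. f j x)" using assms(2)
proof (induction J rule: infinite_finite_induct)
 case (insert j J)
 then show ?case by (simp add: Ck_add[OF S])
qed (simp_all add: Ck_const openin_Es_subset[OF S])

text \<open>Telescoping along the coordinates and the mean value theorem.\<close>

lemma C1_slopes:
 assumes S: "eopen n S" and f: "Ck n (Suc 0) S f" and x: "x \<in> S"
 shows "\<exists>g. (\<forall>y\<in>Es n. f y - f x = (\<Sum>j<n. g j y * (y j - x j))) &
  (\<forall>e>0. \<exists>d>0. \<forall>y\<in>Es n. \<forall>j<n. (\<forall>i<n. abs (y i - x i) < d) --> abs (g j y - pdv j f x) < e)"
proof -
 note s = openin_Es_subset[OF S]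
 have xE: "x \<in> Es n" using x s by auto
 define z where "z y j = (%i. if i < j then y i else x i)" for y :: "nat => real" and j :: nat
 have zE: "z y j \<in> Es n" if "y \<in> Es n" for y j using that xE by (auto simp: z_def Es_iff)
 have zS: "z y (Suc j) = (z y j)(j := y j)" for y j by (auto simp: z_def fun_eq_iff less_Suc_eq)
 have zx: "(z y j)(j := x j) = z y j" for y j by (auto simp: z_def fun_eq_iff)
 define g where "g j y = (if y j = x j then pdv j f x else (f (z y (Suc j)) - f (z y j)) / (y j - x j))" for j y
 have "f y - f x = (\<Sum>j<n. g j y * (y j - x j))" if "y \<in> Es n" for y
 proof -
  have "g j y * (y j - x j) = f (z y (Suc j)) - f (z y j)" for j
  proof (cases "y j = x j")
   case True
   then have "z y (Suc j) = z y j" unfolding zS using zx[of y j] by simp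
   then show ?thesis using True by simp
  qed (simp add: g_def)
  then have "(\<Sum>j<n. g j y * (y j - x j)) = f (z y n) - f (z y 0)" using sum_lessThan_telescope[of "%j. f (z y j)" n] by simp
  moreover have "z y n = y" using that xE by (auto simp: z_def fun_eq_iff Es_iff)
  moreover have "z y 0 = x" by (simp add: z_def)
  ultimately show ?thesis by simp
 qed
 moreover have "\<exists>d>0. \<forall>y\<in>Es n. \<forall>j<n. (\<forall>i<n. abs (y i - x i) < d) --> abs (g j y - pdv j f x) < e" if e: "0 < e" for e
 proof -
  define A where "A = {w \<in> S. \<forall>j<n. abs (pdv j f w - pdv j f x) < e}"
  have pc: "continuous_on S (pdv j f)" if "j < n" for j using f that by (simp add: Ck_simps s)
  have "eopen n A"
  proof -
   have "openin (top_of_set S) (S \<inter> (%w. abs (pdv j f w - pdv j f x)) -` {..<e})" if "j < n" for j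
    using pc[OF that] by (intro continuous_openin_preimage_gen continuous_intros) auto
   then have "openin (top_of_set S) ((\<Inter>j\<in>{..<n}. S \<inter> (%w. abs (pdv j f w - pdv j f x)) -` {..<e}) \<inter> topspace (top_of_set S))"
    by (intro openin_INT) simp_all
   moreover have "(\<Inter>j\<in>{..<n}. S \<inter> (%w. abs (pdv j f w - pdv j f x)) -` {..<e}) \<inter> topspace (top_of_set S) = A" by (auto simp: A_def)
   ultimately have "openin (top_of_set S) A" by simp
   moreover have "openin (top_of_set (Es n)) S" using S unfolding Euclidean_space_top_of_set[symmetric] .
   ultimately have "openin (top_of_set (Es n)) A" by (rule openin_trans)
   then show ?thesis unfolding Euclidean_space_top_of_set[symmetric] .
  qed
  moreover have "x \<in> A" using x e by (simp add: A_def)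
  ultimately obtain d where d: "0 < d" "!!y. y \<in> Es n ==> (\<forall>i<n. abs (y i - x i) < d) ==> y \<in> A"
   using openin_Es_box[of n A x] by blast
  have "abs (g j y - pdv j f x) < e" if y: "y \<in> Es n" "j < n" "\<forall>i<n. abs (y i - x i) < d" for y j
  proof (cases "y j = x j")
   case True then show ?thesis using e by (simp add: g_def)
  next
   case False
   define F where "F t = f ((z y j)(j := t))" for t
   have mem: "(z y j)(j := t) \<in> A" if "abs (t - x j) <= abs (y j - x j)" for t
    using y that d(1) by (intro d(2) fun_upd_Es zE) (auto simp: z_def dest!: spec)
   have dF: "(F has_real_derivative pdv j f ((z y j)(j := t))) (at t)" if "abs (t - x j) <= abs (y j - x j)" for t
   proof -
    have "(z y j)(j := t) \<in> S" using mem[OF that] by (simp add: A_def)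
    from Ck_diff_DERIV[OF s f y(2) this] show ?thesis by (simp add: F_def[abs_def])
   qed
   have "\<exists>t. abs (t - x j) <= abs (y j - x j) & F (y j) - F (x j) = pdv j f ((z y j)(j := t)) * (y j - x j)"
   proof (cases "x j < y j")
    case True
    obtain t where "x j < t" "t < y j" "F (y j) - F (x j) = (y j - x j) * pdv j f ((z y j)(j := t))"
     using MVT2[OF True, of F "%t. pdv j f ((z y j)(j := t))"] dF by auto
    then show ?thesis by (intro exI[of _ t]) (auto simp: mult.commute)
   next
    case F: False
    then have lt: "y j < x j" using False by simp
    obtain t where "y j < t" "t < x j" "F (x j) - F (y j) = (x j - y j) * pdv j f ((z y j)(j := t))"
     using MVT2[OF lt, of F "%t. pdv j f ((z y j)(j := t))"] dF by auto
    then show ?thesis by (intro exI[of _ t]) (auto simp: algebra_simps)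
   qed
   then obtain t where t: "abs (t - x j) <= abs (y j - x j)" "F (y j) - F (x j) = pdv j f ((z y j)(j := t)) * (y j - x j)" by blast
   have "g j y = pdv j f ((z y j)(j := t))" using t(2) False by (simp add: g_def zS F_def zx)
   then show ?thesis using mem[OF t(1)] y(2) by (simp add: A_def)
  qed
  then show ?thesis using d(1) by blast
 qed
 ultimately show ?thesis by blast
qed

text \<open>\<open>C1_slopes\<close> writes the increment of \<open>f\<close> exactly as a sum of
  slopes times coordinate increments, and the slopes converge to the partial derivatives.\<close>

lemma C1_chain:
 assumes S: "eopen n S" and f: "Ck n (Suc 0) S f" and x: "c t0 \<in> S"
  and cE: "!!t. c t \<in> Es n" and dc: "!!j. j < n ==> ((%t. c t j) has_real_derivative d j) (at t0)"
 shows "((%t. f (c t)) has_real_derivative (\<Sum>j<n. pdv j f (c t0) * d j)) (at t0)"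
proof -
 obtain g where dl: "!!y. y \<in> Es n ==> f y - f (c t0) = (\<Sum>j<n. g j y * (y j - c t0 j))"
  and g: "!!e. 0 < e ==> \<exists>m>0. \<forall>y\<in>Es n. \<forall>j<n. (\<forall>i<n. abs (y i - c t0 i) < m) --> abs (g j y - pdv j f (c t0)) < e"
  using C1_slopes[OF S f x] by blast
 have cc: "((%t. c t j) \<longlongrightarrow> c t0 j) (at t0)" if "j < n" for j
  using DERIV_isCont[OF dc[OF that]] by (simp add: isCont_def)
 have close: "eventually (%t. \<forall>i<n. abs (c t i - c t0 i) < m) (at t0)" if "0 < m" for m
 proof -
  have "eventually (%t. \<forall>i\<in>{..<n}. abs (c t i - c t0 i) < m) (at t0)"
   using tendstoD[OF cc that] by (intro eventually_ball_finite) (auto simp: dist_real_def)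
  then show ?thesis by (simp add: Ball_def)
 qed
 have gl: "((%t. g j (c t)) \<longlongrightarrow> pdv j f (c t0)) (at t0)" if j: "j < n" for j
 proof (rule tendstoI)
  fix e :: real assume "0 < e"
  from g[OF this] obtain m where m: "m > 0" "\<forall>y\<in>Es n. \<forall>j<n. (\<forall>i<n. abs (y i - c t0 i) < m) --> abs (g j y - pdv j f (c t0)) < e" by blast
  show "eventually (%t. dist (g j (c t)) (pdv j f (c t0)) < e) (at t0)"
   using close[OF m(1)] by eventually_elim (use m(2) cE j in \<open>auto simp: dist_real_def\<close>)
 qed
 have "((%t. \<Sum>j<n. g j (c t) * ((c t j - c t0 j) / (t - t0))) \<longlongrightarrow> (\<Sum>j<n. pdv j f (c t0) * d j)) (at t0)"
  using dc gl by (intro tendsto_sum tendsto_mult) (auto simp: has_field_derivative_iff)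
 moreover have "(f (c t) - f (c t0)) / (t - t0) = (\<Sum>j<n. g j (c t) * ((c t j - c t0 j) / (t - t0)))" for t
  by (simp add: dl[OF cE] sum_divide_distrib)
 ultimately show ?thesis unfolding has_field_derivative_iff by simp
qed

lemma Ck_compose:
 assumes S: "eopen n S" and T: "eopen m T"
  and FE: "!!x. x \<in> Es n ==> F x \<in> Es m" and FT: "!!x. x \<in> S ==> F x \<in> T"
  and F: "!!j. j < m ==> Ck n k S (%x. F x j)" and f: "Ck m k T f"
 shows "Ck n k S (%x. f (F x))" using F f
proof (induction k arbitrary: f)
 case 0
 note s = openin_Es_subset[OF S] and t = openin_Es_subset[OF T]
 have "continuous_on S F"
 proof (rule continuous_on_coordinatewise_then_product)
  show "continuous_on S (%x. F x i)" for i
  proof (cases "i < m")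
   case False
   then have "continuous_on S (%x. F x i) \<longleftrightarrow> continuous_on S (%x. 0::real)"
    using FE s by (intro continuous_on_cong) (auto simp: Es_iff)
   then show ?thesis by simp
  qed (use 0 s in \<open>simp add: Ck_simps\<close>)
 qed
 then show ?case using 0 FT by (simp add: Ck_simps s t) (rule continuous_on_compose2[of T f S F]; auto)
next
 case (Suc k)
 note s = openin_Es_subset[OF S] and t = openin_Es_subset[OF T]
 have Fk: "Ck n k S (%x. F x j)" if "j < m" for j using Suc(2)[OF that] by (rule Ck_Suc_imp[OF s])
 show ?case
 proof (rule Ck_SucI[OF S])
  have "Ck n k S (%x. f (F x))" using Fk Ck_Suc_imp[OF t Suc(3)] by (rule Suc(1))
  then show "continuous_on S (%x. f (F x))" by (rule Ck_continuous[OF s])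
  show "Ck n k S (%x. \<Sum>j<m. pdv j f (F x) * pdv i (%x. F x j) x)" if "i < n" for i
  proof (rule Ck_sum[OF S], rule Ck_mult[OF S])
   fix j assume j: "j \<in> {..<m}"
   then have "Ck m k T (pdv j f)" using Suc(3) t by (simp add: Ck_simps)
   from Suc(1)[OF Fk this] show "Ck n k S (%x. pdv j f (F x))" by simp
   show "Ck n k S (pdv i (%x. F x j))" using Suc(2)[of j] j that s by (simp add: Ck_simps)
  qed
  fix i x assume ix: "i < n" "x \<in> S"
  define c where "c t = (if x(i := t) \<in> Es n then F (x(i := t)) else (%_. 0))" for t
  have xE: "x \<in> Es n" using ix s by auto
  have c: "c t = F (x(i := t))" for t using xE ix(1) by (simp add: c_def)
  have "Ck m (Suc 0) T f" using Suc(3) t by (cases k) (auto simp: Ck_simps intro: Ck_continuous)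
  then have "((%t. f (c t)) has_real_derivative (\<Sum>j<m. pdv j f (c (x i)) * pdv i (%x. F x j) x)) (at (x i))"
  proof (rule C1_chain[OF T])
   show "c (x i) \<in> T" "!!t. c t \<in> Es m" using FT ix FE xE by (auto simp: c)
   show "((%t. c t j) has_real_derivative pdv i (%x. F x j) x) (at (x i))" if "j < m" for j
    using Ck_diff_DERIV[OF s Suc(2)[OF that] ix] unfolding c .
  qed
  then show "((%t. f (F (x(i := t)))) has_real_derivative (\<Sum>j<m. pdv j f (F x) * pdv i (%x. F x j) x)) (at (x i))"
   by (simp add: c)
 qed
qed

section \<open>Hadamard's lemma on a cube\<close>

definition ebox :: "nat => (nat => real) => real => (nat => real) set" where
 "ebox n p d = {y \<in> Es n. \<forall>i<n. abs (y i - p i) < d}"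

lemma openin_ebox: "eopen n (ebox n p e)"
proof (rule openin_Es_boxI)
 fix x assume x: "x \<in> ebox n p e"
 define d where "d = Min (insert 1 ((%i. e - abs (x i - p i)) ` {..<n}))"
 have "0 < d" using x by (auto simp: d_def ebox_def)
 moreover have "y \<in> ebox n p e" if "y \<in> Es n" "\<forall>i<n. abs (y i - x i) < d" for y
 proof -
  have "abs (y i - p i) < e" if i: "i < n" for i
  proof -
   have "d <= e - abs (x i - p i)" using i by (simp add: d_def)
   then show ?thesis using \<open>\<forall>i<n. \<bar>y i - x i\<bar> < d\<close> i by fastforce
  qed
  then show ?thesis using that by (simp add: ebox_def)
 qed
 ultimately show "\<exists>e'>0. \<forall>y\<in>Es n. (\<forall>i<n. abs (y i - x i) < e') --> y \<in> ebox n p e" by blast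
qed (auto simp: ebox_def)

definition shrink :: "(nat => real) => real => (nat => real) => nat => real" where
 "shrink p t x = (%i. p i + t * (x i - p i))"

lemma shrink_ebox:
 assumes "p \<in> Es n" "x \<in> ebox n p d" "0 <= t" "t <= 1"
 shows "shrink p t x \<in> ebox n p d"
proof -
 have "abs (t * (x i - p i)) <= 1 * abs (x i - p i)" for i
  unfolding abs_mult using assms by (intro mult_right_mono) auto
 then have le: "abs (t * (x i - p i)) <= abs (x i - p i)" for i by (simp only: mult_1)
 have "abs (t * (x i - p i)) < d" if "i < n" for i
 proof -
  have "abs (x i - p i) < d" using that assms(2) by (simp add: ebox_def)
  then show ?thesis by (rule le_less_trans[OF le])
 qed
 moreover have "shrink p t x \<in> Es n" using assms(1,2) by (simp add: Es_iff ebox_def shrink_def)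
 ultimately show ?thesis by (simp add: ebox_def) (simp add: shrink_def)
qed

lemma shrink_upd: "shrink p t (x(i := s)) = (shrink p t x)(i := p i + t * (s - p i))"
 by (auto simp: shrink_def)

lemma continuous_on_shrink: "continuous_on S (%(x, t). shrink p t x)"
proof -
 have *: "continuous_on S (%z. fst z i)" for i :: nat and S :: "((nat => real) \<times> real) set"
  by (rule continuous_on_compose2[OF continuous_on_product_coordinates continuous_on_fst[OF continuous_on_id]]) auto
 then show ?thesis unfolding split_beta shrink_def
  by (intro continuous_on_coordinatewise_then_product continuous_intros *)
qed

text \<open>The weight \<open>t ^ m\<close> closes the induction: differentiating under the integral
  in one coordinate produces one more factor \<open>t\<close>.\<close>

lemma Ck_param_integral:
 assumes p: "p \<in> Es n" and h: "Ck n k (ebox n p d) h"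
 shows "Ck n k (ebox n p d) (%x. integral (cbox 0 1) (%t. t ^ m * h (shrink p t x)))" using h
proof (induction k arbitrary: m h)
 let ?Q = "ebox n p d"
 note Q = openin_Es_subset[OF openin_ebox, of n p d]
 have jc: "continuous_on (?Q \<times> cbox 0 1) (%(x, t). t ^ m * h (shrink p t x))" if "continuous_on ?Q h" for m h
 proof -
  have "continuous_on (?Q \<times> cbox 0 1) (%z. h ((%(x, t). shrink p t x) z))"
   by (rule continuous_on_compose2[OF that continuous_on_shrink]) (auto intro!: shrink_ebox p)
  then have "continuous_on (?Q \<times> cbox 0 1) (%z. snd z ^ m * h ((%(x, t). shrink p t x) z))"
   by (intro continuous_intros)
  then show ?thesis by (simp add: split_beta)
 qed
 {
  case 0
  then show ?case using integral_continuous_on_param[OF jc, of h m] by (simp add: Ck_simps Q)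
 next
  case (Suc k)
  show ?case
  proof (rule Ck_SucI[OF openin_ebox])
   have hc: "continuous_on ?Q h" by (rule Ck_continuous[OF Q Suc(2)])
   show "continuous_on ?Q (%x. integral (cbox 0 1) (%t. t ^ m * h (shrink p t x)))"
    by (rule integral_continuous_on_param[OF jc[OF hc]])
   show "Ck n k ?Q (%x. integral (cbox 0 1) (%t. t ^ Suc m * pdv i h (shrink p t x)))" if "i < n" for i
    using Suc(2) that by (intro Suc(1)) (simp add: Ck_simps Q)
   fix i x assume i: "i < n" and x: "x \<in> ?Q"
   define U where "U = {p i - d<..<p i + d}"
   have xU: "x(i := s) \<in> ?Q \<longleftrightarrow> s \<in> U" for s using x i by (auto simp: ebox_def U_def)
   have upd: "continuous_on (U \<times> cbox 0 1) (%z :: real \<times> real. (x(i := fst z), snd z))"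
    by (rule continuous_on_Pair[OF continuous_on_compose2[OF continuous_on_fun_upd[of UNIV] continuous_on_fst[OF continuous_on_id]] continuous_on_snd[OF continuous_on_id]]) auto
   have c2: "continuous_on (U \<times> cbox 0 1) (%(s, t). t ^ m * h (shrink p t (x(i := s))))" if "continuous_on ?Q h" for m h
   proof -
    have "continuous_on (U \<times> cbox 0 1) (%z. (%(x, t). t ^ m * h (shrink p t x)) (x(i := fst z), snd z))"
     by (rule continuous_on_compose2[OF jc[OF that] upd]) (simp add: image_subset_iff xU)
    then show ?thesis by (simp add: split_beta)
   qed
   have pc: "continuous_on ?Q (pdv i h)" using Suc(2) i by (intro Ck_continuous[OF Q, of k]) (simp add: Ck_simps Q)
   have "((%s. integral (cbox 0 1) (%t. t ^ m * h (shrink p t (x(i := s))))) has_real_derivative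
     integral (cbox 0 1) (%t. t ^ Suc m * pdv i h (shrink p t (x(i := x i))))) (at (x i) within U)"
   proof (rule leibniz_rule_field_derivative)
    show "x i \<in> U" using x i by (auto simp: ebox_def U_def)
    show "convex U" by (simp add: U_def)
    show "continuous_on (U \<times> cbox 0 1) (%(s, t). t ^ Suc m * pdv i h (shrink p t (x(i := s))))"
     by (rule c2[OF pc])
    fix s assume s: "s \<in> U"
    have "continuous_on (cbox 0 1) (%t::real. (s, t))" by (intro continuous_intros)
    from continuous_on_compose2[OF c2[OF hc, of m] this] s
    show "(%t. t ^ m * h (shrink p t (x(i := s)))) integrable_on cbox 0 1"
     by (intro integrable_continuous) auto
    fix t :: real assume t: "t \<in> cbox 0 1"
    define y where "y = shrink p t (x(i := s))"
    have yQ: "y \<in> ?Q" unfolding y_def using s t xU by (intro shrink_ebox p) auto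
    have y: "shrink p t (x(i := r)) = y(i := p i + t * (r - p i))" "y i = p i + t * (s - p i)" for r
     unfolding y_def shrink_upd by simp_all
    have "((%r. h (y(i := r))) has_real_derivative pdv i h y) (at (y i))"
     by (rule Ck_diff_DERIV[OF Q Suc(2) i yQ])
    then have "((%r. h (y(i := p i + t * (r - p i)))) has_real_derivative pdv i h y * t) (at s)"
     unfolding y(2) by (rule DERIV_chain2) (auto intro!: derivative_eq_intros)
    then have "((%r. t ^ m * h (y(i := p i + t * (r - p i)))) has_real_derivative t ^ m * (pdv i h y * t)) (at s)"
     by (rule DERIV_cmult)
    then have "((%r. t ^ m * h (shrink p t (x(i := r)))) has_real_derivative t ^ m * (pdv i h y * t)) (at s)"
     by (simp only: y(1))
    moreover have "t ^ m * (pdv i h y * t) = t ^ Suc m * pdv i h (shrink p t (x(i := s)))" by (simp add: y_def)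
    ultimately show "((%r. t ^ m * h (shrink p t (x(i := r)))) has_real_derivative t ^ Suc m * pdv i h (shrink p t (x(i := s)))) (at s within U)"
     by (simp only: has_field_derivative_at_within)
   qed
   moreover have "at (x i) within U = at (x i)" by (rule at_within_open) (use x i in \<open>auto simp: ebox_def U_def\<close>)
   ultimately show "((%s. integral (cbox 0 1) (%t. t ^ m * h (shrink p t (x(i := s))))) has_real_derivative
     integral (cbox 0 1) (%t. t ^ Suc m * pdv i h (shrink p t x))) (at (x i))" by simp
  qed
 }
qed

lemma CinfD: "Cinf n S f ==> Ck n k S f" by (simp add: Cinf_def)

lemma Cinf_pdv: "S \<subseteq> Es n ==> Cinf n S f ==> i < n ==> Cinf n S (pdv i f)"
 using Ck_simps(2) unfolding Cinf_def by blast

text \<open>The cube is star-shaped about \<open>p\<close>, so the derivative of \<open>f\<close>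
  can be integrated along the segment from \<open>p\<close> to \<open>x\<close>.\<close>

lemma hadamard:
 assumes p: "p \<in> Es n" and f: "Cinf n (ebox n p d) f"
 shows "\<exists>g. (\<forall>j<n. Cinf n (ebox n p d) (g j)) & (\<forall>x\<in>ebox n p d. f x = f p + (\<Sum>j<n. (x j - p j) * g j x))"
proof -
 let ?Q = "ebox n p d"
 note Q = openin_Es_subset[OF openin_ebox, of n p d]
 define g where "g j x = integral (cbox 0 1) (%t. t ^ 0 * pdv j f (shrink p t x))" for j x
 have "Cinf n ?Q (g j)" if "j < n" for j
  using Cinf_pdv[OF Q f that] Ck_param_integral[OF p, of _ d "pdv j f" 0] unfolding Cinf_def g_def by blast
 moreover have "f x = f p + (\<Sum>j<n. (x j - p j) * g j x)" if x: "x \<in> ?Q" for x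
 proof -
  have c1: "continuous_on {0..1} (%t. pdv j f (shrink p t x))" if "j < n" for j
  proof (rule continuous_on_compose2[OF Ck_continuous[OF Q CinfD[OF Cinf_pdv[OF Q f that]]]])
   show "continuous_on {0..1} (%t. shrink p t x)" unfolding shrink_def
    by (intro continuous_on_coordinatewise_then_product continuous_intros)
   show "(%t. shrink p t x) ` {0..1} \<subseteq> ?Q" by (rule image_subsetI, rule shrink_ebox[OF p x]) simp_all
  qed
  have "((%t. \<Sum>j<n. pdv j f (shrink p t x) * (x j - p j)) has_integral f (shrink p 1 x) - f (shrink p 0 x)) {0..1}"
  proof (rule fundamental_theorem_of_calculus)
   fix t :: real assume t: "t \<in> {0..1}"
   have "((%t. f (shrink p t x)) has_real_derivative (\<Sum>j<n. pdv j f (shrink p t x) * (x j - p j))) (at t)"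
   proof (rule C1_chain[OF openin_ebox CinfD[OF f]])
    show "shrink p t x \<in> ?Q" using t by (intro shrink_ebox[OF p x]) simp_all
    show "shrink p s x \<in> Es n" for s using p x by (auto simp: shrink_def Es_iff ebox_def)
    show "((%t. shrink p t x j) has_real_derivative x j - p j) (at t)" for j
     unfolding shrink_def by (auto intro!: derivative_eq_intros)
   qed
   then show "((%t. f (shrink p t x)) has_vector_derivative (\<Sum>j<n. pdv j f (shrink p t x) * (x j - p j))) (at t within {0..1})"
    by (simp add: has_real_derivative_iff_has_vector_derivative has_vector_derivative_at_within)
  qed simp
  then have "f x - f p = integral {0..1} (%t. \<Sum>j<n. pdv j f (shrink p t x) * (x j - p j))"
   by (simp add: integral_unique shrink_def)
  also have "... = (\<Sum>j<n. integral {0..1} (%t. pdv j f (shrink p t x) * (x j - p j)))"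
   using c1 by (intro integral_sum integrable_continuous_interval continuous_intros) auto
  also have "... = (\<Sum>j<n. (x j - p j) * g j x)" by (intro sum.cong refl) (simp add: g_def mult.commute)
  finally show ?thesis by simp
 qed
 ultimately show ?thesis by blast
qed

section \<open>Tangent vectors in a single chart\<close>

lemma Cinf_cong: "eopen n S ==> (!!x. x \<in> S ==> f x = g x) ==> Cinf n S f \<longleftrightarrow> Cinf n S g"
 unfolding Cinf_def using Ck_cong by blast

lemma Cinf_subset: "T \<subseteq> S ==> S \<subseteq> Es n ==> Cinf n S f ==> Cinf n T f"
 unfolding Cinf_def using Ck_subset by blast

lemma Cinf_const: "eopen n S ==> Cinf n S (%x. c)" by (simp add: Cinf_def Ck_const openin_Es_subset)

lemma Cinf_coord: "eopen n S ==> Cinf n S (%x. x j)" by (simp add: Cinf_def Ck_coord openin_Es_subset)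

lemma Cinf_add: "eopen n S ==> Cinf n S f ==> Cinf n S g ==> Cinf n S (%x. f x + g x)"
 by (simp add: Cinf_def Ck_add)

lemma Cinf_mult: "eopen n S ==> Cinf n S f ==> Cinf n S g ==> Cinf n S (%x. f x * g x)"
 by (simp add: Cinf_def Ck_mult)

lemma Cinf_sum: "eopen n S ==> (!!j. j \<in> J ==> Cinf n S (h j)) ==> Cinf n S (%x. \<Sum>j\<in>J. h j x)"
 by (simp add: Cinf_def Ck_sum)

lemma Cinf_minus: "eopen n S ==> Cinf n S f ==> Cinf n S (%x. - f x)"
 using Cinf_mult[of n S "%x. - 1" f] by (simp add: Cinf_const)

lemma Cinf_diff: "eopen n S ==> Cinf n S f ==> Cinf n S g ==> Cinf n S (%x. f x - g x)"
 using Cinf_add[of n S f "%x. - g x"] by (simp add: Cinf_minus)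

lemma Cinf_power: "eopen n S ==> Cinf n S f ==> Cinf n S (%x. f x ^ m)"
 by (induction m) (simp_all add: Cinf_const Cinf_mult)

text \<open>The value 0 on functions that are not smooth near \<open>p\<close> is the convention of
  \<open>tangent_space\<close>.\<close>

definition tv :: "nat => (nat => real) => (nat => real) => (nat => real) tvec" where
 "tv n p c f = (if \<exists>W. p \<in> W & eopen n W & Cinf n W f then \<Sum>j<n. c j * pdv j f p else 0)"

locale coord_mfd =
 fixes M :: "(nat => real, 'm) smooth_mfd_scheme" and n :: nat
 assumes mtop: "mtop M = Euclidean_space n" and mdim: "mdim M = n"
  and atlas: "atlas M = {(Es n, %x. x)}"
begin

lemma pts: "pts M = Es n" by (simp add: mtop)

lemma smooth_on_iff: "smooth_on M W f \<longleftrightarrow> eopen n W & Cinf n W f"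
proof -
 have "Cinf n ((%x. x) ` (Es n \<inter> W)) (%x. f (inv_into (Es n) (%x. x) x)) \<longleftrightarrow> Cinf n W f"
  if W: "eopen n W"
 proof -
  have "Es n \<inter> W = W" using openin_Es_subset[OF W] by auto
  moreover have "inv_into (Es n) (%x. x) x = x" if "x \<in> W" for x
   using openin_Es_subset[OF W] that inv_into_f_f[of "%x. x" "Es n" x] by (auto simp: inj_on_def)
  ultimately show ?thesis using Cinf_cong[OF W, of "%x. f (inv_into (Es n) (%x. x) x)" f] by simp
 qed
 then show ?thesis unfolding smooth_on_def atlas mtop mdim by auto
qed

lemma smooth_near_iff: "smooth_near M p f \<longleftrightarrow> (\<exists>W. p \<in> W & eopen n W & Cinf n W f)"
 by (simp add: smooth_near_def smooth_on_iff)

lemma tv_eq: "tv n p c f = (if smooth_near M p f then \<Sum>j<n. c j * pdv j f p else 0)"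
 by (simp add: tv_def smooth_near_iff)

lemma smooth_near_coord: "p \<in> Es n ==> smooth_near M p (%x. x j)"
 unfolding smooth_near_iff by (intro exI[of _ "Es n"]) (simp add: Cinf_coord openin_topspace)

lemma smooth_near_const: "p \<in> Es n ==> smooth_near M p (%x. c)"
 unfolding smooth_near_iff by (intro exI[of _ "Es n"]) (simp add: Cinf_const openin_topspace)

lemma smooth_near_pts: "smooth_near M p f ==> p \<in> Es n"
 unfolding smooth_near_iff using openin_Es_subset by blast

lemma smooth_near2:
 assumes "smooth_near M p f" "smooth_near M p g"
 obtains W where "p \<in> W" "eopen n W" "Cinf n W f" "Cinf n W g"
proof -
 obtain V W where V: "p \<in> V" "eopen n V" "Cinf n V f"
  and W: "p \<in> W" "eopen n W" "Cinf n W g"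
  using assms unfolding smooth_near_iff by blast
 show ?thesis
  by (rule that[of "V \<inter> W"]) (use V W openin_Es_subset[OF V(2)] openin_Es_subset[OF W(2)] in
   \<open>auto intro: Cinf_subset[of "V \<inter> W" V] Cinf_subset[of "V \<inter> W" W]\<close>)
qed

lemma smooth_near_add: "smooth_near M p f ==> smooth_near M p g ==> smooth_near M p (%x. f x + g x)"
 by (rule smooth_near2[of p f g]) (auto simp: smooth_near_iff intro: Cinf_add)

lemma smooth_near_mult: "smooth_near M p f ==> smooth_near M p g ==> smooth_near M p (%x. f x * g x)"
 by (rule smooth_near2[of p f g]) (auto simp: smooth_near_iff intro: Cinf_mult)

lemma smooth_near_DERIV:
 assumes "smooth_near M p f" "i < n"
 shows "((%t. f (p(i := t))) has_real_derivative pdv i f p) (at (p i))"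
proof -
 obtain W where W: "p \<in> W" "eopen n W" "Cinf n W f" using assms(1) unfolding smooth_near_iff by blast
 show ?thesis by (rule Ck_diff_DERIV[OF openin_Es_subset[OF W(2)] CinfD[OF W(3)] assms(2) W(1)])
qed

lemma pdv_add: "smooth_near M p f ==> smooth_near M p g ==> i < n ==> pdv i (%x. f x + g x) p = pdv i f p + pdv i g p"
 by (intro pdv_eqI DERIV_add smooth_near_DERIV)

lemma pdv_mult: 
 assumes "smooth_near M p f" "smooth_near M p g" "i < n"
 shows "pdv i (%x. f x * g x) p = f p * pdv i g p + g p * pdv i f p"
proof (rule pdv_eqI)
 show "((%t. f (p(i := t)) * g (p(i := t))) has_real_derivative f p * pdv i g p + g p * pdv i f p) (at (p i))"
  using DERIV_mult[OF smooth_near_DERIV[OF assms(1,3)] smooth_near_DERIV[OF assms(2,3)]]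
  by (simp only: fun_upd_triv add.commute mult.commute)
qed

lemma tv_in_tangent: "p \<in> Es n ==> tv n p c \<in> tangent_space M p"
 unfolding tangent_space_def mem_Collect_eq
proof (intro conjI allI impI)
 fix f g assume p: "p \<in> Es n" and fg: "smooth_near M p f" "smooth_near M p g"
 show "tv n p c (%x. f x + g x) = tv n p c f + tv n p c g"
  using fg smooth_near_add[OF fg] by (simp add: tv_eq pdv_add distrib_left sum.distrib)
 show "tv n p c (%x. f x * g x) = f p * tv n p c g + g p * tv n p c f"
  using fg smooth_near_mult[OF fg] by (simp add: tv_eq pdv_mult distrib_left sum.distrib sum_distrib_left mult_ac)
next
 fix b f assume p: "p \<in> Es n" and f: "smooth_near M p f"
 show "tv n p c (%x. b * f x) = b * tv n p c f"
  using f smooth_near_mult[OF smooth_near_const[OF p, of b] f] pdv_mult[OF smooth_near_const[OF p, of b] f]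
  by (simp add: tv_eq sum_distrib_left mult_ac)
qed (simp add: tv_eq)

lemma tangentD:
 assumes "v \<in> tangent_space M p"
 shows "\<not> smooth_near M p f ==> v f = 0"
  "smooth_near M p f ==> smooth_near M p g ==> v (%x. f x + g x) = v f + v g"
  "smooth_near M p f ==> smooth_near M p g ==> v (%x. f x * g x) = f p * v g + g p * v f"
  "smooth_near M p f ==> v (%x. b * f x) = b * v f" using assms unfolding tangent_space_def by blast+

lemma tangent_const:
 assumes v: "v \<in> tangent_space M p" and p: "p \<in> Es n"
 shows "v (%x. b) = 0"
proof -
 have "v (%x. 1) = 0" using tangentD(3)[OF v smooth_near_const[OF p, of 1] smooth_near_const[OF p, of 1]] by simp
 then show ?thesis using tangentD(4)[OF v smooth_near_const[OF p, of 1], of b] by simp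
qed

text \<open>Tangent vectors act on germs: multiply the difference by the characteristic function of the
  complement of the common neighbourhood.\<close>

lemma tangent_local:
 assumes v: "v \<in> tangent_space M p" and W: "eopen n W" "p \<in> W"
  and fg: "!!x. x \<in> W ==> f x = g x" and f: "smooth_near M p f"
 shows "v f = v g"
proof -
 have p: "p \<in> Es n" using W openin_Es_subset by blast
 define h where "h x = (if x \<in> W then 0 else g x - f x)" for x
 define q :: "(nat => real) => real" where "q x = (if x \<in> W then 0 else 1)" for x
 have "Cinf n W h" "Cinf n W q" using Cinf_cong[OF W(1), of h "%x. 0"] Cinf_cong[OF W(1), of q "%x. 0"]
  by (simp_all add: Cinf_const[OF W(1)] h_def q_def)
 then have s: "smooth_near M p h" "smooth_near M p q" unfolding smooth_near_iff using W by blast+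
 have "(%x. q x * h x) = h" by (auto simp: h_def q_def fun_eq_iff)
 moreover have "v (%x. q x * h x) = q p * v h + h p * v q" by (rule tangentD(3)[OF v s(2,1)])
 ultimately have "v h = 0" using W by (simp add: h_def q_def)
 moreover have "(%x. f x + h x) = g" using fg by (auto simp: h_def fun_eq_iff)
 ultimately show ?thesis using tangentD(2)[OF v f s(1)] by simp
qed

lemma tangent_sum:
 assumes v: "v \<in> tangent_space M p" and p: "p \<in> Es n" and "!!j. j \<in> J ==> smooth_near M p (h j)"
 shows "smooth_near M p (%x. \<Sum>j\<in>J. h j x) & v (%x. \<Sum>j\<in>J. h j x) = (\<Sum>j\<in>J. v (h j))"
 using assms(3)
proof (induction J rule: infinite_finite_induct)
 case (insert j J)
 then show ?case using tangentD(2)[OF v, of "h j" "%x. \<Sum>j\<in>J. h j x"] by (simp add: smooth_near_add)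
qed (simp_all add: tangent_const[OF v p] smooth_near_const[OF p])

text \<open>After Hadamard's lemma the product rule evaluates the remainder functions at
  \<open>p\<close> only, so a derivation is determined by its values on the coordinate
  functions.\<close>

lemma tangent_eq_tv:
 assumes v: "v \<in> tangent_space M p" and p: "p \<in> Es n"
 shows "v = tv n p (%j. v (%x. x j))"
proof
 fix f show "v f = tv n p (%j. v (%x. x j)) f"
 proof (cases "smooth_near M p f")
  case False
  then show ?thesis using tangentD(1)[OF v] by (simp add: tv_eq)
 next
  case True
  then obtain W where W: "p \<in> W" "eopen n W" "Cinf n W f" unfolding smooth_near_iff by blast
  obtain d where d: "0 < d" "\<forall>y\<in>Es n. (\<forall>i<n. abs (y i - p i) < d) --> y \<in> W"
   using openin_Es_box[OF W(2,1)] by blast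
  have Q: "ebox n p d \<subseteq> W" "p \<in> ebox n p d" using d p by (auto simp: ebox_def)
  have "Cinf n (ebox n p d) f" using Q(1) openin_Es_subset[OF W(2)] W(3) by (rule Cinf_subset)
  from hadamard[OF p this] obtain g where g: "!!j. j < n ==> Cinf n (ebox n p d) (g j)"
   "!!x. x \<in> ebox n p d ==> f x = f p + (\<Sum>j<n. (x j - p j) * g j x)" by blast
  have sg: "smooth_near M p (g j)" if "j < n" for j
   unfolding smooth_near_iff using g(1)[OF that] Q(2) openin_ebox by blast
  have sx: "smooth_near M p (%x. x j - p j)" for j
   using smooth_near_add[OF smooth_near_coord[OF p, of j] smooth_near_const[OF p, of "- p j"]] by simp
  have wx: "w (%x. x j - p j) = w (%x. x j)" if "w \<in> tangent_space M p" for w j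
   using tangentD(2)[OF that smooth_near_coord[OF p, of j] smooth_near_const[OF p, of "- p j"]] tangent_const[OF that p] by simp
  have rep: "w f = (\<Sum>j<n. w (%x. x j) * g j p)" if w: "w \<in> tangent_space M p" for w
  proof -
   have "w f = w (%x. f p + (\<Sum>j<n. (x j - p j) * g j x))"
    by (rule tangent_local[OF w openin_ebox Q(2) g(2) True])
   also have "... = w (%x. \<Sum>j<n. (x j - p j) * g j x)"
    using tangentD(2)[OF w smooth_near_const[OF p, of "f p"] conjunct1[OF tangent_sum[OF w p, of "{..<n}" "%j x. (x j - p j) * g j x"]]]
     tangent_const[OF w p] by (simp add: smooth_near_mult sx sg)
   also have "... = (\<Sum>j<n. w (%x. (x j - p j) * g j x))"
    using tangent_sum[OF w p, of "{..<n}" "%j x. (x j - p j) * g j x"] by (simp add: smooth_near_mult sx sg)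
   also have "... = (\<Sum>j<n. w (%x. x j) * g j p)"
    by (intro sum.cong refl) (simp add: tangentD(3)[OF w sx sg] wx[OF w])
   finally show ?thesis .
  qed
  have "tv n p (%j. v (%x. x j)) (%x. x i) = v (%x. x i)" if "i < n" for i
   using that by (simp add: tv_eq smooth_near_coord[OF p] pdv_coord if_distrib sum.delta cong: if_cong)
  then show ?thesis using rep[OF v] rep[OF tv_in_tangent[OF p, of "%j. v (%x. x j)"]] by simp
 qed
qed

lemma tv_coord: "p \<in> Es n ==> tv n p c (%x. x i) = (if i < n then c i else 0)"
 by (simp add: tv_eq smooth_near_coord pdv_coord if_distrib sum.delta cong: if_cong)

lemma tangent_eqI:
 assumes "v \<in> tangent_space M p" "w \<in> tangent_space M p" "p \<in> Es n" "!!j. j < n ==> v (%x. x j) = w (%x. x j)"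
 shows "v = w"
proof -
 have "tv n p (%j. v (%x. x j)) = tv n p (%j. w (%x. x j))" using assms(4) by (auto simp: fun_eq_iff tv_def)
 then show ?thesis using tangent_eq_tv[OF assms(1,3)] tangent_eq_tv[OF assms(2,3)] by simp
qed

lemma tangent_apply:
 "v \<in> tangent_space M p ==> p \<in> Es n ==> smooth_near M p f ==> v f = (\<Sum>j<n. v (%x. x j) * pdv j f p)"
 using tangent_eq_tv[of v p] tv_eq[of p "%j. v (%x. x j)" f] by metis

lemma subspace_tangent: "p \<in> Es n ==> subspace (tangent_space M p)"
 unfolding subspace_def tangent_space_def by (auto simp: scaleR_fun_def algebra_simps)

lemma smooth_vfield_on_iff:
 "smooth_vfield_on M W X \<longleftrightarrow> eopen n W & (\<forall>q\<in>W. X q \<in> tangent_space M q) &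
   (\<forall>j<n. Cinf n W (%q. X q (%x. x j)))"
proof (intro iffI conjI)
 assume X: "smooth_vfield_on M W X"
 then show o: "eopen n W" and "\<forall>q\<in>W. X q \<in> tangent_space M q" by (auto simp: smooth_vfield_on_def mtop)
 show "\<forall>j<n. Cinf n W (%q. X q (%x. x j))"
  using X Cinf_coord[OF o] o unfolding smooth_vfield_on_def smooth_on_iff by blast
next
 assume X: "eopen n W & (\<forall>q\<in>W. X q \<in> tangent_space M q) & (\<forall>j<n. Cinf n W (%q. X q (%x. x j)))"
 have "Cinf n V (%q. X q f)" if V: "V \<subseteq> W" "eopen n V" "Cinf n V f" for V f
 proof -
  note VE = openin_Es_subset[OF V(2)]
  have eq: "X q f = (\<Sum>j<n. X q (%x. x j) * pdv j f q)" if "q \<in> V" for q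
   using V X that VE by (intro tangent_apply) (auto simp: smooth_near_iff)
  moreover have "Cinf n V (%q. \<Sum>j<n. X q (%x. x j) * pdv j f q)"
   using X V(1) by (intro Cinf_sum[OF V(2)] Cinf_mult[OF V(2)] Cinf_pdv[OF VE V(3)]) (auto intro: Cinf_subset[OF V(1) openin_Es_subset])
  ultimately show ?thesis using Cinf_cong[OF V(2) eq] by simp
 qed
 then show "smooth_vfield_on M W X" using X by (auto simp: smooth_vfield_on_def smooth_on_iff mtop)
qed

lemma smooth_vfield_apply:
 "smooth_vfield_on M W X ==> V \<subseteq> W ==> eopen n V ==> Cinf n V f ==> Cinf n V (%q. X q f)"
 unfolding smooth_vfield_on_def smooth_on_iff by blast

lemma smooth_vfield_restrict:
 "smooth_vfield_on M W X ==> V \<subseteq> W ==> eopen n V ==> smooth_vfield_on M V X"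
 unfolding smooth_vfield_on_def mtop by blast

lemma bracket_coord:
 "p \<in> Es n ==> vf_bracket M X Y p (%x. x j) = X p (%q. Y q (%x. x j)) - Y p (%q. X q (%x. x j))"
 by (simp add: vf_bracket_def smooth_near_coord)

text \<open>In the product rule for iterated derivatives the mixed terms are symmetric in
  \<open>X\<close> and \<open>Y\<close> and cancel in the bracket.\<close>

lemma bracket_tangent:
 assumes X: "smooth_vfield_on M W X" and Y: "smooth_vfield_on M W Y" and p: "p \<in> W"
 shows "vf_bracket M X Y p \<in> tangent_space M p"
proof -
 have Wo: "eopen n W" using X by (simp add: smooth_vfield_on_iff)
 have pE: "p \<in> Es n" using p openin_Es_subset[OF Wo] by blast
 have T: "Z q \<in> tangent_space M q" if "q \<in> W" "Z = X \<or> Z = Y" for Z q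
  using X Y that by (auto simp: smooth_vfield_on_def)
 have main: "Z p (%x. Z' x (%y. f y + g y)) = Z p (%x. Z' x f) + Z p (%x. Z' x g)" (is ?P1)
  "Z p (%x. Z' x (%y. f y * g y)) = f p * Z p (%x. Z' x g) + Z' p g * Z p f + (g p * Z p (%x. Z' x f) + Z' p f * Z p g)" (is ?P2)
  "Z p (%x. Z' x (%y. b * f y)) = b * Z p (%x. Z' x f)" (is ?P3)
  if fg: "smooth_near M p f" "smooth_near M p g" and Z: "Z = X \<or> Z = Y" "Z' = X \<or> Z' = Y" for f g b Z Z'
 proof -
  have Z': "smooth_vfield_on M W Z'" and Zp: "Z p \<in> tangent_space M p" using X Y Z T p by auto
  obtain V' where V': "p \<in> V'" "eopen n V'" "Cinf n V' f" "Cinf n V' g" by (rule smooth_near2[OF fg]) (rule that; assumption)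
  define V where "V = V' \<inter> W"
  have V: "p \<in> V" "eopen n V" "Cinf n V f" "Cinf n V g" "V \<subseteq> W"
   using V' Wo p openin_Es_subset[OF V'(2)] by (auto simp: V_def intro: Cinf_subset[of _ V'])
  have q: "smooth_near M q f" "smooth_near M q g" "Z' q \<in> tangent_space M q" if "q \<in> V" for q
   using V T Z(2) that by (auto simp: smooth_near_iff)
  have s: "smooth_near M p (%q. Z' q h)" if "Cinf n V h" for h
   unfolding smooth_near_iff using smooth_vfield_apply[OF Z' V(5,2) that] V(1,2) by blast
  note loc = tangent_local[OF Zp V(2,1)] and D = tangentD(2,3)[OF Zp]
  have "Z p (%x. Z' x (%y. f y + g y)) = Z p (%x. Z' x f + Z' x g)"
   by (rule loc[OF tangentD(2)[OF q(3,1,2)] s[OF Cinf_add[OF V(2,3,4)]]])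
  then show ?P1 using D(1)[OF s[OF V(3)] s[OF V(4)]] by simp
  have "Z p (%x. Z' x (%y. b * f y)) = Z p (%x. b * Z' x f)"
   by (rule loc[OF tangentD(4)[OF q(3,1)] s[OF Cinf_mult[OF V(2) Cinf_const[OF V(2)] V(3)]]])
  then show ?P3 using tangentD(4)[OF Zp s[OF V(3)]] by simp
  have "Z p (%x. Z' x (%y. f y * g y)) = Z p (%x. f x * Z' x g + g x * Z' x f)"
   by (rule loc[OF tangentD(3)[OF q(3,1,2)] s[OF Cinf_mult[OF V(2,3,4)]]])
  also have "... = Z p (%x. f x * Z' x g) + Z p (%x. g x * Z' x f)"
   by (rule D(1)[OF smooth_near_mult[OF fg(1) s[OF V(4)]] smooth_near_mult[OF fg(2) s[OF V(3)]]])
  finally show ?P2 using D(2)[OF fg(1) s[OF V(4)]] D(2)[OF fg(2) s[OF V(3)]] by simp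
 qed
 note near = smooth_near_add smooth_near_mult smooth_near_const[OF pE]
 have add: "vf_bracket M X Y p (%x. f x + g x) = vf_bracket M X Y p f + vf_bracket M X Y p g"
  if "smooth_near M p f" "smooth_near M p g" for f g
  using main(1)[OF that, of X Y] main(1)[OF that, of Y X] that near by (simp add: vf_bracket_def)
 have mult: "vf_bracket M X Y p (%x. f x * g x) = f p * vf_bracket M X Y p g + g p * vf_bracket M X Y p f"
  if "smooth_near M p f" "smooth_near M p g" for f g
  using main(2)[OF that, of X Y] main(2)[OF that, of Y X] that near by (simp add: vf_bracket_def algebra_simps)
 have scale: "vf_bracket M X Y p (%x. b * f x) = b * vf_bracket M X Y p f" if "smooth_near M p f" for b f
  using main(3)[OF that that, of X Y] main(3)[OF that that, of Y X] near(2)[OF near(3) that]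
  by (simp add: vf_bracket_def algebra_simps that)
 show ?thesis unfolding tangent_space_def using add mult scale by (simp add: vf_bracket_def)
qed

lemma bracket_smooth:
 assumes X: "smooth_vfield_on M W X" and Y: "smooth_vfield_on M W Y"
 shows "smooth_vfield_on M W (vf_bracket M X Y)" unfolding smooth_vfield_on_iff
proof (intro conjI ballI allI impI)
 show W: "eopen n W" using X by (simp add: smooth_vfield_on_iff)
 show "vf_bracket M X Y q \<in> tangent_space M q" if "q \<in> W" for q by (rule bracket_tangent[OF X Y that])
 fix j assume j: "j < n"
 have "Cinf n W (%q. X q (%q. Y q (%x. x j)) - Y q (%q. X q (%x. x j)))"
  by (rule Cinf_diff[OF W smooth_vfield_apply[OF X order_refl W smooth_vfield_apply[OF Y order_refl W Cinf_coord[OF W]]]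
     smooth_vfield_apply[OF Y order_refl W smooth_vfield_apply[OF X order_refl W Cinf_coord[OF W]]]])
 then show "Cinf n W (%q. vf_bracket M X Y q (%x. x j))"
  using openin_Es_subset[OF W] by (subst Cinf_cong[OF W]) (auto simp: bracket_coord)
qed

lemma smooth_manifold: "smooth_manifold M" unfolding smooth_manifold_def atlas mtop mdim
proof (intro conjI)
 show "Hausdorff_space (Euclidean_space n)" by (rule Hausdorff_Euclidean_space)
 obtain B :: "(nat => real) set set" where B: "countable B" "topological_basis B" using ex_countable_basis by blast
 show "second_countable_top (Euclidean_space n)" unfolding second_countable_top_def
 proof (rule exI[of _ "(%b. Es n \<inter> b) ` B"], intro conjI ballI allI impI)
  show "countable ((%b. Es n \<inter> b) ` B)" using B(1) by simp
  show "eopen n S" if "S \<in> (%b. Es n \<inter> b) ` B" for S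
   using that topological_basis_open[OF B(2)] unfolding openin_Es_iff by blast
  fix S assume "eopen n S"
  then obtain T where T: "open T" "S = Es n \<inter> T" unfolding openin_Es_iff by blast
  obtain B' where "B' \<subseteq> B" "\<Union>B' = T" using B(2) T(1) unfolding topological_basis_def by blast
  then show "\<exists>\<A>\<subseteq>(%b. Es n \<inter> b) ` B. S = \<Union>\<A>" by (intro exI[of _ "(%b. Es n \<inter> b) ` B'"]) (auto simp: T(2))
 qed
 show "\<Union> (fst ` {(Es n, %x. x)}) = Es n" by simp
 have "homeomorphic_map (Euclidean_space n) (Euclidean_space n) (%x. x)" using homeomorphic_map_id[of "Euclidean_space n"] by (simp add: id_def)
 then show "\<forall>(U, h)\<in>{(Es n, %x. x)}. eopen n U & eopen n (h ` U) &
  homeomorphic_map (subtopology (Euclidean_space n) U) (subtopology (Euclidean_space n) (h ` U)) h"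
  by simp
 have "Cinf n (Es n) (%x. inv_into (Es n) (%x. x) x j)" for j
  using Cinf_coord[of n "Es n" j] inv_into_f_f[of "%x. x" "Es n"]
  by (subst Cinf_cong[where g = "%x. x j"]) (auto simp: inj_on_def openin_topspace)
 then show "\<forall>(U, h)\<in>{(Es n, %x. x)}. \<forall>(V, q)\<in>{(Es n, %x. x)}. \<forall>j<n. Cinf n (h ` (U \<inter> V)) (%x. q (inv_into U h x) j)"
  by simp
qed

end

section \<open>The sub-Riemannian structures\<close>

context coord_mfd begin

lemma smooth_near_scale: "p \<in> Es n ==> smooth_near M p f ==> smooth_near M p (%x. c * f x)"
 by (intro smooth_near_mult smooth_near_const)

lemma smooth_near_diff: "p \<in> Es n ==> smooth_near M p f ==> smooth_near M p g ==> smooth_near M p (%x. f x - g x)"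
 using smooth_near_add[of p f "%x. - 1 * g x"] smooth_near_scale[of p g "- 1"] by simp

lemma smooth_near_divide: "p \<in> Es n ==> smooth_near M p f ==> smooth_near M p (%x. f x / c)"
 using smooth_near_scale[of p f "1 / c"] by simp

lemma smooth_near_square: "smooth_near M p f ==> smooth_near M p (%x. (f x)\<^sup>2)"
 using smooth_near_mult[of p f f] by (simp add: power2_eq_square)

lemmas smooth_near_simps = smooth_near_coord smooth_near_const smooth_near_add smooth_near_mult smooth_near_diff
 smooth_near_divide smooth_near_square

lemma tangent_diff:
 "v \<in> tangent_space M p ==> p \<in> Es n ==> smooth_near M p f ==> smooth_near M p g ==> v (%x. f x - g x) = v f - v g"
 using tangentD(2)[of v p f "%x. - 1 * g x"] tangentD(4)[of v p g "- 1"] smooth_near_scale[of p g "- 1"] by simp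

lemma tangent_divide:
 "v \<in> tangent_space M p ==> smooth_near M p f ==> v (%x. f x / c) = v f / c"
 using tangentD(4)[of v p f "1 / c"] by simp

lemma tangent_square:
 "v \<in> tangent_space M p ==> smooth_near M p f ==> v (%x. (f x)\<^sup>2) = 2 * f p * v f"
 using tangentD(3)[of v p f f] by (simp add: power2_eq_square)

lemmas tangent_simps = tangent_const tangentD(2,3) tangent_diff tangent_divide tangent_square

lemma smooth_near_compose:
 assumes F: "!!x. x \<in> Es n ==> F x \<in> Es n" "!!j. j < n ==> Cinf n (Es n) (%x. F x j)"
  and p: "p \<in> Es n" and f: "smooth_near M (F p) f"
 shows "smooth_near M p (%x. f (F x))"
proof -
 obtain W where W: "F p \<in> W" "eopen n W" "Cinf n W f" using f unfolding smooth_near_iff by blast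
 have cF: "continuous_on (Es n) F"
 proof (rule continuous_on_coordinatewise_then_product)
  show "continuous_on (Es n) (%x. F x i)" for i
  proof (cases "i < n")
   case True
   then show ?thesis using Ck_continuous[OF order_refl CinfD[OF F(2)]] by blast
  next
   case False
   then have "continuous_on (Es n) (%x. F x i) \<longleftrightarrow> continuous_on (Es n) (%x. 0::real)"
    using F(1) by (intro continuous_on_cong) (auto simp: Es_iff)
   then show ?thesis by simp
  qed
 qed
 obtain T where T: "open T" "W = Es n \<inter> T" using W(2) unfolding openin_Es_iff by blast
 define V where "V = {x \<in> Es n. F x \<in> W}"
 have "openin (top_of_set (Es n)) (Es n \<inter> F -` T)" by (rule continuous_openin_preimage_gen[OF cF T(1)])
 moreover have "Es n \<inter> F -` T = V" using F(1) T(2) by (auto simp: V_def)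
 ultimately have V: "eopen n V" by (subst Euclidean_space_top_of_set) simp
 have "Cinf n V (%x. f (F x))" unfolding Cinf_def
 proof
  fix k
  show "Ck n k V (%x. f (F x))"
  proof (rule Ck_compose[OF V W(2) F(1)])
   show "F x \<in> W" if "x \<in> V" for x using that by (simp add: V_def)
   show "Ck n k V (%x. F x j)" if "j < n" for j
    by (rule Ck_subset[OF openin_Es_subset[OF V] order_refl CinfD[OF F(2)[OF that]]])
   show "Ck n k W f" by (rule CinfD[OF W(3)])
  qed assumption
 qed
 moreover have "p \<in> V" using W(1) p by (simp add: V_def)
 ultimately show ?thesis unfolding smooth_near_iff using V by (intro exI[of _ V] conjI)
qed

lemma pushforward_tangent:
 assumes F: "!!x. x \<in> Es n ==> F x \<in> Es n" "!!j. j < n ==> Cinf n (Es n) (%x. F x j)"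
  and p: "p \<in> Es n" and v: "v \<in> tangent_space M p"
 shows "pushforward M M F p v \<in> tangent_space M (F p)"
proof -
 have s: "smooth_near M p (%x. f (F x))" if "smooth_near M (F p) f" for f
  by (rule smooth_near_compose[OF F p that]) assumption+
 show ?thesis unfolding tangent_space_def mem_Collect_eq
 proof (intro conjI allI impI)
  fix f g assume fg: "smooth_near M (F p) f" "smooth_near M (F p) g"
  show "pushforward M M F p v (%x. f x + g x) = pushforward M M F p v f + pushforward M M F p v g"
   using tangentD(2)[OF v s[OF fg(1)] s[OF fg(2)]] fg smooth_near_add[OF fg] by (simp add: pushforward_def)
  show "pushforward M M F p v (%x. f x * g x) = f (F p) * pushforward M M F p v g + g (F p) * pushforward M M F p v f"
   using tangentD(3)[OF v s[OF fg(1)] s[OF fg(2)]] fg smooth_near_mult[OF fg] by (simp add: pushforward_def)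
 next
  fix b f assume f: "smooth_near M (F p) f"
  show "pushforward M M F p v (%x. b * f x) = b * pushforward M M F p v f"
   using tangentD(4)[OF v s[OF f]] f smooth_near_mult[OF smooth_near_const[OF F(1)[OF p]] f] by (simp add: pushforward_def)
 qed (simp add: pushforward_def)
qed

lemma pushforward_coord:
 "F p \<in> Es n ==> pushforward M M F p v (%x. x j) = v (%x. F x j)"
 by (simp add: pushforward_def smooth_near_coord)

end

section \<open>The coordinate model of the two groups\<close>

text \<open>\<open>crd\<close> and \<open>sq\<close> connect the sequences of the model space, where
  smoothness is defined, with the tuples in which the measure theory is done.\<close>

definition crd :: "(nat => real) => r5" where
 "crd x = (x 0, x 1, x 2, x 3, x 4)"

definition sq :: "r5 => nat => real" where
 "sq p i = (if i = 0 then x1 p else if i = 1 then x2 p else if i = 2 then x3 p else if i = 3 then x4 p else if i = 4 then x5 p else 0)"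

lemma less5: "j < 5 \<longleftrightarrow> j = 0 \<or> j = 1 \<or> j = 2 \<or> j = 3 \<or> j = (4 :: nat)"
 by (auto simp: eval_nat_numeral less_Suc_eq)

lemma sq_simps [simp]: "sq p 0 = x1 p" "sq p (Suc 0) = x2 p" "sq p 2 = x3 p" "sq p 3 = x4 p" "sq p 4 = x5 p"
 by (simp_all add: sq_def)

lemma crd_simps [simp]: "x1 (crd x) = x 0" "x2 (crd x) = x 1" "x3 (crd x) = x 2" "x4 (crd x) = x 3" "x5 (crd x) = x 4"
 by (simp_all add: crd_def)

lemma sq_Es [simp]: "sq p \<in> Es 5" by (simp add: Es_iff sq_def)

lemma crd_sq [simp]: "crd (sq p) = p" by (simp add: crd_def)

lemma sq_crd [simp]: "x \<in> Es 5 ==> sq (crd x) = x"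
proof
 fix i assume "x \<in> Es 5"
 then show "sq (crd x) i = x i" by (cases "i < 5") (auto simp: sq_def Es_iff less5)
qed

lemma sq_linear: "sq (p + q) = sq p + sq q" "sq (c *\<^sub>R p) = c *\<^sub>R sq p" "sq 0 = 0"
 by (auto simp: fun_eq_iff sq_def scaleR_fun_def)

lemma crd_0 [simp]: "crd 0 = 0" by (simp add: crd_def zero_prod_def)

text \<open>The differential at the identity of left translation by \<open>x\<close>: the
  coordinates at \<open>x\<close> of the left invariant field with value \<open>a\<close> at the
  identity.\<close>

definition fr :: "real => r5 => r5 => r5" where
 "fr k x a = (x1 a, x2 a, x3 a + k * x1 x * x2 a, x4 a + x1 x * x3 a + k * (x1 x)\<^sup>2 * x2 a / 2,
   x5 a + x2 x * x3 a + k * x1 x * x2 x * x2 a)"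

definition lf :: "real => (nat => real) => r5 => (nat => real) tvec" where
 "lf k p a = tv 5 p (sq (fr k (crd p) a))"

text \<open>Solves \<open>fr\<close> for \<open>a\<close>: the coefficients of \<open>v\<close> in
  the left invariant frame at \<open>p\<close>.\<close>

definition cof :: "real => (nat => real) => (nat => real) tvec => r5" where
 "cof k p v = (let w = (%j. v (%x. x j)) in (w 0, w 1, w 2 - k * p 0 * w 1, w 3 - p 0 * w 2 + k * (p 0)\<^sup>2 * w 1 / 2, w 4 - p 1 * w 2))"

definition Mk :: "real => (nat => real) sub_riem" where
 "Mk k = \<lparr>mtop = Euclidean_space 5, mdim = 5, atlas = {(Es 5, %x. x)},
   hor = (%p. {lf k p a | a. x4 a = 0 & x5 a = 0}),
   met = (%p v w. x1 (cof k p v) * x1 (cof k p w) + x2 (cof k p v) * x2 (cof k p w) + x3 (cof k p v) * x3 (cof k p w))\<rparr>"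

definition Grp :: "real => (nat => real) monoid" where
 "Grp k = \<lparr>carrier = Es 5, mult = (%p q. sq (gm k (crd p) (crd q))), one = 0\<rparr>"

definition br :: "real => r5 => r5 => r5" where
 "br k a b = (0, 0, k * (x1 a * x2 b - x2 a * x1 b), x1 a * x3 b - x3 a * x1 b, x2 a * x3 b - x3 a * x2 b)"

interpretation mk: coord_mfd "Mk k" 5 for k
 by unfold_locales (simp_all add: Mk_def)

lemma Mk_sel [simp]: "mtop (Mk k) = Euclidean_space 5" "mdim (Mk k) = 5" "atlas (Mk k) = {(Es 5, %x. x)}"
 by (simp_all add: Mk_def)

lemma hor_Mk: "hor (Mk k) p = lf k p ` {a. x4 a = 0 & x5 a = 0}"
 by (simp only: Mk_def sub_riem.select_convs setcompr_eq_image)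

lemma met_Mk: "met (Mk k) p v w = x1 (cof k p v) * x1 (cof k p w) + x2 (cof k p v) * x2 (cof k p w) + x3 (cof k p v) * x3 (cof k p w)"
 by (simp add: Mk_def)

lemma Grp_sel [simp]: "carrier (Grp k) = Es 5" "p \<otimes>\<^bsub>Grp k\<^esub> q = sq (gm k (crd p) (crd q))" "\<one>\<^bsub>Grp k\<^esub> = 0"
 by (simp_all add: Grp_def)

lemma Es_0 [simp]: "0 \<in> Es n" by (simp add: Es_iff)

lemma lf_linear: "lf k p (a + b) = lf k p a + lf k p b" "lf k p (c *\<^sub>R a) = c *\<^sub>R lf k p a" "lf k p 0 = 0"
proof -
 have "fr k x (a + b) = fr k x a + fr k x b" "fr k x (c *\<^sub>R a) = c *\<^sub>R fr k x a" "fr k x 0 = 0" for x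
  by (simp_all add: fr_def prod_eq_iff zero_prod_def algebra_simps add_divide_distrib)
 then show "lf k p (a + b) = lf k p a + lf k p b" "lf k p (c *\<^sub>R a) = c *\<^sub>R lf k p a" "lf k p 0 = 0"
  by (auto simp: lf_def tv_def fun_eq_iff sq_linear scaleR_fun_def sum.distrib sum_distrib_left algebra_simps)
qed

lemma linear_lf: "linear (lf k p)" by (intro linearI lf_linear)

lemma lf_coord: "p \<in> Es 5 ==> j < 5 ==> lf k p a (%x. x j) = sq (fr k (crd p) a) j"
 by (simp add: lf_def mk.tv_coord)

lemma lf_tangent: "p \<in> Es 5 ==> lf k p a \<in> tangent_space (Mk k') p"
 unfolding lf_def by (rule mk.tv_in_tangent)

lemma lf_outside: "p \<notin> Es 5 ==> lf k p a = 0"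
 using openin_Es_subset by (fastforce simp: lf_def tv_def fun_eq_iff)

lemma cof_lf [simp]: "p \<in> Es 5 ==> cof k p (lf k p a) = a"
 by (simp add: cof_def lf_coord fr_def prod_eq_iff field_simps power2_eq_square)

lemma lf_cof: "v \<in> tangent_space (Mk k') p ==> p \<in> Es 5 ==> lf k p (cof k p v) = v"
proof (rule mk.tangent_eqI)
 assume p: "p \<in> Es 5"
 show "lf k p (cof k p v) (%x. x j) = v (%x. x j)" if "j < 5" for j
  using that p unfolding lf_coord[OF p that] by (auto simp: less5 cof_def fr_def Let_def field_simps power2_eq_square)
qed (auto intro: lf_tangent)

lemma inj_lf: "p \<in> Es 5 ==> inj (lf k p)" by (rule inj_on_inverseI[of _ "cof k p"]) simp

lemma tangent_Mk: "p \<in> Es 5 ==> tangent_space (Mk k') p = range (lf k p)"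
proof (intro equalityI subsetI)
 fix v assume "p \<in> Es 5" "v \<in> tangent_space (Mk k') p"
 then show "v \<in> range (lf k p)" using lf_cof[of v k' p k] by (intro image_eqI[of _ _ "cof k p v"]) simp_all
qed (auto intro: lf_tangent)

lemma cof_linear: "cof k p (v + w) = cof k p v + cof k p w" "cof k p (c *\<^sub>R v) = c *\<^sub>R cof k p v"
 by (simp_all add: cof_def Let_def prod_eq_iff algebra_simps scaleR_fun_def add_divide_distrib)

lemma smooth_lf: "smooth_vfield_on (Mk k') (Es 5) (%p. lf k p a)" unfolding mk.smooth_vfield_on_iff
proof (intro conjI ballI allI impI)
 show E: "eopen 5 (Es 5)" by (rule openin_topspace)
 show "lf k q a \<in> tangent_space (Mk k') q" if "q \<in> Es 5" for q using that by (rule lf_tangent)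
 fix j :: nat assume j: "j < 5"
 have "Cinf 5 (Es 5) (%p. sq (fr k (crd p) a) j)" using j unfolding less5
  by (elim disjE; simp only: sq_simps fr_def crd_simps fst_conv snd_conv One_nat_def divide_inverse)
   (intro Cinf_add[OF E] Cinf_mult[OF E] Cinf_const[OF E] Cinf_coord[OF E] Cinf_power[OF E])+
 then show "Cinf 5 (Es 5) (%q. lf k q a (%x. x j))"
  using j Cinf_cong[OF E, of "%q. lf k q a (%x. x j)" "%p. sq (fr k (crd p) a) j"] by (simp add: lf_coord)
qed

lemma bracket_lf: "vf_bracket (Mk k') (%p. lf k p a) (%p. lf k p b) = (%p. lf k p (br k a b))"
proof
 fix p show "vf_bracket (Mk k') (%p. lf k p a) (%p. lf k p b) p = lf k p (br k a b)"
 proof (cases "p \<in> Es 5")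
  case False
  then have "\<not> smooth_near (Mk k') p f" for f using mk.smooth_near_pts by blast
  then show ?thesis using False by (auto simp: vf_bracket_def lf_outside fun_eq_iff)
 next
  case True
  show ?thesis
  proof (rule mk.tangent_eqI[OF mk.bracket_tangent[OF smooth_lf smooth_lf True] lf_tangent[OF True] True])
   fix j :: nat assume j: "j < 5"
   have E: "eopen 5 (Es 5)" by (rule openin_topspace)
   have *: "lf k p a (%q. lf k q b (%x. x j)) = lf k p a (%q. sq (fr k (crd q) b) j)" for a b
   proof (rule mk.tangent_local[OF lf_tangent[OF True] E True])
    show "smooth_near (Mk k') p (%q. lf k q b (%x. x j))"
     using mk.smooth_vfield_apply[OF smooth_lf order_refl E Cinf_coord[OF E]] True E unfolding mk.smooth_near_iff by blast
   qed (rule lf_coord[OF _ j])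
   show "vf_bracket (Mk k') (%p. lf k p a) (%p. lf k p b) p (%x. x j) = lf k p (br k a b) (%x. x j)"
    unfolding mk.bracket_coord[OF True] * lf_coord[OF True j]
    using j True by (auto simp: less5 fr_def br_def mk.tangent_simps[OF lf_tangent[OF True]] mk.smooth_near_simps lf_coord field_simps power2_eq_square)
  qed
 qed
qed

lemma hor_subset_tangent: "p \<in> Es 5 ==> hor (Mk k) p \<subseteq> tangent_space (Mk k') p"
 unfolding hor_Mk using lf_tangent by blast

lemma hor_iff: "p \<in> Es 5 ==> v \<in> hor (Mk k) p \<longleftrightarrow> v \<in> tangent_space (Mk k) p & x4 (cof k p v) = 0 & x5 (cof k p v) = 0"
proof -
 assume p: "p \<in> Es 5"
 have "v \<in> hor (Mk k) p" if "v \<in> tangent_space (Mk k) p" "x4 (cof k p v) = 0" "x5 (cof k p v) = 0"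
  unfolding hor_Mk using lf_cof[OF that(1) p, of k] that(2,3) by (metis (mono_tags, lifting) image_eqI mem_Collect_eq)
 moreover have "x4 (cof k p v) = 0 & x5 (cof k p v) = 0" if "v \<in> hor (Mk k) p" using that p unfolding hor_Mk by auto
 ultimately show ?thesis using hor_subset_tangent[OF p] by blast
qed

text \<open>The two contact equations of the horizontal space, solved for the last two
  coordinates.\<close>

lemma hor_coord:
 assumes "v \<in> hor (Mk k) p" "p \<in> Es 5"
 shows "v (%x. x 3) = p 0 * v (%x. x 2) - k / 2 * (p 0)\<^sup>2 * v (%x. x 1)" "v (%x. x 4) = p 1 * v (%x. x 2)"
 using hor_iff[OF assms(2), of v k] assms(1) by (simp_all add: cof_def Let_def)

text \<open>Differentiating the contact equations of one field along the other shows that the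
  bracket modulo the horizontal space depends only on the values at \<open>p\<close>. This makes the
  graded bracket computable for arbitrary sections.\<close>

lemma bracket_hor:
 assumes X: "hor_section_on (Mk k) W X" and Y: "hor_section_on (Mk k) W Y" and p: "p \<in> W"
 shows "x4 (cof k p (vf_bracket (Mk k) X Y p)) = x4 (br k (cof k p (X p)) (cof k p (Y p)))" (is ?P1)
  and "x5 (cof k p (vf_bracket (Mk k) X Y p)) = x5 (br k (cof k p (X p)) (cof k p (Y p)))" (is ?P2)
proof -
 have X': "smooth_vfield_on (Mk k) W X" "\<forall>q\<in>W. X q \<in> hor (Mk k) q" using X by (auto simp: hor_section_on_def)
 have Y': "smooth_vfield_on (Mk k) W Y" "\<forall>q\<in>W. Y q \<in> hor (Mk k) q" using Y by (auto simp: hor_section_on_def)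
 have W: "eopen 5 W" using X' by (simp add: mk.smooth_vfield_on_iff)
 note WE = openin_Es_subset[OF W]
 have pE: "p \<in> Es 5" using p WE by blast
 have T: "X p \<in> tangent_space (Mk k) p" "Y p \<in> tangent_space (Mk k) p" using X' Y' p by (auto simp: smooth_vfield_on_def)
 have main: "v (%q. Z q (%x. x 3)) = v (%q. q 0 * Z q (%x. x 2) - k / 2 * (q 0)\<^sup>2 * Z q (%x. x 1))" (is ?P3)
   "v (%q. Z q (%x. x 4)) = v (%q. q 1 * Z q (%x. x 2))" (is ?P4)
   "smooth_near (Mk k) p (%q. Z q (%x. x j))"
  if Z: "smooth_vfield_on (Mk k) W Z" "\<forall>q\<in>W. Z q \<in> hor (Mk k) q" and v: "v \<in> tangent_space (Mk k) p" for Z v j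
 proof -
  show s: "smooth_near (Mk k) p (%q. Z q (%x. x j))" for j
   using mk.smooth_vfield_apply[OF Z(1) order_refl W Cinf_coord[OF W]] p W unfolding mk.smooth_near_iff by blast
  show ?P3 by (rule mk.tangent_local[OF v W p hor_coord(1)[OF Z(2)[rule_format]] s]) (use WE in auto)
  show ?P4 by (rule mk.tangent_local[OF v W p hor_coord(2)[OF Z(2)[rule_format]] s]) (use WE in auto)
 qed
 note XY = main(1,2)[OF Y' T(1)] main(1,2)[OF X' T(2)]
 note sm = main(3)[OF Y' T(1)] main(3)[OF X' T(2)]
 note ts = mk.tangent_simps[OF T(1)] mk.tangent_simps[OF T(2)]
 show ?P1 unfolding cof_def Let_def mk.bracket_coord[OF pE] XY br_def
  by (simp add: ts mk.smooth_near_simps pE sm) (simp add: field_simps power2_eq_square)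
 show ?P2 unfolding cof_def Let_def mk.bracket_coord[OF pE] XY br_def
  by (simp add: ts mk.smooth_near_simps pE sm) (simp add: field_simps power2_eq_square)
qed

lemma group_Grp: "group (Grp k)"
proof (rule groupI)
 fix x y z assume "x \<in> carrier (Grp k)" "y \<in> carrier (Grp k)" "z \<in> carrier (Grp k)"
 then show "x \<otimes>\<^bsub>Grp k\<^esub> y \<otimes>\<^bsub>Grp k\<^esub> z = x \<otimes>\<^bsub>Grp k\<^esub> (y \<otimes>\<^bsub>Grp k\<^esub> z)" by (simp add: gm_assoc)
next
 fix x assume x: "x \<in> carrier (Grp k)"
 then show "\<one>\<^bsub>Grp k\<^esub> \<otimes>\<^bsub>Grp k\<^esub> x = x" by simp
 show "\<exists>y\<in>carrier (Grp k). y \<otimes>\<^bsub>Grp k\<^esub> x = \<one>\<^bsub>Grp k\<^esub>"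
  by (rule bexI[of _ "sq (gi k (crd x))"]) (simp_all add: sq_linear)
qed simp_all

lemma inv_Grp: "x \<in> Es 5 ==> inv\<^bsub>Grp k\<^esub> x = sq (gi k (crd x))"
 by (intro group.inv_equality[OF group_Grp]) (simp_all add: sq_linear)

lemma continuous_on_crd [continuous_intros]: "continuous_on S f ==> continuous_on S (%x. crd (f x))"
 unfolding crd_def
 by (intro continuous_on_Pair continuous_on_compose2[OF continuous_on_product_coordinates, of S f]) auto

lemma continuous_on_sq [continuous_intros]: "continuous_on S f ==> continuous_on S (%x. sq (f x))"
proof (rule continuous_on_coordinatewise_then_product)
 fix i assume "continuous_on S f"
 then show "continuous_on S (%x. sq (f x) i)"
  by (cases "i < 5") (auto simp: less5 sq_def intro!: continuous_intros)
qed

lemma continuous_map_Es_Es: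
 "continuous_map (Euclidean_space n) (Euclidean_space m) f \<longleftrightarrow> continuous_on (Es n) f & f \<in> Es n \<rightarrow> Es m"
 by (subst (1 2) Euclidean_space_top_of_set) (rule continuous_map_subtopology_eu)

lemma continuous_map_Es_prod:
 "continuous_map (prod_topology (Euclidean_space n) (Euclidean_space n')) (Euclidean_space m) f \<longleftrightarrow> continuous_on (Es n \<times> Es n') f & f \<in> Es n \<times> Es n' \<rightarrow> Es m"
 by (subst (1 2 3) Euclidean_space_top_of_set) (simp only: prod_topology_subtopology_eu continuous_map_subtopology_eu)

lemma inv_into_Es: "x \<in> Es n ==> inv_into (Es n) (%x. x) x = x"
 using inv_into_f_f[of "%x. x" "Es n" x] by (simp add: inj_on_def)

lemmas Cinf_rules = Cinf_add Cinf_mult Cinf_diff Cinf_minus Cinf_const Cinf_coord Cinf_power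

lemma lie_group_Grp: "lie_group (Grp k) (Mk k)" unfolding lie_group_def
proof (intro conjI)
 show "group (Grp k)" by (rule group_Grp)
 show "smooth_manifold (Mk k)" by (rule mk.smooth_manifold)
 show "carrier (Grp k) = pts (Mk k)" by simp
 have E: "eopen n (Es n)" for n by (rule openin_topspace)
 show "smooth_map (Mk k) (Mk k) (%x. inv\<^bsub>Grp k\<^esub> x)" unfolding smooth_map_def
 proof (intro conjI)
  have "continuous_map (Euclidean_space 5) (Euclidean_space 5) (%x. sq (gi k (crd x)))"
   unfolding continuous_map_Es_Es by (auto intro!: continuous_intros)
  then show "continuous_map (mtop (Mk k)) (mtop (Mk k)) (%x. inv\<^bsub>Grp k\<^esub> x)"
   unfolding Mk_sel by (rule continuous_map_eq) (simp add: inv_Grp)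
  have "Cinf 5 (Es 5) (%x. sq (gi k (crd x)) j)" if "j < 5" for j using that unfolding less5
   by (elim disjE; simp only: sq_simps gi_def crd_simps fst_conv snd_conv One_nat_def divide_inverse)
    (intro Cinf_rules E)+
  then have "Cinf 5 (Es 5) (%x. (inv\<^bsub>Grp k\<^esub> (inv_into (Es 5) (%x. x) x)) j)" if "j < 5" for j
   using that Cinf_cong[OF E, of 5 "%x. (inv\<^bsub>Grp k\<^esub> (inv_into (Es 5) (%x. x) x)) j" "%x. sq (gi k (crd x)) j"]
   by (simp add: inv_Grp inv_into_Es)
  moreover have "{p \<in> Es 5. inv\<^bsub>Grp k\<^esub> p \<in> Es 5} = Es 5" by (auto simp: inv_Grp)
  ultimately show "\<forall>(U, h)\<in>atlas (Mk k). \<forall>(V, g)\<in>atlas (Mk k). \<forall>j<mdim (Mk k).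
    Cinf (mdim (Mk k)) (h ` {p \<in> U. inv\<^bsub>Grp k\<^esub> p \<in> V}) (%x. g (inv\<^bsub>Grp k\<^esub> (inv_into U h x)) j)" by simp
 qed
 \<comment> \<open>\<open>h\<close> is the chart of the product manifold and \<open>g\<close> its
   inverse; smoothness of the multiplication becomes that of polynomials in ten variables.\<close>
 define h :: "(nat => real) \<times> (nat => real) => nat => real" where "h = (%(p, q) i. if i < 5 then p i else q (i - 5))"
 define g :: "(nat => real) => (nat => real) \<times> (nat => real)" where
  "g x = (sq (x 0, x 1, x 2, x 3, x 4), sq (x 5, x 6, x 7, x 8, x 9))" for x
 have gh: "g (h z) = z" if "z \<in> Es 5 \<times> Es 5" for z
 proof -
  obtain p q where z: "z = (p, q)" by (metis surj_pair)
  have "g (h z) = (sq (crd p), sq (crd q))" by (simp add: g_def h_def crd_def z)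
  then show ?thesis using that by (simp add: z)
 qed
 have hg: "h (g x) = x" if "x \<in> Es 10" for x
 proof
  fix i show "h (g x) i = x i"
  proof (cases "i < 10")
   case True
   then have "i \<in> {0, 1, 2, 3, 4, 5, 6, 7, 8, 9}" by auto
   then show ?thesis by (auto simp: g_def h_def)
  next
   case False
   then show ?thesis using that by (auto simp: g_def h_def Es_iff sq_def)
  qed
 qed
 have inj: "inj_on h (Es 5 \<times> Es 5)" by (rule inj_on_inverseI[of _ g]) (rule gh)
 have img: "h ` (Es 5 \<times> Es 5) = Es 10"
 proof
  show "h ` (Es 5 \<times> Es 5) \<subseteq> Es 10" by (auto simp: h_def Es_iff)
  show "Es 10 \<subseteq> h ` (Es 5 \<times> Es 5)"
  proof
   fix x assume "x \<in> Es 10"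
   moreover have "g x \<in> Es 5 \<times> Es 5" by (simp add: g_def)
   ultimately show "x \<in> h ` (Es 5 \<times> Es 5)" using hg by (metis imageI)
  qed
 qed
 have inv: "inv_into (Es 5 \<times> Es 5) h x = g x" if "x \<in> Es 10" for x
  by (rule inv_into_f_eq[OF inj _ hg[OF that]]) (simp add: g_def)
 show "smooth_map (prod_mfd (Mk k) (Mk k)) (Mk k) (%(x, y). x \<otimes>\<^bsub>Grp k\<^esub> y)"
  unfolding smooth_map_def
 proof (intro conjI)
  have "continuous_map (prod_topology (Euclidean_space 5) (Euclidean_space 5)) (Euclidean_space 5) (%z. sq (gm k (crd (fst z)) (crd (snd z))))"
   unfolding continuous_map_Es_prod
   by (intro conjI continuous_on_sq continuous_on_gm continuous_on_crd continuous_on_fst continuous_on_snd continuous_on_id) simp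
  then show "continuous_map (mtop (prod_mfd (Mk k) (Mk k))) (mtop (Mk k)) (%(x, y). x \<otimes>\<^bsub>Grp k\<^esub> y)"
   by (simp add: prod_mfd_def case_prod_unfold)
  have c: "Cinf 10 (Es 10) (%x. sq (gm k (x 0, x 1, x 2, x 3, x 4) (x 5, x 6, x 7, x 8, x 9)) j)" if "j < 5" for j
   using that unfolding less5
   by (elim disjE; simp only: sq_simps gm_def fst_conv snd_conv One_nat_def divide_inverse)
    (intro Cinf_rules E)+
  have "Cinf 10 (Es 10) (%x. (%(x, y). x \<otimes>\<^bsub>Grp k\<^esub> y) (inv_into (Es 5 \<times> Es 5) h x) j)" if "j < 5" for j
   using c[OF that] Cinf_cong[OF E, of 10 "%x. (%(x, y). x \<otimes>\<^bsub>Grp k\<^esub> y) (inv_into (Es 5 \<times> Es 5) h x) j" "%x. sq (gm k (x 0, x 1, x 2, x 3, x 4) (x 5, x 6, x 7, x 8, x 9)) j"]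
   by (simp add: inv) (simp add: g_def)
  moreover have "{p \<in> Es 5 \<times> Es 5. (case p of (x, y) => x \<otimes>\<^bsub>Grp k\<^esub> y) \<in> Es 5} = Es 5 \<times> Es 5" by auto
  moreover have "atlas (prod_mfd (Mk k) (Mk k)) = {(Es 5 \<times> Es 5, h)}"
   by (simp add: prod_mfd_def h_def cong: if_cong)
  moreover have "mdim (prod_mfd (Mk k) (Mk k)) = 10" by (simp add: prod_mfd_def)
  ultimately show "\<forall>(U, h)\<in>atlas (prod_mfd (Mk k) (Mk k)). \<forall>(V, g)\<in>atlas (Mk k). \<forall>j<mdim (Mk k).
    Cinf (mdim (prod_mfd (Mk k) (Mk k))) (h ` {p \<in> U. (case p of (x, y) => x \<otimes>\<^bsub>Grp k\<^esub> y) \<in> V})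
     (%x. g (case inv_into U h x of (x, y) => x \<otimes>\<^bsub>Grp k\<^esub> y) j)"
   by (simp add: img del: Grp_sel(2))
 qed
qed

lemma subgroup_GrpI:
 assumes "!!a b. a \<in> S ==> b \<in> S ==> gm k a b \<in> S" "!!a. a \<in> S ==> gi k a \<in> S" "0 \<in> S"
 shows "subgroup (sq ` S) (Grp k)"
proof (rule group.subgroupI[OF group_Grp])
 show "sq ` S \<subseteq> carrier (Grp k)" "sq ` S ~= {}" using assms(3) by auto
 show "inv\<^bsub>Grp k\<^esub> a \<in> sq ` S" if "a \<in> sq ` S" for a using that assms(2) by (auto simp: inv_Grp)
 show "a \<otimes>\<^bsub>Grp k\<^esub> b \<in> sq ` S" if "a \<in> sq ` S" "b \<in> sq ` S" for a b using that assms(1) by auto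
qed

lemma lower_central_Grp_step:
 assumes L: "lower_central (Grp k) n \<subseteq> sq ` S" and T: "subgroup (sq ` T) (Grp k)"
  and "!!a b. b \<in> S ==> gm k (gm k (gm k a b) (gi k a)) (gi k b) \<in> T"
 shows "lower_central (Grp k) (Suc n) \<subseteq> sq ` T" unfolding lower_central.simps
proof (rule group.generate_subgroup_incl[OF group_Grp _ T], clarify)
 fix x y assume x: "x \<in> carrier (Grp k)" and "y \<in> lower_central (Grp k) n"
 then obtain b where b: "b \<in> S" "y = sq b" using L by auto
 show "x \<otimes>\<^bsub>Grp k\<^esub> y \<otimes>\<^bsub>Grp k\<^esub> inv\<^bsub>Grp k\<^esub> x \<otimes>\<^bsub>Grp k\<^esub> inv\<^bsub>Grp k\<^esub> y \<in> sq ` T"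
  using x assms(3)[OF b(1), of "crd x"] by (auto simp: b(2) inv_Grp)
qed

text \<open>The lower central series loses coordinates one and two, then the third, then the
  rest.\<close>

lemma nilpotent_Grp: "nilpotent_group (Grp k)" unfolding nilpotent_group_def
proof (intro conjI exI[of _ 3])
 show "group (Grp k)" by (rule group_Grp)
 have 0: "lower_central (Grp k) 0 \<subseteq> sq ` UNIV"
 proof
  fix x assume "x \<in> lower_central (Grp k) 0"
  then show "x \<in> sq ` UNIV" by (intro image_eqI[of _ _ "crd x"]) simp_all
 qed
 have 1: "lower_central (Grp k) (Suc 0) \<subseteq> sq ` {a. x1 a = 0 & x2 a = 0}"
  by (rule lower_central_Grp_step[OF 0 subgroup_GrpI]) (simp_all add: gm_def gi_def zero_prod_def)
 have 2: "lower_central (Grp k) (Suc (Suc 0)) \<subseteq> sq ` {a. x1 a = 0 & x2 a = 0 & x3 a = 0}"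
  by (rule lower_central_Grp_step[OF 1 subgroup_GrpI]) (simp_all add: gm_def gi_def zero_prod_def)
 have 3: "lower_central (Grp k) (Suc (Suc (Suc 0))) \<subseteq> sq ` {0}"
  by (rule lower_central_Grp_step[OF 2 subgroup_GrpI]) (auto simp: gm_def gi_def zero_prod_def algebra_simps power2_eq_square)
 moreover have "\<one>\<^bsub>Grp k\<^esub> \<in> lower_central (Grp k) (Suc (Suc (Suc 0)))"
  unfolding lower_central.simps(2)[of _ "Suc (Suc 0)"] by (rule generate.one)
 ultimately show "lower_central (Grp k) 3 = {\<one>\<^bsub>Grp k\<^esub>}" by (auto simp: numeral_3_eq_3 sq_linear)
qed

lemma left_push_lf:
 assumes a: "a \<in> Es 5" and p: "p \<in> Es 5"
 shows "left_push (Grp k) (Mk k) a p (lf k p c) = lf k (a \<otimes>\<^bsub>Grp k\<^esub> p) c"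
proof -
 have E: "eopen 5 (Es 5)" by (rule openin_topspace)
 have ap: "a \<otimes>\<^bsub>Grp k\<^esub> p \<in> Es 5" by simp
 have T: "left_push (Grp k) (Mk k) a p (lf k p c) \<in> tangent_space (Mk k) (a \<otimes>\<^bsub>Grp k\<^esub> p)"
 proof (rule mk.pushforward_tangent[OF _ _ p lf_tangent[OF p]])
  show "Cinf 5 (Es 5) (%x. (a \<otimes>\<^bsub>Grp k\<^esub> x) j)" if "j < 5" for j
   using that unfolding less5
   by (elim disjE; simp only: Grp_sel sq_simps gm_def crd_simps fst_conv snd_conv One_nat_def divide_inverse)
    (intro Cinf_rules E)+
 qed simp
 show ?thesis
 proof (rule mk.tangent_eqI[OF T lf_tangent[OF ap] ap])
  fix j :: nat assume j: "j < 5"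
  show "left_push (Grp k) (Mk k) a p (lf k p c) (%x. x j) = lf k (a \<otimes>\<^bsub>Grp k\<^esub> p) c (%x. x j)"
   unfolding mk.pushforward_coord[where F = "%y. a \<otimes>\<^bsub>Grp k\<^esub> y" and p = p, OF ap] lf_coord[OF ap j]
   using j p by (auto simp: less5 gm_def fr_def mk.tangent_simps[OF lf_tangent[OF p]] mk.smooth_near_simps lf_coord field_simps power2_eq_square)
 qed
qed

section \<open>The sub-Riemannian structure and its flag\<close>

lemma dim_lf: "p \<in> Es 5 ==> dim (lf k p ` S) = dim S"
proof -
 assume p: "p \<in> Es 5"
 obtain B where B: "B \<subseteq> S" "independent B" "S \<subseteq> span B" "card B = dim S" by (rule basis_exists[of S]) (rule that; assumption)
 show "dim (lf k p ` S) = dim S"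
 proof (rule real_vector.dim_unique[of "lf k p ` B"])
  show "lf k p ` B \<subseteq> lf k p ` S" using B(1) by auto
  show "lf k p ` S \<subseteq> span (lf k p ` B)" using B(3) by (simp add: linear_span_image[OF linear_lf] image_mono)
  show "independent (lf k p ` B)"
   by (rule linear_independent_injective_image[OF linear_lf B(2)]) (rule inj_on_subset[OF inj_lf[OF p]], simp)
  show "card (lf k p ` B) = dim S" using B(4) by (simp add: card_image inj_on_subset[OF inj_lf[OF p]])
 qed
qed

definition e1 :: r5 where "e1 = (1, 0, 0, 0, 0)"
definition e2 :: r5 where "e2 = (0, 1, 0, 0, 0)"
definition e3 :: r5 where "e3 = (0, 0, 1, 0, 0)"

lemma hor_span: "{a. x4 a = 0 & x5 a = 0} = span {e1, e2, e3}"
proof (intro equalityI subsetI)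
 fix a :: r5 assume "a \<in> {a. x4 a = 0 & x5 a = 0}"
 then have "a = x1 a *\<^sub>R e1 + x2 a *\<^sub>R e2 + x3 a *\<^sub>R e3" by (simp add: e1_def e2_def e3_def prod_eq_iff)
 then show "a \<in> span {e1, e2, e3}" by (metis span_add span_scale span_base insertCI)
next
 have "span {e1, e2, e3} \<subseteq> {a. x4 a = 0 & x5 a = 0}"
  by (rule span_minimal) (auto simp: e1_def e2_def e3_def subspace_def zero_prod_def)
 then show "a \<in> {a. x4 a = 0 & x5 a = 0}" if "a \<in> span {e1, e2, e3}" for a using that by blast
qed

lemma subspace_hor_coords: "subspace {a :: r5. x4 a = 0 & x5 a = 0}"
 unfolding hor_span by (rule subspace_span)

lemma dim_hor: "dim {a :: r5. x4 a = 0 & x5 a = 0} = 3"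
proof -
 have "independent {e1, e2, e3}"
  by (rule pairwise_orthogonal_independent) (auto simp: pairwise_def orthogonal_def e1_def e2_def e3_def zero_prod_def)
 moreover have "card {e1, e2, e3} = 3" by (simp add: e1_def e2_def e3_def)
 ultimately show ?thesis unfolding hor_span by (simp add: dim_eq_card_independent)
qed

lemma subspace_hor: "subspace (hor (Mk k) p)"
 unfolding hor_Mk by (rule linear_subspace_image[OF linear_lf subspace_hor_coords])

lemma hor_section_lf: "x4 a = 0 ==> x5 a = 0 ==> hor_section_on (Mk k) (Es 5) (%p. lf k p a)"
 unfolding hor_section_on_def hor_Mk using smooth_lf by blast

lemma smooth_subbundle_Mk: "smooth_subbundle (Mk k)" unfolding smooth_subbundle_def
proof (intro exI[of _ 3] ballI)
 fix p assume "p \<in> pts (Mk k)"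
 then have p: "p \<in> Es 5" by simp
 define E where "E i = (%q. lf k q (if i = 0 then e1 else if i = Suc 0 then e2 else e3))" for i :: nat
 have E: "(%i. E i q) ` {..<3} = lf k q ` {e1, e2, e3}" for q
  by (auto simp: E_def eval_nat_numeral lessThan_Suc)
 have "span ((%i. E i q) ` {..<3}) = hor (Mk k) q" for q
  unfolding hor_Mk hor_span E by (rule linear_span_image[OF linear_lf])
 moreover have "hor_section_on (Mk k) (Es 5) (E i)" for i
  unfolding E_def by (rule hor_section_lf) (simp_all add: e1_def e2_def e3_def)
 moreover have "dim (hor (Mk k) q) = 3" if "q \<in> Es 5" for q
  unfolding hor_Mk using dim_lf[OF that] dim_hor by simp
 ultimately show "\<exists>W E. p \<in> W & (\<forall>i<(3::nat). hor_section_on (Mk k) W (E i)) & openin (mtop (Mk k)) W &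
   (\<forall>q\<in>W. hor (Mk k) q = span ((%i. E i q) ` {..<3}) & dim (hor (Mk k) q) = 3)"
  using p by (rule_tac exI[of _ "Es 5"], rule_tac exI[of _ E]) (simp add: openin_topspace)
qed

lemma smooth_hor_metric_Mk: "smooth_hor_metric (Mk k)" unfolding smooth_hor_metric_def
proof (intro conjI ballI allI impI)
 fix p u v w c assume p: "p \<in> pts (Mk k)" and u: "u \<in> hor (Mk k) p"
 show "met (Mk k) p (u + v) w = met (Mk k) p u w + met (Mk k) p v w"
  "met (Mk k) p (c *\<^sub>R u) w = c * met (Mk k) p u w" "met (Mk k) p u v = met (Mk k) p v u"
  by (simp_all add: met_Mk cof_linear algebra_simps)
 assume "u ~= 0"
 obtain a where a: "u = lf k p a" "x4 a = 0" "x5 a = 0" using u by (auto simp: hor_Mk)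
 have "a ~= 0" using \<open>u ~= 0\<close> by (auto simp: a lf_linear)
 then have "x1 a ~= 0 \<or> x2 a ~= 0 \<or> x3 a ~= 0" using a(2,3) by (auto simp: prod_eq_iff zero_prod_def)
 then have "0 < x1 a * x1 a + x2 a * x2 a + x3 a * x3 a"
  by (metis add_nonneg_nonneg add_nonneg_pos add_pos_nonneg not_real_square_gt_zero zero_le_square)
 then show "0 < met (Mk k) p u u" using p by (simp add: met_Mk a(1))
next
 fix W X Y assume X: "hor_section_on (Mk k) W X" and Y: "hor_section_on (Mk k) W Y"
 have W: "eopen 5 W" using X by (simp add: hor_section_on_def mk.smooth_vfield_on_iff)
 have c: "Cinf 5 W (%q. Z q (%x. x j))" if "hor_section_on (Mk k) W Z" for Z j
  using that mk.smooth_vfield_apply[OF _ order_refl W Cinf_coord[OF W]] by (auto simp: hor_section_on_def)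
 show "smooth_on (Mk k) W (%q. met (Mk k) q (X q) (Y q))"
  unfolding mk.smooth_on_iff met_Mk cof_def Let_def fst_conv snd_conv
  by (intro conjI W Cinf_add[OF W] Cinf_mult[OF W] Cinf_diff[OF W] Cinf_const[OF W] Cinf_coord[OF W] c[OF X] c[OF Y])
qed

lemma vfield_zero: "smooth_vfield_on (Mk k) (Es 5) 0"
proof -
 have "(%p. lf k p 0) = 0" by (simp add: lf_linear fun_eq_iff)
 then show ?thesis using smooth_lf[of k k 0] by simp
qed

lemma vfield_add:
 assumes X: "smooth_vfield_on (Mk k) W X" and Y: "smooth_vfield_on (Mk k) W Y"
 shows "smooth_vfield_on (Mk k) W (X + Y)"
proof -
 have W: "eopen 5 W" using X by (simp add: mk.smooth_vfield_on_iff)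
 have "X q + Y q \<in> tangent_space (Mk k) q" if "q \<in> W" for q
  using X Y that openin_Es_subset[OF W] by (intro subspace_add[OF mk.subspace_tangent]) (auto simp: smooth_vfield_on_def)
 then show ?thesis using X Y by (auto simp: mk.smooth_vfield_on_iff intro: Cinf_add)
qed

lemma vfield_scale:
 assumes X: "smooth_vfield_on (Mk k) W X"
 shows "smooth_vfield_on (Mk k) W (c *\<^sub>R X)"
proof -
 have W: "eopen 5 W" using X by (simp add: mk.smooth_vfield_on_iff)
 have "c *\<^sub>R X q \<in> tangent_space (Mk k) q" if "q \<in> W" for q
  using X that openin_Es_subset[OF W] by (intro subspace_scale[OF mk.subspace_tangent]) (auto simp: smooth_vfield_on_def)
 then show ?thesis using X by (auto simp: mk.smooth_vfield_on_iff scaleR_fun_def intro: Cinf_mult Cinf_const)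
qed

lemma vfield_common:
 assumes V: "p \<in> V" "smooth_vfield_on (Mk k) V X" and W: "p \<in> W" "smooth_vfield_on (Mk k) W Y"
 shows "p \<in> V \<inter> W" "smooth_vfield_on (Mk k) (V \<inter> W) X" (is ?P1) "smooth_vfield_on (Mk k) (V \<inter> W) Y"
proof -
 have "eopen 5 (V \<inter> W)" using V(2) W(2) by (simp add: mk.smooth_vfield_on_iff openin_Int)
 then show ?P1 "smooth_vfield_on (Mk k) (V \<inter> W) Y"
  using mk.smooth_vfield_restrict[OF V(2), of "V \<inter> W"] mk.smooth_vfield_restrict[OF W(2), of "V \<inter> W"] by auto
qed (use V W in auto)

text \<open>Members of \<open>Lsec\<close> come with different domains; a linear combination or
  bracket is smooth on the intersection of the finitely many that occur.\<close>

lemma Lsec_smooth: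
 assumes p: "p \<in> Es 5"
 shows "X \<in> Lsec (Mk k) p i ==> \<exists>W. p \<in> W & smooth_vfield_on (Mk k) W X"
proof (induction i arbitrary: X)
 case 0
 then have "X = 0" by simp
 then show ?case using vfield_zero[of k] p by blast
next
 case (Suc i)
 show ?case
 proof (cases i)
  case 0
  then show ?thesis using Suc(2) by (auto simp: hor_section_on_def)
 next
  case (Suc l)
  have IH: "\<exists>W. p \<in> W & smooth_vfield_on (Mk k) W Y" if "Y \<in> Lsec (Mk k) p (Suc l)" for Y
   using Suc.IH that Suc by simp
  have "X \<in> span (Lsec (Mk k) p (Suc l) \<union> {vf_bracket (Mk k) X Y | X Y. X \<in> Lsec (Mk k) p (Suc 0) & Y \<in> Lsec (Mk k) p (Suc l)})"
   using Suc.prems Suc by simp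
  then show ?thesis
  proof (induction rule: span_induct_alt)
   case base
   then show ?case using vfield_zero p by blast
  next
   case (step c x y)
   obtain V where V: "p \<in> V" "smooth_vfield_on (Mk k) V y" using step by blast
   have "\<exists>W. p \<in> W & smooth_vfield_on (Mk k) W x"
   proof (cases "x \<in> Lsec (Mk k) p (Suc l)")
    case False
    then obtain X Y where XY: "x = vf_bracket (Mk k) X Y" "X \<in> Lsec (Mk k) p (Suc 0)" "Y \<in> Lsec (Mk k) p (Suc l)"
     using step(1) by blast
    obtain A where A: "p \<in> A" "smooth_vfield_on (Mk k) A X" using XY(2) by (auto simp: hor_section_on_def)
    obtain B where B: "p \<in> B" "smooth_vfield_on (Mk k) B Y" using IH[OF XY(3)] by blast
    show ?thesis unfolding XY(1) using vfield_common[OF A B] mk.bracket_smooth by blast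
   qed (rule IH)
   then obtain W where W: "p \<in> W" "smooth_vfield_on (Mk k) W x" by blast
   have c: "p \<in> V \<inter> W" "smooth_vfield_on (Mk k) (V \<inter> W) y" "smooth_vfield_on (Mk k) (V \<inter> W) x"
    using vfield_common[OF V W] by auto
   show ?case using c(1) vfield_add[OF vfield_scale[OF c(3)] c(2)] by blast
  qed
 qed
qed

lemma Lsec_mono: "Lsec (Mk k) p (Suc i) \<subseteq> Lsec (Mk k) p (Suc (Suc i))"
 unfolding Lsec.simps(3) by (rule order_trans[OF Un_upper1 span_superset])

text \<open>The brackets of \<open>e1\<close> and \<open>e2\<close> with \<open>e3\<close> give the
  last two fields for every \<open>k\<close>, so the flag is complete after two steps in the group
  and in the cone alike.\<close>

lemma lf_in_Lsec:
 assumes p: "p \<in> Es 5"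
 shows "(%q. lf k q a) \<in> Lsec (Mk k) p (Suc (Suc i))"
proof (induction i)
 case 0
 have L1: "(%q. lf k q b) \<in> Lsec (Mk k) p (Suc 0)" if "x4 b = 0" "x5 b = 0" for b
  using hor_section_lf[OF that] p by auto
 let ?S = "Lsec (Mk k) p (Suc 0) \<union> {vf_bracket (Mk k) X Y | X Y. X \<in> Lsec (Mk k) p (Suc 0) & Y \<in> Lsec (Mk k) p (Suc 0)}"
 have B: "(%q. lf k q (br k b c)) \<in> ?S" if "x4 b = 0" "x5 b = 0" "x4 c = 0" "x5 c = 0" for b c
  using L1[OF that(1,2)] L1[OF that(3,4)] bracket_lf[of k k b c, symmetric] by blast
 have "a = (x1 a, x2 a, x3 a, 0, 0) + (x4 a *\<^sub>R br k e1 e3 + x5 a *\<^sub>R br k e2 e3)"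
  by (simp add: e1_def e2_def e3_def br_def prod_eq_iff)
 then have "lf k q a = lf k q (x1 a, x2 a, x3 a, 0, 0) + (x4 a *\<^sub>R lf k q (br k e1 e3) + x5 a *\<^sub>R lf k q (br k e2 e3))" for q
  by (metis lf_linear(1,2))
 then have "(%q. lf k q a) = (%q. lf k q (x1 a, x2 a, x3 a, 0, 0)) + (x4 a *\<^sub>R (%q. lf k q (br k e1 e3)) + x5 a *\<^sub>R (%q. lf k q (br k e2 e3)))"
  by (simp add: fun_eq_iff scaleR_fun_def)
 also have "... \<in> span ?S"
  by (intro span_add span_scale span_base B) (simp_all add: L1[simplified] e1_def e2_def e3_def)
 finally show ?case by simp
next
 case (Suc i)
 then show ?case using Lsec_mono by blast
qed

lemma Lval_Mk:
 assumes p: "p \<in> Es 5"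
 shows "Lval (Mk k) p 0 = {0}" "Lval (Mk k) p (Suc 0) = hor (Mk k) p" (is ?P1)
  "Lval (Mk k) p (Suc (Suc i)) = tangent_space (Mk k) p" (is ?P2)
proof -
 show "Lval (Mk k) p 0 = {0}" by (simp add: Lval_def)
 show ?P1
 proof
  show "Lval (Mk k) p (Suc 0) \<subseteq> hor (Mk k) p" by (auto simp: Lval_def hor_section_on_def)
  show "hor (Mk k) p \<subseteq> Lval (Mk k) p (Suc 0)"
  proof
   fix v assume "v \<in> hor (Mk k) p"
   then obtain a where a: "v = lf k p a" "x4 a = 0" "x5 a = 0" by (auto simp: hor_Mk)
   have "(%q. lf k q a) \<in> Lsec (Mk k) p (Suc 0)" using hor_section_lf[OF a(2,3)] p by auto
   then show "v \<in> Lval (Mk k) p (Suc 0)" unfolding Lval_def a(1) by (rule rev_image_eqI) simp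
  qed
 qed
 show ?P2
 proof
  show "Lval (Mk k) p (Suc (Suc i)) \<subseteq> tangent_space (Mk k) p"
  proof
   fix v assume "v \<in> Lval (Mk k) p (Suc (Suc i))"
   then obtain X where X: "X \<in> Lsec (Mk k) p (Suc (Suc i))" "v = X p" unfolding Lval_def by blast
   then show "v \<in> tangent_space (Mk k) p" using Lsec_smooth[OF p X(1)] by (auto simp: smooth_vfield_on_def)
  qed
  show "tangent_space (Mk k) p \<subseteq> Lval (Mk k) p (Suc (Suc i))"
   unfolding tangent_Mk[OF p, of k k] Lval_def
  proof (rule image_subsetI)
   fix a show "lf k p a \<in> (%X. X p) ` Lsec (Mk k) p (Suc (Suc i))"
    by (rule image_eqI[OF _ lf_in_Lsec[OF p, of k a i]]) (rule refl)
  qed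
 qed
qed

lemma bracket_generating_Mk: "bracket_generating (Mk k)" unfolding bracket_generating_def
proof
 fix p assume "p \<in> pts (Mk k)"
 then have p: "p \<in> Es 5" by simp
 have "Lval (Mk k) p i \<subseteq> tangent_space (Mk k) p" for i
 proof (cases i)
  case 0
  then show ?thesis using Lval_Mk(1)[OF p] subspace_0[OF mk.subspace_tangent[OF p]] by simp
 next
  case (Suc l)
  then show ?thesis using Lval_Mk(2,3)[OF p, where k = k] hor_subset_tangent[OF p] by (cases l) auto
 qed
 then have "(\<Union>i. Lval (Mk k) p i) = tangent_space (Mk k) p" using Lval_Mk(3)[OF p, of k 0] by blast
 then show "span (\<Union>i. Lval (Mk k) p i) = tangent_space (Mk k) p"
  using mk.subspace_tangent[OF p] by (simp add: span_eq_iff)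
qed

lemma sub_riemannian_Mk: "sub_riemannian (Mk k)"
proof -
 have "pts (Mk k) ~= {}" using Es_0[of 5] by (metis Mk_sel(1) empty_iff)
 then show ?thesis unfolding sub_riemannian_def
  using mk.smooth_manifold smooth_subbundle_Mk bracket_generating_Mk smooth_hor_metric_Mk connected_Euclidean_space[of 5] by (simp only: Mk_sel simp_thms)
qed

lemma equiregular_Mk: "equiregular (Mk k)"
proof -
 have d: "dim (Lval (Mk k) p i) = dim (Lval (Mk k) q i)" if pq: "p \<in> Es 5" "q \<in> Es 5" for p q i
 proof (cases i)
  case 0
  then show ?thesis using Lval_Mk(1)[OF pq(1)] Lval_Mk(1)[OF pq(2)] by simp
 next
  case (Suc l)
  then show ?thesis using Lval_Mk(2,3)[OF pq(1), where k = k] Lval_Mk(2,3)[OF pq(2), where k = k]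
   by (cases l) (simp_all add: hor_Mk tangent_Mk[of _ k k] pq dim_lf)
 qed
 show ?thesis unfolding equiregular_def Mk_sel by (intro ballI allI impI arg_cong2[where f = "(-)"] d)
qed

lemma left_invariant_Mk: "left_invariant_sub_riemannian (Grp k) (Mk k)"
 unfolding left_invariant_sub_riemannian_def
proof (intro conjI ballI)
 show "lie_group (Grp k) (Mk k)" "sub_riemannian (Mk k)" by (rule lie_group_Grp sub_riemannian_Mk)+
 fix a x assume "a \<in> carrier (Grp k)" "x \<in> carrier (Grp k)"
 then have ax: "a \<in> Es 5" "x \<in> Es 5" "a \<otimes>\<^bsub>Grp k\<^esub> x \<in> Es 5" by simp_all
 note lp = left_push_lf[OF ax(1,2)]
 show "left_push (Grp k) (Mk k) a x ` hor (Mk k) x = hor (Mk k) (a \<otimes>\<^bsub>Grp k\<^esub> x)"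
  unfolding hor_Mk image_image lp ..
 fix v w assume "v \<in> hor (Mk k) x" "w \<in> hor (Mk k) x"
 then obtain b c where "v = lf k x b" "w = lf k x c" unfolding hor_Mk by blast
 then show "met (Mk k) (a \<otimes>\<^bsub>Grp k\<^esub> x) (left_push (Grp k) (Mk k) a x v) (left_push (Grp k) (Mk k) a x w) = met (Mk k) x v w"
  by (simp only: lp met_Mk cof_lf[OF ax(2)] cof_lf[OF ax(3)])
qed

lemma left_invariant_fields_Mk: "left_invariant_fields (Grp k) (Mk k) = range (%a p. lf k p a)"
proof (intro equalityI subsetI)
 fix X assume X: "X \<in> left_invariant_fields (Grp k) (Mk k)"
 have "X 0 \<in> tangent_space (Mk k) 0" using X by (auto simp: left_invariant_fields_def smooth_vfield_on_def)
 then have X0: "X 0 = lf k 0 (cof k 0 (X 0))" using lf_cof[of "X 0" k 0 k] by simp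
 have "X p = lf k p (cof k 0 (X 0))" for p
 proof (cases "p \<in> Es 5")
  case False
  then show ?thesis using X by (simp add: left_invariant_fields_def lf_outside)
 next
  case True
  have "X (p \<otimes>\<^bsub>Grp k\<^esub> 0) = left_push (Grp k) (Mk k) p 0 (X 0)"
   using X True Es_0[of 5] unfolding left_invariant_fields_def Grp_sel(1) mem_Collect_eq by metis
  also have "... = lf k (p \<otimes>\<^bsub>Grp k\<^esub> 0) (cof k 0 (X 0))" by (subst X0) (rule left_push_lf[OF True Es_0])
  finally show ?thesis using True by simp
 qed
 then show "X \<in> range (%a p. lf k p a)" by blast
next
 fix X assume "X \<in> range (%a p. lf k p a)"
 then obtain a where a: "X = (%p. lf k p a)" by blast
 show "X \<in> left_invariant_fields (Grp k) (Mk k)" unfolding left_invariant_fields_def mem_Collect_eq a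
  unfolding Grp_sel(1) by (intro conjI ballI allI impI smooth_lf left_push_lf lf_outside)
qed

section \<open>The stratified Lie algebra of the cone\<close>

definition lif :: "real => r5 => (nat => real) vfield" where
 "lif k a = (%p. lf k p a)"

lemma lif_linear: "lif k (a + b) = lif k a + lif k b" "lif k (c *\<^sub>R a) = c *\<^sub>R lif k a" "lif k 0 = 0"
 by (simp_all add: lif_def lf_linear fun_eq_iff scaleR_fun_def)

lemma linear_lif: "linear (lif k)" by (intro linearI lif_linear)

lemma inj_lif: "inj (lif k)" by (rule inj_on_inverseI[of _ "%X. cof k 0 (X 0)"]) (simp add: lif_def)

lemma bracket_lif: "vf_bracket (Mk k) (lif k a) (lif k b) = lif k (br k a b)"
 unfolding lif_def by (rule bracket_lf)

lemma left_invariant_fields_lif: "left_invariant_fields (Grp k) (Mk k) = range (lif k)"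
 unfolding left_invariant_fields_Mk lif_def ..

lemma lie_algebra_Mk: "lie_algebra (range (lif k)) (vf_bracket (Mk k))" unfolding lie_algebra_def
proof (intro conjI ballI allI)
 show "subspace (range (lif k))" by (rule linear_subspace_image[OF linear_lif subspace_UNIV])
 fix x y z c assume "x \<in> range (lif k)" "y \<in> range (lif k)" "z \<in> range (lif k)"
 then obtain a b d where abd: "x = lif k a" "y = lif k b" "z = lif k d" by blast
 show "vf_bracket (Mk k) x y \<in> range (lif k)" by (simp add: abd bracket_lif)
 have "br k a a = 0" by (simp add: br_def zero_prod_def)
 then show "vf_bracket (Mk k) x x = 0" by (simp add: abd bracket_lif lif_linear)
 have "br k (a + b) d = br k a d + br k b d" "br k d (a + b) = br k d a + br k d b"
  "br k (c *\<^sub>R a) b = c *\<^sub>R br k a b" "br k a (c *\<^sub>R b) = c *\<^sub>R br k a b"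
  "br k a (br k b d) + br k b (br k d a) + br k d (br k a b) = 0"
  by (simp_all add: br_def prod_eq_iff zero_prod_def algebra_simps)
 then show "vf_bracket (Mk k) (x + y) z = vf_bracket (Mk k) x z + vf_bracket (Mk k) y z"
  "vf_bracket (Mk k) z (x + y) = vf_bracket (Mk k) z x + vf_bracket (Mk k) z y"
  "vf_bracket (Mk k) (c *\<^sub>R x) y = c *\<^sub>R vf_bracket (Mk k) x y"
  "vf_bracket (Mk k) x (c *\<^sub>R y) = c *\<^sub>R vf_bracket (Mk k) x y"
  "vf_bracket (Mk k) x (vf_bracket (Mk k) y z) + vf_bracket (Mk k) y (vf_bracket (Mk k) z x) + vf_bracket (Mk k) z (vf_bracket (Mk k) x y) = 0"
  unfolding abd bracket_lif lif_linear(1,2)[symmetric] by (simp_all add: lif_linear(3) bracket_lif flip: lif_linear(1,2))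
qed

text \<open>The layers are compatible with \<open>br 0\<close> only: for \<open>k = 1\<close> the
  bracket of two elements of the first layer may have a component in the first layer.\<close>

definition strat :: "nat => r5 set" where
 "strat j = (if j = 1 then {a. x4 a = 0 & x5 a = 0} else if j = 2 then {a. x1 a = 0 & x2 a = 0 & x3 a = 0} else {0})"

definition layer :: "real => nat => (nat => real) vfield set" where
 "layer k j = lif k ` strat j"

lemma subspace_strat: "subspace (strat j)" by (auto simp: strat_def subspace_def zero_prod_def)

lemma subspace_layer: "subspace (layer k j)"
 unfolding layer_def by (rule linear_subspace_image[OF linear_lif subspace_strat])

lemma layer_span_1: "span {vf_bracket (Mk 0) x y | x y. x \<in> layer 0 1 & y \<in> layer 0 1} = layer 0 2"
proof
 have "{vf_bracket (Mk 0) x y | x y. x \<in> layer 0 1 & y \<in> layer 0 1} \<subseteq> layer 0 2"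
 proof clarify
  fix x y assume "x \<in> layer 0 1" "y \<in> layer 0 1"
  then obtain a b where "x = lif 0 a" "y = lif 0 b" by (auto simp: layer_def)
  moreover have "br 0 a b \<in> strat 2" by (simp add: br_def strat_def)
  ultimately show "vf_bracket (Mk 0) x y \<in> layer 0 2" by (simp add: bracket_lif layer_def)
 qed
 then show "span {vf_bracket (Mk 0) x y | x y. x \<in> layer 0 1 & y \<in> layer 0 1} \<subseteq> layer 0 2"
  by (rule span_minimal) (rule subspace_layer)
 show "layer 0 2 \<subseteq> span {vf_bracket (Mk 0) x y | x y. x \<in> layer 0 1 & y \<in> layer 0 1}"
 proof
  fix X assume "X \<in> layer 0 2"
  then obtain a where a: "X = lif 0 a" "a \<in> strat 2" by (auto simp: layer_def)
  have e: "lif 0 e1 \<in> layer 0 1" "lif 0 e2 \<in> layer 0 1" "lif 0 e3 \<in> layer 0 1"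
   unfolding layer_def by (intro imageI; simp add: strat_def e1_def e2_def e3_def)+
  have "a = x4 a *\<^sub>R br 0 e1 e3 + x5 a *\<^sub>R br 0 e2 e3"
   using a(2) by (simp add: strat_def br_def e1_def e2_def e3_def prod_eq_iff)
  then have "X = x4 a *\<^sub>R vf_bracket (Mk 0) (lif 0 e1) (lif 0 e3) + x5 a *\<^sub>R vf_bracket (Mk 0) (lif 0 e2) (lif 0 e3)"
   unfolding a(1) bracket_lif lif_linear(1,2)[symmetric] by (rule arg_cong)
  then show "X \<in> span {vf_bracket (Mk 0) x y | x y. x \<in> layer 0 1 & y \<in> layer 0 1}"
   using e by (simp only:) (intro span_add span_scale span_base; blast)
 qed
qed

lemma layer_span_2: "span {vf_bracket (Mk 0) x y | x y. x \<in> layer 0 2 & y \<in> layer 0 1} = layer 0 3"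
proof -
 have "vf_bracket (Mk 0) x y = 0" if xy: "x \<in> layer 0 2" "y \<in> layer 0 1" for x y
 proof -
  obtain a b where ab: "x = lif 0 a" "a \<in> strat 2" "y = lif 0 b" using xy by (auto simp: layer_def)
  have "br 0 a b = 0" using ab(2) by (simp add: br_def strat_def zero_prod_def)
  then show ?thesis by (simp add: ab bracket_lif lif_linear)
 qed
 then have "{vf_bracket (Mk 0) x y | x y. x \<in> layer 0 2 & y \<in> layer 0 1} \<subseteq> {0}" by blast
 then have "span {vf_bracket (Mk 0) x y | x y. x \<in> layer 0 2 & y \<in> layer 0 1} \<subseteq> {0}"
  by (rule span_minimal) (rule subspace_single_0)
 moreover have "layer 0 3 = {0}" by (simp add: layer_def strat_def lif_linear)
 ultimately show ?thesis using span_zero by auto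
qed

lemma layer_sum: "bij_betw (%u. \<Sum>j\<in>{1..2}. u j) (\<Pi>\<^sub>E j\<in>{1..2}. layer k j) (range (lif k))"
proof -
 have s: "(\<Sum>j\<in>{1..2::nat}. u j) = u 1 + u 2" for u :: "nat => (nat => real) vfield"
  by (simp add: eval_nat_numeral atLeastAtMostSuc_conv add.commute)
 have i12: "{1..2::nat} = {1, 2}" by auto
 show ?thesis unfolding s
 proof (rule bij_betw_imageI)
  show "inj_on (%u. u 1 + u 2) (\<Pi>\<^sub>E j\<in>{1..2}. layer k j)"
  proof (rule inj_onI)
   fix u w assume u: "u \<in> (\<Pi>\<^sub>E j\<in>{1..2}. layer k j)" and w: "w \<in> (\<Pi>\<^sub>E j\<in>{1..2}. layer k j)" and eq: "u 1 + u 2 = w 1 + w 2"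
   have "u 1 \<in> layer k 1" "u 2 \<in> layer k 2" "w 1 \<in> layer k 1" "w 2 \<in> layer k 2"
    using u w by (auto simp: PiE_iff)
   then obtain a b c d where abcd: "u 1 = lif k a" "u 2 = lif k b" "w 1 = lif k c" "w 2 = lif k d"
    and st: "a \<in> strat 1" "b \<in> strat 2" "c \<in> strat 1" "d \<in> strat 2" by (auto simp: layer_def)
   have "lif k (a + b) = lif k (c + d)" using eq by (simp only: abcd lif_linear)
   then have "a + b = c + d" using inj_lif[of k] by (simp add: inj_eq)
   then have "a = c & b = d" using st by (simp add: strat_def prod_eq_iff)
   then have "!!i. i \<in> {1..2} ==> u i = w i" unfolding i12 using abcd by auto
   then show "u = w" using PiE_ext[OF u w] by blast
  qed
  show "(%u. u 1 + u 2) ` (\<Pi>\<^sub>E j\<in>{1..2}. layer k j) = range (lif k)"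
  proof (intro equalityI subsetI)
   fix X assume "X \<in> (%u. u 1 + u 2) ` (\<Pi>\<^sub>E j\<in>{1..2}. layer k j)"
   then obtain u where u: "u \<in> (\<Pi>\<^sub>E j\<in>{1..2}. layer k j)" "X = u 1 + u 2" by blast
   then have "u 1 \<in> layer k 1" "u 2 \<in> layer k 2" by (auto simp: PiE_iff)
   then show "X \<in> range (lif k)" unfolding u(2) layer_def by (auto simp flip: lif_linear(1))
  next
   fix X assume "X \<in> range (lif k)"
   then obtain a where a: "X = lif k a" by blast
   define u where "u = (\<lambda>j\<in>{1..2::nat}. if j = 1 then lif k (x1 a, x2 a, x3 a, 0, 0) else lif k (0, 0, 0, x4 a, x5 a))"
   have "u \<in> (\<Pi>\<^sub>E j\<in>{1..2}. layer k j)"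
    unfolding i12 by (auto simp: u_def layer_def strat_def PiE_iff)
   moreover have "u 1 + u 2 = X"
   proof -
    have "(x1 a, x2 a, x3 a, 0, 0) + (0, 0, 0, x4 a, x5 a) = a" by (simp add: prod_eq_iff)
    moreover have "u 1 = lif k (x1 a, x2 a, x3 a, 0, 0)" "u 2 = lif k (0, 0, 0, x4 a, x5 a)" by (simp_all add: u_def)
    ultimately show ?thesis unfolding a by (metis lif_linear(1))
   qed
   ultimately show "X \<in> (%u. u 1 + u 2) ` (\<Pi>\<^sub>E j\<in>{1..2}. layer k j)"
    by (intro image_eqI[where x = u]) simp_all
  qed
 qed
qed

lemma stratified_Mk: "stratified_lie_algebra (left_invariant_fields (Grp 0) (Mk 0)) (vf_bracket (Mk 0)) (layer 0) 2"
 unfolding stratified_lie_algebra_def left_invariant_fields_lif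
proof (intro conjI ballI lie_algebra_Mk subspace_layer layer_sum)
 show "span {vf_bracket (Mk 0) x y | x y. x \<in> layer 0 j & y \<in> layer 0 1} = layer 0 (Suc j)" if "j \<in> {1..2}" for j
 proof -
  have "j = 1 \<or> j = 2" using that by auto
  then show ?thesis using layer_span_1 layer_span_2 by (auto simp: eval_nat_numeral)
 qed
 have "lif 0 (0, 0, 0, 1, 0) \<in> layer 0 2" unfolding layer_def by (rule imageI) (simp add: strat_def)
 moreover have "lif 0 (0, 0, 0, 1, 0) ~= lif 0 0"
 proof
  assume "lif 0 (0, 0, 0, 1, 0) = lif 0 0"
  then have "(0, 0, 0, 1, 0) = (0 :: r5)" by (rule injD[OF inj_lif])
  then show False by (simp add: zero_prod_def)
 qed
 moreover note lif_linear(3)[of 0]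
 ultimately show "layer 0 2 ~= {0}" by (metis singletonD)
 show "layer 0 (Suc 2) = {0}" by (simp add: layer_def strat_def lif_linear)
qed simp

lemma simply_connected_Es: "simply_connected_top (Euclidean_space n)" unfolding simply_connected_top_def
proof (intro allI impI)
 fix p q :: "real => nat => real"
 assume *: "pathin (Euclidean_space n) p & p 1 = p 0 & pathin (Euclidean_space n) q & q 1 = q 0"
 have pq: "continuous_on {0..1} p" "p ` {0..1} \<subseteq> Es n" "continuous_on {0..1} q" "q ` {0..1} \<subseteq> Es n"
 proof -
  have "continuous_on {0..1} r & r ` {0..1} \<subseteq> Es n" if "pathin (Euclidean_space n) r" for r
   using that unfolding pathin_def by (subst (asm) Euclidean_space_top_of_set) (auto simp: continuous_map_subtopology_eu)
  then show "continuous_on {0..1} p" "p ` {0..1} \<subseteq> Es n" "continuous_on {0..1} q" "q ` {0..1} \<subseteq> Es n" using * by blast+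
 qed
 define h :: "real \<times> real => nat => real" where "h z = (%i. (1 - fst z) * p (snd z) i + fst z * q (snd z) i)" for z
 have c: "continuous_on ({0..1} \<times> {0..1}) (%z. r (snd z) i)" if "continuous_on {0..1} r" for r :: "real => nat => real" and i
  by (rule continuous_on_compose2[OF continuous_on_product_coordinates continuous_on_compose2[OF that continuous_on_snd[OF continuous_on_id]]]) auto
 have "continuous_on ({0..1} \<times> {0..1}) h"
  unfolding h_def by (intro continuous_on_coordinatewise_then_product continuous_on_add continuous_on_mult continuous_on_diff
    continuous_on_const continuous_on_fst continuous_on_id c pq)
 moreover have "h ` ({0..1} \<times> {0..1}) \<subseteq> Es n" using pq(2,4) by (auto simp: h_def Es_iff image_subset_iff)
 ultimately have "continuous_map (prod_topology (top_of_set {0..1}) (top_of_set {0..1})) (Euclidean_space n) h"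
  by (subst Euclidean_space_top_of_set) (auto simp: continuous_map_subtopology_eu)
 moreover have "h (0, x) = p x" "h (1, x) = q x" for x by (simp_all add: h_def)
 moreover have "h (t, 1) = h (t, 0)" for t using * by (simp add: h_def)
 ultimately show "homotopic_with (%r. r 1 = r 0) (top_of_set {0..1}) (Euclidean_space n) p q"
  unfolding homotopic_with_def by (intro exI[of _ h]) simp
qed

lemma carnot_Mk: "carnot_group (Grp 0) (Mk 0) (layer 0) 2" unfolding carnot_group_def Mk_sel
proof (intro conjI ballI lie_group_Grp connected_Euclidean_space simply_connected_Es stratified_Mk left_invariant_Mk)
 fix x show "hor (Mk 0) x = (%X. X x) ` layer 0 1"
  by (simp add: hor_Mk layer_def image_image strat_def lif_def)
qed

section \<open>The graded algebra at the identity and the tangent cone\<close>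

context fixes k :: real
begin

definition hp :: "(nat => real) tvec set" where "hp = hor (Mk k) 0"
definition tp :: "(nat => real) tvec set" where "tp = tangent_space (Mk k) 0"

definition trunc :: "r5 => r5" where "trunc a = (x1 a, x2 a, x3 a, 0, 0)"

text \<open>Parametrises the graded algebra: a singleton in degree 1, a coset of the horizontal
  space in degree 2, and in higher degrees the zero class, which is all of
  \<open>tp\<close>.\<close>

definition gr_elt :: "r5 => nat => (nat => real) tvec set" where
 "gr_elt a i = (if i = 0 then {0} else if i = 1 then {lf k 0 (trunc a)} else if i = 2 then lf k 0 a +o hp else tp)"

lemma subspaces: "subspace hp" "subspace tp" "hp \<subseteq> tp"
 unfolding hp_def tp_def using subspace_hor mk.subspace_tangent[OF Es_0] hor_subset_tangent[OF Es_0] by blast+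

lemma tp_range: "tp = range (lf k 0)" unfolding tp_def by (rule tangent_Mk[OF Es_0])

lemma hp_iff: "lf k 0 a \<in> hp \<longleftrightarrow> x4 a = 0 & x5 a = 0"
 unfolding hp_def hor_iff[OF Es_0] using lf_tangent[OF Es_0, of k a k] by simp

lemma coset_eq: "subspace H ==> v +o H = w +o H \<longleftrightarrow> v - w \<in> H" for H :: "'b::real_vector set"
proof
 assume H: "subspace H" and eq: "v +o H = w +o H"
 have "v + 0 \<in> v +o H" using subspace_0[OF H] by (rule set_plus_intro2)
 then have "v \<in> w +o H" using eq by simp
 then show "v - w \<in> H" by (auto simp: elt_set_plus_def)
next
 assume H: "subspace H" and d: "v - w \<in> H"
 show "v +o H = w +o H"
 proof (intro equalityI subsetI)
  fix x assume "x \<in> v +o H"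
  then obtain h where "h \<in> H" "x = v + h" by (auto simp: elt_set_plus_def)
  then show "x \<in> w +o H" using subspace_add[OF H d, of h] by (auto simp: elt_set_plus_def intro!: bexI[of _ "v - w + h"])
 next
  fix x assume "x \<in> w +o H"
  then obtain h where "h \<in> H" "x = w + h" by (auto simp: elt_set_plus_def)
  then show "x \<in> v +o H" using subspace_diff[OF H _ d, of h] by (auto simp: elt_set_plus_def intro!: bexI[of _ "h - (v - w)"])
 qed
qed

lemma coset_absorb: "subspace H ==> v \<in> H ==> v +o H = H" for H :: "'b::real_vector set"
 using coset_eq[of H v 0] by simp

lemma subspace_plus: "subspace H ==> H + H = H" for H :: "'b::real_vector set"
proof (intro equalityI subsetI)
 assume H: "subspace H"
 fix x
 show "x \<in> H" if "x \<in> H + H" using that subspace_add[OF H] by (auto simp: set_plus_def)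
 show "x \<in> H + H" if "x \<in> H" using set_plus_intro[OF that subspace_0[OF H]] by simp
qed

lemma Lval_0: "Lval (Mk k) 0 i = (if i = 0 then {0} else if i = 1 then hp else tp)"
proof -
 consider "i = 0" | "i = Suc 0" | j where "i = Suc (Suc j)" by (metis not0_implies_Suc)
 then show ?thesis by cases (simp_all add: Lval_Mk[OF Es_0] hp_def tp_def)
qed

lemma Lval_high: "3 <= i ==> Lval (Mk k) 0 (i - 1) = tp" "3 <= i ==> Lval (Mk k) 0 i = tp"
 by (auto simp: Lval_0)

lemma zero_set: "(0 :: (nat => real) tvec set) = {0}" by (rule set_zero)

lemma gr_elt_in: "gr_elt a \<in> gr_alg (Mk k) 0" unfolding gr_alg_def gr_layer_def mem_Collect_eq
proof
 fix i
 have "lf k 0 (trunc a) \<in> hp" by (simp add: hp_iff trunc_def)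
 moreover have "lf k 0 a \<in> tp" "0 \<in> tp" by (auto simp: tp_range subspace_0[OF subspaces(2)[unfolded tp_range]])
 moreover have "tp = 0 +o tp" "{0} = 0 +o {0 :: (nat => real) tvec}" "{lf k 0 (trunc a)} = lf k 0 (trunc a) +o {0}"
  by (simp_all add: elt_set_plus_def)
 ultimately show "\<exists>v. gr_elt a i = v +o Lval (Mk k) 0 (i - 1) & v \<in> Lval (Mk k) 0 i"
 proof -
  assume *: "lf k 0 (trunc a) \<in> hp" "lf k 0 a \<in> tp" "0 \<in> tp" "tp = 0 +o tp" "{0} = 0 +o {0 :: (nat => real) tvec}"
   "{lf k 0 (trunc a)} = lf k 0 (trunc a) +o {0}"
  consider "i = 0" | "i = 1" | "i = 2" | "3 <= i" by linarith
  then show ?thesis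
  proof cases
   case 1 then show ?thesis using *(5) by (simp add: Lval_0 gr_elt_def)
  next
   case 2 then show ?thesis using *(1,6) by (auto simp: Lval_0 gr_elt_def)
  next
   case 3 then show ?thesis using *(2) by (auto simp: Lval_0 gr_elt_def)
  next
   case 4 then show ?thesis using *(3,4) Lval_high[OF 4] by (intro exI[of _ 0]) (simp add: gr_elt_def)
  qed
 qed
qed

lemma gr_alg_elt:
 assumes "u \<in> gr_alg (Mk k) 0" shows "\<exists>a. u = gr_elt a"
proof -
 have u: "\<exists>v. u i = v +o Lval (Mk k) 0 (i - 1) & v \<in> Lval (Mk k) 0 i" for i
  using assms by (simp add: gr_alg_def gr_layer_def)
 obtain v1 where v1: "u 1 = v1 +o {0}" "v1 \<in> hp" using u[of 1] by (auto simp: Lval_0)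
 obtain v2 where v2: "u 2 = v2 +o hp" "v2 \<in> tp" using u[of 2] by (auto simp: Lval_0)
 have v1t: "v1 \<in> tp" using v1(2) subspaces(3) by blast
 obtain b c where b: "v1 = lf k 0 b" and c: "v2 = lf k 0 c" using v1t v2(2) unfolding tp_range by blast
 define a where "a = (x1 b, x2 b, x3 b, x4 c, x5 c)"
 have "u i = gr_elt a i" for i
 proof -
  consider "i = 0" | "i = 1" | "i = 2" | "3 <= i" by linarith
  then show ?thesis
  proof cases
   case 1
   then show ?thesis using u[of 0] by (simp add: Lval_0 gr_elt_def elt_set_plus_def)
  next
   case 2
   have "trunc a = b" using v1(2) by (simp add: b hp_iff trunc_def a_def prod_eq_iff)
   then show ?thesis using 2 v1(1) b by (simp add: gr_elt_def elt_set_plus_def)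
  next
   case 3
   have "lf k 0 c - lf k 0 a \<in> hp" by (simp add: hp_iff a_def flip: linear_diff[OF linear_lf])
   then show ?thesis using 3 v2(1) c by (simp add: gr_elt_def coset_eq[OF subspaces(1)])
  next
   case 4
   then show ?thesis using u[of i] coset_absorb[OF subspaces(2)] Lval_high[OF 4] by (auto simp: gr_elt_def)
  qed
 qed
 then show ?thesis by blast
qed

lemma inj_gr_elt: "inj gr_elt"
proof (rule injI)
 fix a b assume eq: "gr_elt a = gr_elt b"
 have "lf k 0 (trunc a) = lf k 0 (trunc b)" using fun_cong[OF eq, of 1] by (simp add: gr_elt_def)
 then have 1: "trunc a = trunc b" using inj_lf[OF Es_0] by (simp add: inj_eq)
 have "lf k 0 a - lf k 0 b \<in> hp" using fun_cong[OF eq, of 2] by (simp add: gr_elt_def coset_eq[OF subspaces(1)])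
 then have "x4 (a - b) = 0 & x5 (a - b) = 0" by (simp add: hp_iff flip: linear_diff[OF linear_lf])
 then show "a = b" using 1 by (simp add: trunc_def prod_eq_iff)
qed

lemma gr_add_elt: "gr_add (gr_elt a) (gr_elt b) = gr_elt (a + b)"
proof
 fix i
 have "trunc (a + b) = trunc a + trunc b" by (simp add: trunc_def)
 then show "gr_add (gr_elt a) (gr_elt b) i = gr_elt (a + b) i" unfolding gr_add_def gr_elt_def
  by (simp add: lf_linear set_plus_rearrange subspace_plus subspaces) (simp add: set_plus_def)
qed

lemma subspace_scale_plus: "subspace H ==> (%v. c *\<^sub>R v) ` (w +o H) + H = c *\<^sub>R w +o H" for H :: "'b::real_vector set"
proof (intro equalityI subsetI)
 assume H: "subspace H"
 fix x
 show "x \<in> c *\<^sub>R w +o H" if x: "x \<in> (%v. c *\<^sub>R v) ` (w +o H) + H"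
 proof -
  obtain g h where "g \<in> H" "h \<in> H" "x = c *\<^sub>R (w + g) + h" using x by (auto simp: set_plus_def elt_set_plus_def)
  then show ?thesis using subspace_add[OF H subspace_scale[OF H, of g c], of h]
   by (auto simp: elt_set_plus_def scaleR_add_right add.assoc intro!: bexI[of _ "c *\<^sub>R g + h"])
 qed
 show "x \<in> (%v. c *\<^sub>R v) ` (w +o H) + H" if x: "x \<in> c *\<^sub>R w +o H"
 proof -
  obtain h where h: "h \<in> H" "x = c *\<^sub>R w + h" using x by (auto simp: elt_set_plus_def)
  have "w \<in> w +o H" using set_plus_intro2[OF subspace_0[OF H], of w] by simp
  then show ?thesis unfolding h(2) using h(1) by (intro set_plus_intro imageI)
 qed
qed

lemma gr_scale_elt: "gr_scale (Mk k) 0 c (gr_elt a) = gr_elt (c *\<^sub>R a)"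
proof
 fix i :: nat
 have t: "trunc (c *\<^sub>R a) = c *\<^sub>R trunc a" by (simp add: trunc_def)
 have sc: "(%v. c *\<^sub>R v) ` tp + tp = tp" using subspace_scale_plus[OF subspaces(2), of c 0] by simp
 consider "i = 0" | "i = 1" | "i = 2" | "3 <= i" by linarith
 then show "gr_scale (Mk k) 0 c (gr_elt a) i = gr_elt (c *\<^sub>R a) i"
 proof cases
  case 1
  then show ?thesis by (simp add: gr_scale_def gr_elt_def Lval_0 set_plus_def)
 next
  case 2
  then show ?thesis by (simp add: gr_scale_def gr_elt_def Lval_0 t lf_linear set_plus_def)
 next
  case 3
  then show ?thesis by (simp add: gr_scale_def gr_elt_def Lval_0 lf_linear subspace_scale_plus[OF subspaces(1)])
 next
  case 4
  then show ?thesis using sc unfolding gr_scale_def Lval_high(1)[OF 4] by (simp add: gr_elt_def)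
 qed
qed

text \<open>\<open>br k\<close> and \<open>br 0\<close> differ only in the third coordinate, which
  is horizontal. So the class of the bracket does not see \<open>k\<close>; this is why the cone has
  structure constant 0.\<close>

lemma coset_bracket_11:
 assumes a: "x4 a = 0" "x5 a = 0" and b: "x4 b = 0" "x5 b = 0"
 shows "coset_bracket (Mk k) 0 1 1 {lf k 0 a} {lf k 0 b} = lf k 0 (br 0 a b) +o hp"
proof -
 have L: "(%q. lf k q a) \<in> Lsec (Mk k) 0 1" "(%q. lf k q b) \<in> Lsec (Mk k) 0 1"
  using hor_section_lf[OF a] hor_section_lf[OF b] Es_0 by (auto intro!: exI[of _ "Es 5"])
 have "vf_bracket (Mk k) X Y 0 +o hp = lf k 0 (br 0 a b) +o hp"
  if XY: "X \<in> Lsec (Mk k) 0 1" "Y \<in> Lsec (Mk k) 0 1" "X 0 = lf k 0 a" "Y 0 = lf k 0 b" for X Y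
 proof -
  obtain V W where V: "0 \<in> V" "hor_section_on (Mk k) V X" and W: "0 \<in> W" "hor_section_on (Mk k) W Y"
   using XY(1,2) by auto
  have c: "0 \<in> V \<inter> W" "smooth_vfield_on (Mk k) (V \<inter> W) X" "smooth_vfield_on (Mk k) (V \<inter> W) Y"
   using vfield_common[of 0 V k X W Y] V W by (auto simp: hor_section_on_def)
  have h: "hor_section_on (Mk k) (V \<inter> W) X" "hor_section_on (Mk k) (V \<inter> W) Y"
   using c V W by (auto simp: hor_section_on_def)
  let ?v = "vf_bracket (Mk k) X Y 0"
  have T: "?v \<in> tangent_space (Mk k) 0" by (rule mk.bracket_tangent[OF c(2,3,1)])
  have cc: "x4 (cof k 0 ?v) = x4 (br k a b)" "x5 (cof k 0 ?v) = x5 (br k a b)"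
   using bracket_hor[OF h c(1)] XY(3,4) by simp_all
  have "?v - lf k 0 (br 0 a b) = lf k 0 (cof k 0 ?v - br 0 a b)"
   using lf_cof[OF T Es_0, of k] by (simp add: linear_diff[OF linear_lf])
  moreover have "... \<in> hp" unfolding hp_iff by (simp add: cc) (simp add: br_def)
  ultimately show ?thesis by (simp add: coset_eq[OF subspaces(1)])
 qed
 then show ?thesis unfolding coset_bracket_def using L by (simp add: Lval_0) blast
qed

lemma gr_elt_section:
 assumes "1 <= i"
 shows "\<exists>X. X \<in> Lsec (Mk k) 0 i & X 0 \<in> gr_elt a i"
proof (cases "i = 1")
 case True
 have "(%q. lf k q (trunc a)) \<in> Lsec (Mk k) 0 1"
  using hor_section_lf[of "trunc a"] Es_0[of 5] by (auto simp: trunc_def intro!: exI[of _ "Es 5"])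
 then show ?thesis using True by (auto simp: gr_elt_def)
next
 case False
 then obtain j where j: "i = Suc (Suc j)" using assms by (metis One_nat_def not0_implies_Suc not_one_le_zero)
 have "(%q. lf k q a) \<in> Lsec (Mk k) 0 i" unfolding j by (rule lf_in_Lsec[OF Es_0])
 moreover have "lf k 0 a \<in> lf k 0 a +o hp" using set_plus_intro2[OF subspace_0[OF subspaces(1)], of "lf k 0 a"] by simp
 ultimately show ?thesis using j by (intro exI[of _ "%q. lf k q a"]) (auto simp: gr_elt_def tp_range)
qed

text \<open>From total degree 3 on, the class is taken modulo \<open>tp\<close> and hence is
  \<open>tp\<close>. Sections with the required values exist in every degree, so the union is not
  empty.\<close>

lemma coset_bracket_high:
 assumes ij: "1 <= i" "1 <= j" "3 <= i + j"
 shows "coset_bracket (Mk k) 0 i j (gr_elt a i) (gr_elt b j) = tp"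
proof -
 have "vf_bracket (Mk k) X Y 0 +o Lval (Mk k) 0 (i + j - 1) = tp"
  if XY: "X \<in> Lsec (Mk k) 0 i" "Y \<in> Lsec (Mk k) 0 j" for X Y
 proof -
  obtain V where V: "0 \<in> V" "smooth_vfield_on (Mk k) V X" using Lsec_smooth[OF Es_0 XY(1)] by blast
  obtain W where W: "0 \<in> W" "smooth_vfield_on (Mk k) W Y" using Lsec_smooth[OF Es_0 XY(2)] by blast
  note c = vfield_common[OF V W]
  have "vf_bracket (Mk k) X Y 0 \<in> tp" unfolding tp_def by (rule mk.bracket_tangent[OF c(2,3,1)])
  moreover have "Lval (Mk k) 0 (i + j - 1) = tp" using ij by (intro Lval_high)
  ultimately show ?thesis by (simp add: coset_absorb[OF subspaces(2)])
 qed
 moreover obtain X Y where "X \<in> Lsec (Mk k) 0 i" "X 0 \<in> gr_elt a i" "Y \<in> Lsec (Mk k) 0 j" "Y 0 \<in> gr_elt b j"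
  using gr_elt_section ij by blast
 ultimately show ?thesis unfolding coset_bracket_def by (intro equalityI subsetI) (simp; blast)+
qed

lemma gr_bracket_elt: "gr_bracket (Mk k) 0 (gr_elt a) (gr_elt b) = gr_elt (br 0 a b)"
proof
 fix l :: nat
 have t0: "trunc (br 0 a b) = 0" by (simp add: trunc_def br_def zero_prod_def)
 consider "l = 0 \<or> l = 1" | "l = 2" | "3 <= l" by linarith
 then show "gr_bracket (Mk k) 0 (gr_elt a) (gr_elt b) l = gr_elt (br 0 a b) l"
 proof cases
  case 1
  then show ?thesis by (auto simp: gr_bracket_def gr_elt_def t0 lf_linear zero_set)
 next
  case 2
  have "gr_bracket (Mk k) 0 (gr_elt a) (gr_elt b) l = coset_bracket (Mk k) 0 1 1 {lf k 0 (trunc a)} {lf k 0 (trunc b)}"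
   unfolding gr_bracket_def 2 by (simp add: eval_nat_numeral gr_elt_def)
  also have "... = lf k 0 (br 0 (trunc a) (trunc b)) +o hp"
   by (rule coset_bracket_11) (simp_all add: trunc_def)
  also have "br 0 (trunc a) (trunc b) = br 0 a b" by (simp add: br_def trunc_def)
  also have "lf k 0 (br 0 a b) +o hp = gr_elt (br 0 a b) l" by (simp add: gr_elt_def 2)
  finally show ?thesis .
 next
  case 3
  have S: "(\<Sum>i\<in>I. tp) = tp" if "finite I" "I ~= {}" for I :: "nat set"
   using that by (induction I rule: finite_ne_induct) (simp_all add: subspace_plus subspaces)
  have "gr_bracket (Mk k) 0 (gr_elt a) (gr_elt b) l = (\<Sum>i\<in>{1..<l}. tp)"
   unfolding gr_bracket_def using 3 by (intro sum.cong refl coset_bracket_high) auto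
  also have "... = tp" using 3 by (intro S) auto
  finally show ?thesis using 3 by (simp add: gr_elt_def)
 qed
qed

lemma gr_incl_elt:
 "x4 a = 0 ==> x5 a = 0 ==> gr_incl (Mk k) 0 1 (lf k 0 a) = gr_elt a"
 "gr_incl (Mk k) 0 2 (lf k 0 a) = gr_elt (0, 0, 0, x4 a, x5 a)"
proof -
 have d: "lf k 0 a - lf k 0 (0, 0, 0, x4 a, x5 a) \<in> hp" by (simp add: hp_iff flip: linear_diff[OF linear_lf])
 have "trunc (0, 0, 0, x4 a, x5 a) = 0" by (simp add: trunc_def zero_prod_def)
 then show "gr_incl (Mk k) 0 2 (lf k 0 a) = gr_elt (0, 0, 0, x4 a, x5 a)"
  using d by (auto simp: fun_eq_iff gr_incl_def gr_elt_def Lval_0 coset_eq[OF subspaces(1)] lf_linear elt_set_plus_def[of 0])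
 assume a: "x4 a = 0" "x5 a = 0"
 then have "trunc a = a" by (simp add: trunc_def prod_eq_iff)
 moreover have "lf k 0 a \<in> hp" using a by (simp add: hp_iff)
 ultimately show "gr_incl (Mk k) 0 1 (lf k 0 a) = gr_elt a"
  by (auto simp: fun_eq_iff gr_incl_def gr_elt_def Lval_0 coset_absorb[OF subspaces(1)]) (auto simp: elt_set_plus_def)
qed

lemma tangent_cone_Mk: "tangent_cone (Mk k) 0 (Grp 0) (Mk 0)" unfolding tangent_cone_def
proof (intro conjI exI)
 define F where "F u = lif 0 (inv_into UNIV gr_elt u)" for u
 have F: "F (gr_elt a) = lif 0 a" for a by (simp add: F_def inv_f_f[OF inj_gr_elt])
 have R: "gr_alg (Mk k) 0 = range gr_elt" using gr_elt_in gr_alg_elt by blast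
 show "equiregular (Mk k)" by (rule equiregular_Mk)
 show "carnot_group (Grp 0) (Mk 0) (layer 0) 2" by (rule carnot_Mk)
 show "bij_betw F (gr_alg (Mk k) 0) (left_invariant_fields (Grp 0) (Mk 0))"
  unfolding R left_invariant_fields_lif
 proof (rule bij_betw_imageI)
  show "inj_on F (range gr_elt)"
  proof (rule inj_onI)
   fix u w assume "u \<in> range gr_elt" "w \<in> range gr_elt" and eq: "F u = F w"
   then obtain a b where ab: "u = gr_elt a" "w = gr_elt b" by blast
   have "a = b" using eq unfolding ab F by (rule injD[OF inj_lif])
   then show "u = w" by (simp add: ab)
  qed
  show "F ` range gr_elt = range (lif 0)" by (simp add: image_image F)
 qed
 show "\<forall>u\<in>gr_alg (Mk k) 0. \<forall>w\<in>gr_alg (Mk k) 0. \<forall>c. F (gr_add u w) = F u + F w &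
   F (gr_scale (Mk k) 0 c u) = c *\<^sub>R F u & F (gr_bracket (Mk k) 0 u w) = vf_bracket (Mk 0) (F u) (F w)"
  unfolding R by (simp add: gr_add_elt gr_scale_elt gr_bracket_elt F lif_linear bracket_lif)
 show "\<forall>i\<in>{1..2}. (%v. F (gr_incl (Mk k) 0 i v)) ` Lval (Mk k) 0 i = layer 0 i"
 proof
  fix i :: nat assume "i \<in> {1..2}"
  then consider "i = 1" | "i = 2" by fastforce
  then show "(%v. F (gr_incl (Mk k) 0 i v)) ` Lval (Mk k) 0 i = layer 0 i"
  proof cases
   case 1
   have "(%v. F (gr_incl (Mk k) 0 1 v)) ` hp = (%a. F (gr_incl (Mk k) 0 1 (lf k 0 a))) ` strat 1"
    unfolding hp_def hor_Mk image_image by (simp add: strat_def)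
   also have "... = lif 0 ` strat 1"
    by (rule image_cong[OF refl]) (simp add: strat_def gr_incl_elt(1)[unfolded One_nat_def] F)
   finally show ?thesis unfolding 1 layer_def by (simp add: Lval_0)
  next
   case 2
   have "(%v. F (gr_incl (Mk k) 0 2 v)) ` tp = range (%a. lif 0 (0, 0, 0, x4 a, x5 a))"
    unfolding tp_range image_image by (simp add: gr_incl_elt(2) F)
   also have "... = lif 0 ` range (%a. (0, 0, 0, x4 a, x5 a))" by (simp add: image_image)
   also have "range (%a. (0, 0, 0, x4 a, x5 a)) = strat 2"
   proof (intro equalityI subsetI)
    fix b :: r5 assume "b \<in> strat 2"
    then have "b = (0, 0, 0, x4 b, x5 b)" by (simp add: strat_def prod_eq_iff)
    then show "b \<in> range (%a. (0, 0, 0, x4 a, x5 a))" by blast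
   qed (auto simp: strat_def)
   finally have "(%v. F (gr_incl (Mk k) 0 2 v)) ` tp = lif 0 ` strat 2" .
   moreover have "Lval (Mk k) 0 2 = tp" by (simp add: Lval_0)
   ultimately show ?thesis unfolding 2 layer_def by (simp only:)
  qed
 qed
 show "\<forall>v\<in>hor (Mk k) 0. \<forall>w\<in>hor (Mk k) 0. met (Mk 0) \<one>\<^bsub>Grp 0\<^esub> (F (gr_incl (Mk k) 0 1 v) \<one>\<^bsub>Grp 0\<^esub>)
   (F (gr_incl (Mk k) 0 1 w) \<one>\<^bsub>Grp 0\<^esub>) = met (Mk k) 0 v w"
  unfolding hor_Mk by (simp add: gr_incl_elt(1)[unfolded One_nat_def] F met_Mk lif_def)
qed

end

section \<open>The Carnot-Caratheodory distance\<close>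

lemma abs_continuousD:
 assumes "abs_continuous a b f" "0 < e"
 obtains d where "0 < d"
  "!!I. ac_family a b I ==> tlen I < d ==> osc f I < e"
 using assms unfolding abs_continuous_def by (elim allE[of _ e]) blast

lemma abs_continuousI:
 assumes "!!e. 0 < e ==> \<exists>d>0. \<forall>I. ac_family a b I --> tlen I < d --> osc f I < e"
 shows "abs_continuous a b f" using assms unfolding abs_continuous_def imp_conjL by simp

lemma abs_continuous_subset:
 "abs_continuous a b f ==> a <= c ==> d <= b ==> abs_continuous c d f"
 unfolding abs_continuous_pair_ac by (erule pair_ac_mono) auto

text \<open>The common source of the closure properties: sums, differences, products and Lipschitz
  functions are all dominated in this sense.\<close>

lemma abs_continuous_dominated:
 assumes f: "abs_continuous a b f" and g: "abs_continuous a b g" and L: "0 < L"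
  and h: "!!x y. a <= x ==> x < y ==> y <= b ==> abs (h y - h x) <= L * (abs (f y - f x) + abs (g y - g x))"
 shows "abs_continuous a b h"
proof (rule abs_continuousI)
 fix d :: real assume "0 < d"
 then have e: "0 < d / (2 * L)" using L by simp
 obtain dl1 where dl1: "0 < dl1"
  "!!I. ac_family a b I ==> tlen I < dl1 ==> osc f I < d / (2 * L)" by (rule abs_continuousD[OF f e]) blast
 obtain dl2 where dl2: "0 < dl2"
  "!!I. ac_family a b I ==> tlen I < dl2 ==> osc g I < d / (2 * L)" by (rule abs_continuousD[OF g e]) blast
 have "osc h I < d" if I: "ac_family a b I" "tlen I < min dl1 dl2" for I
 proof -
  have "osc h I <= (\<Sum>(x, y)\<in>I. L * (abs (f y - f x) + abs (g y - g x)))"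
   using I(1) h by (intro sum_mono) auto
  also have "... = L * (osc f I + (osc g I))" by (simp add: split_beta sum.distrib flip: sum_distrib_left)
  also have "... < L * (d / (2 * L) + d / (2 * L))"
   using dl1(2)[OF I(1)] dl2(2)[OF I(1)] I(2) L by (intro mult_strict_left_mono add_strict_mono) auto
  also have "... = d" using L by simp
  finally show ?thesis .
 qed
 then show "\<exists>dl>0. \<forall>I. ac_family a b I --> tlen I < dl --> osc h I < d"
  using dl1(1) dl2(1) by (intro exI[of _ "min dl1 dl2"]) auto
qed

lemma abs_continuous_cong: "abs_continuous a b f ==> (!!t. a <= t ==> t <= b ==> f t = g t) ==> abs_continuous a b g"
 by (rule abs_continuous_dominated[of a b f f 1]) auto

lemma abs_continuous_continuous_on:
 assumes "abs_continuous a b f"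
 shows "continuous_on {a..b} f" unfolding continuous_on_iff
proof (intro ballI allI impI)
 fix x e :: real assume x: "x \<in> {a..b}" and "0 < e"
 then obtain dl where dl: "0 < dl"
  "!!I. ac_family a b I ==> tlen I < dl ==> osc f I < e" by (rule_tac abs_continuousD[OF assms, of e]) blast+
 have "dist (f y) (f x) < e" if y: "y \<in> {a..b}" "dist y x < dl" for y
 proof (cases "x = y")
  case True
  then show ?thesis using \<open>0 < e\<close> by simp
 next
  case False
  then have "min x y < max x y" by auto
  then have "abs (f (max x y) - f (min x y)) < e"
   using dl(2)[of "{(min x y, max x y)}"] x y by (auto simp: dist_real_def)
  then show ?thesis by (auto simp: dist_real_def max_def min_def split: if_splits)
 qed
 then show "\<exists>d>0. \<forall>x'\<in>{a..b}. dist x' x < d --> dist (f x') (f x) < e" using dl(1) by blast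
qed

lemma abs_continuous_add: "abs_continuous a b f ==> abs_continuous a b g ==> abs_continuous a b (%t. f t + g t)"
 by (rule abs_continuous_dominated[of a b f g 1]) auto

lemma abs_continuous_lipschitz:
 assumes "!!x y. a <= x ==> x < y ==> y <= b ==> abs (h y - h x) <= L * (y - x)"
 shows "abs_continuous a b h"
proof -
 have id: "abs_continuous a b (%t. t)"
 proof (rule abs_continuousI)
  fix e :: real assume "0 < e"
  moreover have "(\<Sum>(x, y)\<in>I. abs (y - x)) = tlen I" if "ac_family a b I" for I
   using that by (intro sum.cong) auto
  ultimately show "\<exists>d>0. \<forall>I. ac_family a b I --> tlen I < d --> (\<Sum>(x, y)\<in>I. abs (y - x)) < e"
   by (intro exI[of _ e]) auto
 qed
 show ?thesis
 proof (rule abs_continuous_dominated[OF id id, of "abs L + 1"])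
  show "abs (h y - h x) <= (abs L + 1) * (abs (y - x) + abs (y - x))" if "a <= x" "x < y" "y <= b" for x y
  proof -
   have "L * (y - x) <= (abs L + 1) * (abs (y - x) + abs (y - x))" using that by (intro mult_mono) auto
   then show ?thesis using assms[OF that] by linarith
  qed
 qed auto
qed

lemma abs_continuous_mult:
 assumes f: "abs_continuous a b f" and g: "abs_continuous a b g"
 shows "abs_continuous a b (%t. f t * g t)"
proof -
 have bd: "\<exists>F. \<forall>t\<in>{a..b}. abs (h t) <= F" if "abs_continuous a b h" for h
 proof -
  have "bounded (h ` {a..b})"
   by (intro compact_imp_bounded compact_continuous_image abs_continuous_continuous_on[OF that] compact_Icc)
  then show ?thesis by (simp add: bounded_iff)
 qed
 obtain F where F: "\<forall>t\<in>{a..b}. abs (f t) <= F" using bd[OF f] by blast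
 obtain G where G: "\<forall>t\<in>{a..b}. abs (g t) <= G" using bd[OF g] by blast
 show ?thesis
 proof (rule abs_continuous_dominated[OF f g, of "abs F + abs G + 1"])
  show "abs (f y * g y - f x * g x) <= (abs F + abs G + 1) * (abs (f y - f x) + abs (g y - g x))" if "a <= x" "x < y" "y <= b" for x y
  proof -
   have "f y * g y - f x * g x = f y * (g y - g x) + g x * (f y - f x)" by (simp add: algebra_simps)
   then have "abs (f y * g y - f x * g x) <= abs (f y) * abs (g y - g x) + abs (g x) * abs (f y - f x)"
    by (metis abs_mult abs_triangle_ineq)
   also have "... <= (abs F + abs G + 1) * abs (g y - g x) + (abs F + abs G + 1) * abs (f y - f x)"
    using F[rule_format, of y] G[rule_format, of x] that by (intro add_mono mult_right_mono) auto
   finally show ?thesis by (simp add: algebra_simps)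
  qed
 qed auto
qed

lemma abs_continuous_const: "abs_continuous a b (%t. c)" by (rule abs_continuous_lipschitz[of _ _ _ 0]) simp

lemma abs_continuous_diff: "abs_continuous a b f ==> abs_continuous a b g ==> abs_continuous a b (%t. f t - g t)"
 by (rule abs_continuous_dominated[of a b f g 1]) auto

text \<open>A monotone or antitone Lipschitz map carries a disjoint family of intervals to one.\<close>

lemma abs_continuous_comp:
 assumes f: "abs_continuous a b f" and L: "0 < L"
  and lip: "!!x y. c <= x ==> x < y ==> y <= d ==> abs (h y - h x) <= L * (y - x)"
  and ran: "!!x. c <= x ==> x <= d ==> a <= h x & h x <= b"
  and mono: "mono_on {c..d} h \<or> antimono_on {c..d} h"
 shows "abs_continuous c d (%t. f (h t))"
proof (rule abs_continuousI)
 fix e :: real assume "0 < e"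
 then obtain dl where dl: "0 < dl"
  "!!I. ac_family a b I ==> tlen I < dl ==> osc f I < e" by (rule abs_continuousD[OF f]) blast
 define m where "m z = (min (h (fst z)) (h (snd z)), max (h (fst z)) (h (snd z)))" for z
 have "(\<Sum>(x, y)\<in>I. abs (f (h y) - f (h x))) < e" if I: "ac_family c d I" "tlen I < dl / L" for I
 proof -
  define J where "J = {z \<in> I. h (fst z) ~= h (snd z)}"
  have fin: "finite I" and bd: "!!z. z \<in> I ==> c <= fst z & fst z < snd z & snd z <= d" using I(1) by auto
  have sep: "disjnt {fst (m z)<..<snd (m z)} {fst (m w)<..<snd (m w)}" if zw: "z \<in> I" "w \<in> I" "z ~= w" for z w
  proof -
   have dj: "disjnt {fst z<..<snd z} {fst w<..<snd w}" using I(1) zw unfolding pairwise_def by (auto simp: split_beta)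
   have le: "disjnt {fst (m z)<..<snd (m z)} {fst (m w)<..<snd (m w)}" if "snd z <= fst w" "z \<in> I" "w \<in> I" for z w
   proof -
    note b = bd[OF that(2)] bd[OF that(3)]
    have "h (fst z) <= h (snd z) & h (snd z) <= h (fst w) & h (fst w) <= h (snd w) \<or>
      h (fst z) \<ge> h (snd z) & h (snd z) \<ge> h (fst w) & h (fst w) \<ge> h (snd w)"
     using mono
    proof
     assume "mono_on {c..d} h"
     then show ?thesis using b that(1) by (intro disjI1 conjI) (auto elim!: monotone_onD)
    next
     assume "antimono_on {c..d} h"
     then show ?thesis using b that(1) by (intro disjI2 conjI) (auto elim!: monotone_onD)
    qed
    then show ?thesis by (auto simp: m_def disjnt_iff)
   qed
   have "snd z <= fst w \<or> snd w <= fst z"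
   proof (rule ccontr)
    assume n: "\<not> ?thesis"
    define t where "t = (max (fst z) (fst w) + min (snd z) (snd w)) / 2"
    have "max (fst z) (fst w) < min (snd z) (snd w)" using n bd[OF zw(1)] bd[OF zw(2)] by auto
    then have "t \<in> {fst z<..<snd z}" "t \<in> {fst w<..<snd w}" unfolding t_def by auto
    then show False using dj by (auto simp: disjnt_iff)
   qed
   then show ?thesis using le zw by (metis disjnt_sym)
  qed
  have inj: "inj_on m J"
  proof (rule inj_onI, rule ccontr)
   fix z w assume zw: "z \<in> J" "w \<in> J" "m z = m w" "z ~= w"
   then have "disjnt {fst (m z)<..<snd (m z)} {fst (m z)<..<snd (m z)}" using sep[of z w] by (simp add: J_def)
   moreover have "fst (m z) < snd (m z)" using zw by (auto simp: J_def m_def)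
   ultimately show False by (simp add: disjnt_def)
  qed
  have JI: "J \<subseteq> I" by (auto simp: J_def)
  have "ac_family a b (m ` J)"
  proof (intro conjI)
   show "finite (m ` J)" using fin JI finite_subset by blast
   show "\<forall>(x, y)\<in>m ` J. a <= x & x < y & y <= b"
   proof -
    have "a <= fst (m z) & fst (m z) < snd (m z) & snd (m z) <= b" if "z \<in> J" for z
    proof -
     have "z \<in> I" "h (fst z) ~= h (snd z)" using that by (auto simp: J_def)
     then show ?thesis using ran[of "fst z"] ran[of "snd z"] bd[of z] by (auto simp: m_def)
    qed
    then show ?thesis by (simp add: split_beta)
   qed
   show "pairwise (%(x, y) (x', y'). disjnt {x<..<y} {x'<..<y'}) (m ` J)"
    unfolding pairwise_def split_beta using sep JI by blast
  qed
  moreover have "tlen (m ` J) < dl"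
  proof -
   have "tlen (m ` J) = (\<Sum>z\<in>J. snd (m z) - fst (m z))" by (simp add: sum.reindex[OF inj] split_beta)
   also have "... <= (\<Sum>z\<in>J. L * (snd z - fst z))"
   proof (rule sum_mono)
    fix z assume "z \<in> J"
    then have "abs (h (snd z) - h (fst z)) <= L * (snd z - fst z)" using bd[of z] JI by (intro lip) auto
    moreover have "snd (m z) - fst (m z) = abs (h (snd z) - h (fst z))" by (auto simp: m_def max_def min_def)
    ultimately show "snd (m z) - fst (m z) <= L * (snd z - fst z)" by simp
   qed
   also have "... <= (\<Sum>z\<in>I. L * (snd z - fst z))" using L bd by (intro sum_mono2 fin JI) (auto intro!: mult_nonneg_nonneg less_imp_le)
   also have "... = L * (tlen I)" by (simp add: sum_distrib_left split_beta)
   also have "... < dl" using I(2) L by (simp add: pos_less_divide_eq mult.commute)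
   finally show ?thesis .
  qed
  ultimately have "osc f (m ` J) < e" by (rule dl(2))
  moreover have "osc f (m ` J) = (\<Sum>z\<in>J. abs (f (h (snd z)) - f (h (fst z))))"
   by (simp add: sum.reindex[OF inj] split_beta) (rule sum.cong, auto simp: m_def min_def max_def abs_minus_commute)
  moreover have "(\<Sum>z\<in>J. abs (f (h (snd z)) - f (h (fst z)))) = (\<Sum>z\<in>I. abs (f (h (snd z)) - f (h (fst z))))"
   by (rule sum.mono_neutral_left[OF fin JI]) (auto simp: J_def)
  ultimately show ?thesis by (simp add: split_beta)
 qed
 then show "\<exists>dl>0. \<forall>I. ac_family c d I --> tlen I < dl --> (\<Sum>(x, y)\<in>I. abs (f (h y) - f (h x))) < e"
  using dl(1) L by (intro exI[of _ "dl / L"]) auto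
qed

text \<open>\<open>f t = f (min t m) + f (max t m) - f m\<close>, and both clamping maps are
  monotone and Lipschitz.\<close>

lemma abs_continuous_join:
 assumes f: "abs_continuous a m f" "abs_continuous m b f" and m: "a <= m" "m <= b"
 shows "abs_continuous a b f"
proof -
 have "abs_continuous a b (%t. f (min t m))"
  using m by (intro abs_continuous_comp[OF f(1), of 1]) (auto simp: monotone_on_def)
 moreover have "abs_continuous a b (%t. f (max t m))"
  using m by (intro abs_continuous_comp[OF f(2), of 1]) (auto simp: monotone_on_def)
 ultimately have "abs_continuous a b (%t. f (min t m) + f (max t m) - f m)"
  by (intro abs_continuous_diff abs_continuous_add abs_continuous_const)
 then show ?thesis by (rule abs_continuous_cong) (auto simp: min_def max_def)
qed

lemma abs_continuous_has_integral:
 assumes f: "abs_continuous a b f" and st: "a <= s" "s <= t" "t <= b"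
 shows "(deriv f has_integral (f t - f s)) {s..t}"
proof -
 have fs: "abs_continuous s t f" using f st by (intro abs_continuous_subset[OF f]) auto
 define N where "N = {s, t} \<union> {x. s < x & x < t & \<not> f differentiable (at x)}"
 have "negligible N" unfolding N_def by (intro negligible_Un abs_continuous_differentiable_ae[OF fs]) auto
 then show ?thesis
 proof (rule abs_continuous_fundamental[OF st(2) fs])
  fix x assume "x \<in> {s..t} - N"
  then have "f differentiable (at x)" by (auto simp: N_def)
  then show "(f has_vector_derivative deriv f x) (at x within {s..t})"
   by (metis DERIV_imp_deriv has_real_derivative_iff_has_vector_derivative has_vector_derivative_at_within real_differentiable_def)
 qed
qed

text \<open>By the fundamental theorem, the integrals of the derivative over the pieces of a
  division are increments of \<open>f\<close>, and the majorant \<open>V\<close> bounds their total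
  variation.\<close>

lemma abs_continuous_deriv_absolutely_integrable:
 assumes f: "abs_continuous a b f" and ab: "a <= b"
 shows "deriv f absolutely_integrable_on {a..b}"
proof -
 obtain V where V: "mono V" "!!s t. a <= s ==> s < t ==> t <= b ==> abs (f t - f s) <= V t - V s"
  using f ab unfolding abs_continuous_pair_ac by (rule_tac pair_ac_majorant[of a b "%x y. abs (f y - f x)"]) auto
 have "deriv f absolutely_integrable_on cbox a b"
 proof (rule bounded_variation_absolutely_integrable_interval)
  show "deriv f integrable_on cbox a b" using abs_continuous_has_integral[OF f order_refl ab order_refl] by auto
  fix d assume d: "d division_of cbox a b"
  \<comment> \<open>Left endpoints as tags turn the division into a tagged one, over which the
    increments of \<open>V\<close> telescope.\<close>
  have inj: "inj_on (%K. (Inf K, K)) d" by (auto simp: inj_on_def)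
  have tag: "(%K. (Inf K, K)) ` d tagged_division_of {a..b}"
  proof (rule tagged_division_ofI)
   show "finite ((%K. (Inf K, K)) ` d)" using division_of_finite[OF d] by simp
   fix x K assume xK: "(x, K) \<in> (%K. (Inf K, K)) ` d"
   then have Kd: "K \<in> d" "x = Inf K" by auto
   obtain u v where "K = cbox u v" using division_ofD(4)[OF d Kd(1)] by blast
   then have K: "K \<in> d" "x = Inf K" "K = cbox u v" "K ~= {}" "K \<subseteq> cbox a b"
    using Kd division_ofD(2,3)[OF d Kd(1)] by auto
   then show "\<exists>a b. K = cbox a b" by blast
   show "x \<in> K" "K \<subseteq> {a..b}" using K by auto
   fix x' K' assume xK': "(x', K') \<in> (%K. (Inf K, K)) ` d" "(x, K) ~= (x', K')"
   then have "K' \<in> d" "K ~= K'" using xK by auto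
   then show "interior K \<inter> interior K' = {}" using division_ofD(5)[OF d K(1)] by auto
  next
   show "\<Union>{K. \<exists>x. (x, K) \<in> (%K. (Inf K, K)) ` d} = {a..b}"
    using division_ofD(6)[OF d] by (auto simp: image_iff)
  qed
  have "(\<Sum>K\<in>d. norm (integral K (deriv f))) <= (\<Sum>K\<in>d. V (Sup K) - V (Inf K))"
  proof (rule sum_mono)
   fix K assume "K \<in> d"
   then obtain u v where K: "K = cbox u v" "K ~= {}" "K \<subseteq> cbox a b" using division_ofD[OF d] by metis
   then have uv: "u <= v" "a <= u" "v <= b" by auto
   have "integral K (deriv f) = f v - f u" unfolding K(1) using abs_continuous_has_integral[OF f uv(2,1,3)] by (simp add: integral_unique)
   then show "norm (integral K (deriv f)) <= V (Sup K) - V (Inf K)"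
    using V(2)[OF uv(2) _ uv(3)] uv by (cases "u = v") (auto simp: K(1))
  qed
  also have "... = (\<Sum>(x, K)\<in>(%K. (Inf K, K)) ` d. V (Sup K) - V (Inf K))"
   by (simp add: sum.reindex[OF inj])
  also have "... = V b - V a" by (rule additive_tagged_division_1[OF ab tag])
  finally show "(\<Sum>K\<in>d. norm (integral K (deriv f))) <= V b - V a" .
 qed
 then show ?thesis by simp
qed

text \<open>\<open>v\<close> are the coordinates of the velocity in the left invariant horizontal frame.\<close>

definition hvel :: "real => (real => r5) => real => real \<times> real \<times> real => bool" where
 "hvel k c t v \<longleftrightarrow> (let w = fr k (c t) (fst v, fst (snd v), snd (snd v), 0, 0) in
   ((%s. x1 (c s)) has_real_derivative x1 w) (at t) & ((%s. x2 (c s)) has_real_derivative x2 w) (at t) &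
   ((%s. x3 (c s)) has_real_derivative x3 w) (at t) & ((%s. x4 (c s)) has_real_derivative x4 w) (at t) &
   ((%s. x5 (c s)) has_real_derivative x5 w) (at t))"

text \<open>The norm of the frame coefficients; the third one subtracts what X2 contributes to the
  third coordinate. Written with \<open>deriv\<close>, it is a total integrand even where the curve
  is not differentiable.\<close>

definition speed :: "real => (real => r5) => real => real" where
 "speed k c t = sqrt ((deriv (%s. x1 (c s)) t)\<^sup>2 + (deriv (%s. x2 (c s)) t)\<^sup>2 +
   (deriv (%s. x3 (c s)) t - k * x1 (c t) * deriv (%s. x2 (c s)) t)\<^sup>2)"

definition acs :: "real => real => (real => r5) => bool" where
 "acs a b c \<longleftrightarrow> abs_continuous a b (%s. x1 (c s)) & abs_continuous a b (%s. x2 (c s)) & abs_continuous a b (%s. x3 (c s)) &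
   abs_continuous a b (%s. x4 (c s)) & abs_continuous a b (%s. x5 (c s))"

definition hcurve :: "real => real => real => (real => r5) => bool" where
 "hcurve k a b c \<longleftrightarrow> acs a b c & negligible {t. a < t & t < b & \<not> (\<exists>v. hvel k c t v)}"

section \<open>Lengths of horizontal curves\<close>

lemma speed_hvel: "hvel k c t v ==> speed k c t = norm v"
proof -
 assume "hvel k c t v"
 then have "deriv (%s. x1 (c s)) t = fst v" "deriv (%s. x2 (c s)) t = fst (snd v)"
  "deriv (%s. x3 (c s)) t = snd (snd v) + k * x1 (c t) * fst (snd v)"
  by (auto simp: hvel_def Let_def fr_def intro!: DERIV_imp_deriv)
 then show ?thesis by (simp add: speed_def norm_prod_def)
qed

lemma speed_nonneg [simp]: "0 <= speed k c t" by (simp add: speed_def)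

lemma speed_cong_ev:
 assumes "eventually (%s. c s = c' s) (nhds t)"
 shows "speed k c t = speed k c' t" and "hvel k c t v \<longleftrightarrow> hvel k c' t v" (is ?P1)
proof -
 have e: "eventually (%s. x1 (c s) = x1 (c' s)) (nhds t)" "eventually (%s. x2 (c s) = x2 (c' s)) (nhds t)"
  "eventually (%s. x3 (c s) = x3 (c' s)) (nhds t)" "eventually (%s. x4 (c s) = x4 (c' s)) (nhds t)"
  "eventually (%s. x5 (c s) = x5 (c' s)) (nhds t)" using assms by (eventually_elim, simp)+
 have "c t = c' t" using assms by (rule eventually_nhds_x_imp_x)
 then show "speed k c t = speed k c' t"
  unfolding speed_def using deriv_cong_ev[OF e(1) refl] deriv_cong_ev[OF e(2) refl] deriv_cong_ev[OF e(3) refl] by simp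
 show ?P1 unfolding hvel_def Let_def \<open>c t = c' t\<close>
  using DERIV_cong_ev[OF refl e(1) refl] DERIV_cong_ev[OF refl e(2) refl] DERIV_cong_ev[OF refl e(3) refl]
   DERIV_cong_ev[OF refl e(4) refl] DERIV_cong_ev[OF refl e(5) refl] by simp
qed

lemma eventually_eq_interior:
 fixes c :: "real => 'b"
 assumes "!!s. a <= s ==> s <= b ==> c s = c' s" "a < t" "t < b"
 shows "eventually (%s. c s = c' s) (nhds t)"
proof -
 have "eventually (%s. s \<in> {a<..<b}) (nhds t)" using assms(2,3) by (intro eventually_nhds_in_open) auto
 then show ?thesis by eventually_elim (use assms(1) in auto)
qed

lemma integral_spike_interior:
 fixes f g :: "real => real"
 assumes "negligible N" "!!t. a < t ==> t < b ==> t \<notin> N ==> f t = g t"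
 shows "integral {a..b} f = integral {a..b} g"
 by (rule integral_spike[of "N \<union> {a, b}"]) (use assms in \<open>auto simp: negligible_Un\<close>)

lemma hcurve_cong:
 assumes "hcurve k a b c" "!!s. a <= s ==> s <= b ==> c s = c' s"
 shows "hcurve k a b c'" and "integral {a..b} (speed k c') = integral {a..b} (speed k c)" (is ?P1)
proof -
 have ev: "eventually (%s. c s = c' s) (nhds t)" if "a < t" "t < b" for t
  by (rule eventually_eq_interior[OF assms(2) that])
 have "abs_continuous a b (%s. \<pi> (c' s))" if "abs_continuous a b (%s. \<pi> (c s))" for \<pi>
  using that by (rule abs_continuous_cong) (simp add: assms(2))
 from this[of fst] this[of "%p. x2 p"] this[of "%p. x3 p"] this[of "%p. x4 p"] this[of "%p. x5 p"]
 have "acs a b c'" using assms(1) unfolding hcurve_def acs_def by simp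
 moreover have "{t. a < t & t < b & \<not> (\<exists>v. hvel k c' t v)} = {t. a < t & t < b & \<not> (\<exists>v. hvel k c t v)}"
  using speed_cong_ev(2)[OF ev] by blast
 ultimately show "hcurve k a b c'" using assms(1) by (simp add: hcurve_def)
 show ?P1 by (rule integral_spike_interior[of "{}"]) (simp_all add: speed_cong_ev(1)[OF ev])
qed

text \<open>Absolute integrability matters because \<open>sr_length\<close> is a Lebesgue integral,
  whereas lengths are computed here as gauge integrals.\<close>

lemma speed_absolutely_integrable:
 assumes c: "hcurve k a b c" and ab: "a <= b"
 shows "speed k c absolutely_integrable_on {a..b}"
proof -
 have ac: "abs_continuous a b (%s. x1 (c s))" "abs_continuous a b (%s. x2 (c s))" "abs_continuous a b (%s. x3 (c s))"
  using c by (auto simp: hcurve_def acs_def)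
 note d = abs_continuous_deriv_absolutely_integrable[OF ac(1) ab] abs_continuous_deriv_absolutely_integrable[OF ac(2) ab]
  abs_continuous_deriv_absolutely_integrable[OF ac(3) ab]
 have S: "{a..b} \<in> sets lebesgue" by simp
 have m: "deriv (%s. x1 (c s)) \<in> borel_measurable (lebesgue_on {a..b})" "deriv (%s. x2 (c s)) \<in> borel_measurable (lebesgue_on {a..b})"
  "deriv (%s. x3 (c s)) \<in> borel_measurable (lebesgue_on {a..b})"
  using absolutely_integrable_imp_borel_measurable[OF d(1) S] absolutely_integrable_imp_borel_measurable[OF d(2) S]
   absolutely_integrable_imp_borel_measurable[OF d(3) S] by simp_all
 have cc: "continuous_on {a..b} (%s. x1 (c s))" by (rule abs_continuous_continuous_on[OF ac(1)])
 then have m1: "(%s. x1 (c s)) \<in> borel_measurable (lebesgue_on {a..b})" by (rule continuous_imp_measurable_on_sets_lebesgue) simp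
 have "bounded ((%s. x1 (c s)) ` {a..b})" by (intro compact_imp_bounded compact_continuous_image cc compact_Icc)
 then have "\<exists>B. \<forall>s\<in>{a..b}. abs (x1 (c s)) <= B" by (simp add: bounded_iff)
 then obtain B where B: "!!s. s \<in> {a..b} ==> abs (x1 (c s)) <= B" by blast
 show ?thesis
 proof (rule measurable_bounded_by_integrable_imp_absolutely_integrable[OF _ S])
  show "speed k c \<in> borel_measurable (lebesgue_on {a..b})"
   unfolding speed_def[abs_def] using m m1 by measurable
  let ?g = "%t. abs (deriv (%s. x1 (c s)) t) + abs (deriv (%s. x2 (c s)) t) + (abs (deriv (%s. x3 (c s)) t) + abs k * B * abs (deriv (%s. x2 (c s)) t))"
  show "?g integrable_on {a..b}" using d[unfolded absolutely_integrable_on_def real_norm_def]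
   by (intro integrable_add integrable_on_mult_right) simp_all
  fix t assume t: "t \<in> {a..b}"
  have sq: "sqrt (x\<^sup>2 + y\<^sup>2 + z\<^sup>2) <= abs x + abs y + abs z" for x y z :: real
   using sqrt_add_le_add_sqrt[of "x\<^sup>2 + y\<^sup>2" "z\<^sup>2"] sqrt_add_le_add_sqrt[of "x\<^sup>2" "y\<^sup>2"] by simp
  have "abs (deriv (%s. x3 (c s)) t - k * x1 (c t) * deriv (%s. x2 (c s)) t) <= abs (deriv (%s. x3 (c s)) t) + abs (k * x1 (c t) * deriv (%s. x2 (c s)) t)"
   by (rule abs_triangle_ineq4)
  also have "abs (k * x1 (c t) * deriv (%s. x2 (c s)) t) <= abs k * B * abs (deriv (%s. x2 (c s)) t)"
   unfolding abs_mult using B[OF t] by (intro mult_right_mono mult_left_mono) auto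
  finally have "abs (deriv (%s. x3 (c s)) t - k * x1 (c t) * deriv (%s. x2 (c s)) t) <= abs (deriv (%s. x3 (c s)) t) + abs k * B * abs (deriv (%s. x2 (c s)) t)"
   by simp
  moreover have "speed k c t <= abs (deriv (%s. x1 (c s)) t) + abs (deriv (%s. x2 (c s)) t) + abs (deriv (%s. x3 (c s)) t - k * x1 (c t) * deriv (%s. x2 (c s)) t)"
   unfolding speed_def by (rule sq)
  ultimately show "norm (speed k c t) <= ?g t" by simp
 qed
qed

lemma speed_integrable: "hcurve k a b c ==> a <= b ==> speed k c integrable_on {a..b}"
 using speed_absolutely_integrable absolutely_integrable_on_def by blast

lemma acs_continuous: "acs a b c ==> continuous_on {a..b} c"
proof -
 assume "acs a b c"
 then have "continuous_on {a..b} (%s. (x1 (c s), x2 (c s), x3 (c s), x4 (c s), x5 (c s)))"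
  unfolding acs_def by (intro continuous_on_Pair) (auto intro: abs_continuous_continuous_on)
 then show ?thesis by simp
qed

lemma hvel_translate: "hvel k c t v ==> hvel k (%s. gm k p (c s)) t v"
proof -
 assume "hvel k c t v"
 then have d: "((%s. x1 (c s)) has_real_derivative fst v) (at t)" "((%s. x2 (c s)) has_real_derivative fst (snd v)) (at t)"
   "((%s. x3 (c s)) has_real_derivative snd (snd v) + k * x1 (c t) * fst (snd v)) (at t)"
   "((%s. x4 (c s)) has_real_derivative x1 (c t) * snd (snd v) + k * (x1 (c t))\<^sup>2 * fst (snd v) / 2) (at t)"
   "((%s. x5 (c s)) has_real_derivative x2 (c t) * snd (snd v) + k * x1 (c t) * x2 (c t) * fst (snd v)) (at t)"
  by (simp_all add: hvel_def Let_def fr_def)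
 show ?thesis unfolding hvel_def Let_def fr_def gm_def fst_conv snd_conv
  by (intro conjI) (auto intro!: derivative_eq_intros d simp: field_simps power2_eq_square)
qed

lemma acs_translate:
 assumes "acs a b c"
 shows "acs a b (%s. gm k p (c s))"
proof -
 have ac: "abs_continuous a b (%s. x1 (c s))" "abs_continuous a b (%s. x2 (c s))" "abs_continuous a b (%s. x3 (c s))"
   "abs_continuous a b (%s. x4 (c s))" "abs_continuous a b (%s. x5 (c s))" using assms by (auto simp: acs_def)
 show ?thesis unfolding acs_def gm_def fst_conv snd_conv divide_inverse power2_eq_square
  by (intro conjI abs_continuous_add abs_continuous_mult abs_continuous_const ac)
qed

lemma hcurve_translate:
 assumes c: "hcurve k a b c"
 shows "hcurve k a b (%s. gm k p (c s))" (is ?P1) and "integral {a..b} (speed k (%s. gm k p (c s))) = integral {a..b} (speed k c)" (is ?P2)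
proof -
 have N: "negligible {t. a < t & t < b & (\<nexists>v. hvel k c t v)}" using c by (simp add: hcurve_def)
 show ?P1 unfolding hcurve_def
 proof
  show "acs a b (%s. gm k p (c s))" using c by (intro acs_translate) (simp add: hcurve_def)
  show "negligible {t. a < t & t < b & (\<nexists>v. hvel k (%s. gm k p (c s)) t v)}"
   by (rule negligible_subset[OF N]) (use hvel_translate in blast)
 qed
 note N
 then show ?P2
 proof (rule integral_spike_interior)
  fix t assume "a < t" "t < b" "t \<notin> {t. a < t & t < b & (\<nexists>v. hvel k c t v)}"
  then obtain v where "hvel k c t v" by blast
  then show "speed k (%s. gm k p (c s)) t = speed k c t" using speed_hvel hvel_translate by metis
 qed
qed

lemma hvel_affine:
 assumes "hvel k c (m * t + e) v"
 shows "hvel k (%s. c (m * s + e)) t (m *\<^sub>R v)"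
proof -
 have ch: "((%s. f (m * s + e)) has_real_derivative m * d) (at t)" if "(f has_real_derivative d) (at (m * t + e))" for f d
 proof -
  have "((%s. m * s + e) has_real_derivative m) (at t)" by (auto intro!: derivative_eq_intros)
  then have "((%s. f (m * s + e)) has_real_derivative d * m) (at t)" by (rule DERIV_chain2[where g = "%s. m * s + e", OF that])
  then show ?thesis by (subst mult.commute)
 qed
 have w: "fr k x (fst (m *\<^sub>R v), fst (snd (m *\<^sub>R v)), snd (snd (m *\<^sub>R v)), 0, 0) = m *\<^sub>R fr k x (fst v, fst (snd v), snd (snd v), 0, 0)" for x
  by (simp add: fr_def algebra_simps)
 show ?thesis using assms unfolding hvel_def Let_def w unfolding fst_scaleR snd_scaleR real_scaleR_def
  by (intro conjI ch) simp_all
qed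

text \<open>\<open>m = - 1\<close> reverses curves and \<open>m = 2\<close> serves concatenation.
  The new interval is given as an image because a negative \<open>m\<close> swaps the
  endpoints.\<close>

lemma hcurve_affine:
 assumes c: "hcurve k a b c" and m: "m ~= 0" and ab: "a <= b" and img: "(%t. (t - e) / m) ` {a..b} = {a'..b'}" and ab': "a' <= b'"
 shows "hcurve k a' b' (%s. c (m * s + e))" (is ?P1)
  and "integral {a'..b'} (speed k (%s. c (m * s + e))) = integral {a..b} (speed k c)" (is ?P2)
proof -
 have r: "m * s + e \<in> {a..b}" if "s \<in> {a'..b'}" for s using that m unfolding img[symmetric] by auto
 have mono: "mono_on {a'..b'} (%s. m * s + e) \<or> antimono_on {a'..b'} (%s. m * s + e)"
  using m by (cases "0 < m") (auto simp: monotone_on_def)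
 have "abs_continuous a' b' (%s. f (m * s + e))" if "abs_continuous a b f" for f
 proof (rule abs_continuous_comp[OF that _ _ _ mono])
  show "0 < abs m" using m by simp
  show "abs ((m * y + e) - (m * x + e)) <= abs m * (y - x)" if "x < y" for x y using that by (simp add: abs_mult flip: right_diff_distrib)
  show "a <= m * x + e & m * x + e <= b" if "a' <= x" "x <= b'" for x using r[of x] that by auto
 qed
 then have ac: "acs a' b' (%s. c (m * s + e))" using c by (auto simp: hcurve_def acs_def)
 define N where "N = {t. a < t & t < b & (\<nexists>v. hvel k c t v)}"
 have N: "negligible N" using c by (simp add: hcurve_def N_def)
 have "negligible ((%t. (t - e) / m) ` (N \<union> {a, b}))" unfolding divide_inverse
  by (rule negligible_differentiable_image_negligible)
   (auto intro!: negligible_Un N differentiable_on_mult differentiable_on_diff differentiable_on_id differentiable_on_const)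
 moreover have good: "\<exists>v. hvel k c (m * t + e) v" if t: "a' < t" "t < b'" "t \<notin> (%t. (t - e) / m) ` (N \<union> {a, b})" for t
 proof -
  have "t = ((m * t + e) - e) / m" using m by simp
  then have "m * t + e \<notin> N \<union> {a, b}" using t(3) by (metis imageI)
  then show ?thesis using r[of t] t by (auto simp: N_def)
 qed
 ultimately have N': "negligible ((%t. (t - e) / m) ` (N \<union> {a, b}))" and good: "!!t. a' < t ==> t < b' ==> t \<notin> (%t. (t - e) / m) ` (N \<union> {a, b}) ==> \<exists>v. hvel k c (m * t + e) v"
  by blast+
 have "negligible {t. a' < t & t < b' & (\<nexists>v. hvel k (%s. c (m * s + e)) t v)}"
  by (rule negligible_subset[OF N']) (use good hvel_affine in blast)
 then show ?P1 using ac by (simp add: hcurve_def)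
 have "(speed k c has_integral integral {a..b} (speed k c)) (cbox a b)"
  using integrable_integral[OF speed_integrable[OF c ab]] by simp
 from has_integral_affinity[OF this m, of e]
 have "((%x. speed k c (m * x + e)) has_integral (1 / abs m) * integral {a..b} (speed k c)) ((%t. (t - e) / m) ` {a..b})"
  using m by (simp add: diff_divide_distrib)
 then have "((%x. abs m * speed k c (m * x + e)) has_integral (abs m) * ((1 / abs m) * integral {a..b} (speed k c))) {a'..b'}"
  unfolding img by (rule has_integral_mult_right)
 then have "((%x. abs m * speed k c (m * x + e)) has_integral integral {a..b} (speed k c)) {a'..b'}"
  using m by simp
 then have "integral {a'..b'} (%x. abs m * speed k c (m * x + e)) = integral {a..b} (speed k c)"
  by (rule integral_unique)
 moreover have "integral {a'..b'} (speed k (%s. c (m * s + e))) = integral {a'..b'} (%x. abs m * speed k c (m * x + e))"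
 proof (rule integral_spike_interior[OF N'])
  fix t assume "a' < t" "t < b'" "t \<notin> (%t. (t - e) / m) ` (N \<union> {a, b})"
  then obtain v where v: "hvel k c (m * t + e) v" using good by blast
  show "speed k (%s. c (m * s + e)) t = abs m * speed k c (m * t + e)"
   by (simp add: speed_hvel[OF v] speed_hvel[OF hvel_affine[OF v]])
 qed
 ultimately show ?P2 by simp
qed

lemma hcurve_join:
 assumes c: "hcurve k a m c" "hcurve k m b c" and m: "a <= m" "m <= b"
 shows "hcurve k a b c" and "integral {a..b} (speed k c) = integral {a..m} (speed k c) + integral {m..b} (speed k c)" (is ?P1)
proof -
 have "acs a b c" using c m unfolding hcurve_def acs_def by (auto intro: abs_continuous_join)
 moreover have "negligible ({t. a < t & t < m & (\<nexists>v. hvel k c t v)} \<union> {t. m < t & t < b & (\<nexists>v. hvel k c t v)} \<union> {m})"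
  using c by (intro negligible_Un) (auto simp: hcurve_def)
 then have "negligible {t. a < t & t < b & (\<nexists>v. hvel k c t v)}" by (rule negligible_subset) auto
 ultimately show h: "hcurve k a b c" by (simp add: hcurve_def)
 show ?P1 using Henstock_Kurzweil_Integration.integral_combine[OF m speed_integrable[OF h]] m by simp
qed

definition lengths :: "real => r5 => r5 => real set" where
 "lengths k p q = {integral {0..1} (speed k c) | c. hcurve k 0 1 c & c 0 = p & c 1 = q}"

lemma lengths_nonneg: "l \<in> lengths k p q ==> 0 <= l"
 unfolding lengths_def by (auto intro!: Henstock_Kurzweil_Integration.integral_nonneg speed_integrable)

lemma lengths_translate: "l \<in> lengths k p q ==> l \<in> lengths k (gm k a p) (gm k a q)"
 unfolding lengths_def using hcurve_translate by (smt (verit) mem_Collect_eq)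

lemma lengths_reverse: "l \<in> lengths k p q ==> l \<in> lengths k q p"
proof -
 assume "l \<in> lengths k p q"
 then obtain c where c: "hcurve k 0 1 c" "c 0 = p" "c 1 = q" "l = integral {0..1} (speed k c)" unfolding lengths_def by blast
 have "(%t::real. (t - 1) / - 1) ` {0..1} = {0..1}"
 proof (intro equalityI subsetI)
  fix x :: real assume "x \<in> {0..1}"
  then show "x \<in> (%t. (t - 1) / - 1) ` {0..1}" by (intro image_eqI[of _ _ "1 - x"]) auto
 qed auto
 note h = hcurve_affine[OF c(1), of "- 1" 1 0 1, OF _ _ this]
 show ?thesis unfolding lengths_def by (rule CollectI, rule exI[of _ "%s. c (- 1 * s + 1)"]) (use h c in simp)
qed

lemma lengths_concat:
 assumes "l1 \<in> lengths k p q" "l2 \<in> lengths k q r"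
 shows "l1 + l2 \<in> lengths k p r"
proof -
 obtain c1 where c1: "hcurve k 0 1 c1" "c1 0 = p" "c1 1 = q" "l1 = integral {0..1} (speed k c1)" using assms(1) unfolding lengths_def by blast
 obtain c2 where c2: "hcurve k 0 1 c2" "c2 0 = q" "c2 1 = r" "l2 = integral {0..1} (speed k c2)" using assms(2) unfolding lengths_def by blast
 define c where "c t = (if t <= 1 / 2 then c1 (2 * t + 0) else c2 (2 * t + - 1))" for t
 have i1: "(%t::real. (t - 0) / 2) ` {0..1} = {0..1 / 2}"
 proof (intro equalityI subsetI)
  fix x :: real assume "x \<in> {0..1 / 2}"
  then show "x \<in> (%t. (t - 0) / 2) ` {0..1}" by (intro image_eqI[of _ _ "2 * x"]) auto
 qed auto
 have i2: "(%t::real. (t - - 1) / 2) ` {0..1} = {1 / 2..1}"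
 proof (intro equalityI subsetI)
  fix x :: real assume "x \<in> {1 / 2..1}"
  then show "x \<in> (%t. (t - - 1) / 2) ` {0..1}" by (intro image_eqI[of _ _ "2 * x - 1"]) auto
 qed auto
 have h1: "hcurve k 0 (1 / 2) (%s. c1 (2 * s + 0))" "integral {0..1 / 2} (speed k (%s. c1 (2 * s + 0))) = l1"
  using hcurve_affine[OF c1(1) _ _ i1] c1(4) by simp_all
 have h2: "hcurve k (1 / 2) 1 (%s. c2 (2 * s + - 1))" "integral {1 / 2..1} (speed k (%s. c2 (2 * s + - 1))) = l2"
  using hcurve_affine[OF c2(1) _ _ i2] c2(4) by simp_all
 have e1: "c1 (2 * s + 0) = c s" if "0 <= s" "s <= 1 / 2" for s using that by (simp add: c_def)
 have e2: "c2 (2 * s + - 1) = c s" if "1 / 2 <= s" "s <= 1" for s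
 proof (cases "s = 1 / 2")
  case True
  show ?thesis unfolding True using c1(3) c2(2) by (simp add: c_def)
 next
  case False
  then have "\<not> s <= 1 / 2" using that by linarith
  then show ?thesis by (simp add: c_def)
 qed
 note j1 = hcurve_cong[OF h1(1) e1]
 note j2 = hcurve_cong[OF h2(1) e2]
 note j = hcurve_join[OF j1(1) j2(1)]
 have "c 0 = p" "c 1 = r" using c1(2) c2(3) by (simp_all add: c_def)
 then show ?thesis unfolding lengths_def
  by (intro CollectI exI[of _ c]) (use j j1(2) j2(2) h1(2) h2(2) in simp)
qed

lemma increment_le_length:
 assumes f: "abs_continuous 0 1 f" and c: "hcurve k 0 1 c" and M: "0 <= M" and t: "0 <= t" "t <= 1"
  and d: "!!s v. 0 < s ==> s < 1 ==> hvel k c s v ==> abs (deriv f s) <= M * norm v"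
 shows "abs (f t - f 0) <= M * integral {0..1} (speed k c)"
proof -
 define N where "N = {0, 1} \<union> {s. 0 < s & s < 1 & (\<nexists>v. hvel k c s v)}"
 have N: "negligible N" using c unfolding N_def by (intro negligible_Un) (auto simp: hcurve_def)
 have "((%s. if s \<in> N then 0 else deriv f s) has_integral (f t - f 0)) {0..t}"
  by (rule has_integral_spike[OF N _ abs_continuous_has_integral[OF f order_refl t]]) auto
 moreover have i: "speed k c integrable_on {0..1}" by (rule speed_integrable[OF c]) simp
 then have it: "speed k c integrable_on {0..t}" by (rule integrable_on_subinterval) (use t in auto)
 moreover have "norm (if s \<in> N then 0 else deriv f s) <= M * speed k c s" if s: "s \<in> {0..t}" for s
 proof (cases "s \<in> N")
  case False
  then have s': "0 < s" "s < 1" "\<exists>v. hvel k c s v" using s t by (force simp: N_def)+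
  then obtain v where "hvel k c s v" by blast
  then show ?thesis using d[OF s'(1,2)] False by (simp add: speed_hvel)
 qed (use M in simp)
 ultimately have "norm (integral {0..t} (%s. if s \<in> N then 0 else deriv f s)) <= integral {0..t} (%s. M * speed k c s)"
  by (intro Henstock_Kurzweil_Integration.integral_norm_bound_integral) (auto intro!: integrable_on_mult_right)
 also have "integral {0..t} (%s. if s \<in> N then 0 else deriv f s) = f t - f 0"
  by (rule integral_unique) fact
 also have "integral {0..t} (%s. M * speed k c s) = M * integral {0..t} (speed k c)" by simp
 also have "... <= M * integral {0..1} (speed k c)"
  using M t by (intro mult_left_mono integral_subset_le it i) auto
 finally show ?thesis by simp
qed

lemma norm3_bounds:
 fixes v :: "real \<times> real \<times> real"
 shows "abs (fst v) <= norm v" "abs (fst (snd v)) <= norm v" "abs (snd (snd v)) <= norm v"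
 using norm_fst_le[of "fst v" "snd v"] norm_snd_le[of "snd v" "fst v"] norm_fst_le[of "fst (snd v)" "snd (snd v)"]
  norm_snd_le[of "snd (snd v)" "fst (snd v)"] by auto

text \<open>A bootstrap: the first two coordinates stay below \<open>l\<close>, hence below 1, so
  the third changes at rate at most 2. The rates of the last two contain a factor \<open>x1\<close>
  or \<open>x2\<close>, hence are at most \<open>2 * l\<close>, which gives the quadratic
  bound.\<close>

lemma lengths_lower:
 assumes l: "l \<in> lengths k 0 h" and k: "abs k <= 1" and l1: "l < 1"
 shows "nrm h <= 2 * l"
proof -
 obtain c where c: "hcurve k 0 1 c" "c 0 = 0" "c 1 = h" "l = integral {0..1} (speed k c)" using l unfolding lengths_def by blast
 have l0: "0 <= l" using l by (rule lengths_nonneg)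
 have ac: "abs_continuous 0 1 (%s. x1 (c s))" "abs_continuous 0 1 (%s. x2 (c s))" "abs_continuous 0 1 (%s. x3 (c s))"
   "abs_continuous 0 1 (%s. x4 (c s))" "abs_continuous 0 1 (%s. x5 (c s))" using c(1) by (auto simp: hcurve_def acs_def)
 have d: "deriv (%s. x1 (c s)) s = fst v" "deriv (%s. x2 (c s)) s = fst (snd v)"
  "deriv (%s. x3 (c s)) s = snd (snd v) + k * x1 (c s) * fst (snd v)"
  "deriv (%s. x4 (c s)) s = x1 (c s) * snd (snd v) + k * (x1 (c s))\<^sup>2 * fst (snd v) / 2"
  "deriv (%s. x5 (c s)) s = x2 (c s) * snd (snd v) + k * x1 (c s) * x2 (c s) * fst (snd v)" if "hvel k c s v" for s v
  using that by (auto simp: hvel_def Let_def fr_def intro!: DERIV_imp_deriv)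
 have b1: "abs (x1 (c t)) <= l" if "0 <= t" "t <= 1" for t
  using increment_le_length[OF ac(1) c(1), of 1 t] that norm3_bounds(1) c(2,4) by (simp add: d)
 have b2: "abs (x2 (c t)) <= l" if "0 <= t" "t <= 1" for t
  using increment_le_length[OF ac(2) c(1), of 1 t] that norm3_bounds(2) c(2,4) by (simp add: d)
 have kx: "abs (k * x) <= abs x" for x using mult_right_mono[OF k, of "abs x"] by (simp add: abs_mult)
 have "abs (x3 h) <= 2 * l"
 proof -
  have "abs (deriv (%s. x3 (c s)) s) <= 2 * norm v" if s: "0 < s" "s < 1" "hvel k c s v" for s v
  proof -
   have "abs (k * x1 (c s) * fst (snd v)) <= 1 * norm v"
    unfolding abs_mult[of "k * x1 (c s)"] using kx[of "x1 (c s)"] b1[of s] l1 s norm3_bounds(2)[of v] by (intro mult_mono) auto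
   then show ?thesis unfolding d(3)[OF s(3)] using norm3_bounds(3)[of v] abs_triangle_ineq[of "snd (snd v)" "k * x1 (c s) * fst (snd v)"] by linarith
  qed
  then show ?thesis using increment_le_length[OF ac(3) c(1), of 2 1] c(2,3,4) by simp
 qed
 moreover have "abs (x4 h) <= (2 * l) * l"
 proof -
  have "abs (deriv (%s. x4 (c s)) s) <= (2 * l) * norm v" if s: "0 < s" "s < 1" "hvel k c s v" for s v
  proof -
   have "abs (x1 (c s) * snd (snd v)) <= l * norm v"
    unfolding abs_mult using b1[of s] s norm3_bounds(3)[of v] l0 by (intro mult_mono) auto
   moreover have "abs (k * (x1 (c s))\<^sup>2 * fst (snd v) / 2) <= l * norm v"
   proof -
    have "abs (k * (x1 (c s))\<^sup>2) <= abs (x1 (c s)) * abs (x1 (c s))" using kx[of "(x1 (c s))\<^sup>2"] by (simp add: power2_eq_square abs_mult)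
    also have "... <= l * 1" using b1[of s] s l0 l1 by (intro mult_mono) auto
    finally have "abs (k * (x1 (c s))\<^sup>2) * abs (fst (snd v)) <= l * norm v" using norm3_bounds(2)[of v] l0 by (intro mult_mono) auto
    moreover have "0 <= l * norm v" using l0 by simp
    moreover have "abs (k * (x1 (c s))\<^sup>2 * fst (snd v) / 2) = abs (k * (x1 (c s))\<^sup>2) * abs (fst (snd v)) / 2" by (simp add: abs_mult)
    ultimately show ?thesis by linarith
   qed
   ultimately show ?thesis unfolding d(4)[OF s(3)] using abs_triangle_ineq[of "x1 (c s) * snd (snd v)" "k * (x1 (c s))\<^sup>2 * fst (snd v) / 2"] by linarith
  qed
  then show ?thesis using increment_le_length[OF ac(4) c(1), of "2 * l" 1] c(2,3,4) l0 by simp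
 qed
 moreover have "abs (x5 h) <= (2 * l) * l"
 proof -
  have "abs (deriv (%s. x5 (c s)) s) <= (2 * l) * norm v" if s: "0 < s" "s < 1" "hvel k c s v" for s v
  proof -
   have "abs (x2 (c s) * snd (snd v)) <= l * norm v"
    unfolding abs_mult using b2[of s] s norm3_bounds(3)[of v] l0 by (intro mult_mono) auto
   moreover have "abs (k * x1 (c s) * x2 (c s) * fst (snd v)) <= l * norm v"
   proof -
    have "abs (k * x1 (c s)) * abs (x2 (c s)) <= 1 * l" using kx[of "x1 (c s)"] b1[of s] b2[of s] s l0 l1 by (intro mult_mono) auto
    then have "abs (k * x1 (c s)) * abs (x2 (c s)) * abs (fst (snd v)) <= l * norm v" using norm3_bounds(2)[of v] l0 by (intro mult_mono) auto
    then show ?thesis by (simp add: abs_mult)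
   qed
   ultimately show ?thesis unfolding d(5)[OF s(3)] using abs_triangle_ineq[of "x2 (c s) * snd (snd v)" "k * x1 (c s) * x2 (c s) * fst (snd v)"] by linarith
  qed
  then show ?thesis using increment_le_length[OF ac(5) c(1), of "2 * l" 1] c(2,3,4) l0 by simp
 qed
 moreover have "(2 * l) * l <= (2 * l)\<^sup>2" using l0 by (simp add: power2_eq_square mult_mono)
 moreover have "abs (x1 h) <= 2 * l" "abs (x2 h) <= 2 * l" using b1[of 1] b2[of 1] c(3) l0 by auto
 ultimately show ?thesis using l0 by (subst nrm_le_iff) auto
qed

lemma lengths_const_speed:
 assumes "!!t. hvel k c t v" "acs 0 1 c"
 shows "norm v \<in> lengths k (c 0) (c 1)"
proof -
 have "{t. 0 < t & t < 1 & (\<nexists>v. hvel k c t v)} = {}" using assms(1) by blast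
 then have "hcurve k 0 1 c" using assms(2) unfolding hcurve_def by (simp only: negligible_empty simp_thms)
 moreover have "speed k c = (%_. norm v)" using speed_hvel[OF assms(1)] by auto
 then have "integral {0..1} (speed k c) = norm v" by simp
 ultimately show ?thesis unfolding lengths_def by force
qed

lemma abs_continuous_linear: "abs_continuous a b (%t. t * s)"
 by (rule abs_continuous_lipschitz[of _ _ _ "abs s"]) (simp add: abs_mult flip: left_diff_distrib)

lemma lengths_line:
 "abs s \<in> lengths k 0 (s, 0, 0, 0, 0)" "abs s \<in> lengths k 0 (0, s, 0, 0, 0)" "abs s \<in> lengths k 0 (0, 0, s, 0, 0)"
proof -
 have "norm (s, 0::real, 0::real) \<in> lengths k (0 * s, 0, 0, 0, 0) (1 * s, 0, 0, 0, 0)"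
  by (rule lengths_const_speed[where c = "%t. (t * s, 0, 0, 0, 0)"])
   (auto simp: hvel_def Let_def fr_def acs_def abs_continuous_linear abs_continuous_const intro!: derivative_eq_intros)
 then show "abs s \<in> lengths k 0 (s, 0, 0, 0, 0)" by (simp add: zero_prod_def norm_prod_def)
 have "norm (0::real, s, 0::real) \<in> lengths k (0, 0 * s, 0, 0, 0) (0, 1 * s, 0, 0, 0)"
  by (rule lengths_const_speed[where c = "%t. (0, t * s, 0, 0, 0)"])
   (auto simp: hvel_def Let_def fr_def acs_def abs_continuous_linear abs_continuous_const intro!: derivative_eq_intros)
 then show "abs s \<in> lengths k 0 (0, s, 0, 0, 0)" by (simp add: zero_prod_def norm_prod_def)
 have "norm (0::real, 0::real, s) \<in> lengths k (0, 0, 0 * s, 0, 0) (0, 0, 1 * s, 0, 0)"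
  by (rule lengths_const_speed[where c = "%t. (0, 0, t * s, 0, 0)"])
   (auto simp: hvel_def Let_def fr_def acs_def abs_continuous_linear abs_continuous_const intro!: derivative_eq_intros)
 then show "abs s \<in> lengths k 0 (0, 0, s, 0, 0)" by (simp add: zero_prod_def norm_prod_def)
qed

lemma lengths_mult:
 assumes "l1 \<in> lengths k 0 g" "l2 \<in> lengths k 0 h"
 shows "l1 + l2 \<in> lengths k 0 (gm k g h)"
 using lengths_concat[OF assms(1) lengths_translate[OF assms(2), of g, unfolded gm_0]] .

lemma lengths_inverse: "l \<in> lengths k 0 h ==> l \<in> lengths k 0 (gi k h)"
 using lengths_translate[OF lengths_reverse, of l k 0 h "gi k h"] by simp

text \<open>A commutator rectangle of X1, respectively X2, with X3. Its four sides have length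
  \<open>sqrt (abs w)\<close>, and the sign of \<open>w\<close> is carried by
  \<open>a\<close>.\<close>

lemma lengths_vertical:
 "4 * sqrt (abs w) \<in> lengths k 0 (0, 0, 0, w, 0)" "4 * sqrt (abs w) \<in> lengths k 0 (0, 0, 0, 0, w)"
proof -
 define a where "a = sgn w * sqrt (abs w)"
 define t where "t = sqrt (abs w)"
 have at: "a * t = w" "abs a = sqrt (abs w)" "abs t = sqrt (abs w)"
  by (simp_all add: a_def t_def abs_mult mult.assoc mult_sgn_abs abs_sgn_eq)
 have "abs a + abs t + abs (- a) + abs (- t) \<in> lengths k 0 (gm k (gm k (gm k (a, 0, 0, 0, 0) (0, 0, t, 0, 0)) (- a, 0, 0, 0, 0)) (0, 0, - t, 0, 0))"
  by (intro lengths_mult lengths_line)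
 moreover have "gm k (gm k (gm k (a, 0, 0, 0, 0) (0, 0, t, 0, 0)) (- a, 0, 0, 0, 0)) (0, 0, - t, 0, 0) = (0, 0, 0, w, 0)"
  by (simp add: gm_def at)
 ultimately show "4 * sqrt (abs w) \<in> lengths k 0 (0, 0, 0, w, 0)" using at by simp
 have "abs a + abs t + abs (- a) + abs (- t) \<in> lengths k 0 (gm k (gm k (gm k (0, a, 0, 0, 0) (0, 0, t, 0, 0)) (0, - a, 0, 0, 0)) (0, 0, - t, 0, 0))"
  by (intro lengths_mult lengths_line)
 moreover have "gm k (gm k (gm k (0, a, 0, 0, 0) (0, 0, t, 0, 0)) (0, - a, 0, 0, 0)) (0, 0, - t, 0, 0) = (0, 0, 0, 0, w)"
  by (simp add: gm_def at)
 ultimately show "4 * sqrt (abs w) \<in> lengths k 0 (0, 0, 0, 0, w)" using at by simp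
qed

text \<open>Every element is a product of three horizontal exponentials and two vertical elements;
  \<open>z\<close>, \<open>w\<close>, \<open>u\<close> solve for the remaining coordinates. In
  particular the infimum defining the distance is over a nonempty set.\<close>

lemma lengths_all:
 fixes h :: r5 and k :: real
 defines "z \<equiv> x3 h - k * x1 h * x2 h"
 defines "w \<equiv> x4 h - k * (x1 h)\<^sup>2 * x2 h / 2 - x1 h * z"
 defines "u \<equiv> x5 h - k * x1 h * (x2 h)\<^sup>2 / 2 - x2 h * z"
 shows "abs (x1 h) + abs (x2 h) + abs z + 4 * sqrt (abs w) + 4 * sqrt (abs u) \<in> lengths k 0 h"
proof -
 have "abs (x1 h) + abs (x2 h) + abs z + 4 * sqrt (abs w) + 4 * sqrt (abs u) \<in> lengths k 0
  (gm k (gm k (gm k (gm k (x1 h, 0, 0, 0, 0) (0, x2 h, 0, 0, 0)) (0, 0, z, 0, 0)) (0, 0, 0, w, 0)) (0, 0, 0, 0, u))"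
  by (intro lengths_mult lengths_line lengths_vertical)
 moreover have "gm k (gm k (gm k (gm k (x1 h, 0, 0, 0, 0) (0, x2 h, 0, 0, 0)) (0, 0, z, 0, 0)) (0, 0, 0, w, 0)) (0, 0, 0, 0, u) = h"
  by (simp add: gm_def z_def w_def u_def prod_eq_iff)
 ultimately show ?thesis by simp
qed

text \<open>The constant is 1 + 1 + 2 + 8 + 8: \<open>z\<close> is at most \<open>2 * N\<close>,
  while \<open>w\<close> and \<open>u\<close> are at most \<open>4 * N\<^sup>2\<close>, so each
  vertical rectangle costs at most \<open>8 * N\<close>.\<close>

lemma lengths_upper:
 assumes k: "abs k <= 1" and h: "nrm h <= 1"
 shows "\<exists>l\<in>lengths k 0 h. l <= 20 * nrm h"
proof -
 define N where "N = nrm h"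
 define z where "z = x3 h - k * x1 h * x2 h"
 define w where "w = x4 h - k * (x1 h)\<^sup>2 * x2 h / 2 - x1 h * z"
 define u where "u = x5 h - k * x1 h * (x2 h)\<^sup>2 / 2 - x2 h * z"
 have N: "0 <= N" "N <= 1" using h by (simp_all add: N_def)
 have c: "abs (x1 h) <= N" "abs (x2 h) <= N" "abs (x3 h) <= N" "abs (x4 h) <= N\<^sup>2" "abs (x5 h) <= N\<^sup>2"
  unfolding N_def by (rule nrm_comp_le)+
 have NN: "N * N <= N" using mult_left_mono[OF N(2,1)] by simp
 have kx: "abs (k * x) <= abs x" for x using mult_right_mono[OF k, of "abs x"] by (simp add: abs_mult)
 have k1: "abs (k * x1 h) <= N" using kx[of "x1 h"] c(1) by linarith
 have p: "abs (a * b) <= A * B" if "abs a <= A" "abs b <= B" for a b A B :: real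
  unfolding abs_mult using that by (intro mult_mono) auto
 have z: "abs z <= 2 * N" unfolding z_def using p[OF k1 c(2)] c(3) NN by (simp add: abs_le_iff)
 have kk: "abs (k * (x1 h)\<^sup>2 * x2 h) <= N\<^sup>2" (is ?P1) "abs (k * x1 h * (x2 h)\<^sup>2) <= N\<^sup>2" (is ?P2)
 proof -
  have "abs ((k * x1 h) * (x1 h * x2 h)) <= 1 * (N * N)" using k1 N by (intro p c) auto
  then show ?P1 by (simp add: power2_eq_square mult_ac)
  have "abs ((k * x1 h) * (x2 h * x2 h)) <= 1 * (N * N)" using k1 N by (intro p c) auto
  then show ?P2 by (simp add: power2_eq_square mult_ac)
 qed
 have "abs w <= 4 * N\<^sup>2" "abs u <= 4 * N\<^sup>2"
  unfolding w_def u_def using p[OF c(1) z] p[OF c(2) z] kk c(4,5) by (simp_all add: abs_le_iff power2_eq_square)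
 then have s: "sqrt (abs w) <= 2 * N" "sqrt (abs u) <= 2 * N"
  using N by (auto intro!: real_le_lsqrt simp: power_mult_distrib)
 show ?thesis
 proof (rule bexI)
  show "abs (x1 h) + abs (x2 h) + abs z + 4 * sqrt (abs w) + 4 * sqrt (abs u) \<in> lengths k 0 h"
   unfolding w_def u_def z_def by (rule lengths_all)
  show "abs (x1 h) + abs (x2 h) + abs z + 4 * sqrt (abs w) + 4 * sqrt (abs u) <= 20 * nrm h"
   using c(1,2) z s by (simp add: N_def)
 qed
qed

definition ccn :: "real => r5 => real" where
 "ccn k h = Inf (lengths k 0 h)"

lemma ccn_le: "l \<in> lengths k 0 h ==> ccn k h <= l"
 unfolding ccn_def by (rule cInf_lower) (auto intro!: bdd_belowI lengths_nonneg)

lemma ccn_less: "ccn k h < x ==> \<exists>l\<in>lengths k 0 h. l < x"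
 unfolding ccn_def using lengths_all[of h k] by (subst (asm) cInf_less_iff) (auto intro!: bdd_belowI lengths_nonneg)

lemma ccn_nonneg: "0 <= ccn k h"
 unfolding ccn_def using lengths_all[of h k] by (intro cInf_greatest) (auto intro: lengths_nonneg)

lemma ccn_mult: "ccn k (gm k g h) <= ccn k g + ccn k h"
proof (rule field_le_epsilon)
 fix e :: real assume "0 < e"
 then obtain l1 l2 where "l1 \<in> lengths k 0 g" "l1 < ccn k g + e / 2" "l2 \<in> lengths k 0 h" "l2 < ccn k h + e / 2"
  using ccn_less[of k g "ccn k g + e / 2"] ccn_less[of k h "ccn k h + e / 2"] by auto
 then show "ccn k (gm k g h) <= ccn k g + ccn k h + e" using ccn_le[OF lengths_mult, of l1 k g l2 h] by linarith
qed

lemma ccn_inverse: "ccn k (gi k h) = ccn k h"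
proof -
 have le: "ccn k (gi k h) <= ccn k h" for h
 proof (rule field_le_epsilon)
  fix e :: real assume "0 < e"
  then obtain l where "l \<in> lengths k 0 h" "l < ccn k h + e" using ccn_less[of k h "ccn k h + e"] by auto
  then show "ccn k (gi k h) <= ccn k h + e" using ccn_le[OF lengths_inverse, of l k h] by linarith
 qed
 have "gi k (gi k h) = h" by (metis gm_0(1) gm_0(2) gm_assoc gm_gi(1))
 then show ?thesis using le[of h] le[of "gi k h"] by simp
qed

lemma ccn_upper: "abs k <= 1 ==> nrm h <= 1 ==> ccn k h <= 20 * nrm h"
 using lengths_upper[of k h] ccn_le by fastforce

lemma ccn_lower:
 assumes k: "abs k <= 1" and "ccn k h < 1"
 shows "nrm h <= 2 * ccn k h"
proof (rule field_le_epsilon)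
 fix e :: real assume "0 < e"
 then have "ccn k h < min 1 (ccn k h + e / 2)" using assms(2) by simp
 then obtain l where l: "l \<in> lengths k 0 h" "l < min 1 (ccn k h + e / 2)" using ccn_less by blast
 then show "nrm h <= 2 * ccn k h + e" using lengths_lower[OF l(1) k] by simp
qed

lemma ccn_eq_0: "abs k <= 1 ==> ccn k h = 0 \<longleftrightarrow> h = 0"
proof
 assume k: "abs k <= 1" and "ccn k h = 0"
 then have "nrm h <= 0" using ccn_lower[OF k, of h] by simp
 then show "h = 0" using nrm_nonneg[of h] by (simp add: order_antisym nrm_eq_0_iff[THEN iffD1])
next
 assume k: "abs k <= 1" and "h = 0"
 moreover have z: "nrm 0 = 0" by (rule nrm_eq_0_iff[THEN iffD2, OF refl])
 have "ccn k 0 <= 0" using ccn_upper[OF k, of 0] unfolding z by simp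
 ultimately show "ccn k h = 0" using ccn_nonneg[of k 0] by simp
qed

section \<open>Identification with the Carnot-Caratheodory distance\<close>

lemma velocity_coord:
 assumes "\<gamma> t \<in> Es 5"
 shows "velocity (Mk k) \<gamma> t (%x. x j) = deriv (%s. \<gamma> s j) t"
 using mk.smooth_near_coord[OF assms, of k j] by (simp add: velocity_def)

lemma sr_length_speed:
 assumes E: "!!t. t \<in> {0..1} ==> \<gamma> t \<in> Es 5" and c: "hcurve k 0 1 (%t. crd (\<gamma> t))"
 shows "sr_length (Mk k) \<gamma> = integral {0..1} (speed k (%t. crd (\<gamma> t)))"
proof -
 have "sqrt (met (Mk k) (\<gamma> t) (velocity (Mk k) \<gamma> t) (velocity (Mk k) \<gamma> t)) = speed k (%t. crd (\<gamma> t)) t" if "t \<in> {0..1}" for t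
  by (simp add: met_Mk cof_def Let_def velocity_coord[where \<gamma> = \<gamma> and t = t, OF E[OF that]] speed_def power2_eq_square)
 then have "sr_length (Mk k) \<gamma> = (LINT t|lebesgue_on {0..1}. speed k (%t. crd (\<gamma> t)) t)"
  unfolding sr_length_def by (intro Bochner_Integration.integral_cong refl) simp
 also have "... = integral {0..1} (speed k (%t. crd (\<gamma> t)))"
  by (intro lebesgue_integral_eq_integral absolutely_integrable_imp_integrable speed_absolutely_integrable[OF c]) simp_all
 finally show ?thesis .
qed

lemma horizontal_curve_Es: "horizontal_curve (Mk k) \<gamma> ==> t \<in> {0..1} ==> \<gamma> t \<in> Es 5"
 unfolding horizontal_curve_def abs_continuous_curve_def Mk_sel using continuous_map_image_subset_topspace by fastforce

text \<open>The contact equations express the last two derivatives by the first three, so a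
  horizontal velocity has frame coefficients of the form \<open>hvel\<close> asks for.\<close>

lemma horizontal_curve_hcurve:
 assumes h: "horizontal_curve (Mk k) \<gamma>"
 shows "hcurve k 0 1 (%t. crd (\<gamma> t))"
proof -
 note E = horizontal_curve_Es[OF h]
 have img: "\<gamma> ` {0..1} \<subseteq> Es 5" using E by blast
 have ac: "abs_continuous 0 1 (%t. \<gamma> t i)" if "i < 5" for i
  using h that img unfolding horizontal_curve_def abs_continuous_curve_def Mk_sel by auto
 have acs: "acs 0 1 (%t. crd (\<gamma> t))" by (simp add: acs_def ac)
 have "AE t in lebesgue_on {0..1}. velocity (Mk k) \<gamma> t \<in> hor (Mk k) (\<gamma> t)" using h by (simp add: horizontal_curve_def)
 then have "AE t in lebesgue. t \<in> {0..1} --> velocity (Mk k) \<gamma> t \<in> hor (Mk k) (\<gamma> t)"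
  by (subst (asm) AE_restrict_space_iff) auto
 then obtain N where N: "negligible N" "{t. \<not> (t \<in> {0..1} --> velocity (Mk k) \<gamma> t \<in> hor (Mk k) (\<gamma> t))} \<subseteq> N"
  unfolding eventually_ae_filter_negligible by blast
 define N' where "N' i = {t. 0 < t & t < 1 & \<not> (%t. \<gamma> t i) differentiable (at t)}" for i
 have "negligible (N' i)" if "i < 5" for i unfolding N'_def by (rule abs_continuous_differentiable_ae[OF ac[OF that]])
 then have neg: "negligible (N \<union> (\<Union>i\<in>{..<5}. N' i))" by (intro negligible_Un N(1) negligible_Union_nat negligible_Union) auto
 have "\<exists>v. hvel k (%t. crd (\<gamma> t)) t v" if t: "0 < t" "t < 1" "t \<notin> N \<union> (\<Union>i\<in>{..<5}. N' i)" for t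
 proof -
  have tE: "\<gamma> t \<in> Es 5" using t by (intro E) simp
  have v: "velocity (Mk k) \<gamma> t \<in> hor (Mk k) (\<gamma> t)"
  proof -
   have "t \<in> {0..1}" "t \<notin> N" using t by auto
   then show ?thesis using N(2) by blast
  qed
  define w where "w i = deriv (%s. \<gamma> s i) t" for i
  have d: "((%s. \<gamma> s i) has_real_derivative w i) (at t)" if "i < 5" for i
  proof -
   have "(%s. \<gamma> s i) differentiable (at t)" using t that by (auto simp: N'_def)
   then show ?thesis unfolding w_def by (metis DERIV_imp_deriv real_differentiable_def)
  qed
  have "w 3 = \<gamma> t 0 * w 2 - k / 2 * (\<gamma> t 0)\<^sup>2 * w 1" "w 4 = \<gamma> t 1 * w 2"
   using hor_coord[OF v tE] by (simp_all add: velocity_coord[where \<gamma> = \<gamma> and t = t, OF tE] w_def)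
  then have e: "w 2 - k * \<gamma> t 0 * w 1 + k * \<gamma> t 0 * w 1 = w 2"
   "0 + \<gamma> t 0 * (w 2 - k * \<gamma> t 0 * w 1) + k * (\<gamma> t 0)\<^sup>2 * w 1 / 2 = w 3"
   "0 + \<gamma> t 1 * (w 2 - k * \<gamma> t 0 * w 1) + k * \<gamma> t 0 * \<gamma> t 1 * w 1 = w 4"
   by (simp_all add: field_simps power2_eq_square)
  have "hvel k (%t. crd (\<gamma> t)) t (w 0, w 1, w 2 - k * \<gamma> t 0 * w 1)"
   unfolding hvel_def Let_def fr_def fst_conv snd_conv crd_simps e using d by simp
  then show ?thesis by blast
 qed
 then have "negligible {t. 0 < t & t < 1 & (\<nexists>v. hvel k (%t. crd (\<gamma> t)) t v)}"
  by (intro negligible_subset[OF neg]) blast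
 then show ?thesis using acs by (simp only: hcurve_def simp_thms)
qed

text \<open>\<open>velocity\<close> is given by its action on all smooth functions, so the chain
  rule is what identifies it with the frame vector of the same coordinates.\<close>

lemma hcurve_horizontal_curve:
 assumes c: "hcurve k 0 1 c"
 shows "horizontal_curve (Mk k) (%t. sq (c t))" unfolding horizontal_curve_def abs_continuous_curve_def Mk_sel
proof (intro conjI)
 have acs: "acs 0 1 c" using c by (simp add: hcurve_def)
 have "continuous_on {0..1} (%t. sq (c t))" by (rule continuous_on_sq[OF acs_continuous[OF acs]])
 then show "continuous_map (top_of_set {0..1}) (Euclidean_space 5) (%t. sq (c t))"
  by (subst Euclidean_space_top_of_set) (simp add: continuous_map_subtopology_eu)
 have "abs_continuous 0 1 (%t. sq (c t) i)" if "i < 5" for i using that acs by (auto simp: less5 acs_def)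
 then have "abs_continuous a b (%t. sq (c t) i)" if "i < 5" "0 <= a" "b <= 1" for i a b
  using that by (blast intro: abs_continuous_subset)
 then show "\<forall>(U, h)\<in>{(Es 5, %x. x)}. \<forall>a b. 0 <= a --> a <= b --> b <= 1 --> (%t. sq (c t)) ` {a..b} \<subseteq> U -->
   (\<forall>i<5. abs_continuous a b (%t. h (sq (c t)) i))" by simp
 have hv: "velocity (Mk k) (%t. sq (c t)) t \<in> hor (Mk k) (sq (c t))" if "hvel k c t v" for t v
 proof -
  define a where "a = (fst v, fst (snd v), snd (snd v), 0::real, 0::real)"
  have d: "((%s. sq (c s) j) has_real_derivative sq (fr k (c t) a) j) (at t)" if "j < 5" for j
   using that \<open>hvel k c t v\<close> by (auto simp: less5 hvel_def Let_def a_def)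
  have "velocity (Mk k) (%t. sq (c t)) t f = lf k (sq (c t)) a f" for f
  proof (cases "smooth_near (Mk k) (sq (c t)) f")
   case True
   then obtain W where W: "sq (c t) \<in> W" "eopen 5 W" "Cinf 5 W f" unfolding mk.smooth_near_iff by blast
   have "((%s. f (sq (c s))) has_real_derivative (\<Sum>j<5. pdv j f (sq (c t)) * sq (fr k (c t) a) j)) (at t)"
    by (rule C1_chain[OF W(2) CinfD[OF W(3)] W(1) sq_Es d])
   then show ?thesis using True by (simp add: velocity_def DERIV_imp_deriv lf_def mk.tv_eq[where k = k] mult.commute)
  next
   case False
   then show ?thesis by (simp add: velocity_def lf_def mk.tv_eq[where k = k])
  qed
  then have "velocity (Mk k) (%t. sq (c t)) t = lf k (sq (c t)) a" by blast
  then show ?thesis unfolding hor_Mk by (simp add: a_def)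
 qed
 have "negligible ({0, 1} \<union> {t. 0 < t & t < 1 & (\<nexists>v. hvel k c t v)})"
  using c by (intro negligible_Un) (auto simp: hcurve_def)
 moreover have "{t. \<not> (t \<in> {0..1} --> velocity (Mk k) (%t. sq (c t)) t \<in> hor (Mk k) (sq (c t)))} \<subseteq>
   {0, 1} \<union> {t. 0 < t & t < 1 & (\<nexists>v. hvel k c t v)}"
 proof
  fix t assume t: "t \<in> {t. \<not> (t \<in> {0..1} --> velocity (Mk k) (%t. sq (c t)) t \<in> hor (Mk k) (sq (c t)))}"
  then have "\<nexists>v. hvel k c t v" using hv by blast
  then show "t \<in> {0, 1} \<union> {t. 0 < t & t < 1 & (\<nexists>v. hvel k c t v)}" using t by auto
 qed
 ultimately have "AE t in lebesgue. t \<in> {0..1} --> velocity (Mk k) (%t. sq (c t)) t \<in> hor (Mk k) (sq (c t))"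
  unfolding eventually_ae_filter_negligible by blast
 then show "AE t in lebesgue_on {0..1}. velocity (Mk k) (%t. sq (c t)) t \<in> hor (Mk k) (sq (c t))"
  by (subst AE_restrict_space_iff) auto
qed

text \<open>Both notions of horizontal curve yield the same lengths, and lengths are left
  invariant.\<close>

lemma cc_dist_Mk:
 assumes p: "p \<in> Es 5" and q: "q \<in> Es 5"
 shows "cc_dist (Mk k) p q = ccn k (gm k (gi k (crd p)) (crd q))"
proof -
 have "{sr_length (Mk k) \<gamma> | \<gamma>. horizontal_curve (Mk k) \<gamma> & \<gamma> 0 = p & \<gamma> 1 = q} = lengths k (crd p) (crd q)"
 proof (intro equalityI subsetI)
  fix l assume "l \<in> {sr_length (Mk k) \<gamma> | \<gamma>. horizontal_curve (Mk k) \<gamma> & \<gamma> 0 = p & \<gamma> 1 = q}"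
  then obtain \<gamma> where \<gamma>: "horizontal_curve (Mk k) \<gamma>" "\<gamma> 0 = p" "\<gamma> 1 = q" "l = sr_length (Mk k) \<gamma>" by blast
  note h = horizontal_curve_hcurve[OF \<gamma>(1)]
  have "l = integral {0..1} (speed k (%t. crd (\<gamma> t)))"
   unfolding \<gamma>(4) by (rule sr_length_speed[OF horizontal_curve_Es[OF \<gamma>(1)] h])
  then show "l \<in> lengths k (crd p) (crd q)" unfolding lengths_def using h \<gamma>(2,3) by blast
 next
  fix l assume "l \<in> lengths k (crd p) (crd q)"
  then obtain c where c: "hcurve k 0 1 c" "c 0 = crd p" "c 1 = crd q" "l = integral {0..1} (speed k c)" unfolding lengths_def by blast
  have "sr_length (Mk k) (%t. sq (c t)) = l" using c by (subst sr_length_speed) simp_all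
  moreover have "sq (c 0) = p" "sq (c 1) = q" using c p q by simp_all
  ultimately show "l \<in> {sr_length (Mk k) \<gamma> | \<gamma>. horizontal_curve (Mk k) \<gamma> & \<gamma> 0 = p & \<gamma> 1 = q}"
   using hcurve_horizontal_curve[OF c(1)] by blast
 qed
 moreover have "lengths k (crd p) (crd q) = lengths k 0 (gm k (gi k (crd p)) (crd q))"
 proof (intro equalityI subsetI)
  show "l \<in> lengths k 0 (gm k (gi k (crd p)) (crd q))" if "l \<in> lengths k (crd p) (crd q)" for l
   using lengths_translate[OF that, of "gi k (crd p)"] by simp
  show "l \<in> lengths k (crd p) (crd q)" if "l \<in> lengths k 0 (gm k (gi k (crd p)) (crd q))" for l
   using lengths_translate[OF that, of "crd p"] by simp
 qed
 ultimately show ?thesis using p q by (simp add: cc_dist_def ccn_def)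
qed

lemma cc_dist_outside: "p \<notin> Es 5 \<or> q \<notin> Es 5 ==> cc_dist (Mk k) p q = 0"
 by (auto simp: cc_dist_def)

lemma gi_gm: "gi k (gm k p q) = gm k (gi k q) (gi k p)" by (metis gm_0(1,2) gm_assoc gm_gi(1,2))

lemma gi_gi [simp]: "gi k (gi k p) = p" by (metis gm_0(1,2) gm_assoc gm_gi(1))

lemma metric_Mk:
 assumes k: "abs k <= 1"
 shows "Metric_space (Es 5) (cc_dist (Mk k))"
proof
 fix p q r
 show "0 <= cc_dist (Mk k) p q"
  by (cases "p \<in> Es 5 & q \<in> Es 5") (auto simp: cc_dist_Mk cc_dist_outside ccn_nonneg)
 show "cc_dist (Mk k) p q = cc_dist (Mk k) q p"
 proof (cases "p \<in> Es 5 & q \<in> Es 5")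
  case True
  have "gm k (gi k (crd q)) (crd p) = gi k (gm k (gi k (crd p)) (crd q))" by (simp add: gi_gm)
  then show ?thesis using True by (simp add: cc_dist_Mk ccn_inverse)
 qed (auto simp: cc_dist_outside)
 assume p: "p \<in> Es 5" and q: "q \<in> Es 5"
 show "cc_dist (Mk k) p q = 0 \<longleftrightarrow> p = q"
 proof
  assume "cc_dist (Mk k) p q = 0"
  then have "gm k (gi k (crd p)) (crd q) = 0" using p q k by (simp add: cc_dist_Mk ccn_eq_0)
  then have "crd q = crd p" by (metis gm_gi_cancel(2) gm_0(2))
  then show "p = q" using p q by (metis sq_crd)
 qed (use p k in \<open>simp add: cc_dist_Mk ccn_eq_0\<close>)
 assume r: "r \<in> Es 5"
 have "gm k (gi k (crd p)) (crd r) = gm k (gm k (gi k (crd p)) (crd q)) (gm k (gi k (crd q)) (crd r))"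
  by (simp add: gm_assoc)
 then show "cc_dist (Mk k) p r <= cc_dist (Mk k) p q + cc_dist (Mk k) q r"
  using p q r ccn_mult by (simp add: cc_dist_Mk)
qed

text \<open>Near the identity \<open>ccn k\<close> and \<open>nrm\<close> are comparable, so the
  metric topology is the Euclidean one. This gives access to invariance of domain and Lebesgue
  measure.\<close>

lemma openin_mtopology_Mk:
 assumes k: "abs k <= 1"
 shows "openin (Metric_space.mtopology (Es 5) (cc_dist (Mk k))) U \<longleftrightarrow> U \<subseteq> Es 5 & open (crd ` U)"
proof -
 interpret Metric_space "Es 5" "cc_dist (Mk k)" by (rule metric_Mk[OF k])
 have ball: "mball p e = {q \<in> Es 5. ccn k (gm k (gi k (crd p)) (crd q)) < e}" if "p \<in> Es 5" for p e
  using that by (auto simp: mball_def cc_dist_Mk)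
 show ?thesis
 proof
  assume U: "openin mtopology U"
  then have UE: "U \<subseteq> Es 5" using openin_subset by fastforce
  have "open (crd ` U)"
  proof (subst open_subopen, intro ballI)
   fix x assume "x \<in> crd ` U"
   then obtain p where p: "p \<in> U" "x = crd p" by blast
   then obtain e where e: "0 < e" "mball p e \<subseteq> U" using U unfolding openin_mtopology by blast
   define r where "r = min 1 (e / 20)"
   let ?T = "{y. nrm (gm k (gi k (crd p)) y) < r}"
   have "open ?T" by (intro open_Collect_less continuous_intros)
   moreover have "x \<in> ?T" using e(1) by (simp add: p(2) r_def nrm_eq_0_iff[THEN iffD2])
   moreover have "?T \<subseteq> crd ` U"
   proof
    fix y assume y: "y \<in> ?T"
    then have "ccn k (gm k (gi k (crd p)) y) <= 20 * nrm (gm k (gi k (crd p)) y)"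
     by (intro ccn_upper[OF k]) (simp add: r_def)
    also have "... < e" using y by (simp add: r_def)
    finally have "ccn k (gm k (gi k (crd p)) y) < e" .
    moreover have "p \<in> Es 5" using p(1) UE by blast
    ultimately have "sq y \<in> mball p e" by (simp only: ball mem_Collect_eq sq_Es crd_sq simp_thms)
    then have "sq y \<in> U" using e(2) by blast
    then show "y \<in> crd ` U" by (intro image_eqI[of _ _ "sq y"]) simp_all
   qed
   ultimately show "\<exists>T. open T & x \<in> T & T \<subseteq> crd ` U" by blast
  qed
  then show "U \<subseteq> Es 5 & open (crd ` U)" using UE by blast
 next
  assume U: "U \<subseteq> Es 5 & open (crd ` U)"
  show "openin mtopology U" unfolding openin_mtopology
  proof (intro conjI ballI allI impI)
   show "U \<subseteq> Es 5" using U by blast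
   fix p assume p: "p \<in> U"
   obtain B r where r: "crd p \<in> B" "0 < r" "!!q h. q \<in> B ==> nrm h <= r ==> gm k q h \<in> crd ` U"
    using gm_nest[of "crd ` U" "crd p" k] U p by (metis imageI)
   have "mball p (min 1 (r / 2)) \<subseteq> U"
   proof
    fix q assume "q \<in> mball p (min 1 (r / 2))"
    moreover have "p \<in> Es 5" using p U by blast
    ultimately have q: "q \<in> Es 5" "ccn k (gm k (gi k (crd p)) (crd q)) < min 1 (r / 2)"
     by (simp_all only: ball mem_Collect_eq)
    then have "nrm (gm k (gi k (crd p)) (crd q)) <= r" using ccn_lower[OF k, of "gm k (gi k (crd p)) (crd q)"] by simp
    then have "crd q \<in> crd ` U" using r(3)[OF r(1)] by (metis gm_gi_cancel(2))
    then obtain q' where "q' \<in> U" "crd q = crd q'" by blast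
    then show "q \<in> U" using q(1) U by (metis sq_crd subsetD)
   qed
   then show "\<exists>e>0. mball p e \<subseteq> U" using r(2) by (intro exI[of _ "min 1 (r / 2)"]) simp
  qed
 qed
qed

section \<open>From the quasiconformality quotient to the locale\<close>

text \<open>The case \<open>B = 0\<close> is included: division of a nonzero \<open>A\<close> by 0
  is infinite, so a finite bound forces \<open>A = 0\<close>.\<close>

lemma ennreal_quotient_bound:
 fixes a b A B c :: ennreal
 assumes "a <= A" "B <= b" "A / B <= c" "b < top_class.top" "c < top_class.top"
 shows "a <= c * b"
proof (cases "B = 0")
 case True
 then have "A = 0" using assms(3,5) by (auto split: if_splits simp: top_unique)
 then show ?thesis using assms(1) by simp
next
 case False
 have "B < top_class.top" using assms(2,4) by (rule le_less_trans)
 then have "A = A / B * B" using False by (simp add: ennreal_divide_times)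
 also have "... <= c * b" using assms(2,3) by (intro mult_mono) auto
 finally show ?thesis using assms(1) by simp
qed

text \<open>Near \<open>p\<close> the quotient is below \<open>K + 1\<close> by the upper limit, and
  replacing the distance of the cone by \<open>rho\<close> costs the factors 2 and 20 of
  \<open>ccn_lower\<close> and \<open>ccn_upper\<close>; together \<open>40 * (K + 1)\<close>. The
  last parameter 20 is \<open>ccn_upper\<close> in the source.\<close>

lemma qc_embedding_setup:
 assumes U: "openin (Metric_space.mtopology (Es 5) (cc_dist (Mk 1))) U"
  and f: "quasiconformal_on K (Es 5) (cc_dist (Mk 1)) (Es 5) (cc_dist (Mk 0)) U f" and K: "1 <= K"
 shows "qc_setup (crd ` U) (%x. crd (f (sq x))) (ccn 1) (40 * (K + 1)) 20"
proof
 let ?T1 = "Metric_space.mtopology (Es 5) (cc_dist (Mk 1))" and ?T0 = "Metric_space.mtopology (Es 5) (cc_dist (Mk 0))"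
 have k: "abs (1::real) <= 1" "abs (0::real) <= 1" by simp_all
 have UE: "U \<subseteq> Es 5" and oU: "open (crd ` U)" using U unfolding openin_mtopology_Mk[OF k(1)] by auto
 have T0: "topspace ?T0 = Es 5" by (rule Metric_space.topspace_mtopology[OF metric_Mk[OF k(2)]])
 have T1U: "topspace (subtopology ?T1 U) = U"
  using UE Metric_space.topspace_mtopology[OF metric_Mk[OF k(1)]] by (simp add: topspace_subtopology Int_absorb1)
 have emb: "embedding_map (subtopology ?T1 U) ?T0 f" and lim: "!!p. p \<in> U ==> Limsup (at_right 0) (qc_quotient U (cc_dist (Mk 1)) (cc_dist (Mk 0)) f p) <= ennreal K"
  using f by (auto simp: quasiconformal_on_def)
 have hom: "homeomorphic_map (subtopology ?T1 U) (subtopology ?T0 (f ` U)) f" using emb unfolding embedding_map_def T1U .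
 have cm: "continuous_map (subtopology ?T1 U) ?T0 f"
  using homeomorphic_imp_continuous_map[OF hom] continuous_map_in_subtopology by blast
 have fE: "f p \<in> Es 5" if "p \<in> U" for p
  using continuous_map_image_subset_topspace[OF cm] that unfolding T0 T1U by blast
 have injf: "inj_on f U" using homeomorphic_imp_injective_map[OF hom] unfolding T1U .
 have sqU: "sq x \<in> U" if "x \<in> crd ` U" for x using that UE by auto
 show "open (crd ` U)" by (rule oU)
 show cont: "continuous_on (crd ` U) (%x. crd (f (sq x)))" unfolding continuous_on_open_vimage[OF oU]
 proof (intro allI impI)
  fix V :: "r5 set" assume V: "open V"
  have "crd ` sq ` V = V" by (simp add: image_image)
  then have "openin ?T0 (sq ` V)" unfolding openin_mtopology_Mk[OF k(2)] using V by auto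
  then have "openin (subtopology ?T1 U) {x \<in> topspace (subtopology ?T1 U). f x \<in> sq ` V}" by (rule openin_continuous_map_preimage[OF cm])
  then have "openin ?T1 {x \<in> U. f x \<in> sq ` V}" unfolding T1U using U by (rule openin_trans_full)
  then have "open (crd ` {x \<in> U. f x \<in> sq ` V})" unfolding openin_mtopology_Mk[OF k(1)] by blast
  moreover have "crd ` {x \<in> U. f x \<in> sq ` V} = (%x. crd (f (sq x))) -` V \<inter> crd ` U"
  proof (intro equalityI subsetI)
   fix y assume "y \<in> crd ` {x \<in> U. f x \<in> sq ` V}"
   then obtain x where x: "y = crd x" "x \<in> U" "f x \<in> sq ` V" by blast
   then have "sq y = x" using UE by auto
   then show "y \<in> (%x. crd (f (sq x))) -` V \<inter> crd ` U" using x by auto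
  next
   fix y assume "y \<in> (%x. crd (f (sq x))) -` V \<inter> crd ` U"
   then obtain x where x: "y = crd x" "x \<in> U" "crd (f (sq y)) \<in> V" by blast
   then have s: "sq y = x" using UE by auto
   have "f x = sq (crd (f x))" using fE[OF x(2)] by simp
   then have "f x \<in> sq ` V" using x(3) unfolding s by (metis imageI)
   then show "y \<in> crd ` {x \<in> U. f x \<in> sq ` V}" using x by blast
  qed
  ultimately show "open ((%x. crd (f (sq x))) -` V \<inter> crd ` U)" by simp
 qed
 show "inj_on (%x. crd (f (sq x))) (crd ` U)"
 proof (rule inj_onI)
  fix x y assume x: "x \<in> crd ` U" and y: "y \<in> crd ` U" and eq: "crd (f (sq x)) = crd (f (sq y))"
  have "f (sq x) = f (sq y)" using eq fE[OF sqU[OF x]] fE[OF sqU[OF y]] by (metis sq_crd)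
  then have "sq x = sq y" using injf sqU[OF x] sqU[OF y] by (auto dest: inj_onD)
  then show "x = y" by (metis crd_sq)
 qed
 show "ccn 1 g <= 20 * nrm g" if "nrm g <= 1" for g using k(1) that by (rule ccn_upper)
 show "nrm g <= 2 * ccn 1 g" if "ccn 1 g < 1" for g using k(1) that by (rule ccn_lower)
 show "1 <= (20::real)" "1 <= 40 * (K + 1)" using K by simp_all
 fix p assume p: "p \<in> crd ` U"
 define P where "P = sq p"
 have P: "P \<in> U" "crd P = p" "P \<in> Es 5" unfolding P_def using sqU[OF p] by simp_all
 define F where "F x = crd (f (sq x))" for x
 define d where "d x = ccn 0 (gm 0 (gi 0 (F p)) (F x))" for x
 have d: "cc_dist (Mk 0) (f P) (f (sq x)) = d x" if "x \<in> crd ` U" for x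
  unfolding d_def F_def P_def by (rule cc_dist_Mk[OF fE[OF sqU[OF p]] fE[OF sqU[OF that]]])
 have D: "cc_dist (Mk 1) P (sq (gm 1 p g)) = ccn 1 g" for g by (simp add: cc_dist_Mk P)
 have "eventually (%t. qc_quotient U (cc_dist (Mk 1)) (cc_dist (Mk 0)) f P t < ennreal (K + 1)) (at_right 0)"
  using K by (intro Limsup_lessD le_less_trans[OF lim[OF P(1)]]) (simp add: ennreal_less_iff)
 then obtain e0 where e0: "0 < e0" "!!t. 0 < t ==> t < e0 ==> qc_quotient U (cc_dist (Mk 1)) (cc_dist (Mk 0)) f P t < ennreal (K + 1)"
  unfolding eventually_at_right_field by auto
 \<comment> \<open>Below \<open>1 / 40\<close> the factor 20 keeps the distance of the image under
   1, where it can be compared with \<open>rho\<close> in the other direction.\<close>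
 have "open ((%x. rho (F p) (F x)) -` {..<1 / 40} \<inter> crd ` U)"
 proof -
  have "continuous_on (crd ` U) (%x. rho (F p) (F x))"
   unfolding F_def by (intro continuous_on_rho continuous_on_const cont)
  then show ?thesis unfolding continuous_on_open_vimage[OF oU] by (simp add: open_lessThan)
 qed
 moreover have "p \<in> (%x. rho (F p) (F x)) -` {..<1 / 40} \<inter> crd ` U" using p by (simp add: rho_eq_0_iff[THEN iffD2])
 ultimately obtain r where r: "0 < r" "!!h. nrm h <= r ==> gm 1 p h \<in> (%x. rho (F p) (F x)) -` {..<1 / 40} \<inter> crd ` U"
  by (rule_tac gm_nest[of "(%x. rho (F p) (F x)) -` {..<1 / 40} \<inter> crd ` U" p 1]) blast+
 have low: "rho (F p) (F x) <= 2 * d x" if "d x < 1" for x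
  unfolding rho_def using ccn_lower[OF k(2)] that by (simp add: d_def)
 have up: "d x <= 20 * rho (F p) (F x)" if "rho (F p) (F x) <= 1" for x
  unfolding d_def using ccn_upper[OF k(2)] that by (simp add: rho_def)
 have rn: "0 <= rho (F p) (F x)" for x by (simp add: rho_def)
 have main: "rho (F p) (F (gm 1 p g)) <= 40 * (K + 1) * rho (F p) (F (gm 1 p h))"
  if g: "gm 1 p g \<in> crd ` U" and h: "gm 1 p h \<in> crd ` U" and gd: "ccn 1 g < min e0 (min 1 (r / 2))" and gh: "ccn 1 g <= ccn 1 h" for g h
 proof (cases "ccn 1 g = 0")
  case True
  then have "g = 0" by (simp add: ccn_eq_0)
  then have "rho (F p) (F (gm 1 p g)) = 0" by (simp add: rho_eq_0_iff[THEN iffD2])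
  then show ?thesis using rn K by simp
 next
  case False
  then have t: "0 < ccn 1 g" using ccn_nonneg[of 1 g] by simp
  have "nrm g <= r" using ccn_lower[OF k(1), of g] gd by simp
  then have small: "rho (F p) (F (gm 1 p g)) < 1 / 40" using r(2) by blast
  then have "d (gm 1 p g) < 1" using up[of "gm 1 p g"] by simp
  then have 1: "rho (F p) (F (gm 1 p g)) <= 2 * d (gm 1 p g)" by (rule low)
  have "ennreal (d (gm 1 p g)) <= ennreal (K + 1) * ennreal (d (gm 1 p h))"
  proof (rule ennreal_quotient_bound)
   show "ennreal (d (gm 1 p g)) <= (SUP q\<in>{q \<in> U. cc_dist (Mk 1) P q <= ccn 1 g}. ennreal (cc_dist (Mk 0) (f P) (f q)))"
    by (rule SUP_upper2[of "sq (gm 1 p g)"]) (simp_all add: sqU[OF g] D d[OF g])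
   show "(INF q\<in>{q \<in> U. cc_dist (Mk 1) P q \<ge> ccn 1 g}. ennreal (cc_dist (Mk 0) (f P) (f q))) <= ennreal (d (gm 1 p h))"
    by (rule INF_lower2[of "sq (gm 1 p h)"]) (simp_all add: sqU[OF h] D d[OF h] gh)
   show "(SUP q\<in>{q \<in> U. cc_dist (Mk 1) P q <= ccn 1 g}. ennreal (cc_dist (Mk 0) (f P) (f q))) /
     (INF q\<in>{q \<in> U. cc_dist (Mk 1) P q \<ge> ccn 1 g}. ennreal (cc_dist (Mk 0) (f P) (f q))) <= ennreal (K + 1)"
    using e0(2)[OF t] gd unfolding qc_quotient_def by simp
  qed simp_all
  also have "... = ennreal ((K + 1) * d (gm 1 p h))" using K ccn_nonneg by (simp add: ennreal_mult d_def)
  finally have 2: "d (gm 1 p g) <= (K + 1) * d (gm 1 p h)" using K ccn_nonneg by (subst (asm) ennreal_le_iff) (simp_all add: d_def)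
  show ?thesis
  proof (cases "rho (F p) (F (gm 1 p h)) <= 1")
   case True
   have "(K + 1) * d (gm 1 p h) <= (K + 1) * (20 * rho (F p) (F (gm 1 p h)))"
    using up[OF True] K by (intro mult_left_mono) auto
   then show ?thesis using 1 2 by (simp add: algebra_simps)
  next
   \<comment> \<open>Where the farther image point is out of range of the comparison, the right side
     exceeds 1 and the left side is below \<open>1 / 40\<close>.\<close>
   case False
   have "1 * 1 <= 40 * (K + 1) * rho (F p) (F (gm 1 p h))" using False K by (intro mult_mono) auto
   then show ?thesis using small by linarith
  qed
 qed
 show "\<exists>e>0. \<forall>g h. gm 1 p g \<in> crd ` U --> gm 1 p h \<in> crd ` U --> ccn 1 g < e --> ccn 1 g <= ccn 1 h -->
   rho (crd (f (sq p))) (crd (f (sq (gm 1 p g)))) <= 40 * (K + 1) * rho (crd (f (sq p))) (crd (f (sq (gm 1 p h))))"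
  using main[unfolded F_def] e0(1) r(1) by (intro exI[of _ "min e0 (min 1 (r / 2))"]) (simp del: min_less_iff_conj)
qed

theorem theorem1p1:
 shows "\<exists>(H :: (nat \<Rightarrow> real) monoid) (M :: (nat \<Rightarrow> real) sub_riem)
     (G :: (nat \<Rightarrow> real) monoid) (C :: (nat \<Rightarrow> real) sub_riem).
  lie_group H M \<and> nilpotent_group H \<and> left_invariant_sub_riemannian H M \<and>
  tangent_cone M \<one>\<^bsub>H\<^esub> G C \<and>
  \<not> locally_qc_equivalent (carrier H) (cc_dist M) (carrier G) (cc_dist C)"
proof (intro exI conjI)
 show "lie_group (Grp 1) (Mk 1)" by (rule lie_group_Grp)
 show "nilpotent_group (Grp 1)" by (rule nilpotent_Grp)
 show "left_invariant_sub_riemannian (Grp 1) (Mk 1)" by (rule left_invariant_Mk)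
 show "tangent_cone (Mk 1) \<one>\<^bsub>Grp 1\<^esub> (Grp 0) (Mk 0)" unfolding Grp_sel by (rule tangent_cone_Mk)
 show "\<not> locally_qc_equivalent (carrier (Grp 1)) (cc_dist (Mk 1)) (carrier (Grp 0)) (cc_dist (Mk 0))"
 proof
  assume "locally_qc_equivalent (carrier (Grp 1)) (cc_dist (Mk 1)) (carrier (Grp 0)) (cc_dist (Mk 0))"
  then obtain U f K where qc: "U \<noteq> {}" "openin (Metric_space.mtopology (Es 5) (cc_dist (Mk 1))) U" "1 \<le> K"
   "quasiconformal_on K (Es 5) (cc_dist (Mk 1)) (Es 5) (cc_dist (Mk 0)) U f"
   unfolding locally_qc_equivalent_def Grp_sel by blast
  note ne = qc(1)
  interpret qc_setup "crd ` U" "\<lambda>x. crd (f (sq x))" "ccn 1" "40 * (K + 1)" 20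
   by (rule qc_embedding_setup[OF qc(2,4,3)])
  show False by (rule no_qc) (use ne in simp)
 qed
qed

end
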